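(* Let $\mathfrak q$ be an algebraic Lie algebra over an algebraically closed field $\Bbbk$ of characteristic zero. (i) Suppose that the coadjoint representation of $\mathfrak q$ has the codim--$2$ property and that $\mathcal Z(\mathfrak q)$ contains algebraically independent polynomials $f_1,\ldots,f_l$, where $l=\mathrm{ind}\,\mathfrak q$, such that $\sum_{i=1}^l\deg f_i=b(\mathfrak q)$. Then, for any $\xi\in\mathfrak q^*_{reg}$, $\mathcal F_\xi(\mathcal Z(\mathfrak q))=\mathcal F_\xi(\{f_1,\ldots,f_l\})$, and this is a polynomial algebra of Krull dimension $b(\mathfrak q)$. (ii) Furthermore, if (in addition to the hypotheses of (i)) the coadjoint representation of $\mathfrak q$ has the codim--$3$ property, then, for any $\xi\in\mathfrak q^*_{reg}$, $\mathcal F_\xi(\mathcal Z(\mathfrak q))$ is a maximal commutative subalgebra of $\mathcal S(\mathfrak q)$.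
   Context: The Lie algebra $\mathfrak q$ is algebraic if it is the Lie algebra of a connected (affine) algebraic group $Q$ over $\Bbbk$. The symmetric algebra $\mathcal S(\mathfrak q)$ is identified with the polynomial algebra $\Bbbk[\mathfrak q^*]$. For $f\in\mathcal S(\mathfrak q)$ and $\eta\in\mathfrak q^*$, the differential $(\mathrm df)_\eta\in\mathfrak q$ is defined by: $\langle(\mathrm df)_\eta,\nu\rangle$ is the coefficient of $t$ in $f(\eta+t\nu)$, for $\nu\in\mathfrak q^*$. The Lie-Poisson bracket on $\mathcal S(\mathfrak q)$ is $\{f,g\}(\eta)=\langle\eta,[(\mathrm df)_\eta,(\mathrm dg)_\eta]\rangle$. Its Poisson centre is denoted $\mathcal Z(\mathfrak q)$; it equals $\mathcal S(\mathfrak q)^Q=\Bbbk[\mathfrak q^*]^Q$. For $\xi\in\mathfrak q^*$, $\mathfrak q_\xi=\{x\in\mathfrak q\mid\langle\xi,[x,y]\rangle=0\ \forall y\in\mathfrak q\}$ is its stabiliser for the coadjoint representation. $\mathfrak q^*_{reg}$ is the set of $\xi\in\mathfrak q^*$ for which $\dim\mathfrak q_\xi$ is minimal (equivalently, the coadjoint orbit $Q\cdot\xi$ has maximal dimension); it is a dense open subset of $\mathfrak q^*$. The index $\mathrm{ind}\,\mathfrak q$ is this minimal dimension, and $b(\mathfrak q)=(\dim\mathfrak q+\mathrm{ind}\,\mathfrak q)/2$. The coadjoint representation of $\mathfrak q$ has the codim--$n$ property if $\mathrm{codim}(\mathfrak q^*\setminus\mathfrak q^*_{reg})\ge n$ (codimension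 in the Zariski topology; the empty set has codimension $\infty$). Argument shift: for $f\in\mathcal S(\mathfrak q)$ of degree $d$ and $\xi\in\mathfrak q^*$, write $f(\mu+a\xi)=\sum_{j=0}^d f_\xi^j(\mu)a^j$ for $\mu\in\mathfrak q^*$, $a\in\Bbbk$. The polynomials $f_\xi^j\in\mathcal S(\mathfrak q)$, $j=0,1,\ldots,d-1$, are called the $\xi$-shifts of $f$. For a subset $\mathcal B\subset\mathcal Z(\mathfrak q)$, $\mathcal F_\xi(\mathcal B)$ is the subalgebra of the associative commutative algebra $\mathcal S(\mathfrak q)$ generated by the $\xi$-shifts of all elements of $\mathcal B$. A subalgebra $\mathcal A$ of the associative algebra $\mathcal S(\mathfrak q)$ is called commutative (meaning Poisson-commutative) if $\{\ ,\ \}$ vanishes on $\mathcal A$. It is a maximal commutative subalgebra if it is maximal with respect to inclusion among the (Poisson-)commutative subalgebras of $\mathcal S(\mathfrak q)$. It is known that $\mathcal F_\xi(\mathcal Z(\mathfrak q))$ is always commutative in this sense. *)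

theory Defs
  imports
    "HOL-Analysis.Analysis"
    "HOL-Algebra.Generated_Rings"
    "HOL-Algebra.Ideal"
    "HOL-Library.Poly_Mapping"
    "HOL-Library.Extended_Nat"
    "HOL-Computational_Algebra.Polynomial"
begin

section \<open>Polynomials and polynomial functions\<close>

text \<open>
  Multivariate polynomials with indeterminates in \<open>'i\<close> are elements of
  \<open>('i \<Rightarrow>\<^sub>0 nat) \<Rightarrow>\<^sub>0 'k\<close>: finitely supported maps from exponent vectors to coefficients.
\<close>

definition mpoly_eval :: "(('i \<Rightarrow>\<^sub>0 nat) \<Rightarrow>\<^sub>0 'k::comm_ring_1) \<Rightarrow> ('i \<Rightarrow> 'k) \<Rightarrow> 'k" where
  "mpoly_eval P x =
     (\<Sum>m\<in>Poly_Mapping.keys P. Poly_Mapping.lookup P m *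
        (\<Prod>i\<in>Poly_Mapping.keys m. x i ^ Poly_Mapping.lookup m i))"

definition mpoly_vars :: "(('i \<Rightarrow>\<^sub>0 nat) \<Rightarrow>\<^sub>0 'k::comm_ring_1) \<Rightarrow> 'i set" where
  "mpoly_vars P = (\<Union>m\<in>Poly_Mapping.keys P. Poly_Mapping.keys m)"

text \<open>Total degree; the zero polynomial gets degree 0.\<close>

definition mpoly_degree :: "(('i \<Rightarrow>\<^sub>0 nat) \<Rightarrow>\<^sub>0 'k::comm_ring_1) \<Rightarrow> nat" where
  "mpoly_degree P =
     Max (insert 0 ((\<lambda>m. \<Sum>i\<in>Poly_Mapping.keys m. Poly_Mapping.lookup m i) ` Poly_Mapping.keys P))"

text \<open>
  Functions on a subset \<open>X\<close> of \<open>'i \<Rightarrow> 'k\<close> are represented by total functions vanishing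
  outside \<open>X\<close>, so that equality of functions on \<open>X\<close> is HOL equality.
\<close>

definition poly_fun :: "('i \<Rightarrow> 'k::comm_ring_1) set \<Rightarrow> (('i \<Rightarrow>\<^sub>0 nat) \<Rightarrow>\<^sub>0 'k) \<Rightarrow> ('i \<Rightarrow> 'k) \<Rightarrow> 'k" where
  "poly_fun X P = (\<lambda>x. if x \<in> X then mpoly_eval P x else 0)"

definition const_fun :: "('i \<Rightarrow> 'k::comm_ring_1) set \<Rightarrow> 'k \<Rightarrow> ('i \<Rightarrow> 'k) \<Rightarrow> 'k" where
  "const_fun X c = (\<lambda>x. if x \<in> X then c else 0)"

definition coord_ring :: "('i \<Rightarrow> 'k::comm_ring_1) set \<Rightarrow> (('i \<Rightarrow> 'k) \<Rightarrow> 'k) ring" where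
  "coord_ring X =
     \<lparr>carrier = {f. \<exists>P. f = poly_fun X P},
      monoid.mult = (\<lambda>f g x. f x * g x), one = const_fun X 1,
      zero = (\<lambda>x. 0), add = (\<lambda>f g x. f x + g x)\<rparr>"

abbreviation coord_funs :: "('i \<Rightarrow> 'k::comm_ring_1) set \<Rightarrow> (('i \<Rightarrow> 'k) \<Rightarrow> 'k) set" where
  "coord_funs X \<equiv> carrier (coord_ring X)"

definition fun_degree :: "('i \<Rightarrow> 'k::comm_ring_1) set \<Rightarrow> (('i \<Rightarrow> 'k) \<Rightarrow> 'k) \<Rightarrow> nat" where
  "fun_degree X f = (LEAST d. \<exists>P. f = poly_fun X P \<and> mpoly_degree P = d)"

text \<open>Subalgebras are unital and are taken over the ground field.\<close>

definition is_subalg :: "('i \<Rightarrow> 'k::comm_ring_1) set \<Rightarrow> (('i \<Rightarrow> 'k) \<Rightarrow> 'k) set \<Rightarrow> bool" where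
  "is_subalg X A \<longleftrightarrow> subring A (coord_ring X) \<and> range (const_fun X) \<subseteq> A"

definition subalg_generated_by ::
  "('i \<Rightarrow> 'k::comm_ring_1) set \<Rightarrow> (('i \<Rightarrow> 'k) \<Rightarrow> 'k) set \<Rightarrow> (('i \<Rightarrow> 'k) \<Rightarrow> 'k) set" where
  "subalg_generated_by X G = generate_ring (coord_ring X) (range (const_fun X) \<union> G)"

definition alg_independent ::
  "('i \<Rightarrow> 'k::comm_ring_1) set \<Rightarrow> 'j set \<Rightarrow> ('j \<Rightarrow> ('i \<Rightarrow> 'k) \<Rightarrow> 'k) \<Rightarrow> bool" where
  "alg_independent X J f \<longleftrightarrow>
     (\<forall>P. mpoly_vars P \<subseteq> J \<and> (\<forall>x\<in>X. mpoly_eval P (\<lambda>j. f j x) = 0) \<longrightarrow> P = 0)"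

definition is_polynomial_algebra :: "('i \<Rightarrow> 'k::comm_ring_1) set \<Rightarrow> (('i \<Rightarrow> 'k) \<Rightarrow> 'k) set \<Rightarrow> bool" where
  "is_polynomial_algebra X A \<longleftrightarrow>
     (\<exists>(n::nat) g. (\<forall>j\<in>{1..n}. g j \<in> coord_funs X) \<and> alg_independent X {1..n} g \<and>
        A = subalg_generated_by X (g ` {1..n}))"

definition krull_dim :: "('a, 'm) ring_scheme \<Rightarrow> enat" where
  "krull_dim R =
     (SUP n\<in>{n. \<exists>I. (\<forall>i\<le>n. primeideal (I i) R) \<and> (\<forall>i<n. I i \<subset> I (Suc i))}. enat n)"


section \<open>Zariski topology\<close>

text \<open>The topology on \<open>X\<close> whose basic open sets are the non-vanishing loci of polynomial functions.\<close>

definition zariski :: "('i \<Rightarrow> 'k::comm_ring_1) set \<Rightarrow> ('i \<Rightarrow> 'k) topology" where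
  "zariski X = topology_generated_by {{x \<in> X. f x \<noteq> 0} |f. f \<in> coord_funs X}"

definition irreducible_closed :: "'a topology \<Rightarrow> 'a set \<Rightarrow> bool" where
  "irreducible_closed T Z \<longleftrightarrow> closedin T Z \<and> Z \<noteq> {} \<and>
     (\<forall>A B. closedin T A \<and> closedin T B \<and> Z \<subseteq> A \<union> B \<longrightarrow> Z \<subseteq> A \<or> Z \<subseteq> B)"

text \<open>The infimum over the empty family is \<open>\<infinity>\<close>, hence so is the codimension of the empty set.\<close>

definition codim :: "'a topology \<Rightarrow> 'a set \<Rightarrow> enat" where
  "codim T Z =
     (INF W\<in>{W. irreducible_closed T W \<and> W \<subseteq> Z}.
      SUP n\<in>{n. \<exists>C. C 0 = W \<and> (\<forall>i\<le>n. irreducible_closed T (C i)) \<and> (\<forall>i<n. C i \<subset> C (Suc i))}.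
        enat n)"


section \<open>Algebraic Lie algebras\<close>

locale lie_algebra = finite_dimensional_vector_space sc Basis
  for sc :: "'k::field \<Rightarrow> 'q::ab_group_add \<Rightarrow> 'q" and Basis :: "'q set" +
  fixes br :: "'q \<Rightarrow> 'q \<Rightarrow> 'q"
  assumes br_linear_left: "\<And>y. Vector_Spaces.linear sc sc (\<lambda>x. br x y)"
    and br_linear_right: "\<And>x. Vector_Spaces.linear sc sc (br x)"
    and br_alternating: "\<And>x. br x x = 0"
    and jacobi: "\<And>x y z. br x (br y z) + br y (br z x) + br z (br x y) = 0"

definition affine_space :: "nat \<Rightarrow> (nat \<Rightarrow> 'k::comm_ring_1) set" where
  "affine_space n = {x. \<forall>i\<ge>n. x i = 0}"

definition affine_algebraic_group :: "nat \<Rightarrow> (nat \<Rightarrow> 'k::comm_ring_1) monoid \<Rightarrow> bool" where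
  "affine_algebraic_group n Q \<longleftrightarrow>
     group Q \<and> closedin (zariski (affine_space n)) (carrier Q) \<and>
     (\<forall>i. \<exists>P. \<forall>x\<in>carrier Q. \<forall>y\<in>carrier Q. (x \<otimes>\<^bsub>Q\<^esub> y) i = mpoly_eval P (case_sum x y)) \<and>
     (\<forall>i. \<exists>P. \<forall>x\<in>carrier Q. (inv\<^bsub>Q\<^esub> x) i = mpoly_eval P x)"

definition left_translate ::
  "(nat \<Rightarrow> 'k::comm_ring_1) monoid \<Rightarrow> (nat \<Rightarrow> 'k) \<Rightarrow> ((nat \<Rightarrow> 'k) \<Rightarrow> 'k) \<Rightarrow> (nat \<Rightarrow> 'k) \<Rightarrow> 'k" where
  "left_translate Q g f = (\<lambda>x. if x \<in> carrier Q then f (inv\<^bsub>Q\<^esub> g \<otimes>\<^bsub>Q\<^esub> x) else 0)"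

text \<open>
  The Lie algebra of \<open>Q\<close>: left-invariant derivations of the coordinate ring, with the commutator
  as bracket. Derivations are extended by zero outside the coordinate ring.
\<close>

definition lie_algebra_of_group ::
  "(nat \<Rightarrow> 'k::comm_ring_1) monoid \<Rightarrow> (((nat \<Rightarrow> 'k) \<Rightarrow> 'k) \<Rightarrow> (nat \<Rightarrow> 'k) \<Rightarrow> 'k) set" where
  "lie_algebra_of_group Q =
     {D. (\<forall>f\<in>coord_funs (carrier Q). D f \<in> coord_funs (carrier Q)) \<and>
         (\<forall>f. f \<notin> coord_funs (carrier Q) \<longrightarrow> D f = (\<lambda>x. 0)) \<and>
         (\<forall>f\<in>coord_funs (carrier Q). \<forall>g\<in>coord_funs (carrier Q).
            D (\<lambda>x. f x + g x) = (\<lambda>x. D f x + D g x)) \<and>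
         (\<forall>f\<in>coord_funs (carrier Q). \<forall>c. D (\<lambda>x. c * f x) = (\<lambda>x. c * D f x)) \<and>
         (\<forall>f\<in>coord_funs (carrier Q). \<forall>g\<in>coord_funs (carrier Q).
            D (\<lambda>x. f x * g x) = (\<lambda>x. f x * D g x + D f x * g x)) \<and>
         (\<forall>a\<in>carrier Q. \<forall>f\<in>coord_funs (carrier Q).
            D (left_translate Q a f) = left_translate Q a (D f))}"

definition algebraic_lie_algebra ::
  "('k::comm_ring_1 \<Rightarrow> 'q::ab_group_add \<Rightarrow> 'q) \<Rightarrow> ('q \<Rightarrow> 'q \<Rightarrow> 'q) \<Rightarrow> bool" where
  "algebraic_lie_algebra sc br \<longleftrightarrow>
     (\<exists>n (Q :: (nat \<Rightarrow> 'k) monoid) \<phi>.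
        affine_algebraic_group n Q \<and> connected_space (zariski (carrier Q)) \<and>
        bij_betw \<phi> UNIV (lie_algebra_of_group Q) \<and>
        (\<forall>x y. \<phi> (x + y) = (\<lambda>f p. \<phi> x f p + \<phi> y f p)) \<and>
        (\<forall>c x. \<phi> (sc c x) = (\<lambda>f p. c * \<phi> x f p)) \<and>
        (\<forall>x y. \<phi> (br x y) = (\<lambda>f p. \<phi> x (\<phi> y f) p - \<phi> y (\<phi> x f) p)))"


section \<open>The coadjoint representation and the Lie--Poisson structure\<close>

definition dual_space :: "('k::field \<Rightarrow> 'q::ab_group_add \<Rightarrow> 'q) \<Rightarrow> ('q \<Rightarrow> 'k) set" where
  "dual_space sc = {\<eta>. Vector_Spaces.linear sc (*) \<eta>}"

definition coadj_stabiliser :: "('q \<Rightarrow> 'q \<Rightarrow> 'q) \<Rightarrow> ('q \<Rightarrow> 'k::zero) \<Rightarrow> 'q set" where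
  "coadj_stabiliser br \<xi> = {x. \<forall>y. \<xi> (br x y) = 0}"

definition lie_index :: "('k::field \<Rightarrow> 'q::ab_group_add \<Rightarrow> 'q) \<Rightarrow> ('q \<Rightarrow> 'q \<Rightarrow> 'q) \<Rightarrow> nat" where
  "lie_index sc br = (INF \<xi>\<in>dual_space sc. vector_space.dim sc (coadj_stabiliser br \<xi>))"

definition dual_reg :: "('k::field \<Rightarrow> 'q::ab_group_add \<Rightarrow> 'q) \<Rightarrow> ('q \<Rightarrow> 'q \<Rightarrow> 'q) \<Rightarrow> ('q \<Rightarrow> 'k) set" where
  "dual_reg sc br =
     {\<xi> \<in> dual_space sc. vector_space.dim sc (coadj_stabiliser br \<xi>) = lie_index sc br}"

text \<open>
  The division is exact: coadjoint orbits have even dimension, so the dimension and the index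
  have the same parity.
\<close>

definition b_number :: "('k::field \<Rightarrow> 'q::ab_group_add \<Rightarrow> 'q) \<Rightarrow> ('q \<Rightarrow> 'q \<Rightarrow> 'q) \<Rightarrow> nat" where
  "b_number sc br = (vector_space.dim sc (UNIV :: 'q set) + lie_index sc br) div 2"

definition codim_property ::
  "('k::field \<Rightarrow> 'q::ab_group_add \<Rightarrow> 'q) \<Rightarrow> ('q \<Rightarrow> 'q \<Rightarrow> 'q) \<Rightarrow> nat \<Rightarrow> bool" where
  "codim_property sc br n \<longleftrightarrow>
     codim (zariski (dual_space sc)) (dual_space sc - dual_reg sc br) \<ge> enat n"

text \<open>
  The symmetric algebra, as the algebra of polynomial functions on the dual space. The elements
  of \<open>'q\<close> serve as indeterminates, \<open>x\<close> being evaluated at \<open>\<eta>\<close> as \<open>\<eta> x\<close>; linear relations between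
  them hold because the functions are restricted to linear \<open>\<eta>\<close>, and over an infinite field
  \<^const>\<open>fun_degree\<close> is the usual degree.
\<close>

abbreviation sym_alg ::
  "('k::field \<Rightarrow> 'q::ab_group_add \<Rightarrow> 'q) \<Rightarrow> (('q \<Rightarrow> 'k) \<Rightarrow> 'k) set" where
  "sym_alg sc \<equiv> coord_funs (dual_space sc)"

text \<open>The polynomial \<open>f (\<eta> + t \<nu>)\<close> in \<open>t\<close>.\<close>

definition line_poly :: "(('q \<Rightarrow> 'k::comm_ring_1) \<Rightarrow> 'k) \<Rightarrow> ('q \<Rightarrow> 'k) \<Rightarrow> ('q \<Rightarrow> 'k) \<Rightarrow> 'k poly" where
  "line_poly f \<eta> \<nu> = (THE p. \<forall>t. poly p t = f (\<lambda>x. \<eta> x + t * \<nu> x))"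

definition differential ::
  "('k::field \<Rightarrow> 'q::ab_group_add \<Rightarrow> 'q) \<Rightarrow> (('q \<Rightarrow> 'k) \<Rightarrow> 'k) \<Rightarrow> ('q \<Rightarrow> 'k) \<Rightarrow> 'q" where
  "differential sc f \<eta> = (THE x. \<forall>\<nu>\<in>dual_space sc. \<nu> x = Polynomial.coeff (line_poly f \<eta> \<nu>) 1)"

definition poisson ::
  "('k::field \<Rightarrow> 'q::ab_group_add \<Rightarrow> 'q) \<Rightarrow> ('q \<Rightarrow> 'q \<Rightarrow> 'q) \<Rightarrow>
   (('q \<Rightarrow> 'k) \<Rightarrow> 'k) \<Rightarrow> (('q \<Rightarrow> 'k) \<Rightarrow> 'k) \<Rightarrow> ('q \<Rightarrow> 'k) \<Rightarrow> 'k" where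
  "poisson sc br f g =
     (\<lambda>\<eta>. if \<eta> \<in> dual_space sc then \<eta> (br (differential sc f \<eta>) (differential sc g \<eta>)) else 0)"

definition poisson_centre ::
  "('k::field \<Rightarrow> 'q::ab_group_add \<Rightarrow> 'q) \<Rightarrow> ('q \<Rightarrow> 'q \<Rightarrow> 'q) \<Rightarrow> (('q \<Rightarrow> 'k) \<Rightarrow> 'k) set" where
  "poisson_centre sc br = {f \<in> sym_alg sc. \<forall>g\<in>sym_alg sc. poisson sc br f g = (\<lambda>\<eta>. 0)}"

definition commutative_subalg ::
  "('k::field \<Rightarrow> 'q::ab_group_add \<Rightarrow> 'q) \<Rightarrow> ('q \<Rightarrow> 'q \<Rightarrow> 'q) \<Rightarrow> (('q \<Rightarrow> 'k) \<Rightarrow> 'k) set \<Rightarrow> bool" where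
  "commutative_subalg sc br A \<longleftrightarrow>
     is_subalg (dual_space sc) A \<and> (\<forall>f\<in>A. \<forall>g\<in>A. poisson sc br f g = (\<lambda>\<eta>. 0))"

definition maximal_commutative_subalg ::
  "('k::field \<Rightarrow> 'q::ab_group_add \<Rightarrow> 'q) \<Rightarrow> ('q \<Rightarrow> 'q \<Rightarrow> 'q) \<Rightarrow> (('q \<Rightarrow> 'k) \<Rightarrow> 'k) set \<Rightarrow> bool" where
  "maximal_commutative_subalg sc br A \<longleftrightarrow>
     commutative_subalg sc br A \<and> (\<forall>B. commutative_subalg sc br B \<and> A \<subseteq> B \<longrightarrow> B = A)"


section \<open>Argument shift\<close>

definition shift_coeff ::
  "('k::field \<Rightarrow> 'q::ab_group_add \<Rightarrow> 'q) \<Rightarrow> ('q \<Rightarrow> 'k) \<Rightarrow> (('q \<Rightarrow> 'k) \<Rightarrow> 'k) \<Rightarrow> nat \<Rightarrow> ('q \<Rightarrow> 'k) \<Rightarrow> 'k" where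
  "shift_coeff sc \<xi> f j =
     (\<lambda>\<mu>. if \<mu> \<in> dual_space sc then Polynomial.coeff (line_poly f \<mu> \<xi>) j else 0)"

definition shift_subalg ::
  "('k::field \<Rightarrow> 'q::ab_group_add \<Rightarrow> 'q) \<Rightarrow> ('q \<Rightarrow> 'k) \<Rightarrow> (('q \<Rightarrow> 'k) \<Rightarrow> 'k) set \<Rightarrow> (('q \<Rightarrow> 'k) \<Rightarrow> 'k) set" where
  "shift_subalg sc \<xi> \<B> =
     subalg_generated_by (dual_space sc)
       {shift_coeff sc \<xi> f j |f j. f \<in> \<B> \<and> j < fun_degree (dual_space sc) f}"

end

theory Submission
  imports Defs "Jordan_Normal_Form.Determinant"
begin

text \<open>
  Replace the \<open>f i\<close> by their leading components \<open>h k\<close>; by the degree hypothesis and codim--2 the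
  \<open>h k\<close> have independent differentials at every regular point. On a line \<open>\<eta> + a \<xi>\<close> of regular points the shifts
  of the \<open>h k\<close> then have independent differentials, which span a maximal isotropic subspace for the
  form given by \<open>\<eta>\<close>: so the shifts are \<open>b\<close> algebraically independent functions, and the differential of whatever
  commutes with all of them depends on theirs. A polynomial whose differential depends on
  those of homogeneous \<open>F j\<close> that are differentially independent outside codimension two is a polynomial in the \<open>F j\<close>: the
  coefficients of the dependence are polynomials of the same kind and lower degree, and Euler's identity
  integrates. This is applied to central functions and the \<open>h k\<close>, with codim--2, and to commuting functions and the shifts,
  with codim--3, since the line through a bad point in direction \<open>\<xi>\<close> meets the singular set.
\<close>

section \<open>Polynomial functions\<close>

text \<open>Codimension enters only through \<open>singular_killer\<close>: if the singular set has
  codimension at least m, then for any m - 1 directions some nonzero polynomial is constant along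
  them and vanishes on the singular set. So with m = 2 a general line in a prescribed direction
  consists of regular points, and one-variable division suffices to extend rational functions; with
  m = 3 one of two directions can be \<open>\<xi>\<close> and the other stays free.

  The obstacle is independence of the leading components at every regular point. The squared
  Jacobian determinants of \<open>ind\<close> central functions are proportional to the determinants
  of the Poisson matrix bordered by \<open>ind\<close> covectors, which vanish simultaneously
  exactly at the singular points. The squares take the place of Pfaffians. The bordered determinants
  scale with exponent dim - ind, the squared Jacobians grow at most with exponent twice the sum of
  the \<open>d k - 1\<close>, and the degree hypothesis bounds the latter by the former. This leaves
  the factor of proportionality no room to be nonconstant.

  Points of the dual space are handled as arbitrary functions on \<open>'q\<close> of which only the
  values on \<open>Basis\<close> count, so that all calculus takes place on a full affine
  space.\<close>

inductive pdeg :: "'i set \<Rightarrow> nat \<Rightarrow> (('i \<Rightarrow> 'k::field_char_0) \<Rightarrow> 'k) \<Rightarrow> bool" for J where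
  pdeg_const: "pdeg J d (\<lambda>x. c)"
| pdeg_var: "i \<in> J \<Longrightarrow> pdeg J (Suc d) (\<lambda>x. x i)"
| pdeg_add: "pdeg J d F \<Longrightarrow> pdeg J d G \<Longrightarrow> pdeg J d (\<lambda>x. F x + G x)"
| pdeg_mult: "pdeg J d F \<Longrightarrow> pdeg J e G \<Longrightarrow> pdeg J (d + e) (\<lambda>x. F x * G x)"

text \<open>A constant has every degree by \<open>pdeg_const\<close>, so multiplication by 1 raises
  the bound.\<close>

lemma pdeg_mono:
  assumes "pdeg J d F" "d \<le> e" shows "pdeg J e F"
  using pdeg_mult[OF pdeg_const[of J "e - d" 1] assms(1)] assms(2) by simp

lemma pdeg_subset:
  assumes "pdeg J d F" "J \<subseteq> K" shows "pdeg K d F"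
  using assms by induction (auto intro: pdeg.intros)

lemma pdeg_cong_vars:
  assumes "pdeg J d F" "\<And>i. i \<in> J \<Longrightarrow> x i = y i" shows "F x = F y"
  using assms by induction auto

text \<open>\<open>pdeg\<close> gives only an upper bound, which is stable under cancellation;
  \<open>pf\<close> forgets it. Formal polynomials are needed only where the given definitions
  mention them.\<close>

definition pf :: "'i set \<Rightarrow> (('i \<Rightarrow> 'k::field_char_0) \<Rightarrow> 'k) set" where
  "pf J = {F. \<exists>d. pdeg J d F}"

lemma pfI: "pdeg J d F \<Longrightarrow> F \<in> pf J" by (auto simp: pf_def)

lemma pfE: assumes "F \<in> pf J" obtains d where "pdeg J d F" using assms by (auto simp: pf_def)

lemma pf_const [simp, intro]: "(\<lambda>x. c) \<in> pf J"
  by (auto simp: pf_def intro: pdeg_const)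

lemma pf_var [intro]: "i \<in> J \<Longrightarrow> (\<lambda>x. x i) \<in> pf J"
  by (auto simp: pf_def intro: pdeg_var)

lemma pf_add [intro]: "F \<in> pf J \<Longrightarrow> G \<in> pf J \<Longrightarrow> (\<lambda>x. F x + G x) \<in> pf J"
proof (elim pfE)
  fix d e assume "pdeg J d F" "pdeg J e G"
  hence "pdeg J (max d e) (\<lambda>x. F x + G x)" by (intro pdeg_add) (auto intro: pdeg_mono)
  thus ?thesis by (rule pfI)
qed

lemma pf_mult [intro]: "F \<in> pf J \<Longrightarrow> G \<in> pf J \<Longrightarrow> (\<lambda>x. F x * G x) \<in> pf J"
  by (elim pfE) (rule pfI[OF pdeg_mult])

lemma pf_cmult [intro]: "F \<in> pf J \<Longrightarrow> (\<lambda>x. c * F x) \<in> pf J"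
  by (rule pf_mult) auto

lemma pf_uminus [intro]: "F \<in> pf J \<Longrightarrow> (\<lambda>x. - F x) \<in> pf J"
  using pf_cmult[of F J "-1"] by simp

lemma pf_diff [intro]: "F \<in> pf J \<Longrightarrow> G \<in> pf J \<Longrightarrow> (\<lambda>x. F x - G x) \<in> pf J"
  using pf_add[OF _ pf_uminus, of F J G] by simp

lemma pf_power [intro]: "F \<in> pf J \<Longrightarrow> (\<lambda>x. F x ^ n) \<in> pf J"
  by (induction n) auto

lemma pf_sum [intro]: "(\<And>a. a \<in> A \<Longrightarrow> F a \<in> pf J) \<Longrightarrow> (\<lambda>x. \<Sum>a\<in>A. F a x) \<in> pf J"
  by (induction A rule: infinite_finite_induct) auto

lemma pf_prod [intro]: "(\<And>a. a \<in> A \<Longrightarrow> F a \<in> pf J) \<Longrightarrow> (\<lambda>x. \<Prod>a\<in>A. F a x) \<in> pf J"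
  by (induction A rule: infinite_finite_induct) auto

lemma pf_subset: "F \<in> pf J \<Longrightarrow> J \<subseteq> K \<Longrightarrow> F \<in> pf K"
  by (elim pfE) (rule pfI[OF pdeg_subset])

lemma pf_cong_vars: "F \<in> pf J \<Longrightarrow> (\<And>i. i \<in> J \<Longrightarrow> x i = y i) \<Longrightarrow> F x = F y"
  by (elim pfE) (rule pdeg_cong_vars)

lemma pdeg_sum: "(\<And>a. a \<in> A \<Longrightarrow> pdeg J d (F a)) \<Longrightarrow> pdeg J d (\<lambda>x. \<Sum>a\<in>A. F a x)"
  by (induction A rule: infinite_finite_induct) (auto intro: pdeg.intros)

lemma pdeg_prod: "(\<And>a. a \<in> A \<Longrightarrow> pdeg J (d a) (F a)) \<Longrightarrow> pdeg J (\<Sum>a\<in>A. d a) (\<lambda>x. \<Prod>a\<in>A. F a x)"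
  by (induction A rule: infinite_finite_induct) (auto intro: pdeg.intros)

lemma pdeg_power: "pdeg J d F \<Longrightarrow> pdeg J (n * d) (\<lambda>x. F x ^ n)"
  by (induction n) (auto intro: pdeg.intros)

lemma pf_compose:
  assumes "F \<in> pf K" "\<And>k. k \<in> K \<Longrightarrow> g k \<in> pf J"
  shows "(\<lambda>x. F (\<lambda>k. g k x)) \<in> pf J"
proof -
  obtain d where "pdeg K d F" using assms(1) by (rule pfE)
  thus ?thesis using assms(2) by induction auto
qed

subsection \<open>Restriction to lines\<close>

lemma poly_ext:
  fixes p q :: "'k::field_char_0 poly"
  assumes "\<And>t. poly p t = poly q t" shows "p = q"
  using assms poly_eq_poly_eq_iff by blast

lemma poly_as_sum:
  fixes p :: "'k::comm_ring_1 poly"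
  assumes "degree p \<le> d" shows "poly p t = (\<Sum>j\<le>d. Polynomial.coeff p j * t ^ j)"
  unfolding poly_altdef by (rule sum.mono_neutral_left) (use assms in \<open>auto simp: coeff_eq_0\<close>)

text \<open>In characteristic zero the field is infinite, so a polynomial is determined by its
  values and the \<open>THE\<close> in \<open>line_poly\<close> is well defined.\<close>

lemma line_poly_eqI:
  fixes p :: "'k::field_char_0 poly"
  assumes "\<And>t. poly p t = F (\<lambda>i. x i + t * y i)"
  shows "line_poly F x y = p"
  unfolding line_poly_def by (rule the_equality) (auto simp: assms intro: poly_ext)

lemma line_exists:
  assumes "pdeg J d F"
  shows "\<exists>p. (\<forall>t. poly p t = F (\<lambda>i. x i + t * y i)) \<and> degree p \<le> d"
  using assms
proof induction
  case (pdeg_const d c)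
  show ?case by (rule exI[of _ "[:c:]"]) simp
next
  case (pdeg_var i d)
  show ?case by (rule exI[of _ "[:x i, y i:]"]) simp
next
  case (pdeg_add d F G)
  then obtain p q where "\<forall>t. poly p t = F (\<lambda>i. x i + t * y i)" "degree p \<le> d"
    "\<forall>t. poly q t = G (\<lambda>i. x i + t * y i)" "degree q \<le> d" by blast
  thus ?case by (intro exI[of _ "p + q"]) (simp add: degree_add_le)
next
  case (pdeg_mult d F e G)
  then obtain p q where "\<forall>t. poly p t = F (\<lambda>i. x i + t * y i)" "degree p \<le> d"
    "\<forall>t. poly q t = G (\<lambda>i. x i + t * y i)" "degree q \<le> e" by blast
  thus ?case using degree_mult_le[of p q] by (intro exI[of _ "p * q"]) simp
qed

lemma poly_line_poly:
  assumes "F \<in> pf J" shows "poly (line_poly F x y) t = F (\<lambda>i. x i + t * y i)"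
proof -
  obtain d where "pdeg J d F" using assms by (rule pfE)
  then obtain p where p: "\<forall>t. poly p t = F (\<lambda>i. x i + t * y i)" using line_exists[of J d F x y] by blast
  hence "line_poly F x y = p" by (intro line_poly_eqI) auto
  with p show ?thesis by simp
qed

lemma degree_line_poly: "pdeg J d F \<Longrightarrow> degree (line_poly F x y) \<le> d"
proof -
  assume "pdeg J d F"
  then obtain p where p: "\<forall>t. poly p t = F (\<lambda>i. x i + t * y i)" "degree p \<le> d"
    using line_exists[of J d F x y] by blast
  hence "line_poly F x y = p" by (intro line_poly_eqI) auto
  with p show ?thesis by simp
qed

lemma line_poly_const [simp]: "line_poly (\<lambda>x. c :: 'k::field_char_0) x y = [:c:]"
  by (rule line_poly_eqI) simp

lemma line_poly_var [simp]: "line_poly (\<lambda>x. x i :: 'k::field_char_0) x y = [:x i, y i:]"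
  by (rule line_poly_eqI) simp

lemma line_poly_add:
  "F \<in> pf J \<Longrightarrow> G \<in> pf J \<Longrightarrow> line_poly (\<lambda>x. F x + G x) x y = line_poly F x y + line_poly G x y"
  by (rule line_poly_eqI) (simp add: poly_line_poly)

lemma line_poly_mult:
  "F \<in> pf J \<Longrightarrow> G \<in> pf J \<Longrightarrow> line_poly (\<lambda>x. F x * G x) x y = line_poly F x y * line_poly G x y"
  by (rule line_poly_eqI) (simp add: poly_line_poly)

text \<open>Indices beyond the degree of either factor are dropped, so that the truncated
  differences \<open>d - i\<close> and \<open>e - (j - i)\<close> in \<open>pdeg_line_coeff\<close>
  really add up to \<open>d + e - j\<close>.\<close>

lemma coeff_mult_split:
  fixes p q :: "'k::comm_ring_1 poly"
  assumes "degree p \<le> d" "degree q \<le> e"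
  shows "Polynomial.coeff (p * q) j =
    (\<Sum>i\<in>{i. i \<le> j \<and> i \<le> d \<and> j - i \<le> e}. Polynomial.coeff p i * Polynomial.coeff q (j - i))"
  unfolding coeff_mult
proof (rule sum.mono_neutral_right)
  show "\<forall>i\<in>{..j} - {i. i \<le> j \<and> i \<le> d \<and> j - i \<le> e}. Polynomial.coeff p i * Polynomial.coeff q (j - i) = 0"
  proof
    fix i assume "i \<in> {..j} - {i. i \<le> j \<and> i \<le> d \<and> j - i \<le> e}"
    hence "degree p < i \<or> degree q < j - i" using assms by auto
    thus "Polynomial.coeff p i * Polynomial.coeff q (j - i) = 0" by (auto simp: coeff_eq_0)
  qed
qed auto

text \<open>The coefficient of \<open>t ^ j\<close> in \<open>F (x + t y)\<close> collects the terms
  with exactly \<open>j\<close> factors taken from \<open>y\<close>.\<close>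

lemma pdeg_line_coeff:
  assumes "pdeg J d F"
  shows "j \<le> d \<Longrightarrow> pdeg J (d - j) (\<lambda>x. Polynomial.coeff (line_poly F x y) j)"
    and "pdeg J j (\<lambda>y. Polynomial.coeff (line_poly F x y) j)"
  using assms
proof (induction arbitrary: j)
  case (pdeg_const d c)
  { case 1 show ?case by (cases j) (auto intro: pdeg.intros)
  next
    case 2 show ?case by (cases j) (auto intro: pdeg.intros) }
next
  case (pdeg_var i d)
  { case 1 show ?case using pdeg_var 1
    by (cases j; cases "j - 1") (auto intro: pdeg.intros simp: coeff_pCons)
  next
    case 2 show ?case using pdeg_var
    by (cases j; cases "j - 1") (auto intro: pdeg.intros simp: coeff_pCons) }
next
  case (pdeg_add d F G)
  hence FG: "F \<in> pf J" "G \<in> pf J" by (auto intro: pfI)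
  { case 1 show ?case using pdeg_add 1 by (simp add: line_poly_add[OF FG] pdeg.pdeg_add)
  next
    case 2 show ?case using pdeg_add by (simp add: line_poly_add[OF FG] pdeg.pdeg_add) }
next
  case (pdeg_mult d F e G)
  hence FG: "F \<in> pf J" "G \<in> pf J" by (auto intro: pfI)
  note dg = degree_line_poly[OF pdeg_mult.hyps(1)] degree_line_poly[OF pdeg_mult.hyps(2)]
  { case 1
    have "pdeg J (d + e - j) (\<lambda>x. \<Sum>i\<in>{i. i \<le> j \<and> i \<le> d \<and> j - i \<le> e}.
        Polynomial.coeff (line_poly F x y) i * Polynomial.coeff (line_poly G x y) (j - i))"
    proof (rule pdeg_sum)
      fix i assume i: "i \<in> {i. i \<le> j \<and> i \<le> d \<and> j - i \<le> e}"
      have "pdeg J ((d - i) + (e - (j - i)))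
        (\<lambda>x. Polynomial.coeff (line_poly F x y) i * Polynomial.coeff (line_poly G x y) (j - i))"
        using i pdeg_mult.IH(1)[of i] pdeg_mult.IH(3)[of "j - i"] by (intro pdeg.pdeg_mult) auto
      moreover have "(d - i) + (e - (j - i)) = d + e - j" using i by auto
      ultimately show "pdeg J (d + e - j)
        (\<lambda>x. Polynomial.coeff (line_poly F x y) i * Polynomial.coeff (line_poly G x y) (j - i))" by simp
    qed
    thus ?case by (simp add: line_poly_mult[OF FG] coeff_mult_split[OF dg])
  next
    case 2
    have "pdeg J j (\<lambda>y. \<Sum>i\<in>{i. i \<le> j \<and> i \<le> d \<and> j - i \<le> e}.
        Polynomial.coeff (line_poly F x y) i * Polynomial.coeff (line_poly G x y) (j - i))"
    proof (rule pdeg_sum)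
      fix i assume i: "i \<in> {i. i \<le> j \<and> i \<le> d \<and> j - i \<le> e}"
      have "pdeg J (i + (j - i))
        (\<lambda>y. Polynomial.coeff (line_poly F x y) i * Polynomial.coeff (line_poly G x y) (j - i))"
        using i pdeg_mult.IH by (intro pdeg.pdeg_mult) auto
      thus "pdeg J j
        (\<lambda>y. Polynomial.coeff (line_poly F x y) i * Polynomial.coeff (line_poly G x y) (j - i))" using i by simp
    qed
    thus ?case by (simp add: line_poly_mult[OF FG] coeff_mult_split[OF dg]) }
qed

lemma pf_line_coeff:
  assumes "F \<in> pf J" shows "(\<lambda>x. Polynomial.coeff (line_poly F x y) j) \<in> pf J"
proof -
  obtain d where d: "pdeg J d F" using assms by (rule pfE)
  show ?thesis
  proof (cases "j \<le> d")
    case True thus ?thesis using pdeg_line_coeff(1)[OF d] pfI by blast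
  next
    case False
    hence "(\<lambda>x. Polynomial.coeff (line_poly F x y) j) = (\<lambda>x. 0)"
      using le_less_trans[OF degree_line_poly[OF d], of j] by (auto intro!: ext coeff_eq_0)
    thus ?thesis by simp
  qed
qed

text \<open>On the line from \<open>a\<close> to \<open>x\<close> the product is the zero polynomial
  in one variable, so one of the two restrictions is zero. It is not that of \<open>F\<close>, whose
  value at parameter 0 is \<open>F a\<close>.\<close>

lemma pf_mult_eq_0:
  assumes "F \<in> pf J" "G \<in> pf J" "\<And>x. F x * G x = 0" "F a \<noteq> 0" shows "G x = 0"
proof (rule ccontr)
  assume "G x \<noteq> 0"
  let ?y = "\<lambda>i. x i - a i"
  have "line_poly F a ?y * line_poly G a ?y = 0"
    by (rule poly_ext) (simp add: poly_line_poly[OF assms(1)] poly_line_poly[OF assms(2)] assms(3))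
  hence "line_poly F a ?y = 0 \<or> line_poly G a ?y = 0" by simp
  thus False using poly_line_poly[OF assms(1), of a ?y 0] poly_line_poly[OF assms(2), of a ?y 1]
     \<open>G x \<noteq> 0\<close> assms(4) by auto
qed

text \<open>Replaces density of a nonempty open set: identities between polynomial functions are
  checked only where some nonzero \<open>P\<close> does not vanish.\<close>

lemma pf_eq_dense:
  assumes "P \<in> pf J" "P a \<noteq> 0" "F \<in> pf J" "G \<in> pf J" "\<And>x. P x \<noteq> 0 \<Longrightarrow> F x = G x"
  shows "F x = G x"
proof -
  have "F x - G x = 0"
    by (rule pf_mult_eq_0[OF assms(1) pf_diff[OF assms(3,4)] _ assms(2)]) (use assms(5) in auto)
  thus ?thesis by simp
qed

lemma pf_prod_nonzero:
  assumes "finite A" "\<And>a. a \<in> A \<Longrightarrow> F a \<in> pf J" "\<And>a. a \<in> A \<Longrightarrow> \<exists>x. F a x \<noteq> 0"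
  shows "\<exists>x. (\<Prod>a\<in>A. F a x) \<noteq> 0"
  using assms
proof (induction A)
  case (insert a A)
  then obtain x where x: "F a x \<noteq> 0" by blast
  obtain y where y: "(\<Prod>a\<in>A. F a y) \<noteq> 0" using insert by blast
  note xy = x y
  have "(\<lambda>x. \<Prod>a\<in>A. F a x) \<in> pf J" using insert by blast
  with pf_mult_eq_0[where F = "F a" and G = "\<lambda>x. \<Prod>a\<in>A. F a x" and a = x and x = y] xy insert.prems(1)
  have "\<exists>x. F a x * (\<Prod>a\<in>A. F a x) \<noteq> 0" by blast
  thus ?case using insert by simp
qed auto

subsection \<open>Directional derivatives\<close>

text \<open>The direction precedes the point, so that \<open>dd F y\<close> is again a polynomial
  function and can be differentiated further.\<close>

definition dd :: "(('i \<Rightarrow> 'k::field_char_0) \<Rightarrow> 'k) \<Rightarrow> ('i \<Rightarrow> 'k) \<Rightarrow> ('i \<Rightarrow> 'k) \<Rightarrow> 'k" where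
  "dd F y x = Polynomial.coeff (line_poly F x y) 1"

lemma pf_dd [intro]: "F \<in> pf J \<Longrightarrow> dd F y \<in> pf J"
  unfolding dd_def by (rule pf_line_coeff)

lemma pdeg_dd: "pdeg J d F \<Longrightarrow> pdeg J (d - 1) (dd F y)"
  unfolding dd_def
proof (cases d)
  case 0
  assume "pdeg J d F"
  hence "(\<lambda>x. Polynomial.coeff (line_poly F x y) 1) = (\<lambda>x. 0)"
    using degree_line_poly[of J d F _ y] 0 by (auto intro!: ext coeff_eq_0)
  thus "pdeg J (d - 1) (\<lambda>x. Polynomial.coeff (line_poly F x y) 1)" by (simp add: pdeg_const)
qed (use pdeg_line_coeff(1)[of J d F 1] in auto)

lemma coeff_line_poly_0: "F \<in> pf J \<Longrightarrow> Polynomial.coeff (line_poly F x y) 0 = F x"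
  using poly_line_poly[of F J x y 0] by (simp add: poly_0_coeff_0)

lemma dd_const [simp]: "dd (\<lambda>x. c) y x = 0" by (simp add: dd_def)

lemma dd_var [simp]: "dd (\<lambda>x. x i) y x = y i" by (simp add: dd_def)

lemma dd_add: "F \<in> pf J \<Longrightarrow> G \<in> pf J \<Longrightarrow> dd (\<lambda>x. F x + G x) y x = dd F y x + dd G y x"
  by (simp add: dd_def line_poly_add)

lemma dd_mult:
  "F \<in> pf J \<Longrightarrow> G \<in> pf J \<Longrightarrow> dd (\<lambda>x. F x * G x) y x = F x * dd G y x + dd F y x * G x"
  by (simp add: dd_def line_poly_mult coeff_mult coeff_line_poly_0)

lemma dd_cmult: "F \<in> pf J \<Longrightarrow> dd (\<lambda>x. c * F x) y x = c * dd F y x"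
  using dd_mult[of "\<lambda>x. c" J F] by simp

lemma dd_sum: "(\<And>a. a \<in> A \<Longrightarrow> F a \<in> pf J) \<Longrightarrow> dd (\<lambda>x. \<Sum>a\<in>A. F a x) y x = (\<Sum>a\<in>A. dd (F a) y x)"
proof (induction A rule: infinite_finite_induct)
  case (insert a A)
  thus ?case using dd_add[of "F a" J "\<lambda>x. \<Sum>a\<in>A. F a x"] by (auto simp: pf_sum)
qed auto

lemma dd_linear:
  assumes "F \<in> pf J"
  shows "dd F (\<lambda>i. a * y i + b * z i) x = a * dd F y x + b * dd F z x"
proof -
  obtain d where "pdeg J d F" using assms by (rule pfE)
  thus ?thesis
  proof induction
    case (pdeg_add d F G)
    thus ?case using dd_add[OF pfI pfI, of J d F d G] by (simp add: algebra_simps)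
  next
    case (pdeg_mult d F e G)
    thus ?case using dd_mult[OF pfI pfI, of J d F e G] by (simp add: algebra_simps)
  qed auto
qed

definition unit :: "'i \<Rightarrow> 'i \<Rightarrow> 'k::zero_neq_one" where "unit i = (\<lambda>j. if j = i then 1 else 0)"

lemma dd_compose:
  assumes "finite K" "F \<in> pf K" "\<And>k. k \<in> K \<Longrightarrow> g k \<in> pf J"
  shows "dd (\<lambda>x. F (\<lambda>k. g k x)) y x = (\<Sum>k\<in>K. dd F (unit k) (\<lambda>k. g k x) * dd (g k) y x)"
proof -
  obtain d where "pdeg K d F" using assms(2) by (rule pfE)
  thus ?thesis
  proof induction
    case (pdeg_const d c) thus ?case by simp
  next
    case (pdeg_var i d)
    thus ?case by (simp add: unit_def if_distrib[of "\<lambda>z. z * _"] if_distribR assms(1) cong: if_cong)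
  next
    case (pdeg_add d F G)
    hence FG: "F \<in> pf K" "G \<in> pf K" by (auto intro: pfI)
    have c: "(\<lambda>x. F (\<lambda>k. g k x)) \<in> pf J" "(\<lambda>x. G (\<lambda>k. g k x)) \<in> pf J"
      using pf_compose FG assms(3) by blast+
    show ?case using pdeg_add by (simp add: dd_add[OF FG] dd_add[OF c] sum.distrib algebra_simps)
  next
    case (pdeg_mult d F e G)
    hence FG: "F \<in> pf K" "G \<in> pf K" by (auto intro: pfI)
    have c: "(\<lambda>x. F (\<lambda>k. g k x)) \<in> pf J" "(\<lambda>x. G (\<lambda>k. g k x)) \<in> pf J"
      using pf_compose FG assms(3) by blast+
    show ?case using pdeg_mult
      by (simp add: dd_mult[OF FG] dd_mult[OF c] sum.distrib sum_distrib_left algebra_simps)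
  qed
qed

lemma dd_sum_unit:
  assumes "finite J" "F \<in> pf J"
  shows "dd F y x = (\<Sum>i\<in>J. y i * dd F (unit i) x)"
proof -
  have "dd (\<lambda>x. F x) y x = (\<Sum>i\<in>J. dd F (unit i) x * y i)"
    using dd_compose[OF assms, of "\<lambda>i x. x i" J y x] by auto
  thus ?thesis by (simp add: mult.commute)
qed

lemma dd_commute:
  assumes "F \<in> pf J"
  shows "dd (dd F y) z x = dd (dd F z) y x"
proof -
  obtain d where "pdeg J d F" using assms by (elim pfE)
  thus ?thesis
  proof (induction arbitrary: x)
    case (pdeg_const d c)
    have "dd (\<lambda>x. c) u = (\<lambda>x. 0)" for u by auto
    thus ?case by simp
  next
    case (pdeg_var i d)
    have "dd (\<lambda>x. x i) u = (\<lambda>x. u i)" for u by auto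
    thus ?case by simp
  next
    case (pdeg_add d F G)
    hence FG: "F \<in> pf J" "G \<in> pf J" by (auto intro: pfI)
    have *: "dd (\<lambda>x. F x + G x) u = (\<lambda>x. dd F u x + dd G u x)" for u by (rule ext) (rule dd_add[OF FG])
    have **: "dd (\<lambda>x. dd F u x + dd G u x) v x = dd (dd F u) v x + dd (dd G u) v x" for u v
      by (rule dd_add) (use FG in auto)
    show ?case using pdeg_add by (simp add: * **)
  next
    case (pdeg_mult d F e G)
    hence FG: "F \<in> pf J" "G \<in> pf J" by (auto intro: pfI)
    have *: "dd (\<lambda>x. F x * G x) u = (\<lambda>x. F x * dd G u x + dd F u x * G x)" for u by (rule ext) (rule dd_mult[OF FG])
    have **: "dd (\<lambda>x. F x * dd G u x + dd F u x * G x) v x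
       = F x * dd (dd G u) v x + dd F v x * dd G u x + (dd F u x * dd G v x + dd (dd F u) v x * G x)" for u v
      by (subst dd_add[of _ J]) (auto simp: dd_mult[OF FG(1) pf_dd[OF FG(2)]] dd_mult[OF pf_dd[OF FG(1)] FG(2)] intro!: pf_mult pf_dd FG)
    show ?case using pdeg_mult by (simp add: * **)
  qed
qed

lemma dd_translate:
  assumes "F \<in> pf J"
  shows "dd (\<lambda>x. F (\<lambda>i. x i + a i)) y x = dd F y (\<lambda>i. x i + a i)"
proof -
  have "line_poly (\<lambda>x. F (\<lambda>i. x i + a i)) x y = line_poly F (\<lambda>i. x i + a i) y"
    by (rule line_poly_eqI) (simp add: poly_line_poly[OF assms] algebra_simps)
  thus ?thesis by (simp add: dd_def)
qed

text \<open>Both sides are coefficients in \<open>t\<close> of \<open>dd F y\<close> at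
  \<open>x + t z\<close>: by translation invariance the derivative passes through the expansion in
  powers of \<open>t\<close>. This is how differentials of shifts are computed.\<close>

lemma line_poly_swap_coeff:
  assumes "F \<in> pf J"
  shows "dd (\<lambda>x. Polynomial.coeff (line_poly F x z) j) y x = Polynomial.coeff (line_poly (dd F y) x z) j"
proof -
  obtain d where d: "pdeg J d F" using assms by (rule pfE)
  define c where "c j = (\<lambda>x. Polynomial.coeff (line_poly F x z) j)" for j
  have c: "c j \<in> pf J" for j unfolding c_def by (rule pf_line_coeff[OF assms])
  have c0: "c j = (\<lambda>x. 0)" if "j > d" for j
    unfolding c_def using degree_line_poly[OF d] that le_less_trans[OF degree_line_poly[OF d], of j] by (auto intro!: ext coeff_eq_0)
  have "poly (\<Sum>j\<le>d. Polynomial.monom (dd (c j) y x) j) t = poly (line_poly (dd F y) x z) t" for t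
  proof -
    have e: "F (\<lambda>i. x i + t * z i) = (\<Sum>j\<le>d. t ^ j * c j x)" for x
    proof -
      have "F (\<lambda>i. x i + t * z i) = poly (line_poly F x z) t" by (simp add: poly_line_poly[OF assms])
      also have "\<dots> = (\<Sum>j\<le>d. Polynomial.coeff (line_poly F x z) j * t ^ j)"
        by (rule poly_as_sum[OF degree_line_poly[OF d]])
      finally show ?thesis by (simp add: c_def mult.commute)
    qed
    have "poly (line_poly (dd F y) x z) t = dd F y (\<lambda>i. x i + t * z i)"
      by (rule poly_line_poly[OF pf_dd[OF assms]])
    also have "\<dots> = dd (\<lambda>x. F (\<lambda>i. x i + t * z i)) y x" by (simp add: dd_translate[OF assms])
    also have "\<dots> = dd (\<lambda>x. \<Sum>j\<le>d. t ^ j * c j x) y x" by (simp add: e)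
    also have "\<dots> = (\<Sum>j\<le>d. t ^ j * dd (c j) y x)"
      using c by (subst dd_sum[of _ _ J]) (auto simp: dd_cmult[of _ J])
    also have "\<dots> = poly (\<Sum>j\<le>d. Polynomial.monom (dd (c j) y x) j) t" by (simp add: poly_sum Polynomial.poly_monom mult.commute)
    finally show ?thesis by simp
  qed
  hence *: "line_poly (dd F y) x z = (\<Sum>j\<le>d. Polynomial.monom (dd (c j) y x) j)" by (intro poly_ext) simp
  have "Polynomial.coeff (\<Sum>j\<le>d. Polynomial.monom (dd (c j) y x) j) j = (if j \<le> d then dd (c j) y x else 0)"
    by (simp add: coeff_sum)
  also have "\<dots> = dd (c j) y x" using c0[of j] by auto
  finally show ?thesis using * by (simp add: c_def)
qed

subsection \<open>Homogeneous components\<close>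

text \<open>The scalar 0 is included: with \<open>0 ^ 0 = 1\<close> it forces functions of degree 0
  to be constant. The zero function has every degree.\<close>

definition homog :: "nat \<Rightarrow> (('i \<Rightarrow> 'k::field_char_0) \<Rightarrow> 'k) \<Rightarrow> bool" where
  "homog d F \<longleftrightarrow> (\<forall>t x. F (\<lambda>i. t * x i) = t ^ d * F x)"

lemma homogD: "homog d F \<Longrightarrow> F (\<lambda>i. t * x i) = t ^ d * F x"
  by (simp add: homog_def)

definition hc :: "(('i \<Rightarrow> 'k::field_char_0) \<Rightarrow> 'k) \<Rightarrow> nat \<Rightarrow> ('i \<Rightarrow> 'k) \<Rightarrow> 'k" where
  "hc F d x = Polynomial.coeff (line_poly F (\<lambda>i. 0) x) d"

lemma pdeg_hc: "pdeg J D F \<Longrightarrow> pdeg J d (hc F d)"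
  unfolding hc_def by (rule pdeg_line_coeff(2))

lemma pf_hc [intro]: "F \<in> pf J \<Longrightarrow> hc F d \<in> pf J"
  by (elim pfE) (rule pfI[OF pdeg_hc])

lemma line_poly_scale_dir:
  assumes "F \<in> pf J"
  shows "line_poly F x (\<lambda>i. s * y i) = pcompose (line_poly F x y) [:0, s:]"
  by (rule line_poly_eqI) (simp add: poly_pcompose poly_line_poly[OF assms] algebra_simps)

lemma coeff_pcompose_scale:
  fixes p :: "'k::comm_ring_1 poly"
  shows "Polynomial.coeff (pcompose p [:0, s:]) i = s ^ i * Polynomial.coeff p i"
  by (induction p arbitrary: i) (auto simp: pcompose_pCons coeff_pCons split: nat.splits)

lemma homog_hc: "F \<in> pf J \<Longrightarrow> homog d (hc F d)"
  by (simp add: homog_def hc_def line_poly_scale_dir coeff_pcompose_scale)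

lemma hc_sum:
  assumes "pdeg J D F"
  shows "F (\<lambda>i. t * x i) = (\<Sum>d\<le>D. hc F d x * t ^ d)"
  using poly_line_poly[OF pfI[OF assms], of "\<lambda>i. 0" x t]
    poly_as_sum[OF degree_line_poly[OF assms], of "\<lambda>i. 0" x t] by (simp add: hc_def)

lemma hc_sum1:
  assumes "pdeg J D F" shows "F x = (\<Sum>d\<le>D. hc F d x)"
  using hc_sum[OF assms, of 1 x] by simp

lemma homog_0_const: "homog 0 F \<Longrightarrow> F x = F (\<lambda>i. 0)"
  using homogD[of 0 F 0 x] by simp

lemma coeff_one_plus_power: "Polynomial.coeff ([:1, 1:] ^ d :: 'k::comm_ring_1 poly) 0 = 1"
  "Polynomial.coeff ([:1, 1:] ^ d :: 'k::comm_ring_1 poly) 1 = of_nat d"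
  by (induction d) (auto simp: mult_pCons_left)

text \<open>Euler's identity, read off from \<open>F (x + t x) = (1 + t) ^ d * F x\<close>.\<close>

lemma dd_euler:
  assumes "homog d F" shows "dd F x x = of_nat d * F x"
proof -
  have "line_poly F x x = Polynomial.smult (F x) ([:1, 1:] ^ d)"
  proof (rule line_poly_eqI)
    fix t
    have "F (\<lambda>i. x i + t * x i) = F (\<lambda>i. (1 + t) * x i)" by (simp add: algebra_simps)
    also have "\<dots> = (1 + t) ^ d * F x" by (rule homogD[OF assms])
    finally show "poly (Polynomial.smult (F x) ([:1, 1:] ^ d)) t = F (\<lambda>i. x i + t * x i)" by simp
  qed
  thus ?thesis by (simp add: dd_def coeff_one_plus_power[simplified])
qed

text \<open>The extra factor \<open>t\<close> avoids the exponent \<open>d - 1\<close>, so that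
  \<open>d = 0\<close> and \<open>t = 0\<close> need no separate treatment.\<close>

lemma dd_scale:
  assumes "F \<in> pf J" "homog d F"
  shows "t * dd F y (\<lambda>i. t * x i) = t ^ d * dd F y x"
proof -
  have "pcompose (line_poly F (\<lambda>i. t * x i) y) [:0, t:] = Polynomial.smult (t ^ d) (line_poly F x y)"
  proof (rule poly_ext)
    fix s
    have "F (\<lambda>i. t * x i + t * (s * y i)) = F (\<lambda>i. t * (x i + s * y i))" by (simp add: algebra_simps)
    also have "\<dots> = t ^ d * F (\<lambda>i. x i + s * y i)" by (rule homogD[OF assms(2)])
    finally show "poly (pcompose (line_poly F (\<lambda>i. t * x i) y) [:0, t:]) s = poly (Polynomial.smult (t ^ d) (line_poly F x y)) s"
      by (simp add: poly_pcompose poly_line_poly[OF assms(1)] ac_simps)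
  qed
  hence "Polynomial.coeff (pcompose (line_poly F (\<lambda>i. t * x i) y) [:0, t:]) 1
    = Polynomial.coeff (Polynomial.smult (t ^ d) (line_poly F x y)) 1" by simp
  thus ?thesis by (simp only: coeff_pcompose_scale coeff_smult dd_def) simp
qed

lemma dd_homog:
  assumes "F \<in> pf J" "homog d F" "d > 0" "t \<noteq> 0"
  shows "dd F y (\<lambda>i. t * x i) = t ^ (d - 1) * dd F y x"
  using dd_scale[OF assms(1,2), of t y x] assms(3,4) by (cases d) auto

subsection \<open>Monomials and the correspondence with formal polynomials\<close>

text \<open>Kronecker's substitution: exponents below \<open>N\<close> are read as digits in base
  \<open>N\<close>, so distinct exponent vectors get distinct weights.\<close>

lemma kronecker_weights:
  assumes "finite S"
  shows "\<exists>w :: 'i \<Rightarrow> nat. \<forall>m m'. (\<forall>i\<in>S. m i < N \<and> m' i < N) \<longrightarrow>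
     (\<Sum>i\<in>S. w i * m i) = (\<Sum>i\<in>S. w i * m' i) \<longrightarrow> (\<forall>i\<in>S. m i = m' i)"
  using assms
proof (induction S)
  case (insert s S)
  then obtain w :: "'i \<Rightarrow> nat" where w: "\<And>m m'. (\<forall>i\<in>S. m i < N \<and> m' i < N) \<Longrightarrow>
     (\<Sum>i\<in>S. w i * m i) = (\<Sum>i\<in>S. w i * m' i) \<Longrightarrow> (\<forall>i\<in>S. m i = m' i)" by blast
  \<comment> \<open>The new variable supplies the lowest digit; all earlier digits move up one
    place.\<close>
  define w' where "w' i = (if i = s then 1 else N * w i)" for i
  have e: "(\<Sum>i\<in>insert s S. w' i * m i) = m s + N * (\<Sum>i\<in>S. w i * m i)" for m :: "'i \<Rightarrow> nat"
  proof -
    have "(\<Sum>i\<in>S. w' i * m i) = (\<Sum>i\<in>S. N * (w i * m i))"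
      using insert.hyps by (intro sum.cong) (auto simp: w'_def)
    thus ?thesis using insert.hyps by (simp add: w'_def sum_distrib_left)
  qed
  show ?case
  proof (intro exI[of _ w'] allI impI)
    fix m m' :: "'i \<Rightarrow> nat"
    assume b: "\<forall>i\<in>insert s S. m i < N \<and> m' i < N"
      and eq: "(\<Sum>i\<in>insert s S. w' i * m i) = (\<Sum>i\<in>insert s S. w' i * m' i)"
    hence eq': "m s + N * (\<Sum>i\<in>S. w i * m i) = m' s + N * (\<Sum>i\<in>S. w i * m' i)" by (simp only: e)
    have lt: "m s < N" "m' s < N" using b by auto
    have "(m s + N * (\<Sum>i\<in>S. w i * m i)) mod N = (m' s + N * (\<Sum>i\<in>S. w i * m' i)) mod N"
      by (simp only: eq')
    hence 1: "m s = m' s" using lt by simp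
    have "N > 0" using lt by simp
    with eq' 1 have "(\<Sum>i\<in>S. w i * m i) = (\<Sum>i\<in>S. w i * m' i)" by simp
    with w[of m m'] b 1 show "\<forall>i\<in>insert s S. m i = m' i" by auto
  qed
qed auto

text \<open>Substituting \<open>t ^ w i\<close> for \<open>x i\<close> separates the monomials, so
  that each \<open>c a\<close> becomes a coefficient of one polynomial in \<open>t\<close>.\<close>

lemma monomials_independent:
  fixes c :: "'a \<Rightarrow> 'k::field_char_0"
  assumes "finite S" "finite A"
    and inj: "\<And>a b. a \<in> A \<Longrightarrow> b \<in> A \<Longrightarrow> (\<forall>i\<in>S. e a i = e b i) \<Longrightarrow> a = b"
    and zero: "\<And>x. (\<Sum>a\<in>A. c a * (\<Prod>i\<in>S. x i ^ e a i)) = 0"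
    and "a \<in> A"
  shows "c a = 0"
proof -
  obtain N where N: "\<And>a i. a \<in> A \<Longrightarrow> i \<in> S \<Longrightarrow> e a i < N"
  proof -
    have "finite ((\<lambda>(a, i). e a i) ` (A \<times> S))" using assms(1,2) by auto
    then obtain M where "\<forall>n\<in>(\<lambda>(a, i). e a i) ` (A \<times> S). n \<le> M" using finite_nat_set_iff_bounded_le by blast
    thus ?thesis using that[of "Suc M"] by (force simp: less_Suc_eq_le)
  qed
  obtain w where w: "\<And>m m'. (\<forall>i\<in>S. m i < N \<and> m' i < N) \<Longrightarrow>
     (\<Sum>i\<in>S. w i * m i) = (\<Sum>i\<in>S. w i * m' i) \<Longrightarrow> (\<forall>i\<in>S. m i = m' i)"
    using kronecker_weights[OF assms(1)] by blast
  let ?E = "\<lambda>b. \<Sum>i\<in>S. w i * e b i"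
  have "(\<Sum>b\<in>A. Polynomial.monom (c b) (?E b)) = 0"
  proof (rule poly_ext)
    fix t
    have "poly (\<Sum>b\<in>A. Polynomial.monom (c b) (?E b)) t = (\<Sum>b\<in>A. c b * t ^ ?E b)"
      by (simp add: poly_sum Polynomial.poly_monom)
    also have "\<dots> = (\<Sum>b\<in>A. c b * (\<Prod>i\<in>S. (t ^ w i) ^ e b i))"
      by (simp add: power_mult[symmetric] power_sum)
    finally show "poly (\<Sum>b\<in>A. Polynomial.monom (c b) (?E b)) t = poly 0 t" by (simp add: zero)
  qed
  hence "(\<Sum>b\<in>A. Polynomial.coeff (Polynomial.monom (c b) (?E b)) (?E a)) = 0"
    by (simp only: coeff_sum[symmetric]) simp
  moreover have "(\<Sum>b\<in>A. Polynomial.coeff (Polynomial.monom (c b) (?E b)) (?E a)) = (\<Sum>b\<in>A. if b = a then c b else 0)"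
  proof (rule sum.cong)
    fix b assume b: "b \<in> A"
    have "?E b = ?E a \<longleftrightarrow> b = a" using w[of "e b" "e a"] inj[of b a] N b assms(5) by blast
    thus "Polynomial.coeff (Polynomial.monom (c b) (?E b)) (?E a) = (if b = a then c b else 0)" by auto
  qed auto
  ultimately show ?thesis using assms(2,5) by simp
qed

definition mfun :: "('i \<Rightarrow>\<^sub>0 nat) \<Rightarrow> ('i \<Rightarrow> 'k::comm_ring_1) \<Rightarrow> 'k" where
  "mfun m x = (\<Prod>i\<in>Poly_Mapping.keys m. x i ^ Poly_Mapping.lookup m i)"

lemma mfun_superset:
  assumes "finite S" "Poly_Mapping.keys m \<subseteq> S"
  shows "mfun m x = (\<Prod>i\<in>S. x i ^ Poly_Mapping.lookup m i)"
  unfolding mfun_def by (rule prod.mono_neutral_left) (use assms in \<open>auto simp: in_keys_iff\<close>)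

lemma mfun_add: "mfun (m + n) x = mfun m x * mfun n x"
proof -
  let ?S = "Poly_Mapping.keys m \<union> Poly_Mapping.keys n"
  have "Poly_Mapping.keys (m + n) \<subseteq> ?S" by (rule Poly_Mapping.keys_add)
  thus ?thesis by (simp add: mfun_superset[of ?S] lookup_add power_add prod.distrib)
qed

lemma mpoly_eval_superset:
  assumes "finite A" "Poly_Mapping.keys P \<subseteq> A"
  shows "mpoly_eval P x = (\<Sum>m\<in>A. Poly_Mapping.lookup P m * mfun m x)"
  unfolding mpoly_eval_def mfun_def
  by (rule sum.mono_neutral_left) (use assms in \<open>auto simp: in_keys_iff\<close>)

lemma mpoly_eval_add: "mpoly_eval (P + Q) x = mpoly_eval P x + mpoly_eval Q x"
proof -
  let ?S = "Poly_Mapping.keys P \<union> Poly_Mapping.keys Q"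
  have "Poly_Mapping.keys (P + Q) \<subseteq> ?S" by (rule Poly_Mapping.keys_add)
  thus ?thesis by (simp add: mpoly_eval_superset[of ?S] lookup_add algebra_simps sum.distrib)
qed

definition msize :: "('i \<Rightarrow>\<^sub>0 nat) \<Rightarrow> nat" where
  "msize m = (\<Sum>i\<in>Poly_Mapping.keys m. Poly_Mapping.lookup m i)"

lemma msize_superset:
  assumes "finite S" "Poly_Mapping.keys m \<subseteq> S"
  shows "msize m = (\<Sum>i\<in>S. Poly_Mapping.lookup m i)"
  unfolding msize_def by (rule sum.mono_neutral_left) (use assms in \<open>auto simp: in_keys_iff\<close>)

lemma msize_add: "msize (m + n) = msize m + msize n"
proof -
  let ?S = "Poly_Mapping.keys m \<union> Poly_Mapping.keys n"
  have "Poly_Mapping.keys (m + n) \<subseteq> ?S" by (rule Poly_Mapping.keys_add)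
  thus ?thesis by (simp add: msize_superset[of ?S] lookup_add sum.distrib)
qed

lemma pdeg_mfun:
  assumes "Poly_Mapping.keys m \<subseteq> J" shows "pdeg J (msize m) (mfun m)"
proof -
  have "pdeg J (\<Sum>i\<in>Poly_Mapping.keys m. Poly_Mapping.lookup m i * 1) (\<lambda>x. \<Prod>i\<in>Poly_Mapping.keys m. x i ^ Poly_Mapping.lookup m i)"
    using assms pdeg_var[of _ J 0] by (intro pdeg_prod pdeg_power) auto
  thus ?thesis by (simp add: mfun_def[abs_def] msize_def)
qed

lemma msize_le_degree: "m \<in> Poly_Mapping.keys P \<Longrightarrow> msize m \<le> mpoly_degree P"
  unfolding mpoly_degree_def msize_def by (rule Max_ge) auto

lemma pdeg_mpoly_eval: "pdeg (mpoly_vars P) (mpoly_degree P) (mpoly_eval P)"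
proof -
  have "pdeg (mpoly_vars P) (mpoly_degree P)
    (\<lambda>x. \<Sum>m\<in>Poly_Mapping.keys P. Poly_Mapping.lookup P m * mfun m x)"
  proof (rule pdeg_sum)
    fix m assume m: "m \<in> Poly_Mapping.keys P"
    hence "pdeg (mpoly_vars P) (msize m) (mfun m)"
      by (intro pdeg_mfun) (auto simp: mpoly_vars_def)
    hence "pdeg (mpoly_vars P) (mpoly_degree P) (mfun m)" using msize_le_degree[OF m] by (rule pdeg_mono)
    from pdeg_mult[OF pdeg_const[of _ 0] this]
    show "pdeg (mpoly_vars P) (mpoly_degree P) (\<lambda>x. Poly_Mapping.lookup P m * mfun m x)" by simp
  qed
  thus ?thesis by (simp add: mpoly_eval_def[abs_def] mfun_def)
qed

text \<open>The exponent vectors \<open>\<mu> a\<close> may coincide for different \<open>a\<close>,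
  as happens when two formal polynomials are multiplied out.\<close>

lemma mpoly_of_sum:
  fixes c :: "'a \<Rightarrow> 'k::comm_ring_1"
  assumes "finite A" "\<And>a. a \<in> A \<Longrightarrow> Poly_Mapping.keys (\<mu> a) \<subseteq> J \<and> msize (\<mu> a) \<le> d"
  shows "\<exists>P. mpoly_vars P \<subseteq> J \<and> mpoly_degree P \<le> d \<and> (\<forall>x. mpoly_eval P x = (\<Sum>a\<in>A. c a * mfun (\<mu> a) x))
      \<and> Poly_Mapping.keys P \<subseteq> \<mu> ` A"
proof -
  have ev: "mpoly_eval (Poly_Mapping.single m b) x = b * mfun m x" for m b and x :: "_ \<Rightarrow> 'k"
    by (subst mpoly_eval_superset[of "{m}"]) (auto simp: lookup_single)
  have ev0: "mpoly_eval 0 x = 0" for x :: "_ \<Rightarrow> 'k" by (simp add: mpoly_eval_def)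
  let ?P = "\<Sum>a\<in>A. Poly_Mapping.single (\<mu> a) (c a)"
  have "mpoly_eval ?P x = (\<Sum>a\<in>A. c a * mfun (\<mu> a) x)" for x
    using assms(1) by (induction A) (auto simp: ev ev0 mpoly_eval_add)
  moreover have k: "Poly_Mapping.keys ?P \<subseteq> \<mu> ` A"
    using assms(1)
  proof (induction A)
    case (insert a A)
    have "Poly_Mapping.keys (Poly_Mapping.single (\<mu> a) (c a) + (\<Sum>a\<in>A. Poly_Mapping.single (\<mu> a) (c a)))
      \<subseteq> Poly_Mapping.keys (Poly_Mapping.single (\<mu> a) (c a)) \<union> Poly_Mapping.keys (\<Sum>a\<in>A. Poly_Mapping.single (\<mu> a) (c a))"
      by (rule Poly_Mapping.keys_add)
    also have "\<dots> \<subseteq> \<mu> ` insert a A" using insert.IH by auto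
    finally show ?case using insert.hyps by simp
  qed auto
  moreover have "mpoly_vars ?P \<subseteq> J" using k assms(2) unfolding mpoly_vars_def by blast
  moreover have "mpoly_degree ?P \<le> d"
    unfolding mpoly_degree_def msize_def[symmetric] using k assms(2) by (subst Max_le_iff) auto
  ultimately show ?thesis by blast
qed

text \<open>Converse of \<open>pdeg_mpoly_eval\<close>: the inductive predicate and evaluation of
  formal polynomials describe the same functions, with the same control of variables and
  degree.\<close>

lemma pdeg_imp_mpoly:
  assumes "pdeg J d F"
  shows "\<exists>P. mpoly_vars P \<subseteq> J \<and> mpoly_degree P \<le> d \<and> mpoly_eval P = F"
  using assms
proof induction
  case (pdeg_const d c)
  show ?case using mpoly_of_sum[of "{()}" "\<lambda>_. 0" J d "\<lambda>_. c"]
    by (auto simp: msize_def mfun_def fun_eq_iff)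
next
  case (pdeg_var i d)
  thus ?case using mpoly_of_sum[of "{()}" "\<lambda>_. Poly_Mapping.single i 1" J "Suc d" "\<lambda>_. 1"]
    by (auto simp: msize_def mfun_def fun_eq_iff)
next
  case (pdeg_add d F G)
  then obtain P Q where P: "mpoly_vars P \<subseteq> J" "mpoly_degree P \<le> d" "mpoly_eval P = F"
    and Q: "mpoly_vars Q \<subseteq> J" "mpoly_degree Q \<le> d" "mpoly_eval Q = G" by blast
  have k: "Poly_Mapping.keys (P + Q) \<subseteq> Poly_Mapping.keys P \<union> Poly_Mapping.keys Q"
    by (rule Poly_Mapping.keys_add)
  have "mpoly_vars (P + Q) \<subseteq> J" using k P(1) Q(1) unfolding mpoly_vars_def by blast
  moreover have "msize m \<le> d" if "m \<in> Poly_Mapping.keys (P + Q)" for m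
  proof -
    have "m \<in> Poly_Mapping.keys P \<or> m \<in> Poly_Mapping.keys Q" using k that by auto
    thus ?thesis using msize_le_degree[of m P] msize_le_degree[of m Q] P(2) Q(2) by auto
  qed
  hence "mpoly_degree (P + Q) \<le> d"
    unfolding mpoly_degree_def msize_def[symmetric] by (subst Max_le_iff) auto
  moreover have "mpoly_eval (P + Q) = (\<lambda>x. F x + G x)" using P(3) Q(3) by (auto simp: mpoly_eval_add)
  ultimately show ?case by blast
next
  case (pdeg_mult d F e G)
  then obtain P Q where P: "mpoly_vars P \<subseteq> J" "mpoly_degree P \<le> d" "mpoly_eval P = F"
    and Q: "mpoly_vars Q \<subseteq> J" "mpoly_degree Q \<le> e" "mpoly_eval Q = G" by blast
  let ?A = "Poly_Mapping.keys P \<times> Poly_Mapping.keys Q"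
  have FG: "F x * G x = (\<Sum>a\<in>?A. (Poly_Mapping.lookup P (fst a) * Poly_Mapping.lookup Q (snd a)) * mfun (fst a + snd a) x)" for x
  proof -
    have "F x * G x = (\<Sum>m\<in>Poly_Mapping.keys P. Poly_Mapping.lookup P m * mfun m x) * (\<Sum>m\<in>Poly_Mapping.keys Q. Poly_Mapping.lookup Q m * mfun m x)"
      using P(3)[symmetric] Q(3)[symmetric] by (simp add: mpoly_eval_def mfun_def)
    thus ?thesis by (simp add: sum_product sum.cartesian_product case_prod_unfold mfun_add algebra_simps)
  qed
  have "Poly_Mapping.keys (fst a + snd a) \<subseteq> J \<and> msize (fst a + snd a) \<le> d + e" if "a \<in> ?A" for a
  proof -
    have "Poly_Mapping.keys (fst a + snd a) \<subseteq> Poly_Mapping.keys (fst a) \<union> Poly_Mapping.keys (snd a)"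
      by (rule Poly_Mapping.keys_add)
    moreover have "Poly_Mapping.keys (fst a) \<subseteq> J" "Poly_Mapping.keys (snd a) \<subseteq> J"
      using that P(1) Q(1) unfolding mpoly_vars_def by (metis SUP_le_iff mem_Times_iff)+
    moreover have "msize (fst a) \<le> d" "msize (snd a) \<le> e"
      using that msize_le_degree[of "fst a" P] msize_le_degree[of "snd a" Q] P(2) Q(2) by auto
    ultimately show ?thesis by (auto simp: msize_add)
  qed
  from mpoly_of_sum[of ?A "\<lambda>a. fst a + snd a" J "d + e", OF _ this,
     of "\<lambda>a. Poly_Mapping.lookup P (fst a) * Poly_Mapping.lookup Q (snd a)"]
  show ?case by (auto simp: FG fun_eq_iff)
qed

lemma mpoly_eval_eq_0:
  fixes P :: "('i \<Rightarrow>\<^sub>0 nat) \<Rightarrow>\<^sub>0 'k::field_char_0"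
  assumes "\<And>x. mpoly_eval P x = 0" shows "P = 0"
proof (rule poly_mapping_eqI)
  fix m
  let ?S = "\<Union>m\<in>Poly_Mapping.keys P. Poly_Mapping.keys m"
  have S: "finite ?S" by auto
  have "Poly_Mapping.lookup P m = 0" if "m \<in> Poly_Mapping.keys P"
  proof (rule monomials_independent[OF S _ _ _ that, where e = "Poly_Mapping.lookup"])
    fix x :: "'i \<Rightarrow> 'k"
    have "mpoly_eval P x = (\<Sum>a\<in>Poly_Mapping.keys P. Poly_Mapping.lookup P a * (\<Prod>i\<in>?S. x i ^ Poly_Mapping.lookup a i))"
      unfolding mpoly_eval_def mfun_def[symmetric]
      by (intro sum.cong arg_cong2[of _ _ _ _ "(*)"] refl mfun_superset[OF S]) auto
    thus "(\<Sum>a\<in>Poly_Mapping.keys P. Poly_Mapping.lookup P a * (\<Prod>i\<in>?S. x i ^ Poly_Mapping.lookup a i)) = 0"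
      by (simp add: assms)
  next
    fix a b assume ab: "a \<in> Poly_Mapping.keys P" "b \<in> Poly_Mapping.keys P" and e: "\<forall>i\<in>?S. Poly_Mapping.lookup a i = Poly_Mapping.lookup b i"
    show "a = b"
    proof (rule poly_mapping_eqI)
      fix i show "Poly_Mapping.lookup a i = Poly_Mapping.lookup b i"
      proof (cases "i \<in> ?S")
        case False
        hence "i \<notin> Poly_Mapping.keys a" "i \<notin> Poly_Mapping.keys b" using ab by auto
        thus ?thesis by (simp add: in_keys_iff)
      qed (use e in auto)
    qed
  qed auto
  thus "Poly_Mapping.lookup P m = Poly_Mapping.lookup 0 m" by (auto simp: in_keys_iff)
qed

subsection \<open>Counting algebraically independent functions\<close>

text \<open>Gaussian elimination: an equation \<open>b\<close> with a nonzero coefficient at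
  \<open>a0\<close> is solved for that unknown, leaving one equation and one unknown less.\<close>

lemma underdetermined_system:
  fixes M :: "'a \<Rightarrow> 'b \<Rightarrow> 'k::field"
  assumes "finite B" "finite A" "card B < card A"
  shows "\<exists>c. (\<exists>a\<in>A. c a \<noteq> 0) \<and> (\<forall>b\<in>B. (\<Sum>a\<in>A. c a * M a b) = 0)"
  using assms
proof (induction B arbitrary: A M)
  case empty
  hence "A \<noteq> {}" by auto
  thus ?case by (intro exI[of _ "\<lambda>_. 1"]) auto
next
  case (insert b B)
  show ?case
  proof (cases "\<forall>a\<in>A. M a b = 0")
    case True
    thus ?thesis using insert.IH[of A M] insert by auto
  next
    case False
    then obtain a0 where a0: "a0 \<in> A" "M a0 b \<noteq> 0" by auto
    let ?A = "A - {a0}"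
    have "card B < card ?A" using insert a0 by simp
    then obtain c where c: "\<exists>a\<in>?A. c a \<noteq> 0"
      "\<And>b'. b' \<in> B \<Longrightarrow> (\<Sum>a\<in>?A. c a * (M a b' - M a b / M a0 b * M a0 b')) = 0"
      using insert.IH[of ?A "\<lambda>a b'. M a b' - M a b / M a0 b * M a0 b'"] insert.prems by auto
    \<comment> \<open>Equation \<open>b\<close> forces the value \<open>- s\<close> on the
      eliminated unknown.\<close>
    define s where "s = (\<Sum>a\<in>?A. c a * (M a b / M a0 b))"
    define c' where "c' a = (if a = a0 then - s else c a)" for a
    have sum: "(\<Sum>a\<in>A. c' a * M a b') = - s * M a0 b' + (\<Sum>a\<in>?A. c a * M a b')" for b'
    proof -
      have "(\<Sum>a\<in>A. c' a * M a b') = c' a0 * M a0 b' + (\<Sum>a\<in>?A. c' a * M a b')"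
        by (rule sum.remove) (use insert.prems a0 in auto)
      also have "(\<Sum>a\<in>?A. c' a * M a b') = (\<Sum>a\<in>?A. c a * M a b')"
        by (rule sum.cong) (auto simp: c'_def)
      finally show ?thesis by (simp add: c'_def)
    qed
    have "(\<Sum>a\<in>A. c' a * M a b') = 0" if "b' \<in> insert b B" for b'
    proof (cases "b' = b")
      case True
      have "s * M a0 b = (\<Sum>a\<in>?A. c a * M a b)"
        unfolding s_def sum_distrib_right by (rule sum.cong) (use a0 in auto)
      thus ?thesis using True sum[of b] by simp
    next
      case False
      hence "(\<Sum>a\<in>?A. c a * (M a b' - M a b / M a0 b * M a0 b')) = 0" using that c(2) by auto
      moreover have "(\<Sum>a\<in>?A. c a * (M a b' - M a b / M a0 b * M a0 b')) = (\<Sum>a\<in>?A. c a * M a b') - s * M a0 b'"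
        unfolding s_def sum_distrib_right sum_subtractf[symmetric] by (rule sum.cong) (simp_all add: algebra_simps)
      ultimately have "(\<Sum>a\<in>?A. c a * M a b') = s * M a0 b'" by simp
      thus ?thesis using sum[of b'] by simp
    qed
    moreover have "\<exists>a\<in>A. c' a \<noteq> 0" using c(1) by (auto simp: c'_def)
    ultimately show ?thesis by blast
  qed
qed

text \<open>The exponents run over a full box instead of the vectors of size at most
  \<open>d\<close>, because the box has an easily computed cardinality, all that the counting
  argument below needs.\<close>

lemma pdeg_monomial_expansion:
  assumes "finite J" "pdeg J d F"
  shows "\<exists>c. \<forall>x. F x = (\<Sum>e\<in>J \<rightarrow>\<^sub>E {..d}. c e * (\<Prod>i\<in>J. x i ^ e i))"
proof -
  obtain P where P: "mpoly_vars P \<subseteq> J" "mpoly_degree P \<le> d" "mpoly_eval P = F"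
    using pdeg_imp_mpoly[OF assms(2)] by blast
  define g where "g m = restrict (Poly_Mapping.lookup m) J" for m :: "'a \<Rightarrow>\<^sub>0 nat"
  have kJ: "Poly_Mapping.keys m \<subseteq> J" if "m \<in> Poly_Mapping.keys P" for m
    using P(1) that unfolding mpoly_vars_def by (metis SUP_le_iff)
  have g: "g m \<in> J \<rightarrow>\<^sub>E {..d}" if "m \<in> Poly_Mapping.keys P" for m
  proof -
    have "Poly_Mapping.lookup m i \<le> d" if "i \<in> J" for i
    proof -
      have "Poly_Mapping.lookup m i \<le> (\<Sum>i\<in>J. Poly_Mapping.lookup m i)"
        using that assms(1) by (intro member_le_sum) auto
      also have "\<dots> = msize m"
        by (rule msize_superset[symmetric, OF assms(1) kJ[OF \<open>m \<in> Poly_Mapping.keys P\<close>]])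
      also have "\<dots> \<le> d" using msize_le_degree[OF \<open>m \<in> Poly_Mapping.keys P\<close>] P(2) by simp
      finally show ?thesis .
    qed
    thus ?thesis by (auto simp: g_def)
  qed
  \<comment> \<open>Summing over the fibres of \<open>g\<close> avoids a proof that \<open>g\<close>
    is injective on the monomials of \<open>P\<close>.\<close>
  define c where "c e = (\<Sum>m\<in>{m \<in> Poly_Mapping.keys P. g m = e}. Poly_Mapping.lookup P m)" for e
  have "F x = (\<Sum>e\<in>J \<rightarrow>\<^sub>E {..d}. c e * (\<Prod>i\<in>J. x i ^ e i))" for x
  proof -
    have "F x = (\<Sum>m\<in>Poly_Mapping.keys P. Poly_Mapping.lookup P m * mfun m x)"
      by (simp add: P(3)[symmetric] mpoly_eval_def mfun_def)
    also have "\<dots> = (\<Sum>m\<in>Poly_Mapping.keys P. Poly_Mapping.lookup P m * (\<Prod>i\<in>J. x i ^ g m i))"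
    proof (rule sum.cong[OF refl])
      fix m assume "m \<in> Poly_Mapping.keys P"
      show "Poly_Mapping.lookup P m * mfun m x = Poly_Mapping.lookup P m * (\<Prod>i\<in>J. x i ^ g m i)"
        by (simp add: g_def mfun_superset[OF assms(1) kJ[OF \<open>m \<in> Poly_Mapping.keys P\<close>]])
    qed
    also have "\<dots> = (\<Sum>e\<in>J \<rightarrow>\<^sub>E {..d}. \<Sum>m\<in>{m \<in> Poly_Mapping.keys P. g m = e}.
        Poly_Mapping.lookup P m * (\<Prod>i\<in>J. x i ^ g m i))"
      by (rule sum.group[symmetric]) (use assms(1) g in \<open>auto intro!: finite_PiE\<close>)
    also have "\<dots> = (\<Sum>e\<in>J \<rightarrow>\<^sub>E {..d}. c e * (\<Prod>i\<in>J. x i ^ e i))"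
      unfolding c_def sum_distrib_right by (intro sum.cong) auto
    finally show ?thesis .
  qed
  thus ?thesis by blast
qed

text \<open>Counting: the \<open>D ^ r\<close> monomials in the \<open>\<psi> k\<close> with
  exponents below \<open>D\<close> are combinations of at most \<open>(r * D * e + 1) ^ n\<close>
  monomials in the \<open>n < r\<close> variables. For large \<open>D\<close> there are too many of
  them to be linearly independent.\<close>

lemma more_functions_than_variables:
  fixes \<psi> :: "nat \<Rightarrow> ('i \<Rightarrow> 'k::field_char_0) \<Rightarrow> 'k"
  assumes "finite J" "card J < r" "\<And>k. k < r \<Longrightarrow> \<psi> k \<in> pf J"
  shows "\<exists>\<phi>\<in>pf {..<r}. (\<exists>y. \<phi> y \<noteq> 0) \<and> (\<forall>x. \<phi> (\<lambda>k. \<psi> k x) = 0)"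
proof -
  have "\<forall>k. \<exists>e. k < r \<longrightarrow> pdeg J e (\<psi> k)" using assms(3) by (auto simp: pf_def)
  then obtain e0 where e0: "\<And>k. k < r \<Longrightarrow> pdeg J (e0 k) (\<psi> k)" by metis
  define e where "e = (\<Sum>k<r. e0 k)"
  have e: "pdeg J e (\<psi> k)" if "k < r" for k
    using e0[OF that] by (rule pdeg_mono) (use that in \<open>auto simp: e_def intro!: member_le_sum\<close>)
  define n where "n = card J"
  \<comment> \<open>Chosen larger than \<open>(r * e + 1) ^ n\<close>, so that
    \<open>((r * e + 1) * D) ^ n < D ^ (n + 1) \<le> D ^ r\<close>.\<close>
  define D where "D = Suc ((r * e + 1) ^ n)"
  define A where "A = {..<r} \<rightarrow>\<^sub>E {..<D}"
  define B where "B = J \<rightarrow>\<^sub>E {..r * D * e}"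
  have fin: "finite A" "finite B" unfolding A_def B_def using assms(1) by (auto intro!: finite_PiE)
  have "card B = Suc (r * D * e) ^ n" unfolding B_def n_def using assms(1) by (simp add: card_PiE)
  also have "\<dots> \<le> ((r * e + 1) * D) ^ n"
    by (rule power_mono) (auto simp: algebra_simps D_def)
  also have "\<dots> = (r * e + 1) ^ n * D ^ n" by (rule power_mult_distrib)
  also have "\<dots> < D * D ^ n" by (rule mult_strict_right_mono) (auto simp: D_def)
  also have "\<dots> = D ^ Suc n" by simp
  also have "\<dots> \<le> D ^ r" by (rule power_increasing) (use assms(2) in \<open>auto simp: D_def n_def\<close>)
  also have "\<dots> = card A" unfolding A_def by (simp add: card_PiE)
  finally have lt: "card B < card A" .
  have "\<exists>c. \<forall>x. (\<Prod>k<r. \<psi> k x ^ a k) = (\<Sum>b\<in>B. c b * (\<Prod>i\<in>J. x i ^ b i))" if "a \<in> A" for a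
  proof -
    have "pdeg J (\<Sum>k<r. a k * e) (\<lambda>x. \<Prod>k<r. \<psi> k x ^ a k)"
      by (intro pdeg_prod pdeg_power e) auto
    moreover have "(\<Sum>k<r. a k * e) \<le> (\<Sum>k<r. D * e)"
      using that by (intro sum_mono mult_right_mono) (auto simp: A_def PiE_iff less_imp_le)
    ultimately have "pdeg J (r * D * e) (\<lambda>x. \<Prod>k<r. \<psi> k x ^ a k)"
      by (auto intro: pdeg_mono simp: algebra_simps)
    from pdeg_monomial_expansion[OF assms(1) this] show ?thesis by (simp add: B_def)
  qed
  then obtain M where M: "\<And>a x. a \<in> A \<Longrightarrow> (\<Prod>k<r. \<psi> k x ^ a k) = (\<Sum>b\<in>B. M a b * (\<Prod>i\<in>J. x i ^ b i))"
    by metis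
  from underdetermined_system[OF fin(2,1) lt, of M] obtain c where
    c: "\<exists>a\<in>A. c a \<noteq> 0" "\<And>b. b \<in> B \<Longrightarrow> (\<Sum>a\<in>A. c a * M a b) = 0" by blast
  define \<phi> where "\<phi> = (\<lambda>y. \<Sum>a\<in>A. c a * (\<Prod>k<r. y k ^ a k))"
  have "\<phi> \<in> pf {..<r}" unfolding \<phi>_def by (intro pf_sum pf_cmult pf_prod pf_power pf_var)
  moreover have "\<exists>y. \<phi> y \<noteq> 0"
  proof (rule ccontr)
    assume z: "\<nexists>y. \<phi> y \<noteq> 0"
    have "c a = 0" if "a \<in> A" for a
    proof (rule monomials_independent[of "{..<r}" A "\<lambda>a. a" c a])
      fix a b assume "a \<in> A" "b \<in> A" "\<forall>i\<in>{..<r}. a i = b i"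
      thus "a = b" unfolding A_def by (auto intro: PiE_ext)
    qed (use fin z that in \<open>auto simp: \<phi>_def\<close>)
    thus False using c(1) by blast
  qed
  moreover have "\<phi> (\<lambda>k. \<psi> k x) = 0" for x
  proof -
    have "\<phi> (\<lambda>k. \<psi> k x) = (\<Sum>a\<in>A. \<Sum>b\<in>B. c a * M a b * (\<Prod>i\<in>J. x i ^ b i))"
      unfolding \<phi>_def by (rule sum.cong) (auto simp: M sum_distrib_left mult.assoc)
    also have "\<dots> = (\<Sum>b\<in>B. (\<Sum>a\<in>A. c a * M a b) * (\<Prod>i\<in>J. x i ^ b i))"
      unfolding sum_distrib_right by (rule sum.swap)
    also have "\<dots> = 0" by (rule sum.neutral) (simp add: c(2))
    finally show ?thesis .
  qed
  ultimately show ?thesis by blast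
qed

text \<open>For an ideal \<open>I\<close> this is algebraic independence of the residue classes; the
  quotient ring itself is never formed.\<close>

definition indep_mod :: "nat \<Rightarrow> (nat \<Rightarrow> 'p \<Rightarrow> 'k::field_char_0) \<Rightarrow> ('p \<Rightarrow> 'k) set \<Rightarrow> bool" where
  "indep_mod r g I \<longleftrightarrow> (\<forall>\<phi>\<in>pf {..<r}. (\<lambda>p. \<phi> (\<lambda>k. g k p)) \<in> I \<longrightarrow> (\<forall>y. \<phi> y = 0))"

text \<open>The map \<open>u\<close> makes the bound available inside generated algebras: for
  \<open>u x = (\<lambda>i. F i x)\<close> it counts the generators \<open>F i\<close> instead of
  coordinates.\<close>

lemma indep_mod_le_card:
  assumes "finite J" "indep_mod r g I" "(\<lambda>p. 0) \<in> I"
    and "\<And>k. k < r \<Longrightarrow> \<exists>\<psi>\<in>pf J. g k = (\<lambda>p. \<psi> (u p))"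
  shows "r \<le> card J"
proof (rule ccontr)
  assume "\<not> r \<le> card J"
  hence r: "card J < r" by simp
  obtain \<psi> where \<psi>: "\<And>k. k < r \<Longrightarrow> \<psi> k \<in> pf J" "\<And>k. k < r \<Longrightarrow> g k = (\<lambda>p. \<psi> k (u p))"
    using assms(4) by metis
  obtain \<phi> where \<phi>: "\<phi> \<in> pf {..<r}" "\<exists>y. \<phi> y \<noteq> 0" "\<And>x. \<phi> (\<lambda>k. \<psi> k x) = 0"
    using more_functions_than_variables[of J r \<psi>, OF assms(1) r \<psi>(1)] by blast
  have "\<phi> (\<lambda>k. g k p) = 0" for p
  proof -
    have "\<phi> (\<lambda>k. g k p) = \<phi> (\<lambda>k. \<psi> k (u p))" by (rule pf_cong_vars[OF \<phi>(1)]) (simp add: \<psi>(2))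
    thus ?thesis by (simp add: \<phi>(3))
  qed
  thus False using assms(2,3) \<phi>(1,2) unfolding indep_mod_def by auto
qed

text \<open>The line from \<open>x(r := 0)\<close> in direction \<open>unit r\<close> reaches
  \<open>x\<close> at parameter \<open>x r\<close>, and its starting point does not involve
  \<open>x r\<close>.\<close>

lemma pf_expand:
  assumes "F \<in> pf (insert r K)"
  shows "\<exists>D c. (\<forall>d. c d \<in> pf K) \<and> (\<forall>x. F x = (\<Sum>d\<le>D. c d x * x r ^ d))"
proof -
  obtain D where D: "pdeg (insert r K) D F" using assms by (rule pfE)
  define c where "c d x = Polynomial.coeff (line_poly F (x(r := 0)) (unit r)) d" for d x
  have "c d \<in> pf K" for d
  proof -
    have "(\<lambda>x. Polynomial.coeff (line_poly F (\<lambda>k. (x(r := 0)) k) (unit r)) d) \<in> pf K"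
    proof (rule pf_compose[OF pf_line_coeff[OF assms]])
      fix k assume "k \<in> insert r K"
      thus "(\<lambda>x. (x(r := 0)) k) \<in> pf K" by (cases "k = r") auto
    qed
    thus ?thesis unfolding c_def[abs_def] .
  qed
  moreover have "F x = (\<Sum>d\<le>D. c d x * x r ^ d)" for x
  proof -
    have "(\<lambda>i. (x(r := 0)) i + x r * unit r i) = x" by (auto simp: unit_def)
    hence "F x = poly (line_poly F (x(r := 0)) (unit r)) (x r)" by (simp add: poly_line_poly[OF assms])
    thus ?thesis by (simp add: poly_as_sum[OF degree_line_poly[OF D]] c_def)
  qed
  ultimately show ?thesis by blast
qed

subsection \<open>Chains of prime ideals\<close>

definition fsubalg :: "('p \<Rightarrow> 'k::field_char_0) set \<Rightarrow> bool" where
  "fsubalg R \<longleftrightarrow> (\<forall>c. (\<lambda>p. c) \<in> R) \<and> (\<forall>F\<in>R. \<forall>G\<in>R. (\<lambda>p. F p + G p) \<in> R \<and> (\<lambda>p. F p * G p) \<in> R)"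

text \<open>Working with plain sets of functions lets vanishing ideals and ideals of generated
  subalgebras share one argument without ring records.\<close>

definition fprime :: "('p \<Rightarrow> 'k::field_char_0) set \<Rightarrow> ('p \<Rightarrow> 'k) set \<Rightarrow> bool" where
  "fprime R I \<longleftrightarrow> I \<subseteq> R \<and> (\<lambda>p. 0) \<in> I \<and> (\<lambda>p. 1) \<notin> I \<and> (\<forall>F\<in>I. \<forall>G\<in>I. (\<lambda>p. F p + G p) \<in> I) \<and>
     (\<forall>F\<in>I. \<forall>G\<in>R. (\<lambda>p. F p * G p) \<in> I) \<and>
     (\<forall>F\<in>R. \<forall>G\<in>R. (\<lambda>p. F p * G p) \<in> I \<longrightarrow> F \<in> I \<or> G \<in> I)"

lemma fprime_addD: "fprime R I \<Longrightarrow> F \<in> I \<Longrightarrow> G \<in> I \<Longrightarrow> (\<lambda>p. F p + G p) \<in> I"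
  by (simp add: fprime_def)

lemma fprime_multD: "fprime R I \<Longrightarrow> F \<in> I \<Longrightarrow> G \<in> R \<Longrightarrow> (\<lambda>p. F p * G p) \<in> I"
  by (simp add: fprime_def)

lemma fprime_primeD: "fprime R I \<Longrightarrow> (\<lambda>p. F p * G p) \<in> I \<Longrightarrow> F \<in> R \<Longrightarrow> G \<in> R \<Longrightarrow> F \<in> I \<or> G \<in> I"
  by (simp add: fprime_def)

lemma fsubalg_compose:
  assumes "fsubalg R" "\<phi> \<in> pf K" "\<And>k. k \<in> K \<Longrightarrow> g k \<in> R"
  shows "(\<lambda>p. \<phi> (\<lambda>k. g k p)) \<in> R"
proof -
  obtain d where "pdeg K d \<phi>" using assms(2) by (rule pfE)
  thus ?thesis using assms(1,3) by induction (auto simp: fsubalg_def)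
qed

lemma fsubalg_sum:
  assumes "fsubalg R" "\<And>a. a \<in> A \<Longrightarrow> F a \<in> R"
  shows "(\<lambda>p. \<Sum>a\<in>A. F a p) \<in> R"
  using assms by (induction A rule: infinite_finite_induct) (auto simp: fsubalg_def)

lemma fsubalg_power:
  assumes "fsubalg R" "F \<in> R" shows "(\<lambda>p. F p ^ n) \<in> R"
  using assms by (induction n) (auto simp: fsubalg_def)

lemma fprime_power:
  assumes "fsubalg R" "fprime R I" "h \<in> R" "h \<notin> I" "F \<in> R" "(\<lambda>p. h p ^ e * F p) \<in> I"
  shows "F \<in> I"
  using assms(5,6)
proof (induction e arbitrary: F)
  case (Suc e)
  have "(\<lambda>p. h p * F p) \<in> R" using assms(1,3) Suc.prems(1) unfolding fsubalg_def by auto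
  moreover have "(\<lambda>p. h p ^ e * (h p * F p)) \<in> I" using Suc.prems(2) by (simp add: ac_simps)
  ultimately have "(\<lambda>p. h p * F p) \<in> I" by (rule Suc.IH)
  thus ?case using fprime_primeD[OF assms(2) _ assms(3) Suc.prems(1)] assms(4) by auto
qed simp

text \<open>In a relation between \<open>g\<close> and \<open>h\<close>, powers of the last variable may be cancelled modulo the
  smaller prime; reducing modulo the larger one, which contains \<open>h\<close>, leaves a relation between \<open>g\<close> alone.\<close>

lemma indep_mod_extend:
  fixes h :: "'p \<Rightarrow> 'k::field_char_0"
  assumes R: "fsubalg R" and I: "fprime R I" and I': "fprime R I'" "I \<subseteq> I'"
    and h: "h \<in> I'" "h \<notin> I" and g: "\<And>k. k < r \<Longrightarrow> g k \<in> R" and ind: "indep_mod r g I'"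
  shows "indep_mod (Suc r) (g(r := h)) I"
  unfolding indep_mod_def
proof (intro ballI impI, rule ccontr)
  fix \<phi> :: "(nat \<Rightarrow> 'k) \<Rightarrow> 'k"
  assume \<phi>: "\<phi> \<in> pf {..<Suc r}" and mem: "(\<lambda>p. \<phi> (\<lambda>k. (g(r := h)) k p)) \<in> I" and nz: "\<not> (\<forall>y. \<phi> y = 0)"
  have hR: "h \<in> R" using h(1) I'(1) by (auto simp: fprime_def)
  from pf_expand[of \<phi> r "{..<r}"] \<phi> obtain D c where
    c: "\<And>d. c d \<in> pf {..<r}" and \<phi>c: "\<And>x. \<phi> x = (\<Sum>d\<le>D. c d x * x r ^ d)"
    by (auto simp: lessThan_Suc)
  have "\<exists>d\<le>D. \<exists>y. c d y \<noteq> 0"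
  proof (rule ccontr)
    assume "\<not> ?thesis"
    hence "\<phi> y = 0" for y unfolding \<phi>c by (intro sum.neutral) auto
    thus False using nz by blast
  qed
  \<comment> \<open>\<open>e\<close> is the lowest power of the last variable that occurs. After
    \<open>h ^ e\<close> is factored out, \<open>T e + h * U\<close> remains, and this is
    \<open>T e\<close> modulo the larger prime.\<close>
  define e where "e = (LEAST d. d \<le> D \<and> (\<exists>y. c d y \<noteq> 0))"
  have e: "e \<le> D" "\<exists>y. c e y \<noteq> 0"
    using LeastI_ex[of "\<lambda>d. d \<le> D \<and> (\<exists>y. c d y \<noteq> 0)"] \<open>\<exists>d\<le>D. \<exists>y. c d y \<noteq> 0\<close> unfolding e_def by auto
  have lt: "c d y = 0" if "d < e" for d y
    using not_less_Least[of d "\<lambda>d. d \<le> D \<and> (\<exists>y. c d y \<noteq> 0)"] that e(1) unfolding e_def by auto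
  define T where "T d = (\<lambda>p. c d (\<lambda>k. g k p))" for d
  have T: "T d \<in> R" for d unfolding T_def by (rule fsubalg_compose[OF R c]) (use g in auto)
  have Teq: "c d (\<lambda>k. (g(r := h)) k p) = T d p" for d p
    unfolding T_def by (rule pf_cong_vars[OF c]) auto
  define U where "U = (\<lambda>p. \<Sum>d\<in>{Suc e..D}. T d p * h p ^ (d - Suc e))"
  have U: "U \<in> R" unfolding U_def
    by (rule fsubalg_sum[OF R]) (use T fsubalg_power[OF R hR] R in \<open>auto simp: fsubalg_def\<close>)
  have TU: "(\<lambda>p. T e p + h p * U p) \<in> R" using T U hR R by (auto simp: fsubalg_def)
  have "\<phi> (\<lambda>k. (g(r := h)) k p) = h p ^ e * (T e p + h p * U p)" for p
  proof -
    have "\<phi> (\<lambda>k. (g(r := h)) k p) = (\<Sum>d\<le>D. T d p * h p ^ d)"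
      by (simp only: \<phi>c Teq) simp
    also have "\<dots> = (\<Sum>d\<in>{e..D}. T d p * h p ^ d)"
      by (rule sum.mono_neutral_right) (auto simp: T_def lt)
    also have "\<dots> = T e p * h p ^ e + (\<Sum>d\<in>{Suc e..D}. T d p * h p ^ d)"
      by (rule sum.atLeast_Suc_atMost[OF e(1)])
    also have "(\<Sum>d\<in>{Suc e..D}. T d p * h p ^ d) = (\<Sum>d\<in>{Suc e..D}. h p ^ e * (h p * (T d p * h p ^ (d - Suc e))))"
    proof (rule sum.cong[OF refl])
      fix d assume "d \<in> {Suc e..D}"
      hence "d = e + Suc (d - Suc e)" by simp
      hence "h p ^ d = h p ^ e * (h p * h p ^ (d - Suc e))" by (metis power_add power_Suc)
      thus "T d p * h p ^ d = h p ^ e * (h p * (T d p * h p ^ (d - Suc e)))" by (simp add: ac_simps)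
    qed
    finally show ?thesis by (simp add: U_def sum_distrib_left algebra_simps)
  qed
  hence "(\<lambda>p. h p ^ e * (T e p + h p * U p)) \<in> I" using mem by simp
  from fprime_power[OF R I hR h(2) TU this] have 1: "(\<lambda>p. T e p + h p * U p) \<in> I'" using I'(2) by auto
  have hU: "(\<lambda>p. h p * U p) \<in> I'" by (rule fprime_multD[OF I'(1) h(1) U])
  have neg: "(\<lambda>p. -1) \<in> R" using R unfolding fsubalg_def by auto
  from fprime_addD[OF I'(1) 1 fprime_multD[OF I'(1) hU neg]]
  have "(\<lambda>p. c e (\<lambda>k. g k p)) \<in> I'" by (simp add: T_def)
  thus False using ind c e(2) unfolding indep_mod_def by blast
qed

text \<open>Every strict inclusion supplies an element \<open>h\<close> for
  \<open>indep_mod_extend\<close>, so \<open>m\<close> inclusions add \<open>m\<close> independent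
  elements. Both the codimension bound and the upper bound for the Krull dimension come from
  here.\<close>

lemma indep_mod_chain:
  fixes I :: "nat \<Rightarrow> ('p \<Rightarrow> 'k::field_char_0) set"
  assumes "fsubalg R" "\<And>i. i \<le> m \<Longrightarrow> fprime R (I i)" "\<And>i. i < m \<Longrightarrow> I i \<subset> I (Suc i)"
    and "\<And>k. k < r \<Longrightarrow> g k \<in> R" "indep_mod r g (I m)"
  shows "\<exists>g'. (\<forall>k<r + m. g' k \<in> R) \<and> indep_mod (r + m) g' (I 0)"
  using assms(2-)
proof (induction m arbitrary: I)
  case 0
  thus ?case by auto
next
  case (Suc m)
  have "\<exists>g'. (\<forall>k<r + m. g' k \<in> R) \<and> indep_mod (r + m) g' (I (Suc 0))"
    using Suc.IH[of "\<lambda>i. I (Suc i)"] Suc.prems by auto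
  then obtain g' where g': "\<And>k. k < r + m \<Longrightarrow> g' k \<in> R" "indep_mod (r + m) g' (I (Suc 0))" by blast
  obtain h where h: "h \<in> I (Suc 0)" "h \<notin> I 0" using Suc.prems(2)[of 0] by auto
  have "indep_mod (Suc (r + m)) (g'(r + m := h)) (I 0)"
    by (rule indep_mod_extend[OF assms(1) _ _ _ h g'])
       (use Suc.prems(1)[of 0] Suc.prems(1)[of "Suc 0"] Suc.prems(2)[of 0] in auto)
  moreover have "h \<in> R" using h(1) Suc.prems(1)[of "Suc 0"] by (auto simp: fprime_def)
  hence "\<forall>k<Suc (r + m). (g'(r + m := h)) k \<in> R" using g'(1) by (auto simp: less_Suc_eq)
  ultimately show ?case by (metis add_Suc_right)
qed

subsection \<open>Hilbert's basis theorem and the Zariski topology\<close>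

text \<open>Only the first \<open>k\<close> terms of the sequence generate, which expresses the
  ascending chain condition as membership of a term in the ideal of its predecessors.\<close>

definition idl :: "'i set \<Rightarrow> (nat \<Rightarrow> ('i \<Rightarrow> 'k::field_char_0) \<Rightarrow> 'k) \<Rightarrow> nat \<Rightarrow> (('i \<Rightarrow> 'k) \<Rightarrow> 'k) set" where
  "idl J p k = {F. \<exists>q. (\<forall>i<k. q i \<in> pf J) \<and> (\<forall>x. F x = (\<Sum>i<k. q i x * p i x))}"

lemma idl_cong: "(\<And>i. i < k \<Longrightarrow> p i = p' i) \<Longrightarrow> idl J p k = idl J p' k"
  unfolding idl_def by (intro Collect_cong arg_cong[of _ _ Ex] ext) auto

lemma idl_zero: "(\<lambda>x. 0) \<in> idl J p k"
  unfolding idl_def by (auto intro!: exI[of _ "\<lambda>_ _. 0"])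

lemma idl_add: "F \<in> idl J p k \<Longrightarrow> G \<in> idl J p k \<Longrightarrow> (\<lambda>x. F x + G x) \<in> idl J p k"
proof -
  assume "F \<in> idl J p k" "G \<in> idl J p k"
  then obtain q q' where "\<forall>i<k. q i \<in> pf J" "\<forall>x. F x = (\<Sum>i<k. q i x * p i x)"
    "\<forall>i<k. q' i \<in> pf J" "\<forall>x. G x = (\<Sum>i<k. q' i x * p i x)" unfolding idl_def by blast
  thus ?thesis unfolding idl_def
    by (auto intro!: exI[of _ "\<lambda>i x. q i x + q' i x"] simp: sum.distrib algebra_simps)
qed

lemma idl_mult: "F \<in> idl J p k \<Longrightarrow> G \<in> pf J \<Longrightarrow> (\<lambda>x. G x * F x) \<in> idl J p k"
proof -
  assume "F \<in> idl J p k" and G: "G \<in> pf J"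
  then obtain q where "\<forall>i<k. q i \<in> pf J" "\<forall>x. F x = (\<Sum>i<k. q i x * p i x)" unfolding idl_def by blast
  thus ?thesis using G unfolding idl_def
    by (auto intro!: exI[of _ "\<lambda>i x. G x * q i x"] simp: sum_distrib_left algebra_simps)
qed

lemma idl_sum: "(\<And>a. a \<in> A \<Longrightarrow> F a \<in> idl J p k) \<Longrightarrow> (\<lambda>x. \<Sum>a\<in>A. F a x) \<in> idl J p k"
  by (induction A rule: infinite_finite_induct) (auto intro: idl_zero idl_add)

lemma idl_gen: "i < k \<Longrightarrow> p i \<in> idl J p k"
  unfolding idl_def by (auto intro!: exI[of _ "\<lambda>j x. if j = i then 1 else 0"] simp: if_distrib[of "\<lambda>z. z * _"] cong: if_cong)

lemma idl_subset:
  assumes "\<And>i. i < k \<Longrightarrow> p i \<in> idl J p' k'" shows "idl J p k \<subseteq> idl J p' k'"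
proof
  fix F assume "F \<in> idl J p k"
  then obtain q where q: "\<forall>i<k. q i \<in> pf J" "\<forall>x. F x = (\<Sum>i<k. q i x * p i x)" unfolding idl_def by blast
  have "(\<lambda>x. \<Sum>i<k. q i x * p i x) \<in> idl J p' k'" by (rule idl_sum, rule idl_mult) (use assms q in auto)
  moreover have "F = (\<lambda>x. \<Sum>i<k. q i x * p i x)" using q(2) by auto
  ultimately show "F \<in> idl J p' k'" by simp
qed

lemma idl_mono: "k \<le> k' \<Longrightarrow> idl J p k \<subseteq> idl J p k'"
  by (rule idl_subset) (auto intro: idl_gen)

lemma idl_pf: "(\<And>i. i < k \<Longrightarrow> p i \<in> pf J) \<Longrightarrow> F \<in> idl J p k \<Longrightarrow> F \<in> pf J"
proof -
  assume p: "\<And>i. i < k \<Longrightarrow> p i \<in> pf J" and "F \<in> idl J p k"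
  then obtain q where q: "\<forall>i<k. q i \<in> pf J" "\<forall>x. F x = (\<Sum>i<k. q i x * p i x)" unfolding idl_def by blast
  have "(\<lambda>x. \<Sum>i<k. q i x * p i x) \<in> pf J" by (intro pf_sum pf_mult) (use p q in auto)
  moreover have "F = (\<lambda>x. \<Sum>i<k. q i x * p i x)" using q(2) by auto
  ultimately show "F \<in> pf J" by simp
qed

text \<open>The leading coefficient argument. A counterexample yields an ideal \<open>I\<close> that
  is not finitely generated. Elements of \<open>I\<close> outside the ideal of the previously chosen
  ones are picked with minimal degree in the new variable, and the induction hypothesis is applied
  to their leading coefficients.\<close>

theorem hilbert_basis:
  fixes p :: "nat \<Rightarrow> ('i \<Rightarrow> 'k::field_char_0) \<Rightarrow> 'k"
  assumes "finite J" "\<And>i. p i \<in> pf J"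
  shows "\<exists>k. p k \<in> idl J p k"
  using assms
proof (induction J arbitrary: p)
  case empty
  have const: "p i x = p i y" for i x y by (rule pf_cong_vars[OF empty]) auto
  \<comment> \<open>Without variables all functions are constant: \<open>p 0\<close> is zero and
    lies in the zero ideal, or \<open>p 1\<close> is a multiple of \<open>p 0\<close>.\<close>
  show ?case
  proof (cases "p 0 = (\<lambda>x. 0)")
    case True
    thus ?thesis by (intro exI[of _ 0]) (simp add: idl_def)
  next
    case False
    then obtain z where "p 0 z \<noteq> 0" by auto
    define s where "s = p 1 z / p 0 z"
    have "p 1 x = s * p 0 x" for x
      using \<open>p 0 z \<noteq> 0\<close> const[of 0 x z] const[of 1 x z] by (simp add: s_def)
    hence "\<forall>x. p 1 x = (\<Sum>i<1. (\<lambda>_. s) x * p i x)" by simp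
    moreover have "\<forall>i<1::nat. (\<lambda>_. s) \<in> pf {}" by simp
    ultimately have "p 1 \<in> idl {} p 1" unfolding idl_def by (intro CollectI exI[of _ "\<lambda>_ _. s"] conjI)
    thus ?thesis by blast
  qed
next
  case (insert r K)
  let ?J = "insert r K"
  show ?case
  proof (rule ccontr)
    assume neg: "\<nexists>k. p k \<in> idl ?J p k"
    define I where "I = (\<Union>k. idl ?J p k)"
    have Ipf: "F \<in> pf ?J" if "F \<in> I" for F
    proof -
      from that obtain k where "F \<in> idl ?J p k" by (auto simp: I_def)
      thus ?thesis by (rule idl_pf[OF insert.prems])
    qed
    have Iadd: "(\<lambda>x. F x + G x) \<in> I" if "F \<in> I" "G \<in> I" for F G
    proof -
      from that obtain k k' where "F \<in> idl ?J p k" "G \<in> idl ?J p k'" by (auto simp: I_def)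
      hence "F \<in> idl ?J p (max k k')" "G \<in> idl ?J p (max k k')"
        using idl_mono[of k "max k k'" ?J p] idl_mono[of k' "max k k'" ?J p] by auto
      from idl_add[OF this] show ?thesis by (auto simp: I_def)
    qed
    have Imult: "(\<lambda>x. G x * F x) \<in> I" if "F \<in> I" "G \<in> pf ?J" for F G
    proof -
      from that(1) obtain k where "F \<in> idl ?J p k" by (auto simp: I_def)
      from idl_mult[OF this that(2)] show ?thesis by (auto simp: I_def)
    qed
    have not_fg: "\<exists>F\<in>I. F \<notin> idl ?J f k" if f: "\<And>i. i < k \<Longrightarrow> f i \<in> I" for f k
    proof -
      have "\<forall>i. \<exists>n. i < k \<longrightarrow> f i \<in> idl ?J p n" using f by (auto simp: I_def)
      then obtain n where n: "\<And>i. i < k \<Longrightarrow> f i \<in> idl ?J p (n i)" by metis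
      define N where "N = (\<Sum>i<k. n i)"
      have "n i \<le> N" if "i < k" for i unfolding N_def by (rule member_le_sum) (use that in auto)
      hence "f i \<in> idl ?J p N" if "i < k" for i using n[OF that] idl_mono[of "n i" N ?J p] that by blast
      hence "idl ?J f k \<subseteq> idl ?J p N" by (rule idl_subset)
      moreover have "p N \<in> I" unfolding I_def using idl_gen[of N "Suc N" p ?J] by blast
      ultimately show ?thesis using neg by blast
    qed
    define rd where "rd d F \<longleftrightarrow> (\<exists>c. (\<forall>j. c j \<in> pf K) \<and> (\<forall>x. F x = (\<Sum>j\<le>d. c j x * x r ^ j)))"
      for d :: nat and F :: "('i \<Rightarrow> 'k) \<Rightarrow> 'k"
    have rd_ex: "\<exists>d. rd d F" if "F \<in> I" for F
      using pf_expand[OF Ipf[OF that]] unfolding rd_def by blast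
    \<comment> \<open>Minimality is phrased without a degree function: \<open>F\<close> has an
      expansion in \<open>x r\<close> no longer than any expansion of a competitor
      \<open>G\<close>.\<close>
    define Q where "Q f k F \<longleftrightarrow> F \<in> I \<and> F \<notin> idl ?J f k \<and>
        (\<forall>G d. G \<in> I \<and> G \<notin> idl ?J f k \<and> rd d G \<longrightarrow> (\<exists>d'\<le>d. rd d' F))" for f k F
    have "\<exists>f. \<forall>k. Q f k (f k)"
    proof (rule dependent_wellorder_choice)
      fix F :: "('i \<Rightarrow> 'k) \<Rightarrow> 'k" and f g :: "nat \<Rightarrow> ('i \<Rightarrow> 'k) \<Rightarrow> 'k" and k
      assume "\<And>i. i < k \<Longrightarrow> f i = g i"
      hence "idl ?J f k = idl ?J g k" by (rule idl_cong)
      thus "Q f k F = Q g k F" unfolding Q_def by simp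
    next
      fix k and f :: "nat \<Rightarrow> ('i \<Rightarrow> 'k) \<Rightarrow> 'k"
      assume "\<And>i. i < k \<Longrightarrow> Q f i (f i)"
      hence "\<exists>F\<in>I. F \<notin> idl ?J f k" by (intro not_fg) (auto simp: Q_def)
      hence ex: "\<exists>d. \<exists>F\<in>I. F \<notin> idl ?J f k \<and> rd d F" using rd_ex by blast
      define d where "d = (LEAST d. \<exists>F\<in>I. F \<notin> idl ?J f k \<and> rd d F)"
      obtain F where "F \<in> I" "F \<notin> idl ?J f k" "rd d F" using LeastI_ex[OF ex] unfolding d_def by blast
      moreover have "d \<le> d'" if "G \<in> I" "G \<notin> idl ?J f k" "rd d' G" for G d'
        unfolding d_def by (rule Least_le) (use that in blast)
      ultimately have "Q f k F" unfolding Q_def by blast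
      thus "\<exists>F. Q f k F" by blast
    qed
    then obtain f where f: "\<And>k. Q f k (f k)" by blast
    define d where "d k = (LEAST d. rd d (f k))" for k
    have "rd (d k) (f k)" for k unfolding d_def by (rule LeastI_ex, rule rd_ex) (use f in \<open>auto simp: Q_def\<close>)
    hence "\<forall>k. \<exists>c. (\<forall>j. c j \<in> pf K) \<and> (\<forall>x. f k x = (\<Sum>j\<le>d k. c j x * x r ^ j))" unfolding rd_def by blast
    then obtain c where c: "\<And>k j. c k j \<in> pf K" and fc: "\<And>k x. f k x = (\<Sum>j\<le>d k. c k j x * x r ^ j)" by metis
    have dle: "d k \<le> d'" if "rd d' (f k)" for k d' unfolding d_def by (rule Least_le) (rule that)
    have dmono: "d i \<le> d k" if "i < k" for i k
    proof -
      have "f k \<in> I" "f k \<notin> idl ?J f i" using f[of k] idl_mono[of i k ?J f] that by (auto simp: Q_def)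
      with \<open>rd (d k) (f k)\<close> f[of i] obtain d' where "d' \<le> d k" "rd d' (f i)" unfolding Q_def by blast
      thus ?thesis using dle[of d' i] by simp
    qed
    have "\<exists>k. c k (d k) \<in> idl K (\<lambda>k. c k (d k)) k" by (rule insert.IH) (rule c)
    then obtain k q where
      q: "\<And>i. i < k \<Longrightarrow> q i \<in> pf K" and lead: "\<And>x. c k (d k) x = (\<Sum>i<k. q i x * c i (d i) x)"
      unfolding idl_def by blast
    \<comment> \<open>The earlier \<open>f i\<close>, raised to the degree of \<open>f k\<close> in
      \<open>x r\<close>, are combined so as to cancel its leading coefficient. The result stays
      outside the ideal of the earlier ones but has smaller degree.\<close>
    define G where "G = (\<lambda>x. f k x - (\<Sum>i<k. q i x * x r ^ (d k - d i) * f i x))"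
    define c' where "c' j x = c k j x - (\<Sum>i<k. q i x * (if j < d k - d i then 0 else c i (j - (d k - d i)) x))" for j x
    have c': "c' j \<in> pf K" for j
    proof -
      have "(\<lambda>x. if j < s then 0 else c i (j - s) x) \<in> pf K" for i s by (cases "j < s") (simp_all add: c)
      thus ?thesis unfolding c'_def[abs_def] using q by (intro pf_diff pf_sum pf_mult c) auto
    qed
    have Gc: "G x = (\<Sum>j\<le>d k. c' j x * x r ^ j)" for x
    proof -
      have "x r ^ (d k - d i) * f i x = (\<Sum>j\<le>d k. (if j < d k - d i then 0 else c i (j - (d k - d i)) x) * x r ^ j)"
        if "i < k" for i
      proof -
        let ?s = "d k - d i"
        have "x r ^ ?s * f i x = (\<Sum>j\<le>d i. c i j x * x r ^ (j + ?s))"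
          by (simp add: fc sum_distrib_left power_add ac_simps)
        also have "\<dots> = (\<Sum>j\<in>{?s..d k}. c i (j - ?s) x * x r ^ j)"
          by (rule sum.reindex_bij_witness[of _ "\<lambda>j. j - ?s" "\<lambda>j. j + ?s"]) (use dmono[OF that] in auto)
        also have "\<dots> = (\<Sum>j\<in>{?s..d k}. (if j < ?s then 0 else c i (j - ?s) x) * x r ^ j)"
          by (rule sum.cong) auto
        also have "\<dots> = (\<Sum>j\<le>d k. (if j < ?s then 0 else c i (j - ?s) x) * x r ^ j)"
          by (rule sum.mono_neutral_left) auto
        finally show ?thesis .
      qed
      hence "(\<Sum>i<k. q i x * x r ^ (d k - d i) * f i x) =
        (\<Sum>i<k. \<Sum>j\<le>d k. q i x * (if j < d k - d i then 0 else c i (j - (d k - d i)) x) * x r ^ j)"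
        by (intro sum.cong) (auto simp: sum_distrib_left mult.assoc)
      also have "\<dots> = (\<Sum>j\<le>d k. (\<Sum>i<k. q i x * (if j < d k - d i then 0 else c i (j - (d k - d i)) x)) * x r ^ j)"
        unfolding sum_distrib_right by (rule sum.swap)
      finally show ?thesis unfolding G_def c'_def fc[of k]
        by (simp only: left_diff_distrib sum_subtractf)
    qed
    have top: "c' (d k) x = 0" for x
    proof -
      have "(\<Sum>i<k. q i x * (if d k < d k - d i then 0 else c i (d k - (d k - d i)) x)) = (\<Sum>i<k. q i x * c i (d i) x)"
        by (rule sum.cong) (use dmono in \<open>auto simp: less_imp_le\<close>)
      thus ?thesis by (simp add: c'_def lead)
    qed
    have comb: "(\<lambda>x. \<Sum>i<k. q i x * x r ^ (d k - d i) * f i x) \<in> idl ?J f k"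
    proof (rule idl_sum)
      fix i assume "i \<in> {..<k}"
      hence i: "i < k" by simp
      have "q i \<in> pf ?J" by (rule pf_subset[OF q[OF i]]) auto
      hence "(\<lambda>x. q i x * x r ^ (d k - d i)) \<in> pf ?J" by (intro pf_mult pf_power pf_var) auto
      from idl_mult[OF idl_gen[OF i] this] show "(\<lambda>x. q i x * x r ^ (d k - d i) * f i x) \<in> idl ?J f k" .
    qed
    have combI: "(\<lambda>x. -1 * (\<Sum>i<k. q i x * x r ^ (d k - d i) * f i x)) \<in> I"
    proof (rule Imult)
      have "(\<lambda>x. \<Sum>i\<in>{..<n}. q i x * x r ^ (d k - d i) * f i x) \<in> I" if "n \<le> k" for n
        using that
      proof (induction n)
        case 0 thus ?case by (auto simp: I_def intro: idl_zero)
      next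
        case (Suc n)
        have "q n \<in> pf ?J" by (rule pf_subset[OF q]) (use Suc.prems in auto)
        hence "(\<lambda>x. q n x * x r ^ (d k - d n)) \<in> pf ?J" by (intro pf_mult pf_power pf_var) auto
        hence "(\<lambda>x. q n x * x r ^ (d k - d n) * f n x) \<in> I" using f[of n] by (intro Imult) (auto simp: Q_def)
        from Iadd[OF Suc.IH this] Suc.prems show ?case by simp
      qed
      thus "(\<lambda>x. \<Sum>i<k. q i x * x r ^ (d k - d i) * f i x) \<in> I" by simp
    qed auto
    have "f k \<in> I" using f[of k] by (simp add: Q_def)
    from Iadd[OF this combI] have GI: "G \<in> I" by (simp add: G_def)
    have Gn: "G \<notin> idl ?J f k"
    proof
      assume "G \<in> idl ?J f k"
      from idl_add[OF this comb] have "f k \<in> idl ?J f k" by (simp add: G_def)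
      thus False using f[of k] by (simp add: Q_def)
    qed
    show False
    proof (cases "d k")
      case 0
      hence "G = (\<lambda>x. 0)" using top by (auto simp: Gc)
      thus False using Gn idl_zero[of ?J f k] by simp
    next
      case (Suc m)
      have "G x = (\<Sum>j\<le>m. c' j x * x r ^ j)" for x using top[of x] by (simp add: Gc Suc)
      hence "rd m G" unfolding rd_def using c' by blast
      then obtain d' where "d' \<le> m" "rd d' (f k)" using f[of k] GI Gn unfolding Q_def by blast
      thus False using dle[of d' k] Suc by simp
    qed
  qed
qed

section \<open>Noetherian descent for closed sets, and codimension measured by algebraic
  independence\<close>

definition pclosed :: "('i \<Rightarrow> 'k::field_char_0) set \<Rightarrow> 'i set \<Rightarrow> ('i \<Rightarrow> 'k) set \<Rightarrow> bool" where
  "pclosed V J W \<longleftrightarrow> (\<exists>S\<subseteq>pf J. W = {x \<in> V. \<forall>F\<in>S. F x = 0})"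

text \<open>An infinite strict descent would give polynomials \<open>p n\<close> vanishing on
  \<open>f (Suc n)\<close> but not on \<open>f n\<close>. By \<open>hilbert_basis\<close> some
  \<open>p k\<close> is a combination of earlier ones, all of which vanish on
  \<open>f k\<close>.\<close>

lemma minimal_closed_set:
  assumes "finite J" "\<And>W. W \<in> \<C> \<Longrightarrow> pclosed V J W" "\<C> \<noteq> {}"
  shows "\<exists>W\<in>\<C>. \<forall>W'\<in>\<C>. \<not> W' \<subset> W"
proof (rule ccontr)
  assume "\<not> ?thesis"
  hence step: "\<And>W. W \<in> \<C> \<Longrightarrow> \<exists>W'\<in>\<C>. W' \<subset> W" by blast
  obtain W0 where "W0 \<in> \<C>" using assms(3) by auto
  have "\<exists>f. \<forall>n. f n \<in> \<C> \<and> f (Suc n) \<subset> f n"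
    by (rule dependent_nat_choice) (use \<open>W0 \<in> \<C>\<close> step in auto)
  then obtain f where fn: "\<forall>n. f n \<in> \<C> \<and> f (Suc n) \<subset> f n" by (rule exE)
  have f: "f n \<in> \<C>" "f (Suc n) \<subset> f n" for n using spec[OF fn, of n] by auto
  have "\<exists>p. p \<in> pf J \<and> (\<forall>x\<in>f (Suc n). p x = 0) \<and> (\<exists>x\<in>f n. p x \<noteq> 0)" for n
  proof -
    obtain S where S: "S \<subseteq> pf J" "f (Suc n) = {x \<in> V. \<forall>F\<in>S. F x = 0}" using assms(2)[OF f(1)] unfolding pclosed_def by blast
    obtain x where x: "x \<in> f n" "x \<notin> f (Suc n)" using f(2)[of n] by blast
    have "x \<in> V" using assms(2)[OF f(1)[of n]] x(1) unfolding pclosed_def by auto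
    then obtain F where "F \<in> S" "F x \<noteq> 0" using x(2) S(2) by auto
    thus ?thesis using S x(1) by blast
  qed
  then obtain p where p: "\<And>n. p n \<in> pf J" "\<And>n x. x \<in> f (Suc n) \<Longrightarrow> p n x = 0" "\<And>n. \<exists>x\<in>f n. p n x \<noteq> 0" by metis
  obtain k q where q: "\<And>x. p k x = (\<Sum>i<k. q i x * p i x)"
    using hilbert_basis[of J p] assms(1) p(1) unfolding idl_def by auto
  have anti: "f j \<subseteq> f i" if "i \<le> j" for i j
    using that by (induction rule: dec_induct) (use f(2) in auto)
  have "p k x = 0" if "x \<in> f k" for x
  proof -
    have "p i x = 0" if "i < k" for i using p(2)[of x i] anti[of "Suc i" k] that \<open>x \<in> f k\<close> by auto
    thus ?thesis by (simp add: q)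
  qed
  thus False using p(3)[of k] by blast
qed

lemma pclosed_Int: "pclosed V J A \<Longrightarrow> pclosed V J B \<Longrightarrow> pclosed V J (A \<inter> B)"
proof -
  assume "pclosed V J A" "pclosed V J B"
  then obtain S T where "S \<subseteq> pf J" "A = {x \<in> V. \<forall>F\<in>S. F x = 0}" "T \<subseteq> pf J" "B = {x \<in> V. \<forall>F\<in>T. F x = 0}"
    unfolding pclosed_def by blast
  thus ?thesis unfolding pclosed_def by (intro exI[of _ "S \<union> T"]) auto
qed

lemma pf_UNIV_iff: "F \<in> pf UNIV \<longleftrightarrow> (\<exists>P. F = mpoly_eval P)"
proof
  assume "F \<in> pf UNIV"
  then obtain d where "pdeg UNIV d F" by (rule pfE)
  from pdeg_imp_mpoly[OF this] show "\<exists>P. F = mpoly_eval P" by blast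
next
  assume "\<exists>P. F = mpoly_eval P"
  then obtain P where "F = mpoly_eval P" by blast
  thus "F \<in> pf UNIV" using pdeg_subset[OF pdeg_mpoly_eval, of P UNIV] by (auto intro: pfI)
qed

lemma coord_funs_eq: "coord_funs V = {\<lambda>x. if x \<in> V then F x else 0 |F. F \<in> pf UNIV}"
  by (auto simp: pf_UNIV_iff coord_ring_def poly_fun_def)

text \<open>Multiplying polynomials intersects their non-vanishing loci, so unions of basic open
  sets already form the topology.\<close>

lemma zariski_open_iff:
  "openin (zariski V) U \<longleftrightarrow> (\<exists>S\<subseteq>pf UNIV. U = {x \<in> V. \<exists>F\<in>S. F x \<noteq> 0})"
proof
  let ?B = "{{x \<in> V. f x \<noteq> 0} |f. f \<in> coord_funs V}"
  have B: "W \<in> ?B \<longleftrightarrow> (\<exists>F\<in>pf UNIV. W = {x \<in> V. F x \<noteq> 0})" for W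
  proof
    assume "W \<in> ?B"
    then obtain F where "F \<in> pf UNIV" "W = {x \<in> V. (if x \<in> V then F x else 0) \<noteq> 0}"
      unfolding coord_funs_eq by blast
    thus "\<exists>F\<in>pf UNIV. W = {x \<in> V. F x \<noteq> 0}" by auto
  next
    assume "\<exists>F\<in>pf UNIV. W = {x \<in> V. F x \<noteq> 0}"
    then obtain F where F: "F \<in> pf UNIV" "W = {x \<in> V. F x \<noteq> 0}" by blast
    define f where "f = (\<lambda>x. if x \<in> V then F x else 0)"
    have "f \<in> coord_funs V" unfolding coord_funs_eq f_def using F(1) by (intro CollectI exI[of _ F]) simp
    moreover have "W = {x \<in> V. f x \<noteq> 0}" using F(2) by (auto simp: f_def)
    ultimately show "W \<in> ?B" by (intro CollectI exI[of _ f]) simp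
  qed
  {
    assume "openin (zariski V) U"
    hence "generate_topology_on ?B U" unfolding zariski_def openin_topology_generated_by_iff .
    thus "\<exists>S\<subseteq>pf UNIV. U = {x \<in> V. \<exists>F\<in>S. F x \<noteq> 0}"
    proof induction
      case Empty
      show ?case by (rule exI[of _ "{}"]) auto
    next
      case (Int A B)
      then obtain S T where S: "S \<subseteq> pf UNIV" "A = {x \<in> V. \<exists>F\<in>S. F x \<noteq> 0}"
        and T: "T \<subseteq> pf UNIV" "B = {x \<in> V. \<exists>F\<in>T. F x \<noteq> 0}" by blast
      let ?H = "(\<lambda>(F, G). \<lambda>x. F x * G x) ` (S \<times> T)"
      have "?H \<subseteq> pf UNIV" using S(1) T(1) by auto
      moreover have "A \<inter> B = {x \<in> V. \<exists>F\<in>?H. F x \<noteq> 0}"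
      proof -
        have "(\<exists>F\<in>?H. F x \<noteq> 0) \<longleftrightarrow> (\<exists>F\<in>S. F x \<noteq> 0) \<and> (\<exists>G\<in>T. G x \<noteq> 0)" for x
          by (simp add: bex_simps(7)[symmetric])
        thus ?thesis using S(2) T(2) by blast
      qed
      ultimately show ?case by blast
    next
      case (UN K)
      hence "\<forall>k\<in>K. \<exists>S\<subseteq>pf UNIV. k = {x \<in> V. \<exists>F\<in>S. F x \<noteq> 0}" by blast
      from bchoice[OF this] obtain S where
        "\<forall>k\<in>K. S k \<subseteq> pf UNIV \<and> k = {x \<in> V. \<exists>F\<in>S k. F x \<noteq> 0}" by (rule exE)
      hence S: "\<And>k. k \<in> K \<Longrightarrow> S k \<subseteq> pf UNIV" "\<And>k. k \<in> K \<Longrightarrow> k = {x \<in> V. \<exists>F\<in>S k. F x \<noteq> 0}" by simp_all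
      show ?case
      proof (intro exI[of _ "\<Union>k\<in>K. S k"] conjI)
        show "(\<Union>k\<in>K. S k) \<subseteq> pf UNIV" using S(1) by blast
        show "\<Union> K = {x \<in> V. \<exists>F\<in>\<Union> (S ` K). F x \<noteq> 0}" using S(2) by blast
      qed
    next
      case (Basis s)
      then obtain F where "F \<in> pf UNIV" "s = {x \<in> V. F x \<noteq> 0}" using B by blast
      thus ?case by (intro exI[of _ "{F}"]) auto
    qed
  }
  {
    assume "\<exists>S\<subseteq>pf UNIV. U = {x \<in> V. \<exists>F\<in>S. F x \<noteq> 0}"
    then obtain S where S: "S \<subseteq> pf UNIV" "U = {x \<in> V. \<exists>F\<in>S. F x \<noteq> 0}" by blast
    have "generate_topology_on ?B (\<Union>((\<lambda>F. {x \<in> V. F x \<noteq> 0}) ` S))"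
    proof (rule generate_topology_on.UN)
      fix k assume "k \<in> (\<lambda>F. {x \<in> V. F x \<noteq> 0}) ` S"
      hence "k \<in> ?B" using S(1) B by blast
      thus "generate_topology_on ?B k" by (rule generate_topology_on.Basis)
    qed
    moreover have "\<Union>((\<lambda>F. {x \<in> V. F x \<noteq> 0}) ` S) = U" using S(2) by auto
    ultimately show "openin (zariski V) U" unfolding zariski_def openin_topology_generated_by_iff by simp
  }
qed

lemma topspace_zariski: "topspace (zariski (V :: ('i \<Rightarrow> 'k::field_char_0) set)) = V"
proof
  have "U \<subseteq> V" if "openin (zariski V) U" for U using that unfolding zariski_open_iff by auto
  from this[OF openin_topspace] show "topspace (zariski V) \<subseteq> V" .
  have "openin (zariski V) V" unfolding zariski_open_iff by (intro exI[of _ "{\<lambda>x. 1}"]) auto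
  thus "V \<subseteq> topspace (zariski V)" by (rule openin_subset)
qed

text \<open>The indeterminates of the coordinate ring are all elements of \<open>'i\<close>,
  possibly infinitely many. The assumption reduces them on \<open>V\<close> to the set
  \<open>J\<close>, which is what makes Hilbert's theorem applicable for finite
  \<open>J\<close>.\<close>

lemma zariski_closed_iff:
  assumes J: "\<And>F. F \<in> pf UNIV \<Longrightarrow> \<exists>G\<in>pf J. \<forall>x\<in>V. F x = G x"
  shows "closedin (zariski V) W \<longleftrightarrow> pclosed V J W"
proof
  assume "closedin (zariski V) W"
  hence "W \<subseteq> V" "openin (zariski V) (V - W)" by (auto simp: closedin_def topspace_zariski)
  then obtain S where S: "S \<subseteq> pf UNIV" "V - W = {x \<in> V. \<exists>F\<in>S. F x \<noteq> 0}" by (auto simp: zariski_open_iff)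
  let ?T = "{G \<in> pf J. \<exists>F\<in>S. \<forall>x\<in>V. F x = G x}"
  have "W = {x \<in> V. \<forall>F\<in>S. F x = 0}" using S(2) \<open>W \<subseteq> V\<close> by blast
  also have "\<dots> = {x \<in> V. \<forall>G\<in>?T. G x = 0}"
  proof (intro equalityI subsetI)
    fix x assume x: "x \<in> {x \<in> V. \<forall>G\<in>?T. G x = 0}"
    have "F x = 0" if F: "F \<in> S" for F
    proof -
      obtain G where "G \<in> pf J" "\<forall>x\<in>V. F x = G x" using J[of F] F S(1) by blast
      thus ?thesis using x F by auto
    qed
    thus "x \<in> {x \<in> V. \<forall>F\<in>S. F x = 0}" using x by auto
  qed auto
  finally show "pclosed V J W" unfolding pclosed_def by (intro exI[of _ ?T]) auto
next
  assume "pclosed V J W"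
  then obtain S where S: "S \<subseteq> pf J" "W = {x \<in> V. \<forall>F\<in>S. F x = 0}" unfolding pclosed_def by blast
  have "S \<subseteq> pf UNIV" using S(1) pf_subset by blast
  moreover have "V - W = {x \<in> V. \<exists>F\<in>S. F x \<noteq> 0}" using S(2) by auto
  ultimately have "openin (zariski V) (V - W)" unfolding zariski_open_iff by blast
  thus "closedin (zariski V) W" using S(2) by (auto simp: closedin_def topspace_zariski)
qed

definition indep_on :: "nat \<Rightarrow> (nat \<Rightarrow> 'p \<Rightarrow> 'k::field_char_0) \<Rightarrow> 'p set \<Rightarrow> bool" where
  "indep_on r g W \<longleftrightarrow> (\<forall>\<phi>\<in>pf {..<r}. (\<forall>x\<in>W. \<phi> (\<lambda>k. g k x) = 0) \<longrightarrow> (\<forall>y. \<phi> y = 0))"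

text \<open>If all chains above \<open>W\<close> had length below a positive \<open>m\<close>, their
  supremum would be at most \<open>m - 1\<close>; so some chain has length at least \<open>m\<close>
  and can be cut off there.\<close>

lemma codim_chain:
  assumes "irreducible_closed T W" "W \<subseteq> Z" "codim T Z \<ge> enat m"
  shows "\<exists>C. C 0 = W \<and> (\<forall>i\<le>m. irreducible_closed T (C i)) \<and> (\<forall>i<m. C i \<subset> C (Suc i))"
proof -
  let ?N = "{n. \<exists>C. C 0 = W \<and> (\<forall>i\<le>n. irreducible_closed T (C i)) \<and> (\<forall>i<n. C i \<subset> C (Suc i))}"
  have le: "enat m \<le> (SUP n\<in>?N. enat n)"
    using assms(3) unfolding codim_def by (rule order_trans) (rule INF_lower, use assms(1,2) in auto)
  have "\<exists>n\<in>?N. m \<le> n"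
  proof (cases m)
    case 0
    have "0 \<in> ?N" using assms(1) by (auto intro!: exI[of _ "\<lambda>_. W"])
    thus ?thesis using 0 by blast
  next
    case (Suc m')
    show ?thesis
    proof (rule ccontr)
      assume "\<not> ?thesis"
      hence "enat n \<le> enat m'" if "n \<in> ?N" for n
      proof -
        have "\<not> m \<le> n" using \<open>\<not> (\<exists>n\<in>?N. m \<le> n)\<close> that by blast
        thus ?thesis using Suc by simp
      qed
      hence "(SUP n\<in>?N. enat n) \<le> enat m'" by (rule SUP_least)
      hence "enat m \<le> enat m'" using le by (rule order_trans[rotated])
      thus False using Suc by simp
    qed
  qed
  then obtain n C where "m \<le> n" "C 0 = W" "\<forall>i\<le>n. irreducible_closed T (C i)" "\<forall>i<n. C i \<subset> C (Suc i)" by blast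
  thus ?thesis by (intro exI[of _ C]) auto
qed

text \<open>Among the closed subsets of \<open>Z\<close> on which the \<open>g k\<close> remain
  independent, a minimal one is irreducible. The \<open>m\<close> steps of a chain above it give
  \<open>m\<close> strict inclusions of primes inside its vanishing ideal, hence \<open>m\<close>
  further independent functions, and their total number is bounded by the number of
  variables.\<close>

lemma codim_bound:
  fixes V :: "('i \<Rightarrow> 'k::field_char_0) set"
  assumes fin: "finite J" and J: "\<And>F. F \<in> pf UNIV \<Longrightarrow> \<exists>G\<in>pf J. \<forall>x\<in>V. F x = G x"
    and Z: "closedin (zariski V) Z" "codim (zariski V) Z \<ge> enat m"
    and g: "\<And>k. k < r \<Longrightarrow> g k \<in> pf J" "indep_on r g Z"
  shows "r + m \<le> card J"
proof -
  note cl = zariski_closed_iff[OF J, simplified]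
  let ?C = "{W. pclosed V J W \<and> W \<subseteq> Z \<and> indep_on r g W}"
  have "Z \<in> ?C" using Z(1) g(2) by (simp add: cl)
  hence "\<exists>W\<in>?C. \<forall>W'\<in>?C. \<not> W' \<subset> W" by (intro minimal_closed_set[OF fin]) auto
  then obtain W where W: "pclosed V J W" "W \<subseteq> Z" "indep_on r g W" and min: "\<And>W'. W' \<in> ?C \<Longrightarrow> \<not> W' \<subset> W" by auto
  have irr: "irreducible_closed (zariski V) W"
    unfolding irreducible_closed_def cl
  proof (intro conjI allI impI W(1))
    show "W \<noteq> {}"
    proof
      assume "W = {}"
      thus False using W(3) unfolding indep_on_def by (auto dest!: bspec[of _ _ "\<lambda>x. 1"])
    qed
  next
    fix A B assume AB: "pclosed V J A \<and> pclosed V J B \<and> W \<subseteq> A \<union> B"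
    show "W \<subseteq> A \<or> W \<subseteq> B"
    proof (rule ccontr)
      assume "\<not> ?thesis"
      hence "W \<inter> A \<subset> W" "W \<inter> B \<subset> W" by auto
      hence "W \<inter> A \<notin> ?C" "W \<inter> B \<notin> ?C" using min by auto
      hence "\<not> indep_on r g (W \<inter> A)" "\<not> indep_on r g (W \<inter> B)"
        using pclosed_Int[OF W(1)] AB W(2) by auto
      then obtain \<phi> \<psi> y z where \<phi>: "\<phi> \<in> pf {..<r}" "\<forall>x\<in>W \<inter> A. \<phi> (\<lambda>k. g k x) = 0" "\<phi> y \<noteq> 0"
        and \<psi>: "\<psi> \<in> pf {..<r}" "\<forall>x\<in>W \<inter> B. \<psi> (\<lambda>k. g k x) = 0" "\<psi> z \<noteq> 0"
        unfolding indep_on_def by blast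
      have "\<forall>x\<in>W. \<phi> (\<lambda>k. g k x) * \<psi> (\<lambda>k. g k x) = 0" using \<phi>(2) \<psi>(2) AB by auto
      hence "\<forall>y. \<phi> y * \<psi> y = 0"
        using W(3)[unfolded indep_on_def, THEN bspec, OF pf_mult[OF \<phi>(1) \<psi>(1)]] by simp
      hence "\<psi> z = 0" using pf_mult_eq_0[OF \<phi>(1) \<psi>(1) _ \<phi>(3)] by blast
      thus False using \<psi>(3) by simp
    qed
  qed
  from codim_chain[OF irr W(2) Z(2)] obtain C where C: "C 0 = W" "\<And>i. i \<le> m \<Longrightarrow> irreducible_closed (zariski V) (C i)"
    "\<And>i. i < m \<Longrightarrow> C i \<subset> C (Suc i)" by auto
  define I where "I X = {F \<in> pf J. \<forall>x\<in>X. F x = 0}" for X :: "('i \<Rightarrow> 'k) set"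
  have prime: "fprime (pf J) (I X)" if "irreducible_closed (zariski V) X" for X
  proof -
    have X: "pclosed V J X" "X \<noteq> {}" "\<And>A B. pclosed V J A \<Longrightarrow> pclosed V J B \<Longrightarrow> X \<subseteq> A \<union> B \<Longrightarrow> X \<subseteq> A \<or> X \<subseteq> B"
      using that by (auto simp: irreducible_closed_def cl)
    have XV: "X \<subseteq> V" using X(1) by (auto simp: pclosed_def)
    have "F \<in> I X \<or> G \<in> I X" if FG: "F \<in> pf J" "G \<in> pf J" "(\<lambda>x. F x * G x) \<in> I X" for F G
    proof -
      have "pclosed V J {x \<in> V. F x = 0}" "pclosed V J {x \<in> V. G x = 0}"
        unfolding pclosed_def using FG by (auto intro: exI[of _ "{F}"] exI[of _ "{G}"])
      moreover have "X \<subseteq> {x \<in> V. F x = 0} \<union> {x \<in> V. G x = 0}" using FG(3) XV by (auto simp: I_def)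
      ultimately have "X \<subseteq> {x \<in> V. F x = 0} \<or> X \<subseteq> {x \<in> V. G x = 0}" by (rule X(3))
      thus ?thesis using FG by (auto simp: I_def)
    qed
    thus ?thesis using X(2) unfolding fprime_def by (auto simp: I_def)
  qed
  have strict: "I Y \<subset> I X" if "irreducible_closed (zariski V) X" "irreducible_closed (zariski V) Y" "X \<subset> Y" for X Y
  proof -
    from that(1) obtain S where S: "S \<subseteq> pf J" "X = {x \<in> V. \<forall>F\<in>S. F x = 0}" by (auto simp: irreducible_closed_def cl pclosed_def)
    from that(3) obtain y where y: "y \<in> Y" "y \<notin> X" by blast
    have "y \<in> V" using y(1) that(2) by (auto simp: irreducible_closed_def cl pclosed_def)
    then obtain F where "F \<in> S" "F y \<noteq> 0" using y S by auto
    hence "F \<in> I X" "F \<notin> I Y" using S y by (auto simp: I_def)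
    moreover have "I Y \<subseteq> I X" using that(3) by (auto simp: I_def)
    ultimately show ?thesis by blast
  qed
  \<comment> \<open>The order is reversed by \<open>m - i\<close>: larger sets have smaller ideals,
    and the ideal of \<open>W\<close>, modulo which \<open>g\<close> is independent, must come
    last.\<close>
  have "\<exists>g'. (\<forall>k<r + m. g' k \<in> pf J) \<and> indep_mod (r + m) g' ((\<lambda>i. I (C (m - i))) 0)"
  proof (rule indep_mod_chain)
    show "fsubalg (pf J)" by (auto simp: fsubalg_def)
    show "fprime (pf J) (I (C (m - i)))" for i by (rule prime, rule C) simp
    show "I (C (m - i)) \<subset> I (C (m - Suc i))" if "i < m" for i
    proof -
      have "C (m - Suc i) \<subset> C (Suc (m - Suc i))" using C(3)[of "m - Suc i"] that by simp
      hence "C (m - Suc i) \<subset> C (m - i)" using that by (simp add: Suc_diff_Suc)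
      thus ?thesis using strict C(2) by simp
    qed
    show "g k \<in> pf J" if "k < r" for k by (rule g(1)[OF that])
    show "indep_mod r g (I (C (m - m)))"
      using W(3) C(1) unfolding indep_mod_def indep_on_def I_def by auto
  qed
  then obtain g' where g': "\<And>k. k < r + m \<Longrightarrow> g' k \<in> pf J" "indep_mod (r + m) g' (I (C m))" by auto
  show ?thesis
    by (rule indep_mod_le_card[OF fin g'(2), of "\<lambda>x. x"]) (use g'(1) in \<open>auto simp: I_def\<close>)
qed

subsection \<open>Linear functionals\<close>

definition lin :: "(('i \<Rightarrow> 'k::field) \<Rightarrow> 'k) \<Rightarrow> bool" where
  "lin w \<longleftrightarrow> (\<forall>a b x y. w (\<lambda>i. a * x i + b * y i) = a * w x + b * w y)"

lemma linD: "lin w \<Longrightarrow> w (\<lambda>i. a * x i + b * y i) = a * w x + b * w y"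
  by (simp add: lin_def)

lemma lin_dd: "F \<in> pf J \<Longrightarrow> lin (\<lambda>y. dd F y x)"
  by (simp add: lin_def dd_linear)

text \<open>If \<open>w r\<close> does not vanish on the kernel of the earlier functionals, a
  multiple of it is subtracted from \<open>g\<close> so that the rest vanishes on that
  kernel.\<close>

lemma lin_span:
  fixes r :: nat
  assumes "\<And>i. i < r \<Longrightarrow> lin (w i)" "lin g" "\<And>y. (\<And>i. i < r \<Longrightarrow> w i y = 0) \<Longrightarrow> g y = 0"
  shows "\<exists>c. \<forall>y. g y = (\<Sum>i<r. c i * w i y)"
  using assms
proof (induction r arbitrary: g)
  case (Suc r)
  show ?case
  proof (cases "\<forall>y. (\<forall>i<r. w i y = 0) \<longrightarrow> w r y = 0")
    case True
    have "\<exists>c. \<forall>y. g y = (\<Sum>i<r. c i * w i y)"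
      using Suc.prems True by (intro Suc.IH) (auto simp: less_Suc_eq)
    then obtain c where "\<forall>y. g y = (\<Sum>i<r. c i * w i y)" by blast
    thus ?thesis by (intro exI[of _ "\<lambda>i. if i = r then 0 else c i"]) simp
  next
    case False
    then obtain y0 where y0: "\<And>i. i < r \<Longrightarrow> w i y0 = 0" "w r y0 \<noteq> 0" by blast
    define s where "s = g y0 / w r y0"
    have "\<exists>c. \<forall>y. g y - s * w r y = (\<Sum>i<r. c i * w i y)"
    proof (rule Suc.IH[of "\<lambda>y. g y - s * w r y"])
      show "lin (\<lambda>y. g y - s * w r y)"
        using linD[OF Suc.prems(2)] linD[OF Suc.prems(1)[of r]] by (simp add: lin_def algebra_simps)
    next
      fix y assume y: "\<And>i. i < r \<Longrightarrow> w i y = 0"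
      \<comment> \<open>Projection of \<open>y\<close> to the kernel of \<open>w r\<close> along
        \<open>y0\<close>; the earlier functionals vanish on \<open>y0\<close> and are not
        affected.\<close>
      let ?z = "\<lambda>i. 1 * y i + (- (w r y / w r y0)) * y0 i"
      have "w i ?z = 0" if "i < Suc r" for i
      proof -
        have "w i ?z = 1 * w i y + (- (w r y / w r y0)) * w i y0"
          by (rule linD[OF Suc.prems(1)[OF that]])
        thus ?thesis using that y y0 by (cases "i = r") auto
      qed
      hence "g ?z = 0" by (rule Suc.prems(3))
      moreover have "g ?z = 1 * g y + (- (w r y / w r y0)) * g y0" by (rule linD[OF Suc.prems(2)])
      ultimately show "g y - s * w r y = 0" by (simp add: s_def)
    qed (use Suc.prems(1) in auto)
    then obtain c where c: "\<And>y. g y - s * w r y = (\<Sum>i<r. c i * w i y)" by blast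
    have "g y = (\<Sum>i<Suc r. (if i = r then s else c i) * w i y)" for y using c[of y] by (simp add: algebra_simps)
    thus ?thesis by (intro exI[of _ "\<lambda>i. if i = r then s else c i"] allI)
  qed
qed auto

text \<open>If the common kernel of the other functionals were contained in that of
  \<open>w i\<close>, then \<open>lin_span\<close> would express \<open>w i\<close> by them.\<close>

lemma lin_dual:
  fixes r :: nat
  assumes lin: "\<And>i. i < r \<Longrightarrow> lin (w i)"
    and ind: "\<And>c. (\<forall>y. (\<Sum>i<r. c i * w i y) = 0) \<Longrightarrow> \<forall>i<r. c i = 0"
  shows "\<exists>Y. \<forall>i<r. \<forall>j<r. w j (Y i) = (if i = j then 1 else 0)"
proof -
  have "\<exists>y. \<forall>j<r. w j y = (if i = j then 1 else 0)" if i: "i < r" for i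
  proof -
    define w' where "w' j = (if j = i then (\<lambda>y. 0) else w j)" for j
    have "\<exists>y. (\<forall>j<r. w' j y = 0) \<and> w i y \<noteq> 0"
    proof (rule ccontr)
      assume "\<not> ?thesis"
      moreover have "lin (w' j)" if "j < r" for j using lin[OF that] by (auto simp: w'_def lin_def)
      ultimately have "\<exists>c. \<forall>y. w i y = (\<Sum>j<r. c j * w' j y)" by (intro lin_span lin[OF i]) auto
      then obtain c where c: "\<And>y. w i y = (\<Sum>j<r. c j * w' j y)" by blast
      have "(\<Sum>j<r. (if j = i then -1 else c j) * w j y) = 0" for y
      proof -
        have "(\<Sum>j<r. (if j = i then -1 else c j) * w j y) = (\<Sum>j<r. c j * w' j y + (if j = i then - w i y else 0))"
          by (rule sum.cong) (auto simp: w'_def)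
        thus ?thesis using i by (simp add: sum.distrib c[symmetric])
      qed
      thus False using ind[of "\<lambda>j. if j = i then -1 else c j"] i by auto
    qed
    then obtain y where y: "\<And>j. j < r \<Longrightarrow> w' j y = 0" "w i y \<noteq> 0" by blast
    have "w j (\<lambda>k. (1 / w i y) * y k + 0 * y k) = (1 / w i y) * w j y + 0 * w j y" if "j < r" for j
      by (rule linD[OF lin[OF that]])
    moreover have "w j y = 0" if "j < r" "j \<noteq> i" for j using y(1)[OF that(1)] that(2) by (simp add: w'_def)
    ultimately show ?thesis using y(2) by (intro exI[of _ "\<lambda>k. (1 / w i y) * y k + 0 * y k"]) auto
  qed
  thus ?thesis by metis
qed

subsection \<open>The Jacobian criterion\<close>

definition dindep :: "nat \<Rightarrow> (nat \<Rightarrow> ('i \<Rightarrow> 'k::field_char_0) \<Rightarrow> 'k) \<Rightarrow> ('i \<Rightarrow> 'k) \<Rightarrow> bool" where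
  "dindep r F x \<longleftrightarrow> (\<forall>c. (\<forall>y. (\<Sum>i<r. c i * dd (F i) y x) = 0) \<longrightarrow> (\<forall>i<r. c i = 0))"

lemma dindepD: "dindep r F x \<Longrightarrow> (\<And>y. (\<Sum>i<r. c i * dd (F i) y x) = 0) \<Longrightarrow> i < r \<Longrightarrow> c i = 0"
  by (simp add: dindep_def)

text \<open>Dependence is stated through kernels so that no coefficients have to be carried along;
  \<open>ddep_coeffs\<close> recovers them.\<close>

definition ddep :: "nat \<Rightarrow> (nat \<Rightarrow> ('i \<Rightarrow> 'k::field_char_0) \<Rightarrow> 'k) \<Rightarrow> (('i \<Rightarrow> 'k) \<Rightarrow> 'k) \<Rightarrow> ('i \<Rightarrow> 'k) \<Rightarrow> bool" where
  "ddep r F g x \<longleftrightarrow> (\<forall>y. (\<forall>i<r. dd (F i) y x = 0) \<longrightarrow> dd g y x = 0)"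

lemma ddep_coeffs:
  assumes "\<And>i. i < r \<Longrightarrow> F i \<in> pf J" "g \<in> pf J" "ddep r F g x"
  shows "\<exists>c. \<forall>y. dd g y x = (\<Sum>i<r. c i * dd (F i) y x)"
proof (rule lin_span)
  show "lin (\<lambda>y. dd (F i) y x)" if "i < r" for i by (rule lin_dd[OF assms(1)[OF that]])
  show "lin (\<lambda>y. dd g y x)" by (rule lin_dd[OF assms(2)])
qed (use assms(3) in \<open>auto simp: ddep_def\<close>)

text \<open>The rows belong to arbitrary directions \<open>X i\<close>, not to coordinates. The
  determinants for all \<open>X\<close> together play the role of the maximal minors.\<close>

definition jac :: "nat \<Rightarrow> (nat \<Rightarrow> ('i \<Rightarrow> 'k::field_char_0) \<Rightarrow> 'k) \<Rightarrow> (nat \<Rightarrow> 'i \<Rightarrow> 'k) \<Rightarrow> ('i \<Rightarrow> 'k) \<Rightarrow> 'k mat" where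
  "jac r F X x = Matrix.mat r r (\<lambda>(i, j). dd (F j) (X i) x)"

lemma jac_carrier [simp]: "jac r F X x \<in> carrier_mat r r" by (simp add: jac_def)

lemma pf_det:
  assumes "\<And>i j. i < n \<Longrightarrow> j < n \<Longrightarrow> a i j \<in> pf J"
  shows "(\<lambda>x. Determinant.det (Matrix.mat n n (\<lambda>(i, j). a i j x))) \<in> pf J"
proof -
  have "Determinant.det (Matrix.mat n n (\<lambda>(i, j). a i j x)) =
     (\<Sum>p\<in>{p. p permutes {0..<n}}. signof p * (\<Prod>i = 0..<n. a i (p i) x))" for x
    unfolding det_def'[OF mat_carrier]
    by (intro sum.cong refl arg_cong2[of _ _ _ _ "(*)"] prod.cong) (auto simp: permutes_in_image)
  moreover have "(\<lambda>x. \<Sum>p\<in>{p. p permutes {0..<n}}. signof p * (\<Prod>i = 0..<n. a i (p i) x)) \<in> pf J"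
    by (intro pf_sum pf_cmult pf_prod assms) (auto simp: permutes_in_image)
  ultimately show ?thesis by simp
qed

lemma pf_jac: "(\<And>i. i < r \<Longrightarrow> F i \<in> pf J) \<Longrightarrow> (\<lambda>x. Determinant.det (jac r F X x)) \<in> pf J"
  unfolding jac_def by (rule pf_det) auto

text \<open>For directions dual to the differentials the matrix is the identity; conversely a
  relation between the differentials is a kernel vector of \<open>jac\<close> for every
  \<open>X\<close>.\<close>

lemma dindep_iff_jac:
  assumes "\<And>i. i < r \<Longrightarrow> F i \<in> pf J"
  shows "dindep r F x \<longleftrightarrow> (\<exists>X. Determinant.det (jac r F X x) \<noteq> 0)"
proof
  assume d: "dindep r F x"
  have "\<exists>Y. \<forall>i<r. \<forall>j<r. dd (F j) (Y i) x = (if i = j then 1 else 0)"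
  proof (rule lin_dual)
    show "lin (\<lambda>y. dd (F i) y x)" if "i < r" for i by (rule lin_dd[OF assms[OF that]])
    show "\<forall>i<r. c i = 0" if "\<forall>y. (\<Sum>i<r. c i * dd (F i) y x) = 0" for c
      using d that unfolding dindep_def by simp
  qed
  then obtain Y where "\<And>i j. i < r \<Longrightarrow> j < r \<Longrightarrow> dd (F j) (Y i) x = (if i = j then 1 else 0)" by blast
  hence "jac r F Y x = 1\<^sub>m r" by (intro eq_matI) (auto simp: jac_def)
  thus "\<exists>X. Determinant.det (jac r F X x) \<noteq> 0" by (intro exI[of _ Y]) simp
next
  assume "\<exists>X. Determinant.det (jac r F X x) \<noteq> 0"
  then obtain X where X: "Determinant.det (jac r F X x) \<noteq> 0" by blast
  show "dindep r F x"
    unfolding dindep_def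
  proof (intro allI impI)
    fix c i assume c: "\<forall>y. (\<Sum>i<r. c i * dd (F i) y x) = 0" and i: "i < r"
    have "jac r F X x *\<^sub>v Matrix.vec r c = 0\<^sub>v r"
    proof (rule eq_vecI)
      fix k assume "k < dim_vec (0\<^sub>v r :: 'b Matrix.vec)"
      hence k: "k < r" by simp
      have "(jac r F X x *\<^sub>v Matrix.vec r c) $ k = (\<Sum>j = 0..<r. dd (F j) (X k) x * c j)"
        using k by (simp add: jac_def scalar_prod_def)
      also have "\<dots> = (\<Sum>i<r. c i * dd (F i) (X k) x)" by (simp add: atLeast0LessThan mult.commute)
      finally show "(jac r F X x *\<^sub>v Matrix.vec r c) $ k = 0\<^sub>v r $ k" using c k by simp
    qed (simp add: jac_def)
    hence "Matrix.vec r c = 0\<^sub>v r"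
      using det_0_iff_vec_prod_zero[OF jac_carrier, of r F X x] X by (metis vec_carrier)
    thus "c i = 0" using i by (metis index_vec index_zero_vec(1))
  qed
qed

lemma dd_power:
  assumes "F \<in> pf J" shows "dd (\<lambda>x. F x ^ n) y x = of_nat n * F x ^ (n - 1) * dd F y x"
proof (induction n)
  case (Suc n)
  have "dd (\<lambda>x. F x * F x ^ n) y x = F x * dd (\<lambda>x. F x ^ n) y x + dd F y x * F x ^ n"
    by (rule dd_mult) (use assms in auto)
  thus ?case using Suc by (cases n) (auto simp: algebra_simps)
qed simp

text \<open>By \<open>dep\<close> the coordinate \<open>x j\<close> is algebraic over the
  \<open>g k\<close>. Differentiating a relation of least degree in \<open>x j\<close>, along a
  direction that annihilates the \<open>g k\<close>, leaves \<open>y j\<close> times its derivative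
  in \<open>x j\<close>.\<close>

lemma algebraic_coordinate:
  fixes g :: "nat \<Rightarrow> ('i \<Rightarrow> 'k::field_char_0) \<Rightarrow> 'k"
  assumes g: "\<And>k. k < N \<Longrightarrow> g k \<in> pf J" "indep_on N g UNIV" and j: "j \<in> J"
    and dep: "\<not> indep_on (Suc N) (g(N := (\<lambda>x. x j))) UNIV"
  shows "\<exists>\<Psi>\<in>pf J. (\<exists>x. \<Psi> x \<noteq> 0) \<and> (\<forall>x y. (\<forall>k<N. dd (g k) y x = 0) \<longrightarrow> y j * \<Psi> x = 0)"
proof -
  define Rel where "Rel D c \<longleftrightarrow> (\<forall>d. c d \<in> pf {..<N}) \<and> (\<exists>d\<le>D. \<exists>y. c d y \<noteq> 0) \<and>
     (\<forall>x. (\<Sum>d\<le>D. c d (\<lambda>k. g k x) * x j ^ d) = 0)" for D and c :: "nat \<Rightarrow> (nat \<Rightarrow> 'k) \<Rightarrow> 'k"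
  have ex: "\<exists>D c. Rel D c"
  proof -
    obtain \<phi> where \<phi>: "\<phi> \<in> pf {..<Suc N}" "\<And>x. \<phi> (\<lambda>k. (g(N := (\<lambda>x. x j))) k x) = 0" "\<exists>y. \<phi> y \<noteq> 0"
      using dep unfolding indep_on_def by blast
    obtain D c where c: "\<And>d. c d \<in> pf {..<N}" "\<And>x. \<phi> x = (\<Sum>d\<le>D. c d x * x N ^ d)"
      using pf_expand[of \<phi> N "{..<N}"] \<phi>(1) by (auto simp: lessThan_Suc)
    have "(\<Sum>d\<le>D. c d (\<lambda>k. g k x) * x j ^ d) = 0" for x
    proof -
      have "c d (\<lambda>k. (g(N := (\<lambda>x. x j))) k x) = c d (\<lambda>k. g k x)" for d
        by (rule pf_cong_vars[OF c(1)]) auto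
      thus ?thesis using \<phi>(2)[of x] by (simp add: c(2))
    qed
    moreover have "\<exists>d\<le>D. \<exists>y. c d y \<noteq> 0"
    proof (rule ccontr)
      assume "\<not> ?thesis"
      hence "\<phi> y = 0" for y unfolding c(2) by (intro sum.neutral) auto
      thus False using \<phi>(3) by blast
    qed
    ultimately show ?thesis using c(1) unfolding Rel_def by blast
  qed
  define D where "D = (LEAST D. \<exists>c. Rel D c)"
  obtain c where c: "Rel D c" using LeastI_ex[OF ex] unfolding D_def by blast
  have least: "D \<le> D'" if "Rel D' c'" for D' c' unfolding D_def by (rule Least_le) (use that in blast)
  have cpf: "c d \<in> pf {..<N}" for d using c by (simp add: Rel_def)
  define T where "T d = (\<lambda>x. c d (\<lambda>k. g k x))" for d
  have T: "T d \<in> pf J" for d unfolding T_def by (rule pf_compose[OF cpf]) (use g in auto)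
  have T0: "(\<Sum>d\<le>D. T d x * x j ^ d) = 0" for x using c by (simp add: Rel_def T_def)
  have "D \<noteq> 0"
  proof
    assume "D = 0"
    hence "\<forall>x. c 0 (\<lambda>k. g k x) = 0" using T0 by (simp add: T_def)
    hence "\<forall>y. c 0 y = 0" using g(2) cpf unfolding indep_on_def by blast
    thus False using c \<open>D = 0\<close> by (simp add: Rel_def)
  qed
  then obtain D' where D': "D = Suc D'" by (cases D) auto
  have top: "\<exists>y. c D y \<noteq> 0"
  proof (rule ccontr)
    assume n: "\<not> ?thesis"
    hence "T D x = 0" for x by (simp add: T_def)
    hence "(\<Sum>d\<le>D'. c d (\<lambda>k. g k x) * x j ^ d) = 0" for x using T0[of x] by (simp add: D' T_def)
    moreover have "\<exists>d\<le>D'. \<exists>y. c d y \<noteq> 0" using c n unfolding Rel_def D' by (metis le_Suc_eq)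
    ultimately have "Rel D' c" using cpf unfolding Rel_def by blast
    thus False using least[of D' c] D' by simp
  qed
  \<comment> \<open>The derivative of the minimal relation in its last variable: it has smaller
    degree and, in characteristic zero, nonzero top coefficient, so it is not a relation.\<close>
  define \<Psi> where "\<Psi> = (\<lambda>x. \<Sum>d\<le>D. T d x * (of_nat d * x j ^ (d - 1)))"
  have "\<Psi> \<in> pf J" unfolding \<Psi>_def by (intro pf_sum pf_mult T pf_const pf_power pf_var j)
  moreover have "\<exists>x. \<Psi> x \<noteq> 0"
  proof (rule ccontr)
    assume n: "\<not> ?thesis"
    have "(\<Sum>d\<le>D'. (of_nat (Suc d) * c (Suc d) (\<lambda>k. g k x)) * x j ^ d) = 0" for x
    proof -
      have "\<Psi> x = (\<Sum>d\<le>D'. T (Suc d) x * (of_nat (Suc d) * x j ^ d))"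
        unfolding \<Psi>_def D' by (subst sum.atMost_Suc_shift) simp
      also have "\<dots> = (\<Sum>d\<le>D'. (of_nat (Suc d) * c (Suc d) (\<lambda>k. g k x)) * x j ^ d)"
        by (rule sum.cong) (auto simp: T_def)
      finally show ?thesis using n by simp
    qed
    moreover have "\<exists>d\<le>D'. \<exists>y. of_nat (Suc d) * c (Suc d) y \<noteq> 0"
      using top D' by (intro exI[of _ D']) (auto simp del: of_nat_Suc)
    moreover have "(\<lambda>y. of_nat (Suc d) * c (Suc d) y) \<in> pf {..<N}" for d using cpf by auto
    ultimately have "Rel D' (\<lambda>d y. of_nat (Suc d) * c (Suc d) y)" unfolding Rel_def by blast
    thus False using least D' by fastforce
  qed
  moreover have "y j * \<Psi> x = 0" if y: "\<forall>k<N. dd (g k) y x = 0" for x y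
  proof -
    have dT: "dd (T d) y x = 0" for d
      unfolding T_def by (subst dd_compose[OF _ cpf]) (use g y in auto)
    have "0 = dd (\<lambda>x. \<Sum>d\<le>D. T d x * x j ^ d) y x" by (simp add: T0)
    also have "\<dots> = (\<Sum>d\<le>D. dd (\<lambda>x. T d x * x j ^ d) y x)"
      by (rule dd_sum) (use T j in \<open>auto intro!: pf_mult pf_power\<close>)
    also have "\<dots> = (\<Sum>d\<le>D. y j * (T d x * (of_nat d * x j ^ (d - 1))))"
    proof (rule sum.cong[OF refl])
      fix d
      have "dd (\<lambda>x. T d x * x j ^ d) y x = T d x * dd (\<lambda>x. x j ^ d) y x + dd (T d) y x * x j ^ d"
        by (rule dd_mult[OF T pf_power[OF pf_var[OF j]]])
      thus "dd (\<lambda>x. T d x * x j ^ d) y x = y j * (T d x * (of_nat d * x j ^ (d - 1)))"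
        by (simp add: dT dd_power[OF pf_var[OF j]])
    qed
    finally show ?thesis by (simp add: \<Psi>_def sum_distrib_left)
  qed
  ultimately show ?thesis by blast
qed

text \<open>The family is enlarged to a maximal independent one, over which every coordinate is
  algebraic. At a point where all \<open>\<Psi> j\<close> are nonzero, a direction annihilated by
  all differentials of the large family is zero on \<open>J\<close>; too few independent
  differentials would leave a nonzero one.\<close>

theorem jacobian_criterion:
  fixes g :: "nat \<Rightarrow> ('i \<Rightarrow> 'k::field_char_0) \<Rightarrow> 'k"
  assumes fin: "finite J" and g: "\<And>k. k < r \<Longrightarrow> g k \<in> pf J" "indep_on r g UNIV"
  shows "\<exists>x. dindep r g x"
proof -
  let ?E = "\<lambda>N. r \<le> N \<and> (\<exists>g'. (\<forall>k<r. g' k = g k) \<and> (\<forall>k<N. g' k \<in> pf J) \<and> indep_on N g' UNIV)"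
  have bound: "N \<le> card J" if "\<forall>k<N. g' k \<in> pf J" "indep_on N g' UNIV" for N and g' :: "nat \<Rightarrow> ('i \<Rightarrow> 'k) \<Rightarrow> 'k"
  proof (rule indep_mod_le_card[OF fin, where u = "\<lambda>x. x"])
    show "indep_mod N g' {\<lambda>x. 0}" using that(2) unfolding indep_on_def indep_mod_def by (auto simp: fun_eq_iff)
  qed (use that(1) in auto)
  have "?E r" using g by auto
  moreover have "\<forall>N. ?E N \<longrightarrow> N \<le> card J" using bound by blast
  ultimately have "\<exists>N. ?E N \<and> (\<forall>N'. ?E N' \<longrightarrow> N' \<le> N)" by (rule Nat.ex_has_greatest_nat)
  then obtain N g' where N: "r \<le> N" "\<And>k. k < r \<Longrightarrow> g' k = g k" "\<And>k. k < N \<Longrightarrow> g' k \<in> pf J" "indep_on N g' UNIV"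
    and max: "\<And>N'. ?E N' \<Longrightarrow> N' \<le> N" by blast
  have "\<exists>\<Psi>\<in>pf J. (\<exists>x. \<Psi> x \<noteq> 0) \<and> (\<forall>x y. (\<forall>k<N. dd (g' k) y x = 0) \<longrightarrow> y j * \<Psi> x = 0)" if j: "j \<in> J" for j
  proof (rule algebraic_coordinate[OF N(3,4) j])
    show "\<not> indep_on (Suc N) (g'(N := (\<lambda>x. x j))) UNIV"
    proof
      assume "indep_on (Suc N) (g'(N := (\<lambda>x. x j))) UNIV"
      hence "?E (Suc N)" using N j by (intro conjI exI[of _ "g'(N := (\<lambda>x. x j))"]) (auto simp: less_Suc_eq)
      from max[OF this] show False by simp
    qed
  qed
  hence "\<forall>j\<in>J. \<exists>\<Psi>. \<Psi> \<in> pf J \<and> (\<exists>x. \<Psi> x \<noteq> 0) \<and> (\<forall>x y. (\<forall>k<N. dd (g' k) y x = 0) \<longrightarrow> y j * \<Psi> x = 0)"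
    by (simp add: Bex_def)
  from bchoice[OF this] obtain \<Psi> where "\<forall>j\<in>J. \<Psi> j \<in> pf J \<and> (\<exists>x. \<Psi> j x \<noteq> 0) \<and>
      (\<forall>x y. (\<forall>k<N. dd (g' k) y x = 0) \<longrightarrow> y j * \<Psi> j x = 0)" by (rule exE)
  hence \<Psi>: "\<And>j. j \<in> J \<Longrightarrow> \<Psi> j \<in> pf J" "\<And>j. j \<in> J \<Longrightarrow> \<exists>x. \<Psi> j x \<noteq> 0"
    "\<And>j x y. j \<in> J \<Longrightarrow> (\<forall>k<N. dd (g' k) y x = 0) \<Longrightarrow> y j * \<Psi> j x = 0"
    by simp_all
  obtain x where "(\<Prod>j\<in>J. \<Psi> j x) \<noteq> 0" using pf_prod_nonzero[of J \<Psi> J, OF fin \<Psi>(1,2)] by blast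
  hence \<Psi>x: "\<Psi> j x \<noteq> 0" if "j \<in> J" for j using that fin by auto
  have "\<forall>k<N. c k = 0" if rel: "\<forall>y. (\<Sum>k<N. c k * dd (g' k) y x) = 0" for c
  proof (rule ccontr)
    assume "\<not> ?thesis"
    then obtain k0 where k0: "k0 < N" "c k0 \<noteq> 0" by blast
    \<comment> \<open>A relation with \<open>c k0\<close> nonzero makes the equation for
      \<open>k0\<close> a consequence of the others, so at most \<open>card J - 1\<close> equations
      remain for \<open>card J\<close> unknowns.\<close>
    have "card ({..<N} - {k0}) < card J" using bound[of N g'] N k0 by simp
    from underdetermined_system[OF _ fin this, of "\<lambda>j k. dd (g' k) (unit j) x"]
    obtain y where y: "\<exists>j\<in>J. y j \<noteq> 0" "\<And>k. k \<in> {..<N} - {k0} \<Longrightarrow> (\<Sum>j\<in>J. y j * dd (g' k) (unit j) x) = 0" by auto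
    have z: "dd (g' k) y x = 0" if "k < N" "k \<noteq> k0" for k
      using y(2)[of k] that dd_sum_unit[OF fin N(3)[OF that(1)], of y x] by simp
    have "(\<Sum>k<N. c k * dd (g' k) y x) = c k0 * dd (g' k0) y x"
      by (subst sum.remove[of _ k0]) (use k0 z in auto)
    hence "dd (g' k0) y x = 0" using rel k0 by simp
    hence "\<forall>k<N. dd (g' k) y x = 0" using z by blast
    hence "y j * \<Psi> j x = 0" if "j \<in> J" for j using \<Psi>(3)[OF that] by blast
    thus False using y(1) \<Psi>x by auto
  qed
  hence d: "\<And>c. (\<forall>y. (\<Sum>k<N. c k * dd (g' k) y x) = 0) \<Longrightarrow> \<forall>k<N. c k = 0" by blast
  have "\<forall>k<r. c k = 0" if rel: "\<forall>y. (\<Sum>k<r. c k * dd (g k) y x) = 0" for c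
  proof -
    have "(\<Sum>k<N. (if k < r then c k else 0) * dd (g' k) y x) = (\<Sum>k<r. c k * dd (g k) y x)" for y
    proof -
      have "(\<Sum>k<r. c k * dd (g k) y x) = (\<Sum>k<r. (if k < r then c k else 0) * dd (g' k) y x)"
        by (rule sum.cong) (auto simp: N(2))
      also have "\<dots> = (\<Sum>k<N. (if k < r then c k else 0) * dd (g' k) y x)"
        by (rule sum.mono_neutral_left) (use N(1) in auto)
      finally show ?thesis by simp
    qed
    with rel d[of "\<lambda>k. if k < r then c k else 0"] have z: "\<forall>k<N. (if k < r then c k else 0) = 0" by simp
    show ?thesis
    proof (intro allI impI)
      fix k assume "k < r"
      hence "(if k < r then c k else 0) = 0" using z N(1) less_le_trans by blast
      thus "c k = 0" using \<open>k < r\<close> by simp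
    qed
  qed
  thus ?thesis unfolding dindep_def by blast
qed

section \<open>From independent differentials back to algebraic independence\<close>

lemma coeff_pcompose_shift:
  fixes p :: "'k::idom poly"
  shows "Polynomial.coeff (pcompose p [:t, 1:]) 1 = poly (pderiv p) t"
proof (induction p)
  case (pCons a p)
  have "Polynomial.coeff (pcompose p [:t, 1:]) 0 = poly p t"
    by (metis poly_0_coeff_0 poly_pcompose poly_pCons mult_zero_left add.right_neutral)
  thus ?case using pCons by (simp add: pcompose_pCons pderiv_pCons)
qed simp

lemma dd_zero_imp_const:
  assumes "F \<in> pf J" "\<And>y x. dd F y x = 0" shows "F x = F z"
proof -
  let ?y = "\<lambda>i. z i - x i"
  have "line_poly F (\<lambda>i. x i + t * ?y i) ?y = pcompose (line_poly F x ?y) [:t, 1:]" for t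
    by (rule line_poly_eqI) (simp add: poly_pcompose poly_line_poly[OF assms(1)] algebra_simps)
  hence "poly (pderiv (line_poly F x ?y)) t = 0" for t
    using assms(2)[of ?y "\<lambda>i. x i + t * ?y i"] by (simp add: dd_def coeff_pcompose_shift[simplified])
  hence "pderiv (line_poly F x ?y) = 0" by (intro poly_ext) simp
  hence "degree (line_poly F x ?y) = 0" by (simp add: pderiv_eq_0_iff)
  then obtain c where "line_poly F x ?y = [:c:]" by (rule degree_eq_zeroE)
  thus ?thesis using poly_line_poly[OF assms(1), of x ?y 0] poly_line_poly[OF assms(1), of x ?y 1] by simp
qed

text \<open>Where the differentials are independent, the chain rule turns a relation into relations
  given by its partial derivatives. These have lower degree, so they vanish by induction and the
  relation is a constant, namely zero.\<close>

lemma dindep_imp_indep_on: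
  fixes g :: "nat \<Rightarrow> ('i \<Rightarrow> 'k::field_char_0) \<Rightarrow> 'k"
  assumes g: "\<And>k. k < r \<Longrightarrow> g k \<in> pf J" and d: "dindep r g x0"
  shows "indep_on r g UNIV"
proof -
  obtain X where X: "Determinant.det (jac r g X x0) \<noteq> 0" using d dindep_iff_jac[of r g J, OF g] by blast
  have "\<forall>y. \<phi> y = 0" if "pdeg {..<r} d \<phi>" "\<forall>x. \<phi> (\<lambda>k. g k x) = 0" for d \<phi>
    using that
  proof (induction d arbitrary: \<phi> rule: less_induct)
    case (less d)
    have \<phi>: "\<phi> \<in> pf {..<r}" using less.prems(1) by (rule pfI)
    have z: "dd \<phi> (unit k) (\<lambda>k. g k x) = 0" if k: "k < r" for k x
    proof (rule pf_eq_dense[where F = "\<lambda>x. dd \<phi> (unit k) (\<lambda>k. g k x)" and G = "\<lambda>x. 0" and x = x,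
        OF pf_jac[of r g J, OF g] X])
      show "(\<lambda>x. dd \<phi> (unit k) (\<lambda>k. g k x)) \<in> pf J"
        by (rule pf_compose[OF pf_dd[OF \<phi>]]) (use g in auto)
    next
      fix x assume "Determinant.det (jac r g X x) \<noteq> 0"
      hence "dindep r g x" using dindep_iff_jac[of r g J, OF g] by blast
      moreover have "(\<Sum>k<r. dd \<phi> (unit k) (\<lambda>k. g k x) * dd (g k) y x) = 0" for y
        using dd_compose[OF _ \<phi>, of g J y x] g less.prems(2) by simp
      ultimately show "dd \<phi> (unit k) (\<lambda>k. g k x) = 0"
        by (rule dindepD[where c = "\<lambda>k. dd \<phi> (unit k) (\<lambda>k. g k x)", OF _ _ k])
    qed auto
    have z': "dd \<phi> (unit k) y = 0" if k: "k < r" for k y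
    \<comment> \<open>The bound \<open>d - 1\<close> is not smaller than \<open>d\<close> for
      \<open>d = 0\<close>, where the derivative vanishes anyway.\<close>
    proof (cases "d = 0")
      case True
      thus ?thesis using degree_line_poly[OF less.prems(1), of y "unit k"] by (simp add: dd_def coeff_eq_0)
    next
      case False
      thus ?thesis using less.IH[OF _ pdeg_dd[OF less.prems(1)]] z[OF k] by auto
    qed
    have "dd \<phi> v y = 0" for v y using dd_sum_unit[OF _ \<phi>, of v y] z' by simp
    from dd_zero_imp_const[OF \<phi> this] have "\<phi> y = \<phi> (\<lambda>k. g k x0)" for y .
    thus ?case using less.prems(2) by simp
  qed
  thus ?thesis unfolding indep_on_def by (auto elim: pfE)
qed

subsection \<open>Division along lines\<close>

text \<open>At a root of \<open>v\<close> some \<open>M a\<close> is nonzero, so \<open>u\<close>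
  vanishes there as well; a common linear factor is removed from both and the argument
  repeats.\<close>

lemma alg_closed_dvd:
  fixes u v :: "'k::alg_closed_field poly"
  assumes "v \<noteq> 0" "\<And>t. poly v t = 0 \<Longrightarrow> \<exists>a. poly (M a) t \<noteq> 0" "\<And>a. M a * u = v * N a"
  shows "v dvd u"
  using assms
proof (induction "degree v" arbitrary: u v)
  case 0
  then obtain c where "v = [:c:]" by (metis degree_eq_zeroE)
  thus ?case using 0 by (simp add: const_poly_dvd_iff dvd_field_iff)
next
  case (Suc n)
  obtain t where t: "poly v t = 0" using alg_closed_imp_poly_has_root[of v] Suc.hyps(2) by auto
  then obtain v' where v': "v = [:-t, 1:] * v'" unfolding poly_eq_0_iff_dvd by (elim dvdE)
  obtain a where a: "poly (M a) t \<noteq> 0" using Suc.prems(2)[OF t] by blast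
  have "poly (M a * u) t = 0" using Suc.prems(3)[of a] t by simp
  hence "poly u t = 0" using a by simp
  then obtain u' where u': "u = [:-t, 1:] * u'" unfolding poly_eq_0_iff_dvd by (elim dvdE)
  have "v' \<noteq> 0" using Suc.prems(1) v' by auto
  hence "degree v = Suc (degree v')" unfolding v' by (subst degree_mult_eq) auto
  hence dg: "n = degree v'" using Suc.hyps(2) by simp
  have "v' dvd u'"
  proof (rule Suc.hyps(1)[OF dg \<open>v' \<noteq> 0\<close>])
    show "\<exists>a. poly (M a) s \<noteq> 0" if "poly v' s = 0" for s using Suc.prems(2)[of s] that v' by simp
    show "M a * u' = v' * N a" for a
    proof -
      have "[:-t, 1:] * (M a * u') = [:-t, 1:] * (v' * N a)" using Suc.prems(3)[of a] u' v' by (simp only: ac_simps)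
      thus ?thesis by (metis mult_left_cancel pCons_eq_0_iff one_neq_zero)
    qed
  qed
  thus ?case unfolding u' v' by (rule mult_dvd_mono[OF dvd_refl])
qed

text \<open>Only the constant leading coefficient \<open>c\<close> is inverted, so quotient and
  remainder keep coefficients that are polynomial functions of \<open>x\<close>.\<close>

lemma pf_poly_division:
  fixes p v :: "('i \<Rightarrow> 'k::field_char_0) \<Rightarrow> 'k poly"
  assumes v: "\<And>j. (\<lambda>x. Polynomial.coeff (v x) j) \<in> pf J" "\<And>x. Polynomial.coeff (v x) m = c" "c \<noteq> 0"
    "\<And>x j. j > m \<Longrightarrow> Polynomial.coeff (v x) j = 0"
    and p: "\<And>j. (\<lambda>x. Polynomial.coeff (p x) j) \<in> pf J" "\<And>x j. j \<ge> D \<Longrightarrow> Polynomial.coeff (p x) j = 0"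
  shows "\<exists>q s. (\<forall>x. p x = q x * v x + s x) \<and> (\<forall>j. (\<lambda>x. Polynomial.coeff (q x) j) \<in> pf J) \<and>
     (\<forall>j. (\<lambda>x. Polynomial.coeff (s x) j) \<in> pf J) \<and> (\<forall>x. \<forall>j\<ge>m. Polynomial.coeff (s x) j = 0)"
  using p
proof (induction D arbitrary: p)
  case 0
  thus ?case by (intro exI[of _ "\<lambda>x. 0"] exI[of _ p]) auto
next
  case (Suc D)
  show ?case
  proof (cases "Suc D \<le> m")
    case True
    thus ?thesis using Suc.prems by (intro exI[of _ "\<lambda>x. 0"] exI[of _ p]) auto
  next
    case False
    let ?t = "\<lambda>x. Polynomial.monom (Polynomial.coeff (p x) D / c) (D - m)"
    let ?p = "\<lambda>x. p x - ?t x * v x"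
    have cf: "Polynomial.coeff (?p x) j = Polynomial.coeff (p x) j -
        (if j < D - m then 0 else Polynomial.coeff (p x) D / c * Polynomial.coeff (v x) (j - (D - m)))" for x j
      by (simp add: coeff_monom_mult)
    have "(\<lambda>x. Polynomial.coeff (?p x) j) \<in> pf J" for j
    proof -
      have "(\<lambda>x. Polynomial.coeff (p x) j - (inverse c * Polynomial.coeff (p x) D) * Polynomial.coeff (v x) (j - (D - m))) \<in> pf J"
        by (intro pf_diff pf_mult pf_cmult Suc.prems v)
      thus ?thesis using Suc.prems(1) unfolding cf by (cases "j < D - m") (auto simp: field_simps)
    qed
    moreover have "Polynomial.coeff (?p x) j = 0" if "j \<ge> D" for x j
    proof (cases "j = D")
      case True
      thus ?thesis unfolding cf using False v(2,3) by simp
    next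
      case F: False
      hence "j - (D - m) > m" using False that by auto
      thus ?thesis unfolding cf using F that Suc.prems(2)[of j] v(4) by simp
    qed
    ultimately obtain q s where qs: "\<And>x. ?p x = q x * v x + s x" "\<And>j. (\<lambda>x. Polynomial.coeff (q x) j) \<in> pf J"
      "\<And>j. (\<lambda>x. Polynomial.coeff (s x) j) \<in> pf J" "\<And>x j. j \<ge> m \<Longrightarrow> Polynomial.coeff (s x) j = 0"
      using Suc.IH[of ?p] by blast
    have "p x = (q x + ?t x) * v x + s x" for x using qs(1)[of x] by (simp add: algebra_simps)
    moreover have "(\<lambda>x. Polynomial.coeff (q x + ?t x) j) \<in> pf J" for j
    proof -
      have "(\<lambda>x. Polynomial.coeff (q x) j + inverse c * Polynomial.coeff (p x) D) \<in> pf J"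
        by (intro pf_add pf_cmult Suc.prems qs)
      thus ?thesis using qs(2) by (cases "j = D - m") (auto simp: field_simps)
    qed
    ultimately show ?thesis using qs(3,4) by (intro exI[of _ "\<lambda>x. q x + ?t x"] exI[of _ s]) simp
  qed
qed

lemma pdeg_0_const: "pdeg J 0 F \<Longrightarrow> F x = F y"
proof -
  assume F: "pdeg J 0 F"
  let ?v = "\<lambda>i. y i - x i"
  have "degree (line_poly F x ?v) = 0" using degree_line_poly[OF F] by simp
  then obtain c where "line_poly F x ?v = [:c:]" by (rule degree_eq_zeroE)
  thus ?thesis using poly_line_poly[OF pfI[OF F], of x ?v 0] poly_line_poly[OF pfI[OF F], of x ?v 1] by simp
qed

text \<open>If the highest nonzero homogeneous component of \<open>v\<close>, of degree
  \<open>m\<close>, does not vanish at \<open>e\<close>, then the coefficient of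
  \<open>t ^ m\<close> in \<open>v (x + t e)\<close> has degree 0 in \<open>x\<close> and equals its
  value at \<open>e\<close>.\<close>

lemma monic_direction:
  assumes v: "v \<in> pf J" "v x0 \<noteq> 0"
  shows "\<exists>e m c. c \<noteq> 0 \<and> (\<forall>x. Polynomial.coeff (line_poly v x e) m = c) \<and>
    (\<forall>x. \<forall>j>m. Polynomial.coeff (line_poly v x e) j = 0)"
proof -
  obtain D where D: "pdeg J D v" using v(1) by (rule pfE)
  let ?S = "{d. d \<le> D \<and> (\<exists>e. hc v d e \<noteq> 0)}"
  have "?S \<noteq> {}"
  proof
    assume "?S = {}"
    hence "hc v d x0 = 0" if "d \<le> D" for d using that by auto
    thus False using v(2) hc_sum1[OF D, of x0] by simp
  qed
  define m where "m = Max ?S"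
  have "m \<in> ?S" unfolding m_def by (rule Max_in) (use \<open>?S \<noteq> {}\<close> in auto)
  then obtain e where e: "m \<le> D" "hc v m e \<noteq> 0" by auto
  have z: "hc v d x = 0" if "d \<le> D" "d > m" for d x
  proof (rule ccontr)
    assume "hc v d x \<noteq> 0"
    hence "d \<le> m" unfolding m_def using that by (intro Max_ge) auto
    thus False using that by simp
  qed
  have "v x = (\<Sum>d\<le>m. hc v d x)" for x
    unfolding hc_sum1[OF D, of x] by (rule sum.mono_neutral_right) (use e(1) z in auto)
  hence veq: "(\<lambda>x. \<Sum>d\<le>m. hc v d x) = v" by (intro ext) simp
  have "pdeg J m (\<lambda>x. \<Sum>d\<le>m. hc v d x)"
    by (rule pdeg_sum) (use pdeg_hc[OF D] in \<open>auto intro: pdeg_mono\<close>)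
  hence vm: "pdeg J m v" unfolding veq .
  have "pdeg J 0 (\<lambda>x. Polynomial.coeff (line_poly v x e) m)" using pdeg_line_coeff(1)[OF vm, of m e] by simp
  from pdeg_0_const[OF this, of _ "\<lambda>i. 0"] have "Polynomial.coeff (line_poly v x e) m = hc v m e" for x
    by (simp add: hc_def)
  moreover have "Polynomial.coeff (line_poly v x e) j = 0" if "j > m" for x j
    using degree_line_poly[OF vm, of x e] that by (intro coeff_eq_0) simp
  ultimately show ?thesis using e(2) by blast
qed

text \<open>A Hartogs-type extension: a rational function whose denominators have no common zero in
  codimension one is polynomial. Along a direction in which one denominator is monic, divide with remainder;
  on a general line of that direction the denominators have no common zero, so the remainder vanishes there.\<close>

theorem extension_principle:
  fixes M N :: "'a \<Rightarrow> ('i \<Rightarrow> 'k::{alg_closed_field, field_char_0}) \<Rightarrow> 'k"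
  assumes M: "\<And>a. M a \<in> pf J" and N: "\<And>a. N a \<in> pf J"
    and eq: "\<And>a b x. M a x * N b x = M b x * N a x" and nz: "M a0 x0 \<noteq> 0"
    and P: "\<And>e. \<exists>P\<in>pf J. (\<exists>x. P x \<noteq> 0) \<and> (\<forall>x t. P (\<lambda>i. x i + t * e i) = P x) \<and>
       (\<forall>x. (\<forall>a. M a x = 0) \<longrightarrow> P x = 0)"
  shows "\<exists>c\<in>pf J. \<forall>a x. N a x = c x * M a x"
proof -
  let ?u = "N a0" and ?v = "M a0"
  obtain e m c where e: "c \<noteq> 0" "\<And>x. Polynomial.coeff (line_poly ?v x e) m = c"
    "\<And>x j. j > m \<Longrightarrow> Polynomial.coeff (line_poly ?v x e) j = 0"
    using monic_direction[OF M nz] by blast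
  obtain D where D: "pdeg J D ?u" using N by (rule pfE)
  have "\<exists>q s. (\<forall>x. line_poly ?u x e = q x * line_poly ?v x e + s x) \<and> (\<forall>j. (\<lambda>x. Polynomial.coeff (q x) j) \<in> pf J) \<and>
     (\<forall>j. (\<lambda>x. Polynomial.coeff (s x) j) \<in> pf J) \<and> (\<forall>x. \<forall>j\<ge>m. Polynomial.coeff (s x) j = 0)"
  proof (rule pf_poly_division[where D = "Suc D" and c = c])
    show "Polynomial.coeff (line_poly ?u x e) j = 0" if "j \<ge> Suc D" for x j
      using degree_line_poly[OF D, of x e] that by (intro coeff_eq_0) simp
  qed (use e pf_line_coeff[OF M] pf_line_coeff[OF N] in auto)
  then obtain q s where q: "\<And>x. line_poly ?u x e = q x * line_poly ?v x e + s x"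
    "\<And>j. (\<lambda>x. Polynomial.coeff (q x) j) \<in> pf J" and s: "\<And>j. (\<lambda>x. Polynomial.coeff (s x) j) \<in> pf J"
    "\<And>x j. j \<ge> m \<Longrightarrow> Polynomial.coeff (s x) j = 0" by blast
  obtain P y where P: "P \<in> pf J" "P y \<noteq> 0" "\<And>x t. P (\<lambda>i. x i + t * e i) = P x" "\<And>x. (\<forall>a. M a x = 0) \<Longrightarrow> P x = 0"
    using P[of e] by blast
  have s0: "s x = 0" if "P x \<noteq> 0" for x
  proof -
    let ?V = "line_poly ?v x e"
    have "?V \<noteq> 0" using e(1) e(2)[of x] by auto
    have "?V dvd line_poly ?u x e"
    proof (rule alg_closed_dvd[where M = "\<lambda>a. line_poly (M a) x e" and N = "\<lambda>a. line_poly (N a) x e"])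
      show "\<exists>a. poly (line_poly (M a) x e) t \<noteq> 0" for t
      proof -
        have "P (\<lambda>i. x i + t * e i) \<noteq> 0" using that P(3) by simp
        then obtain a where "M a (\<lambda>i. x i + t * e i) \<noteq> 0" using P(4) by blast
        thus ?thesis by (auto simp: poly_line_poly[OF M])
      qed
      show "line_poly (M a) x e * line_poly ?u x e = ?V * line_poly (N a) x e" for a
        by (rule poly_ext) (simp add: poly_line_poly[OF M] poly_line_poly[OF N] eq)
    qed fact
    hence "?V dvd q x * ?V + s x" by (simp only: q(1)[symmetric])
    hence "?V dvd s x" by (simp add: dvd_add_right_iff)
    show "s x = 0"
    proof (rule ccontr)
      assume "s x \<noteq> 0"
      have "degree ?V \<le> degree (s x)" using \<open>?V dvd s x\<close> \<open>s x \<noteq> 0\<close> by (rule dvd_imp_degree_le)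
      moreover have "m \<le> degree ?V" using e(1) e(2)[of x] by (intro le_degree) simp
      ultimately have "Polynomial.coeff (s x) (degree (s x)) = 0" using s(2)[of "degree (s x)" x] by simp
      thus False using \<open>s x \<noteq> 0\<close> by simp
    qed
  qed
  have "Polynomial.coeff (s x) j = 0" for x j
    by (rule pf_eq_dense[where F = "\<lambda>x. Polynomial.coeff (s x) j" and G = "\<lambda>x. 0" and x = x, OF P(1,2) s(1)])
      (use s0 in auto)
  hence "s x = 0" for x by (intro poly_eqI) simp
  hence uv: "line_poly ?u x e = q x * line_poly ?v x e" for x using q(1)[of x] by simp
  \<comment> \<open>The quotient at parameter 0, that is, at the point \<open>x\<close>
    itself.\<close>
  define C where "C x = Polynomial.coeff (q x) 0" for x
  have C: "C \<in> pf J" unfolding C_def[abs_def] by (rule q(2))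
  have "?u x = C x * ?v x" for x
  proof -
    have "?u x = Polynomial.coeff (line_poly ?u x e) 0" by (simp add: coeff_line_poly_0[OF N])
    also have "\<dots> = C x * ?v x" by (simp add: uv coeff_mult C_def coeff_line_poly_0[OF M])
    finally show ?thesis .
  qed
  hence "N a x = C x * M a x" if "?v x \<noteq> 0" for a x
    using eq[of a0 x a] that by (simp add: ac_simps)
  hence "N a x = C x * M a x" for a x
    by (rule pf_eq_dense[OF M nz N pf_mult[OF C M]])
  thus ?thesis using C by blast
qed

subsection \<open>Integrating differential dependence\<close>

lemma homog_0_constant:
  assumes "homog 0 g" shows "\<exists>c. g = (\<lambda>x. c)"
  using homog_0_const[OF assms] by (intro exI[of _ "g (\<lambda>i. 0)"]) auto

text \<open>The induction step for \<open>integration_homog\<close>: the coefficients \<open>c i\<close> of \<open>dg\<close> in terms of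
  the \<open>dF i\<close> are polynomials, and \<open>d (dg) = 0\<close> forces \<open>dc i\<close> to be dependent on the \<open>dF j\<close> again.\<close>

lemma ddep_polynomial_coeffs:
  fixes F :: "nat \<Rightarrow> ('i \<Rightarrow> 'k::{alg_closed_field, field_char_0}) \<Rightarrow> 'k"
  assumes F: "\<And>i. i < r \<Longrightarrow> F i \<in> pf J" and g: "g \<in> pf J"
    and P: "\<And>e. \<exists>P\<in>pf J. (\<exists>x. P x \<noteq> 0) \<and> (\<forall>x t. P (\<lambda>i. x i + t * e i) = P x) \<and>
       (\<forall>x. \<not> dindep r F x \<longrightarrow> P x = 0)"
    and Q: "Q \<in> pf J" "Q x0 \<noteq> 0" "\<And>x. Q x \<noteq> 0 \<Longrightarrow> ddep r F g x"
  shows "\<exists>c. (\<forall>i<r. c i \<in> pf J) \<and> (\<forall>x y. dd g y x = (\<Sum>i<r. c i x * dd (F i) y x)) \<and>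
    (\<forall>i<r. \<forall>x. dindep r F x \<longrightarrow> ddep r F (c i) x)"
proof -
  let ?M = "\<lambda>X x. Determinant.det (jac r F X x)"
  let ?N = "\<lambda>i X x. Determinant.det (replace_col (jac r F X x) (Matrix.vec r (\<lambda>k. dd g (X k) x)) i)"
  have Mpf: "?M X \<in> pf J" for X by (rule pf_jac[of r F J, OF F])
  have Npf: "?N i X \<in> pf J" for i X
  proof -
    have "?N i X x = Determinant.det (Matrix.mat r r (\<lambda>(k, j). (if j = i then dd g (X k) else dd (F j) (X k)) x))" for x
      unfolding replace_col_def jac_def by (intro arg_cong[of _ _ Determinant.det] eq_matI) auto
    moreover have "(if j = i then dd g (X k) else dd (F j) (X k)) \<in> pf J" if "j < r" for k j
      using F[OF that] g by auto
    ultimately show ?thesis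
      using pf_det[of r "\<lambda>k j. if j = i then dd g (X k) else dd (F j) (X k)" J] by simp
  qed
  obtain Pr z where Pr: "Pr \<in> pf J" "Pr z \<noteq> 0" "\<And>x. \<not> dindep r F x \<Longrightarrow> Pr x = 0"
    using P[of "\<lambda>i. 0"] by (elim bexE conjE exE) simp
  then obtain X0 where X0: "?M X0 z \<noteq> 0" using dindep_iff_jac[of r F J, OF F] by blast
  \<comment> \<open>By Cramer's rule the quotient of \<open>?N i X\<close> by \<open>?M X\<close> is
    the same for all \<open>X\<close>; the extension principle is applied with \<open>X\<close> as
    its index.\<close>
  have cramer: "?N i X x = c i * ?M X x" if c: "\<And>y. dd g y x = (\<Sum>i<r. c i * dd (F i) y x)" and i: "i < r" for c x i X
  proof -
    have "Matrix.vec r (\<lambda>k. dd g (X k) x) = jac r F X x *\<^sub>v Matrix.vec r c"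
      by (rule eq_vecI) (auto simp: jac_def scalar_prod_def c atLeast0LessThan mult.commute)
    thus ?thesis using cramer_lemma_mat[of "jac r F X x" r "Matrix.vec r c" i] i by simp
  qed
  have Neq: "?M X x * ?N i Y x = ?M Y x * ?N i X x" if i: "i < r" for i X Y x
  proof (rule pf_eq_dense[where F = "\<lambda>x. ?M X x * ?N i Y x" and G = "\<lambda>x. ?M Y x * ?N i X x" and x = x, OF Q(1,2)])
    fix x assume "Q x \<noteq> 0"
    from ddep_coeffs[OF F g Q(3)[OF this]] obtain c where "\<And>y. dd g y x = (\<Sum>i<r. c i * dd (F i) y x)" by blast
    from cramer[OF this i] show "?M X x * ?N i Y x = ?M Y x * ?N i X x" by simp
  qed (use Mpf Npf in auto)
  have "\<exists>c\<in>pf J. \<forall>X x. ?N i X x = c x * ?M X x" if i: "i < r" for i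
  proof (rule extension_principle[where M = ?M and N = "?N i"])
    show "?M X \<in> pf J" for X by (rule Mpf)
    show "?N i X \<in> pf J" for X by (rule Npf)
    show "?M X x * ?N i Y x = ?M Y x * ?N i X x" for X Y x by (rule Neq[OF i])
    show "?M X0 z \<noteq> 0" by (rule X0)
    fix e
    have "(\<forall>X. ?M X x = 0) \<longleftrightarrow> \<not> dindep r F x" for x using dindep_iff_jac[of r F J, OF F] by auto
    thus "\<exists>P\<in>pf J. (\<exists>x. P x \<noteq> 0) \<and> (\<forall>x t. P (\<lambda>i. x i + t * e i) = P x) \<and> (\<forall>x. (\<forall>X. ?M X x = 0) \<longrightarrow> P x = 0)"
      using P[of e] by simp
  qed
  hence "\<forall>i\<in>{..<r}. \<exists>c. c \<in> pf J \<and> (\<forall>X x. ?N i X x = c x * ?M X x)" by (simp add: Bex_def)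
  from bchoice[OF this] obtain c where "\<forall>i\<in>{..<r}. c i \<in> pf J \<and> (\<forall>X x. ?N i X x = c i x * ?M X x)" by (rule exE)
  hence c: "\<And>i. i < r \<Longrightarrow> c i \<in> pf J" "\<And>i X x. i < r \<Longrightarrow> ?N i X x = c i x * ?M X x" by simp_all
  have dg: "dd g y x = (\<Sum>i<r. c i x * dd (F i) y x)" for x y
  proof -
    obtain w where w: "Q w * ?M X0 w \<noteq> 0"
      using pf_mult_eq_0[OF Q(1) Mpf _ Q(2), of X0 z] X0 by blast
    show ?thesis
    proof (rule pf_eq_dense[where F = "dd g y" and G = "\<lambda>x. \<Sum>i<r. c i x * dd (F i) y x" and x = x,
        OF pf_mult[OF Q(1) Mpf] w])
      show "(\<lambda>x. \<Sum>i<r. c i x * dd (F i) y x) \<in> pf J" by (intro pf_sum pf_mult pf_dd) (use c F in auto)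
      fix x assume x: "Q x * ?M X0 x \<noteq> 0"
      then obtain c' where c': "\<And>y. dd g y x = (\<Sum>i<r. c' i * dd (F i) y x)" using ddep_coeffs[OF F g Q(3)] by auto
      have "c' i = c i x" if "i < r" for i using cramer[OF c' that, of X0] c(2)[OF that, of X0 x] x by simp
      thus "dd g y x = (\<Sum>i<r. c i x * dd (F i) y x)" by (simp add: c')
    qed (use g in auto)
  qed
  have "ddep r F (c i) x" if i: "i < r" and x: "dindep r F x" for i x
    unfolding ddep_def
  proof (intro allI impI)
    fix y assume y: "\<forall>j<r. dd (F j) y x = 0"
    have d2: "dd (dd g u) v x = (\<Sum>j<r. c j x * dd (dd (F j) u) v x) + (\<Sum>j<r. dd (c j) v x * dd (F j) u x)" for u v
    proof -
      have "dd g u = (\<lambda>x. \<Sum>j<r. c j x * dd (F j) u x)" using dg by auto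
      hence "dd (dd g u) v x = dd (\<lambda>x. \<Sum>j<r. c j x * dd (F j) u x) v x" by simp
      also have "\<dots> = (\<Sum>j<r. dd (\<lambda>x. c j x * dd (F j) u x) v x)"
        by (rule dd_sum[of _ _ J], intro pf_mult pf_dd c(1) F) auto
      also have "\<dots> = (\<Sum>j<r. c j x * dd (dd (F j) u) v x + dd (c j) v x * dd (F j) u x)"
        by (intro sum.cong refl dd_mult[of _ J]) (auto intro!: pf_dd c(1) F)
      finally show ?thesis by (simp add: sum.distrib)
    qed
    have "(\<Sum>j<r. dd (c j) y x * dd (F j) u x) = 0" for u
    proof -
      have "(\<Sum>j<r. c j x * dd (dd (F j) u) y x) = (\<Sum>j<r. c j x * dd (dd (F j) y) u x)"
        by (intro sum.cong refl arg_cong2[of _ _ _ _ "(*)"] dd_commute[of _ J]) (use F in auto)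
      moreover have "(\<Sum>j<r. dd (c j) u x * dd (F j) y x) = 0" using y by simp
      moreover have "dd (dd g u) y x = dd (dd g y) u x" by (rule dd_commute[OF g])
      ultimately show ?thesis using d2[of u y] d2[of y u] by simp
    qed
    thus "dd (c i) y x = 0" by (rule dindepD[where c = "\<lambda>j. dd (c j) y x", OF x _ i])
  qed
  thus ?thesis using c(1) dg by blast
qed

text \<open>Comparing scalings, the coefficients \<open>c i\<close> of the differential of
  \<open>g\<close> are homogeneous of degree \<open>D - d i\<close>, hence by induction polynomials
  in the \<open>F j\<close>; Euler's identity writes \<open>D * g\<close> as the sum of the
  \<open>d i * c i * F i\<close>. The restriction to generators of degree at most \<open>D\<close>
  is later needed to recover leading components one degree at a time.\<close>

lemma integration_homog:
  fixes F :: "nat \<Rightarrow> ('i \<Rightarrow> 'k::{alg_closed_field, field_char_0}) \<Rightarrow> 'k"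
  assumes F: "\<And>i. i < r \<Longrightarrow> F i \<in> pf J" "\<And>i. i < r \<Longrightarrow> homog (d i) (F i)" "\<And>i. i < r \<Longrightarrow> d i > 0"
    and P: "\<And>e. \<exists>P\<in>pf J. (\<exists>x. P x \<noteq> 0) \<and> (\<forall>x t. P (\<lambda>i. x i + t * e i) = P x) \<and>
       (\<forall>x. \<not> dindep r F x \<longrightarrow> P x = 0)"
    and g: "g \<in> pf J" "homog D g" "Q \<in> pf J" "Q x0 \<noteq> 0" "\<And>x. Q x \<noteq> 0 \<Longrightarrow> ddep r F g x"
  shows "\<exists>\<phi>\<in>pf {i. i < r \<and> d i \<le> D}. g = (\<lambda>x. \<phi> (\<lambda>i. F i x))"
  using g
proof (induction D arbitrary: g Q x0 rule: less_induct)
  case (less D)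
  show ?case
  proof (cases "D = 0")
    case True
    then obtain c where "g = (\<lambda>x. c)" using homog_0_constant less.prems(2) by blast
    thus ?thesis by (intro bexI[of _ "\<lambda>_. c"]) auto
  next
    case False
    obtain c where c: "\<And>i. i < r \<Longrightarrow> c i \<in> pf J" "\<And>x y. dd g y x = (\<Sum>i<r. c i x * dd (F i) y x)"
      "\<And>i x. i < r \<Longrightarrow> dindep r F x \<Longrightarrow> ddep r F (c i) x"
      using ddep_polynomial_coeffs[OF F(1) less.prems(1) P less.prems(3,4,5)] by blast
    obtain Pr z where Pr: "Pr \<in> pf J" "Pr z \<noteq> 0" "\<And>x. \<not> dindep r F x \<Longrightarrow> Pr x = 0"
    using P[of "\<lambda>i. 0"] by (elim bexE conjE exE) simp
    \<comment> \<open>The differentials of \<open>g\<close> and of the \<open>F i\<close> scale with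
      exponents \<open>D - 1\<close> and \<open>d i - 1\<close>; independence lets the coefficients
      be compared.\<close>
    have hom: "t ^ (D - 1) * c i x = c i (\<lambda>k. t * x k) * t ^ (d i - 1)" if i: "i < r" and t: "t \<noteq> 0" for i x t
    proof (rule pf_eq_dense[where F = "\<lambda>x. t ^ (D - 1) * c i x" and G = "\<lambda>x. c i (\<lambda>k. t * x k) * t ^ (d i - 1)"
        and x = x, OF Pr(1,2)])
      show "(\<lambda>x. c i (\<lambda>k. t * x k) * t ^ (d i - 1)) \<in> pf J"
        by (intro pf_mult pf_const pf_compose[OF c(1)[OF i]]) auto
      fix x assume "Pr x \<noteq> 0"
      hence x: "dindep r F x" using Pr(3) by blast
      have "(\<Sum>i<r. (t ^ (D - 1) * c i x - c i (\<lambda>k. t * x k) * t ^ (d i - 1)) * dd (F i) y x) = 0" for y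
      proof -
        have "t ^ (D - 1) * dd g y x = dd g y (\<lambda>k. t * x k)"
          using dd_homog[OF less.prems(1,2) _ t] False by simp
        also have "\<dots> = (\<Sum>i<r. c i (\<lambda>k. t * x k) * (t ^ (d i - 1) * dd (F i) y x))"
          unfolding c(2) by (intro sum.cong refl arg_cong2[of _ _ _ _ "(*)"] dd_homog) (use F t in auto)
        finally show ?thesis by (simp add: c(2) sum_distrib_left left_diff_distrib sum_subtractf mult.assoc)
      qed
      hence "t ^ (D - 1) * c i x - c i (\<lambda>k. t * x k) * t ^ (d i - 1) = 0"
        by (rule dindepD[where c = "\<lambda>i. t ^ (D - 1) * c i x - c i (\<lambda>k. t * x k) * t ^ (d i - 1)", OF x _ i])
      thus "t ^ (D - 1) * c i x = c i (\<lambda>k. t * x k) * t ^ (d i - 1)" by simp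
    qed (use c(1)[OF i] in auto)
    have line: "poly (line_poly (c i) (\<lambda>k. 0) x) t = c i (\<lambda>k. t * x k)" if "i < r" for i x t
      using poly_line_poly[OF c(1)[OF that], of "\<lambda>k. 0" x t] by simp
    \<comment> \<open>Such a \<open>c i\<close> would be homogeneous of negative degree: as a
      polynomial in \<open>t\<close> along a ray it would have to absorb a power of
      \<open>t\<close>.\<close>
    have small: "c i x = 0" if i: "i < r" and lt: "D < d i" for i x
    proof -
      have "[:0, 1:] * Polynomial.smult (c i x) ([:0, 1:] ^ (D - 1)) = [:0, 1:] * ([:0, 1:] ^ (d i - 1) * line_poly (c i) (\<lambda>k. 0) x)"
      proof (rule poly_ext)
        fix t show "poly ([:0, 1:] * Polynomial.smult (c i x) ([:0, 1:] ^ (D - 1))) t =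
            poly ([:0, 1:] * ([:0, 1:] ^ (d i - 1) * line_poly (c i) (\<lambda>k. 0) x)) t"
          using hom[OF i, of t x] by (cases "t = 0") (auto simp: line[OF i] poly_power ac_simps)
      qed
      hence "Polynomial.smult (c i x) ([:0, 1:] ^ (D - 1)) = [:0, 1:] ^ (d i - 1) * line_poly (c i) (\<lambda>k. 0) x"
        by (metis mult_left_cancel pCons_eq_0_iff one_neq_zero)
      also have "[:0, 1:] ^ (d i - 1) = [:0, 1:] ^ (D - 1) * [:0, 1:] ^ (d i - D)"
        using lt False by (simp add: power_add[symmetric])
      finally have "[:0, 1:] ^ (D - 1) * [:c i x:] = [:0, 1:] ^ (D - 1) * ([:0, 1:] ^ (d i - D) * line_poly (c i) (\<lambda>k. 0) x)"
        by (simp add: ac_simps)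
      hence "[:c i x:] = [:0, 1:] ^ (d i - D) * line_poly (c i) (\<lambda>k. 0) x"
        by (metis mult_left_cancel pCons_eq_0_iff one_neq_zero power_not_zero)
      hence "poly [:c i x:] 0 = poly ([:0, 1:] ^ (d i - D) * line_poly (c i) (\<lambda>k. 0) x) 0" by simp
      thus ?thesis using lt by (simp add: poly_power power_0_left)
    qed
    have chom: "homog (D - d i) (c i)" if i: "i < r" and le: "d i \<le> D" for i
      unfolding homog_def
    proof (intro allI)
      fix t x
      have "[:0, 1:] ^ (d i) * line_poly (c i) (\<lambda>k. 0) x = [:0, 1:] ^ (d i) * Polynomial.smult (c i x) ([:0, 1:] ^ (D - d i))"
      proof (rule poly_ext)
        fix s
        have "s ^ (d i) * c i (\<lambda>k. s * x k) = s ^ d i * (c i x * s ^ (D - d i))"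
        proof (cases "s = 0")
          case False
          have "s ^ (d i) * c i (\<lambda>k. s * x k) = s * (c i (\<lambda>k. s * x k) * s ^ (d i - 1))"
            using F(3)[OF i] by (cases "d i") auto
          also have "\<dots> = s * (s ^ (D - 1) * c i x)" using hom[OF i False, of x] by simp
          also have "\<dots> = s ^ D * c i x" using \<open>D \<noteq> 0\<close> by (cases D) auto
          also have "s ^ D = s ^ d i * s ^ (D - d i)" using le by (simp add: power_add[symmetric])
          finally show ?thesis by (simp add: ac_simps)
        qed (use F(3)[OF i] in auto)
        thus "poly ([:0, 1:] ^ (d i) * line_poly (c i) (\<lambda>k. 0) x) s =
          poly ([:0, 1:] ^ (d i) * Polynomial.smult (c i x) ([:0, 1:] ^ (D - d i))) s"
          by (simp add: line[OF i] poly_power)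
      qed
      hence "line_poly (c i) (\<lambda>k. 0) x = Polynomial.smult (c i x) ([:0, 1:] ^ (D - d i))"
        by (metis mult_left_cancel pCons_eq_0_iff one_neq_zero power_not_zero)
      thus "c i (\<lambda>k. t * x k) = t ^ (D - d i) * c i x" using line[OF i, of x t] by (simp add: poly_power mult.commute)
    qed
    have IH: "\<exists>\<phi>\<in>pf {j. j < r \<and> d j \<le> D - d i}. c i = (\<lambda>x. \<phi> (\<lambda>i. F i x))" if i: "i < r" and le: "d i \<le> D" for i
      by (rule less.IH[OF _ c(1)[OF i] chom[OF i le] Pr(1,2)]) (use F(3)[OF i] le False c(3)[OF i] Pr(3) in auto)
    have "\<exists>\<phi>. \<phi> \<in> pf {j. j < r \<and> d j \<le> D} \<and> (\<forall>x. c i x * F i x = \<phi> (\<lambda>i. F i x))" if i: "i < r" for i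
    proof (cases "d i \<le> D")
      case True
      from IH[OF i True] obtain \<phi> where \<phi>: "\<phi> \<in> pf {j. j < r \<and> d j \<le> D - d i}" "c i = (\<lambda>x. \<phi> (\<lambda>i. F i x))" by blast
      have "\<phi> \<in> pf {j. j < r \<and> d j \<le> D}" using \<phi>(1) by (rule pf_subset) auto
      hence "(\<lambda>y. \<phi> y * y i) \<in> pf {j. j < r \<and> d j \<le> D}" using i True by auto
      thus ?thesis using \<phi>(2) by (intro exI[of _ "\<lambda>y. \<phi> y * y i"]) auto
    next
      case False
      thus ?thesis using small[OF i] by (intro exI[of _ "\<lambda>y. 0"]) auto
    qed
    hence "\<forall>i\<in>{..<r}. \<exists>\<phi>. \<phi> \<in> pf {j. j < r \<and> d j \<le> D} \<and> (\<forall>x. c i x * F i x = \<phi> (\<lambda>i. F i x))" by simp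
    from bchoice[OF this] obtain \<phi> where
      "\<forall>i\<in>{..<r}. \<phi> i \<in> pf {j. j < r \<and> d j \<le> D} \<and> (\<forall>x. c i x * F i x = \<phi> i (\<lambda>i. F i x))" by (rule exE)
    hence \<phi>: "\<And>i. i < r \<Longrightarrow> \<phi> i \<in> pf {j. j < r \<and> d j \<le> D}" "\<And>i x. i < r \<Longrightarrow> c i x * F i x = \<phi> i (\<lambda>i. F i x)"
      by simp_all
    have "g x = (1 / of_nat D) * (\<Sum>i<r. of_nat (d i) * \<phi> i (\<lambda>i. F i x))" for x
    proof -
      have "of_nat D * g x = dd g x x" by (simp add: dd_euler[OF less.prems(2)])
      also have "\<dots> = (\<Sum>i<r. of_nat (d i) * \<phi> i (\<lambda>i. F i x))"
        unfolding c(2) by (rule sum.cong) (auto simp: dd_euler[OF F(2)] \<phi>(2)[symmetric])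
      finally show ?thesis using False by (simp add: field_simps)
    qed
    moreover have "(\<lambda>y. (1 / of_nat D) * (\<Sum>i<r. of_nat (d i) * \<phi> i y)) \<in> pf {j. j < r \<and> d j \<le> D}"
      by (intro pf_cmult pf_sum) (use \<phi> in auto)
    ultimately show ?thesis by (intro bexI[of _ "\<lambda>y. (1 / of_nat D) * (\<Sum>i<r. of_nat (d i) * \<phi> i y)"]) auto
  qed
qed

lemma dd_hc_sum:
  assumes "pdeg J m g"
  shows "t * dd g y (\<lambda>i. t * x i) = (\<Sum>n\<le>m. dd (hc g n) y x * t ^ n)"
proof -
  have g: "g \<in> pf J" using assms by (rule pfI)
  have gs: "(\<lambda>x. \<Sum>n\<le>m. hc g n x) = g" by (rule ext) (rule hc_sum1[OF assms, symmetric])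
  have "dd (\<lambda>x. \<Sum>n\<le>m. hc g n x) y (\<lambda>i. t * x i) = (\<Sum>n\<le>m. dd (hc g n) y (\<lambda>i. t * x i))"
    by (rule dd_sum[of _ _ J]) (rule pf_hc[OF g])
  hence "t * dd g y (\<lambda>i. t * x i) = (\<Sum>n\<le>m. t * dd (hc g n) y (\<lambda>i. t * x i))"
    unfolding gs by (simp add: sum_distrib_left)
  also have "\<dots> = (\<Sum>n\<le>m. dd (hc g n) y x * t ^ n)"
    by (rule sum.cong) (auto simp: dd_scale[OF pf_hc[OF g] homog_hc[OF g]])
  finally show ?thesis .
qed

lemma dindep_scale:
  assumes "\<And>i. i < r \<Longrightarrow> F i \<in> pf J" "\<And>i. i < r \<Longrightarrow> homog (d i) (F i)" "\<And>i. i < r \<Longrightarrow> d i > 0" "t \<noteq> 0"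
  shows "(\<forall>i<r. dd (F i) y (\<lambda>k. t * x k) = 0) \<longleftrightarrow> (\<forall>i<r. dd (F i) y x = 0)"
  using dd_homog[OF assms(1,2,3,4)] assms(4) by auto

text \<open>The common kernel of the differentials of the \<open>F i\<close> is the same at
  \<open>x\<close> and at \<open>t x\<close> for nonzero \<open>t\<close>. Hence the dependence of
  \<open>g\<close> along the ray through \<open>x\<close> is an identity in \<open>t\<close> whose
  coefficients concern the homogeneous components.\<close>

theorem integration:
  fixes F :: "nat \<Rightarrow> ('i \<Rightarrow> 'k::{alg_closed_field, field_char_0}) \<Rightarrow> 'k"
  assumes F: "\<And>i. i < r \<Longrightarrow> F i \<in> pf J" "\<And>i. i < r \<Longrightarrow> homog (d i) (F i)" "\<And>i. i < r \<Longrightarrow> d i > 0"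
    and P: "\<And>e. \<exists>P\<in>pf J. (\<exists>x. P x \<noteq> 0) \<and> (\<forall>x t. P (\<lambda>i. x i + t * e i) = P x) \<and>
       (\<forall>x. \<not> dindep r F x \<longrightarrow> P x = 0)"
    and g: "g \<in> pf J" "Q \<in> pf J" "Q x0 \<noteq> 0" "\<And>x. Q x \<noteq> 0 \<Longrightarrow> ddep r F g x"
  shows "\<exists>\<phi>\<in>pf {i. i < r \<and> d i \<le> D}. hc g D = (\<lambda>x. \<phi> (\<lambda>i. F i x))"
proof (rule integration_homog[where F = F and d = d and g = "hc g D" and Q = Q and D = D and r = r and J = J])
  show "hc g D \<in> pf J" "homog D (hc g D)" using g(1) by (auto intro: homog_hc)
  fix x assume Qx: "Q x \<noteq> 0"
  show "ddep r F (hc g D) x"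
    unfolding ddep_def
  proof (intro allI impI)
    fix y assume y: "\<forall>i<r. dd (F i) y x = 0"
    obtain m where m: "pdeg J m g" using g(1) by (rule pfE)
    \<comment> \<open>A nonzero polynomial that vanishes at those \<open>t\<close> for which
      dependence at \<open>t x\<close> is unknown; multiplying by it yields an identity for all
      \<open>t\<close>.\<close>
    let ?L = "line_poly Q (\<lambda>i. 0) x"
    have L: "poly ?L t = Q (\<lambda>i. t * x i)" for t using poly_line_poly[OF g(2), of "\<lambda>i. 0" x t] by simp
    let ?p = "\<Sum>n\<le>m. Polynomial.monom (dd (hc g n) y x) n"
    have "[:0, 1:] * ?L * ?p = 0"
    proof (rule poly_ext)
      fix t
      have z: "dd g y (\<lambda>i. t * x i) = 0" if t: "t \<noteq> 0" "Q (\<lambda>i. t * x i) \<noteq> 0"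
      proof -
        have "\<forall>i<r. dd (F i) y (\<lambda>k. t * x k) = 0"
          using y dindep_scale[of r F J d t y x, OF F t(1)] by simp
        thus ?thesis using g(4)[OF t(2)] unfolding ddep_def by simp
      qed
      have "poly ?p t = t * dd g y (\<lambda>i. t * x i)"
        by (simp add: dd_hc_sum[OF m] poly_sum Polynomial.poly_monom)
      hence "t * Q (\<lambda>i. t * x i) * poly ?p t = 0" using z by auto
      thus "poly ([:0, 1:] * ?L * ?p) t = poly 0 t" by (simp add: L)
    qed
    moreover have "?L \<noteq> 0" using L[of 1] Qx by auto
    ultimately have "?p = 0" by simp
    hence "Polynomial.coeff ?p D = 0" by simp
    hence *: "(\<Sum>n\<le>m. if n = D then dd (hc g n) y x else 0) = 0" by (simp add: coeff_sum)
    show "dd (hc g D) y x = 0"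
    proof (cases "D \<le> m")
      case True thus ?thesis using * by simp
    next
      case False
      hence "hc g D z = 0" for z using degree_line_poly[OF m, of "\<lambda>i. 0" z] by (simp add: hc_def coeff_eq_0)
      hence "hc g D = (\<lambda>z. 0)" by auto
      thus ?thesis by simp
    qed
  qed
qed (fact F P g(2,3))+

section \<open>Bordered determinants\<close>

text \<open>Sylvester's determinant identity, from the block matrices \<open>?M\<close> and
  \<open>?U\<close> multiplied in both orders.\<close>

lemma det_one_plus_swap:
  fixes A B :: "'k::field mat"
  assumes A: "A \<in> carrier_mat n l" and B: "B \<in> carrier_mat l n"
  shows "Determinant.det (1\<^sub>m n + A * B) = Determinant.det (1\<^sub>m l + B * A)"
proof -
  let ?M = "four_block_mat (1\<^sub>m n) (- A) B (1\<^sub>m l)"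
  let ?U = "four_block_mat (1\<^sub>m n) A (0\<^sub>m l n) (1\<^sub>m l)"
  have M: "?M \<in> carrier_mat (n + l) (n + l)" and U: "?U \<in> carrier_mat (n + l) (n + l)" by auto
  have "?M * ?U = four_block_mat (1\<^sub>m n * 1\<^sub>m n + (- A) * 0\<^sub>m l n) (1\<^sub>m n * A + (- A) * 1\<^sub>m l)
      (B * 1\<^sub>m n + 1\<^sub>m l * 0\<^sub>m l n) (B * A + 1\<^sub>m l * 1\<^sub>m l)"
    by (rule mult_four_block_mat) (use A B in auto)
  also have "\<dots> = four_block_mat (1\<^sub>m n) (0\<^sub>m n l) B (1\<^sub>m l + B * A)"
    using A B by (intro arg_cong4[of _ _ _ _ _ _ _ _ four_block_mat]) (auto simp: uminus_l_inv_mat comm_add_mat[of _ l l])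
  also have "Determinant.det \<dots> = Determinant.det (1\<^sub>m n :: 'k mat) * Determinant.det (1\<^sub>m l + B * A)"
    by (rule det_four_block_mat_upper_right_zero) (use A B in auto)
  finally have 1: "Determinant.det (?M * ?U) = Determinant.det (1\<^sub>m l + B * A)" by simp
  have "?U * ?M = four_block_mat (1\<^sub>m n * 1\<^sub>m n + A * B) (1\<^sub>m n * (- A) + A * 1\<^sub>m l)
      (0\<^sub>m l n * 1\<^sub>m n + 1\<^sub>m l * B) (0\<^sub>m l n * (- A) + 1\<^sub>m l * 1\<^sub>m l)"
    by (rule mult_four_block_mat) (use A B in auto)
  also have "\<dots> = four_block_mat (1\<^sub>m n + A * B) (0\<^sub>m n l) B (1\<^sub>m l)"
    using A B by (intro arg_cong4[of _ _ _ _ _ _ _ _ four_block_mat]) (auto simp: uminus_l_inv_mat)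
  also have "Determinant.det \<dots> = Determinant.det (1\<^sub>m n + A * B) * Determinant.det (1\<^sub>m l :: 'k mat)"
    by (rule det_four_block_mat_upper_right_zero) (use A B in auto)
  finally have 2: "Determinant.det (?U * ?M) = Determinant.det (1\<^sub>m n + A * B)" by simp
  show ?thesis by (simp only: 1[symmetric] 2[symmetric] det_mult[OF M U] det_mult[OF U M] mult.commute)
qed

text \<open>The two bordered matrices are congruent by a matrix \<open>T\<close> that fixes
  \<open>\<pi>\<close> and carries \<open>X\<close> to \<open>X'\<close>; its determinant is the
  quotient of those of \<open>X' * G\<close> and \<open>X * G\<close>, by Sylvester's
  identity.\<close>

lemma bordered_det:
  fixes \<pi> X X' G :: "'k::field mat"
  assumes \<pi>: "\<pi> \<in> carrier_mat n n" and X: "X \<in> carrier_mat l n" and X': "X' \<in> carrier_mat l n"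
    and G: "G \<in> carrier_mat n l" and z: "\<pi> * G = 0\<^sub>m n l" "transpose_mat G * \<pi> = 0\<^sub>m l n"
    and N: "Determinant.det (X * G) \<noteq> 0"
  shows "Determinant.det (\<pi> + transpose_mat X' * X') * Determinant.det (X * G) ^ 2 =
    Determinant.det (X' * G) ^ 2 * Determinant.det (\<pi> + transpose_mat X * X)"
proof -
  let ?N = "X * G"
  have Nc: "?N \<in> carrier_mat l l" using X G by auto
  obtain Ni where Ni: "Ni \<in> carrier_mat l l" "?N * Ni = 1\<^sub>m l" "Ni * ?N = 1\<^sub>m l"
    using det_non_zero_imp_unit[OF Nc N, of l] unfolding Units_def by (auto simp: ring_mat_def)
  define K where "K = X' - X"
  have K: "K \<in> carrier_mat l n" unfolding K_def using X X' by auto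
  have NiK: "Ni * K \<in> carrier_mat l n" using Ni K by auto
  \<comment> \<open>The correction has its image in that of \<open>G\<close>, which
    \<open>\<pi>\<close> annihilates, and \<open>X\<close> maps it to \<open>X' - X\<close> because
    \<open>X * G * Ni\<close> is the identity.\<close>
  define T where "T = 1\<^sub>m n + G * (Ni * K)"
  have GNK: "G * (Ni * K) \<in> carrier_mat n n" using G NiK by auto
  have T: "T \<in> carrier_mat n n" unfolding T_def using GNK by auto
  have \<pi>T: "\<pi> * T = \<pi>"
  proof -
    have "\<pi> * (G * (Ni * K)) = (\<pi> * G) * (Ni * K)" by (rule assoc_mult_mat[OF \<pi> G NiK, symmetric])
    also have "\<dots> = 0\<^sub>m n n" by (simp only: z(1) left_mult_zero_mat[OF NiK])
    finally show ?thesis unfolding T_def using \<pi> GNK by (simp add: mult_add_distrib_mat[OF \<pi> one_carrier_mat GNK])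
  qed
  have T\<pi>: "transpose_mat T * \<pi> = \<pi>"
  proof -
    have "transpose_mat (G * (Ni * K)) * \<pi> = (transpose_mat (Ni * K) * transpose_mat G) * \<pi>"
      by (simp add: transpose_mult[OF G NiK])
    also have "\<dots> = transpose_mat (Ni * K) * (transpose_mat G * \<pi>)"
      by (rule assoc_mult_mat) (use NiK G \<pi> in auto)
    also have "\<dots> = 0\<^sub>m n n"
      unfolding z(2) by (rule right_mult_zero_mat[of _ n l]) (use NiK in auto)
    finally have "transpose_mat (G * (Ni * K)) * \<pi> = 0\<^sub>m n n" .
    moreover have "transpose_mat T = 1\<^sub>m n + transpose_mat (G * (Ni * K))"
      unfolding T_def using GNK by (simp add: transpose_add[OF one_carrier_mat GNK])
    ultimately show ?thesis using \<pi> GNK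
      by (simp add: add_mult_distrib_mat[OF one_carrier_mat _ \<pi>])
  qed
  have XT: "X * T = X'"
  proof -
    have "X * (G * (Ni * K)) = ?N * (Ni * K)" by (rule assoc_mult_mat[OF X G NiK, symmetric])
    also have "\<dots> = (?N * Ni) * K" by (rule assoc_mult_mat[OF Nc Ni(1) K, symmetric])
    also have "\<dots> = K" using K by (simp add: Ni(2))
    finally have "X * T = X + K" unfolding T_def using X
      by (simp add: mult_add_distrib_mat[OF X one_carrier_mat GNK])
    also have "\<dots> = X'" unfolding K_def using X X' by (intro eq_matI) auto
    finally show ?thesis .
  qed
  have tT: "transpose_mat T \<in> carrier_mat n n" using T by auto
  have XX: "transpose_mat X * X \<in> carrier_mat n n" using X by auto
  have 1: "transpose_mat T * (\<pi> + transpose_mat X * X) * T = \<pi> + transpose_mat X' * X'"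
  proof -
    have "transpose_mat T * (\<pi> + transpose_mat X * X) * T = (\<pi> + transpose_mat T * (transpose_mat X * X)) * T"
      by (simp add: mult_add_distrib_mat[OF tT \<pi> XX] T\<pi>)
    also have "\<dots> = \<pi> + (transpose_mat T * (transpose_mat X * X)) * T"
      using add_mult_distrib_mat[OF \<pi> _ T, of "transpose_mat T * (transpose_mat X * X)"] tT XX by (simp add: \<pi>T)
    also have "(transpose_mat T * (transpose_mat X * X)) * T = (transpose_mat T * transpose_mat X) * (X * T)"
    proof -
      have "transpose_mat T * (transpose_mat X * X) = (transpose_mat T * transpose_mat X) * X"
        by (rule assoc_mult_mat[symmetric, of _ n n _ l _ n]) (use tT X in auto)
      moreover have "transpose_mat T * transpose_mat X \<in> carrier_mat n l" using tT X by auto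
      ultimately show ?thesis by (simp only: assoc_mult_mat[OF _ X T])
    qed
    also have "transpose_mat T * transpose_mat X = transpose_mat X'"
      using transpose_mult[OF X T] by (simp add: XT)
    finally show ?thesis by (simp add: XT)
  qed
  have dT: "Determinant.det T * Determinant.det ?N = Determinant.det (X' * G)"
  proof -
    have "Determinant.det T = Determinant.det (1\<^sub>m l + (Ni * K) * G)"
      unfolding T_def by (rule det_one_plus_swap[OF G NiK])
    also have "1\<^sub>m l + (Ni * K) * G = Ni * (X' * G)"
    proof -
      have "(Ni * K) * G = Ni * (K * G)" by (rule assoc_mult_mat[OF Ni(1) K G])
      also have "K * G = X' * G - ?N" unfolding K_def by (rule minus_mult_distrib_mat[OF X' X G])
      also have "Ni * (X' * G - ?N) = Ni * (X' * G) - Ni * ?N"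
        by (rule mult_minus_distrib_mat[OF Ni(1) _ Nc]) (use X' G in auto)
      finally have "(Ni * K) * G = Ni * (X' * G) - 1\<^sub>m l" by (simp add: Ni(3))
      thus ?thesis using Ni(1) X' G by (intro eq_matI) auto
    qed
    also have "Determinant.det (Ni * (X' * G)) = Determinant.det Ni * Determinant.det (X' * G)"
      by (rule det_mult[OF Ni(1)]) (use X' G in auto)
    finally show ?thesis using det_mult[OF Ni(1) Nc] Ni(3) by (simp add: ac_simps)
  qed
  have "Determinant.det (\<pi> + transpose_mat X' * X') = Determinant.det T * Determinant.det (\<pi> + transpose_mat X * X) * Determinant.det T"
  proof -
    have P: "\<pi> + transpose_mat X * X \<in> carrier_mat n n" using \<pi> XX by auto
    have "Determinant.det (transpose_mat T * (\<pi> + transpose_mat X * X) * T) =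
        Determinant.det (transpose_mat T * (\<pi> + transpose_mat X * X)) * Determinant.det T"
      by (rule det_mult[OF _ T]) (use tT P in auto)
    also have "Determinant.det (transpose_mat T * (\<pi> + transpose_mat X * X)) = Determinant.det T * Determinant.det (\<pi> + transpose_mat X * X)"
      by (simp add: det_mult[OF tT P] det_transpose[OF T])
    finally show ?thesis by (simp add: 1)
  qed
  thus ?thesis using dT[symmetric] by (simp add: power2_eq_square)
qed

section \<open>The dual space in coordinates\<close>

locale lie_acf = lie_algebra sc Basis br
  for sc :: "'k::{alg_closed_field, field_char_0} \<Rightarrow> 'q::ab_group_add \<Rightarrow> 'q" and Basis br
begin

abbreviation V :: "('q \<Rightarrow> 'k) set" where "V \<equiv> dual_space sc"

text \<open>An arbitrary function serves as a coordinate vector through its values on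
  \<open>Basis\<close>; \<open>ext\<close> is the projection onto the dual space.\<close>

definition ext :: "('q \<Rightarrow> 'k) \<Rightarrow> 'q \<Rightarrow> 'k" where
  "ext x q = (\<Sum>b\<in>Basis. representation Basis q b * x b)"

lemma V_iff: "\<eta> \<in> V \<longleftrightarrow> (\<forall>a b. \<eta> (a + b) = \<eta> a + \<eta> b) \<and> (\<forall>c a. \<eta> (sc c a) = c * \<eta> a)"
proof -
  have "vector_space ((*) :: 'k \<Rightarrow> 'k \<Rightarrow> 'k)" by unfold_locales (auto simp: algebra_simps)
  thus ?thesis using vector_space_axioms unfolding dual_space_def
    by (auto simp: Vector_Spaces.linear_def module_hom_def module_hom_axioms_def module_iff_vector_space)
qed

lemma V_add: "\<eta> \<in> V \<Longrightarrow> \<eta> (a + b) = \<eta> a + \<eta> b" by (simp add: V_iff)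
lemma V_scale: "\<eta> \<in> V \<Longrightarrow> \<eta> (sc c a) = c * \<eta> a" by (simp add: V_iff)
lemma V_zero: "\<eta> \<in> V \<Longrightarrow> \<eta> 0 = 0" using V_scale[of \<eta> 0 0] by simp
lemma V_sum: "\<eta> \<in> V \<Longrightarrow> \<eta> (\<Sum>a\<in>A. f a) = (\<Sum>a\<in>A. \<eta> (f a))"
  by (induction A rule: infinite_finite_induct) (auto simp: V_add V_zero)
lemma V_comb: "\<eta> \<in> V \<Longrightarrow> \<nu> \<in> V \<Longrightarrow> (\<lambda>i. \<eta> i + t * \<nu> i) \<in> V"
  by (simp add: V_iff algebra_simps)
lemma V_smult: "\<eta> \<in> V \<Longrightarrow> (\<lambda>i. t * \<eta> i) \<in> V"
  by (simp add: V_iff algebra_simps)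
lemma V_0: "(\<lambda>i. 0) \<in> V" by (simp add: V_iff)

lemma rep_sum: "(\<Sum>b\<in>Basis. sc (representation Basis q b) b) = q"
  by (rule sum_representation_eq) (simp_all add: independent_Basis span_Basis finite_Basis)

lemma ext_in_V [simp]: "ext x \<in> V"
  using span_Basis by (simp add: V_iff ext_def representation_add[OF independent_Basis]
      representation_scale[OF independent_Basis] sum.distrib algebra_simps sum_distrib_left)

lemma ext_V [simp]: "\<eta> \<in> V \<Longrightarrow> ext \<eta> = \<eta>"
proof
  fix q assume "\<eta> \<in> V"
  hence "\<eta> (\<Sum>b\<in>Basis. sc (representation Basis q b) b) = ext \<eta> q"
    by (simp add: V_sum V_scale ext_def)
  thus "ext \<eta> q = \<eta> q" by (simp add: rep_sum)
qed

lemma ext_Basis [simp]: "b \<in> Basis \<Longrightarrow> ext x b = x b"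
  by (simp add: ext_def representation_basis[OF independent_Basis] if_distrib[of "\<lambda>z. z * _"] finite_Basis cong: if_cong)

lemma ext_comb: "ext (\<lambda>i. a * x i + b * y i) q = a * ext x q + b * ext y q"
  by (simp add: ext_def algebra_simps sum.distrib sum_distrib_left)

lemma ext_add: "ext (\<lambda>i. x i + t * y i) = (\<lambda>i. ext x i + t * ext y i)"
  using ext_comb[of 1 x t y] by auto

lemma ext_smult: "ext (\<lambda>i. t * x i) = (\<lambda>i. t * ext x i)"
  by (auto simp: ext_def sum_distrib_left algebra_simps)

lemma separate: "(\<And>\<nu>. \<nu> \<in> V \<Longrightarrow> \<nu> a = \<nu> b) \<Longrightarrow> a = b"
proof -
  assume v: "\<And>\<nu>. \<nu> \<in> V \<Longrightarrow> \<nu> a = \<nu> b"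
  have "representation Basis a c = representation Basis b c" if "c \<in> Basis" for c
  proof -
    have "ext (unit c) q = representation Basis q c" for q
      using that by (simp add: ext_def unit_def if_distrib[of "\<lambda>z. _ * z"] finite_Basis cong: if_cong)
    thus ?thesis using v[OF ext_in_V, of "unit c"] by simp
  qed
  hence "(\<Sum>b'\<in>Basis. sc (representation Basis a b') b') = (\<Sum>b'\<in>Basis. sc (representation Basis b b') b')"
    by simp
  thus "a = b" by (simp only: rep_sum)
qed

lemma pdeg_ext_point: "pdeg Basis (Suc 0) (\<lambda>x. ext x q)"
  unfolding ext_def
proof (rule pdeg_sum)
  fix b assume "b \<in> Basis"
  from pdeg_mult[OF pdeg_const[of _ 0] pdeg_var[OF this, of 0]]
  show "pdeg Basis (Suc 0) (\<lambda>x. representation Basis q b * x b)" by simp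
qed

text \<open>\<open>lft\<close> and \<open>rst\<close> pass between the symmetric algebra and
  \<open>pf Basis\<close>, where the calculus needs no membership in the dual space.\<close>

definition lft :: "(('q \<Rightarrow> 'k) \<Rightarrow> 'k) \<Rightarrow> ('q \<Rightarrow> 'k) \<Rightarrow> 'k" where "lft F = (\<lambda>x. F (ext x))"

definition rst :: "(('q \<Rightarrow> 'k) \<Rightarrow> 'k) \<Rightarrow> ('q \<Rightarrow> 'k) \<Rightarrow> 'k" where "rst \<phi> = (\<lambda>\<eta>. if \<eta> \<in> V then \<phi> \<eta> else 0)"

lemma pdeg_lft: "pdeg UNIV d F \<Longrightarrow> pdeg Basis d (lft F)"
proof (induction rule: pdeg.induct)
  case (pdeg_const d c)
  show ?case unfolding lft_def by (rule pdeg.pdeg_const)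
next
  case (pdeg_var i d)
  show ?case unfolding lft_def by (rule pdeg_mono[OF pdeg_ext_point]) simp
next
  case (pdeg_add d F G)
  thus ?case unfolding lft_def by (intro pdeg.pdeg_add)
next
  case (pdeg_mult d F e G)
  thus ?case unfolding lft_def by (intro pdeg.pdeg_mult)
qed

lemma V_finite_vars: "F \<in> pf UNIV \<Longrightarrow> \<exists>G\<in>pf Basis. \<forall>x\<in>V. F x = G x"
proof -
  assume "F \<in> pf UNIV"
  then obtain d where "pdeg UNIV d F" by (rule pfE)
  hence "lft F \<in> pf Basis" by (rule pfI[OF pdeg_lft])
  thus ?thesis by (intro bexI[of _ "lft F"]) (simp add: lft_def)
qed

lemma rst_in: "\<phi> \<in> pf Basis \<Longrightarrow> rst \<phi> \<in> sym_alg sc"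
  unfolding coord_funs_eq rst_def using pf_subset[of \<phi> Basis UNIV] by auto

lemma sym_algE:
  assumes "F \<in> sym_alg sc" obtains "lft F \<in> pf Basis" "F = rst (lft F)"
proof -
  obtain G where G: "G \<in> pf UNIV" "F = (\<lambda>x. if x \<in> V then G x else 0)"
    using assms unfolding coord_funs_eq by blast
  have "lft F = lft G" by (auto simp: lft_def G(2))
  moreover have "lft G \<in> pf Basis" using G(1) by (elim pfE) (rule pfI[OF pdeg_lft])
  moreover have "F = rst (lft F)" by (auto simp: rst_def lft_def G(2))
  ultimately show ?thesis using that by simp
qed

lemma pf_ext: "\<phi> \<in> pf Basis \<Longrightarrow> \<phi> (ext x) = \<phi> x"
  by (rule pf_cong_vars[of \<phi> Basis]) simp_all

lemma lft_rst [simp]: "\<phi> \<in> pf Basis \<Longrightarrow> lft (rst \<phi>) = \<phi>"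
  by (rule HOL.ext) (simp add: lft_def rst_def pf_ext)

lemma lft_V: "\<eta> \<in> V \<Longrightarrow> lft F \<eta> = F \<eta>" by (simp add: lft_def)

lemma pdeg_fun_degree:
  assumes "F \<in> sym_alg sc" shows "pdeg Basis (fun_degree V F) (lft F)"
proof -
  have "\<exists>d P. F = poly_fun V P \<and> mpoly_degree P = d" using assms by (auto simp: coord_ring_def)
  hence "\<exists>P. F = poly_fun V P \<and> mpoly_degree P = fun_degree V F" unfolding fun_degree_def by (rule LeastI_ex)
  then obtain P where P: "F = poly_fun V P" "mpoly_degree P = fun_degree V F" by blast
  have "pdeg UNIV (fun_degree V F) (mpoly_eval P)" using pdeg_subset[OF pdeg_mpoly_eval, of P UNIV] P(2) by simp
  hence "pdeg Basis (fun_degree V F) (lft (mpoly_eval P))" by (rule pdeg_lft)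
  moreover have "lft (mpoly_eval P) = lft F" by (simp add: P(1) lft_def poly_fun_def)
  ultimately show ?thesis by simp
qed

lemma line_poly_lft: "\<eta> \<in> V \<Longrightarrow> \<nu> \<in> V \<Longrightarrow> line_poly F \<eta> \<nu> = line_poly (lft F) \<eta> \<nu>"
  by (simp add: line_poly_def lft_V V_comb)

definition grad :: "(('q \<Rightarrow> 'k) \<Rightarrow> 'k) \<Rightarrow> ('q \<Rightarrow> 'k) \<Rightarrow> 'q" where
  "grad \<phi> x = (\<Sum>b\<in>Basis. sc (dd \<phi> (unit b) x) b)"

lemma ext_grad: "\<phi> \<in> pf Basis \<Longrightarrow> ext y (grad \<phi> x) = dd \<phi> y x"
  by (simp add: grad_def V_sum V_scale dd_sum_unit[OF finite_Basis, of \<phi> y x] mult.commute)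

lemma V_grad: "\<phi> \<in> pf Basis \<Longrightarrow> \<nu> \<in> V \<Longrightarrow> \<nu> (grad \<phi> x) = dd \<phi> \<nu> x"
  using ext_grad[of \<phi> \<nu> x] by simp

lemma grad_ext: "\<phi> \<in> pf Basis \<Longrightarrow> grad \<phi> (ext x) = grad \<phi> x"
  unfolding grad_def by (intro sum.cong refl arg_cong2[of _ _ _ _ sc] pf_ext pf_dd)

lemma differential_eq:
  assumes "F \<in> sym_alg sc" "\<eta> \<in> V" shows "differential sc F \<eta> = grad (lft F) \<eta>"
  unfolding differential_def
proof (rule the_equality)
  have F: "lft F \<in> pf Basis" using assms(1) by (rule sym_algE)
  show g: "\<forall>\<nu>\<in>V. \<nu> (grad (lft F) \<eta>) = Polynomial.coeff (line_poly F \<eta> \<nu>) 1"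
  proof
    fix \<nu> assume \<nu>: "\<nu> \<in> V"
    have "\<nu> (grad (lft F) \<eta>) = dd (lft F) \<nu> \<eta>" by (rule V_grad[OF F \<nu>])
    thus "\<nu> (grad (lft F) \<eta>) = Polynomial.coeff (line_poly F \<eta> \<nu>) 1"
      by (simp only: dd_def line_poly_lft[OF assms(2) \<nu>, of F])
  qed
  fix x assume x: "\<forall>\<nu>\<in>V. \<nu> x = Polynomial.coeff (line_poly F \<eta> \<nu>) 1"
  show "x = grad (lft F) \<eta>"
  proof (rule separate)
    fix \<nu> assume "\<nu> \<in> V"
    thus "\<nu> x = \<nu> (grad (lft F) \<eta>)" using bspec[OF x] bspec[OF g] by (simp only:)
  qed
qed

lemma poisson_eq:
  assumes "F \<in> sym_alg sc" "G \<in> sym_alg sc"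
  shows "poisson sc br F G = (\<lambda>\<eta>. if \<eta> \<in> V then \<eta> (br (grad (lft F) \<eta>) (grad (lft G) \<eta>)) else 0)"
  unfolding poisson_def using differential_eq assms by auto

lemma br_add: "br (a + b) c = br a c + br b c" "br c (a + b) = br c a + br c b"
  and br_scale: "br (sc s a) c = sc s (br a c)" "br c (sc s a) = sc s (br c a)"
  using br_linear_left[of c] br_linear_right[of c]
  by (auto simp: Vector_Spaces.linear_def module_hom_def module_hom_axioms_def)

lemma br_skew: "br a b = - br b a"
proof -
  have "br (a + b) (a + b) = (br a a + br b a) + (br a b + br b b)" by (simp only: br_add)
  hence "br a b + br b a = 0" by (simp add: br_alternating add.commute)
  thus ?thesis by (simp add: eq_neg_iff_add_eq_0 add.commute)
qed

lemma V_skew: "\<eta> \<in> V \<Longrightarrow> \<eta> (br a b) = - \<eta> (br b a)"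
  using V_scale[of \<eta> "-1" "br b a"] br_skew[of a b] by simp

lemma V_br_sum:
  assumes "\<eta> \<in> V"
  shows "\<eta> (br (\<Sum>a\<in>A. sc (c a) (r a)) z) = (\<Sum>a\<in>A. c a * \<eta> (br (r a) z))"
    and "\<eta> (br z (\<Sum>a\<in>A. sc (c a) (r a))) = (\<Sum>a\<in>A. c a * \<eta> (br z (r a)))"
proof -
  have z: "br 0 z = 0" for z using br_scale(1)[of 0 0 z] by simp
  have z': "br z 0 = 0" for z using br_scale(2)[of z 0 0] by simp
  show "\<eta> (br (\<Sum>a\<in>A. sc (c a) (r a)) z) = (\<Sum>a\<in>A. c a * \<eta> (br (r a) z))"
    by (induction A rule: infinite_finite_induct) (auto simp: z V_zero br_add br_scale V_add V_scale assms)
  show "\<eta> (br z (\<Sum>a\<in>A. sc (c a) (r a))) = (\<Sum>a\<in>A. c a * \<eta> (br z (r a)))"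
    by (induction A rule: infinite_finite_induct) (auto simp: z' V_zero br_add br_scale V_add V_scale assms)
qed

lemma grad_var: "b \<in> Basis \<Longrightarrow> grad (\<lambda>x. x b) x = b"
  by (simp add: grad_def unit_def if_distrib[of "\<lambda>z. sc z _"] finite_Basis cong: if_cong)

text \<open>The coordinate functions have the basis vectors as gradients, so brackets with them test
  all \<open>z\<close>.\<close>

lemma centre_grad:
  assumes F: "F \<in> poisson_centre sc br" and \<eta>: "\<eta> \<in> V"
  shows "\<eta> (br (grad (lft F) \<eta>) z) = 0"
proof -
  have FS: "F \<in> sym_alg sc" using F by (simp add: poisson_centre_def)
  have b: "\<eta> (br (grad (lft F) \<eta>) b) = 0" if "b \<in> Basis" for b
  proof -
    have v: "(\<lambda>x. x b) \<in> pf Basis" using that by auto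
    have "poisson sc br F (rst (\<lambda>x. x b)) = (\<lambda>\<eta>. 0)" using F rst_in[OF v] by (auto simp: poisson_centre_def)
    hence "poisson sc br F (rst (\<lambda>x. x b)) \<eta> = 0" by simp
    thus ?thesis using \<eta> by (simp add: poisson_eq[OF FS rst_in[OF v]] lft_rst[OF v] grad_var[OF that])
  qed
  have "\<eta> (br (grad (lft F) \<eta>) (\<Sum>b\<in>Basis. sc (representation Basis z b) b)) = 0"
    by (simp add: V_br_sum(2)[OF \<eta>] b)
  thus ?thesis by (simp add: rep_sum)
qed

lemma centreI:
  assumes "\<phi> \<in> pf Basis" "\<And>\<eta> z. \<eta> \<in> V \<Longrightarrow> \<eta> (br (grad \<phi> \<eta>) z) = 0"
  shows "rst \<phi> \<in> poisson_centre sc br"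
  unfolding poisson_centre_def using assms rst_in[OF assms(1)] by (auto simp: poisson_eq)

section \<open>Stabilisers and regular elements\<close>

abbreviation stab :: "('q \<Rightarrow> 'k) \<Rightarrow> 'q set" where "stab \<eta> \<equiv> coadj_stabiliser br \<eta>"
abbreviation ind :: nat where "ind \<equiv> lie_index sc br"
abbreviation reg :: "('q \<Rightarrow> 'k) set" where "reg \<equiv> dual_reg sc br"

definition lindep :: "nat \<Rightarrow> (nat \<Rightarrow> 'q) \<Rightarrow> bool" where
  "lindep m r \<longleftrightarrow> (\<forall>c. (\<Sum>j<m. sc (c j) (r j)) = 0 \<longrightarrow> (\<forall>j<m. c j = 0))"

lemma lindepD: "lindep m r \<Longrightarrow> (\<Sum>j<m. sc (c j) (r j)) = 0 \<Longrightarrow> j < m \<Longrightarrow> c j = 0"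
  by (simp add: lindep_def)

lemma subspace_stab: "\<eta> \<in> V \<Longrightarrow> subspace (stab \<eta>)"
proof -
  assume \<eta>: "\<eta> \<in> V"
  have "br 0 y = 0" for y using br_scale(1)[of 0 0 y] by simp
  hence "0 \<in> stab \<eta>" by (simp add: coadj_stabiliser_def V_zero[OF \<eta>])
  moreover have "a + b \<in> stab \<eta>" if "a \<in> stab \<eta>" "b \<in> stab \<eta>" for a b
    using that by (simp add: coadj_stabiliser_def br_add V_add[OF \<eta>])
  moreover have "sc c a \<in> stab \<eta>" if "a \<in> stab \<eta>" for c a
    using that by (simp add: coadj_stabiliser_def br_scale V_scale[OF \<eta>])
  ultimately show ?thesis by (intro subspaceI)
qed

lemma subspace_family:
  assumes "subspace S"
  shows "\<exists>r. (\<forall>j<dim S. r j \<in> S) \<and> lindep (dim S) r \<and> (\<forall>z\<in>S. \<exists>c. z = (\<Sum>j<dim S. sc (c j) (r j)))"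
proof -
  obtain B where B: "B \<subseteq> S" "independent B" "S \<subseteq> span B" "card B = dim S" using basis_exists by blast
  have fin: "finite B" using B(2) by (rule finiteI_independent)
  obtain r where r: "bij_betw r {..<dim S} B" using ex_bij_betw_nat_finite[OF fin] B(4) by (auto simp: atLeast0LessThan)
  have sum: "(\<Sum>j<dim S. sc (f (r j)) (r j)) = (\<Sum>b\<in>B. sc (f b) b)" for f
    by (rule sum.reindex_bij_betw[OF r])
  have "lindep (dim S) r"
    unfolding lindep_def
  proof (intro allI impI)
    fix c j assume c: "(\<Sum>j<dim S. sc (c j) (r j)) = 0" and j: "j < dim S"
    have inj: "inj_on r {..<dim S}" using r by (rule bij_betw_imp_inj_on)
    have "(\<Sum>j<dim S. sc ((c \<circ> inv_into {..<dim S} r) (r j)) (r j)) = (\<Sum>j<dim S. sc (c j) (r j))"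
      by (rule sum.cong) (auto simp: inv_into_f_f[OF inj])
    hence "(\<Sum>b\<in>B. sc ((c \<circ> inv_into {..<dim S} r) b) b) = 0" using sum[of "c \<circ> inv_into {..<dim S} r"] c by simp
    hence "(c \<circ> inv_into {..<dim S} r) (r j) = 0"
      using independentD[OF B(2) fin subset_refl, of "c \<circ> inv_into {..<dim S} r" "r j"] j bij_betwE[OF r] by auto
    thus "c j = 0" using j by (simp add: inv_into_f_f[OF inj])
  qed
  moreover have "\<forall>j<dim S. r j \<in> S" using r B(1) by (auto simp: bij_betw_def)
  moreover have "\<exists>c. z = (\<Sum>j<dim S. sc (c j) (r j))" if "z \<in> S" for z
  proof -
    have "z \<in> span B" using that B(3) by auto
    then obtain u where "z = (\<Sum>b\<in>B. sc (u b) b)" unfolding span_finite[OF fin] by auto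
    thus ?thesis using sum[of u] by (intro exI[of _ "\<lambda>j. u (r j)"]) simp
  qed
  ultimately show ?thesis by blast
qed

lemma lindep_set:
  assumes "lindep m r"
  shows "inj_on r {..<m}" "independent (r ` {..<m})"
proof -
  show inj: "inj_on r {..<m}"
  proof (rule inj_onI, rule ccontr)
    fix i j assume ij: "i \<in> {..<m}" "j \<in> {..<m}" "r i = r j" "i \<noteq> j"
    have "(\<Sum>k<m. sc (if k = i then 1 else if k = j then -1 else 0) (r k)) =
      (\<Sum>k<m. (if k = i then r i else 0) + (if k = j then - r j else 0))"
      by (rule sum.cong) (use ij(4) in auto)
    also have "\<dots> = 0" using ij by (simp add: sum.distrib)
    finally have "(\<Sum>k<m. sc (if k = i then 1 else if k = j then -1 else 0) (r k)) = 0" .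
    from lindepD[OF assms this, of i] show False using ij(1) by simp
  qed
  show "independent (r ` {..<m})"
    unfolding independent_explicit_finite_subsets
  proof (intro allI impI ballI)
    fix A u v assume A: "A \<subseteq> r ` {..<m}" "finite A" and s: "(\<Sum>v\<in>A. sc (u v) v) = 0" and v: "v \<in> A"
    let ?u = "\<lambda>v. if v \<in> A then u v else 0"
    have "(\<Sum>j<m. sc (?u (r j)) (r j)) = (\<Sum>v\<in>r ` {..<m}. sc (?u v) v)"
      by (simp add: sum.reindex[OF inj])
    also have "\<dots> = (\<Sum>v\<in>A. sc (?u v) v)" by (rule sum.mono_neutral_right) (use A in auto)
    also have "\<dots> = 0" using s by (simp cong: sum.cong)
    finally have "(\<Sum>j<m. sc (?u (r j)) (r j)) = 0" .
    from lindepD[OF assms this] have z: "?u (r j) = 0" if "j < m" for j using that .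
    obtain j where "j < m" "v = r j" using A(1) v by auto
    thus "u v = 0" using z[of j] v by simp
  qed
qed

lemma lindep_spans:
  assumes "lindep m r" "\<And>j. j < m \<Longrightarrow> r j \<in> S" "dim S = m" "z \<in> S"
  shows "\<exists>c. z = (\<Sum>j<m. sc (c j) (r j))"
proof -
  let ?B = "r ` {..<m}"
  have "S \<subseteq> span ?B"
    by (rule card_ge_dim_independent)
       (use assms lindep_set card_image[OF lindep_set(1)[OF assms(1)]] in auto)
  hence "z \<in> span ?B" using assms(4) by auto
  then obtain u where "z = (\<Sum>b\<in>?B. sc (u b) b)" using span_finite[of ?B] by auto
  thus ?thesis using sum.reindex[OF lindep_set(1)[OF assms(1)], of "\<lambda>b. sc (u b) b"]
    by (intro exI[of _ "\<lambda>j. u (r j)"]) simp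
qed

lemma dim_UNIV: "dim (UNIV :: 'q set) = card Basis"
  using dim_eq_card[of Basis UNIV] span_Basis independent_Basis by simp

lemma ind_le: "\<eta> \<in> V \<Longrightarrow> ind \<le> dim (stab \<eta>)"
  unfolding lie_index_def by (rule cINF_lower) auto

lemma ind_attained: "\<exists>\<eta>. \<eta> \<in> reg"
proof -
  have "Inf ((\<lambda>\<xi>. dim (stab \<xi>)) ` V) \<in> (\<lambda>\<xi>. dim (stab \<xi>)) ` V"
    by (rule Inf_nat_def1) (use V_0 in auto)
  thus ?thesis by (auto simp: dual_reg_def lie_index_def)
qed

lemma reg_iff: "\<eta> \<in> reg \<longleftrightarrow> \<eta> \<in> V \<and> dim (stab \<eta>) \<le> ind"
  using ind_le by (auto simp: dual_reg_def intro: antisym)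

abbreviation qdim :: nat where "qdim \<equiv> card Basis"

definition bs :: "nat \<Rightarrow> 'q" where "bs = (SOME h. bij_betw h {..<qdim} Basis)"

lemma bs: "bij_betw bs {..<qdim} Basis"
proof -
  have "\<exists>h. bij_betw h {..<qdim} Basis"
    using ex_bij_betw_nat_finite[OF finite_Basis] by (simp add: atLeast0LessThan)
  thus ?thesis unfolding bs_def by (rule someI_ex)
qed

lemma bs_in: "j < qdim \<Longrightarrow> bs j \<in> Basis" using bs by (auto simp: bij_betw_def)

lemma bs_eq: "i < qdim \<Longrightarrow> j < qdim \<Longrightarrow> bs i = bs j \<longleftrightarrow> i = j"
  using bs by (auto simp: bij_betw_def inj_on_def)

lemma sum_bs: "(\<Sum>b\<in>Basis. f b) = (\<Sum>j<qdim. f (bs j))"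
  by (rule sum.reindex_bij_betw[OF bs, symmetric])

definition pim :: "('q \<Rightarrow> 'k) \<Rightarrow> 'k mat" where
  "pim x = Matrix.mat qdim qdim (\<lambda>(i, j). ext x (br (bs i) (bs j)))"

definition xm :: "(nat \<Rightarrow> 'q \<Rightarrow> 'k) \<Rightarrow> 'k mat" where
  "xm X = Matrix.mat ind qdim (\<lambda>(k, j). X k (bs j))"

text \<open>The Poisson matrix plus \<open>transpose_mat (xm X) * xm X\<close>. On the kernel of the
  Poisson form this compensates the degeneracy as soon as the \<open>ind\<close> covectors
  \<open>X k\<close> separate that kernel.\<close>

definition bd :: "(nat \<Rightarrow> 'q \<Rightarrow> 'k) \<Rightarrow> ('q \<Rightarrow> 'k) \<Rightarrow> 'k" where
  "bd X x = Determinant.det (Matrix.mat qdim qdim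
     (\<lambda>(i, j). ext x (br (bs i) (bs j)) + (\<Sum>k<ind. X k (bs i) * X k (bs j))))"

lemma pim_carrier [simp]: "pim x \<in> carrier_mat qdim qdim" by (simp add: pim_def)
lemma xm_carrier [simp]: "xm X \<in> carrier_mat ind qdim" by (simp add: xm_def)

lemma bd_mat_eq: "Matrix.mat qdim qdim (\<lambda>(i, j). ext x (br (bs i) (bs j)) + (\<Sum>k<ind. X k (bs i) * X k (bs j)))
    = pim x + transpose_mat (xm X) * xm X"
  by (rule eq_matI) (auto simp: pim_def xm_def scalar_prod_def atLeast0LessThan)

lemma bd_eq: "bd X x = Determinant.det (pim x + transpose_mat (xm X) * xm X)"
  unfolding bd_def bd_mat_eq ..

lemma pf_bd: "bd X \<in> pf Basis"
proof -
  have "(\<lambda>x. Determinant.det (Matrix.mat qdim qdim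
     (\<lambda>(i, j). (\<lambda>x. ext x (br (bs i) (bs j)) + (\<Sum>k<ind. X k (bs i) * X k (bs j))) x))) \<in> pf Basis"
    by (rule pf_det) (intro pf_add pf_const pfI[OF pdeg_ext_point])
  thus ?thesis unfolding bd_def[abs_def] by simp
qed

lemma ext_unit_sum: "j < qdim \<Longrightarrow> ext (unit (bs j)) (\<Sum>i<qdim. sc (v i) (bs i)) = v j"
proof -
  assume j: "j < qdim"
  have "ext (unit (bs j)) (\<Sum>i<qdim. sc (v i) (bs i)) = (\<Sum>i<qdim. v i * unit (bs j) (bs i))"
    by (simp add: V_sum V_scale bs_in)
  also have "\<dots> = (\<Sum>i<qdim. if i = j then v i else 0)"
    by (rule sum.cong) (use j in \<open>auto simp: unit_def bs_eq\<close>)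
  finally show ?thesis using j by simp
qed

lemma q_sum: "z = (\<Sum>i<qdim. sc (representation Basis z (bs i)) (bs i))"
  using rep_sum[of z] sum_bs[of "\<lambda>b. sc (representation Basis z b) b"] by simp

lemma bd_zero_iff:
  "bd X x = 0 \<longleftrightarrow> (\<exists>z. z \<noteq> 0 \<and> (\<forall>y. ext x (br y z) + (\<Sum>k<ind. ext (X k) y * ext (X k) z) = 0))"
proof -
  let ?A = "Matrix.mat qdim qdim (\<lambda>(i, j). ext x (br (bs i) (bs j)) + (\<Sum>k<ind. X k (bs i) * X k (bs j)))"
  let ?z = "\<lambda>v. \<Sum>i<qdim. sc (v i) (bs i)"
  have row: "(\<Sum>j<qdim. ?A $$ (i, j) * v j) = ext x (br (bs i) (?z v)) + (\<Sum>k<ind. ext (X k) (bs i) * ext (X k) (?z v))"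
    if i: "i < qdim" for i v
  proof -
    have "(\<Sum>j<qdim. ?A $$ (i, j) * v j) = (\<Sum>j<qdim. v j * ext x (br (bs i) (bs j))) +
        (\<Sum>j<qdim. \<Sum>k<ind. X k (bs i) * (v j * X k (bs j)))"
      using i by (simp add: algebra_simps sum.distrib sum_distrib_left)
    also have "(\<Sum>j<qdim. \<Sum>k<ind. X k (bs i) * (v j * X k (bs j))) = (\<Sum>k<ind. X k (bs i) * (\<Sum>j<qdim. v j * X k (bs j)))"
      by (subst sum.swap) (simp add: sum_distrib_left)
    also have "\<dots> = (\<Sum>k<ind. ext (X k) (bs i) * ext (X k) (?z v))"
      using i by (intro sum.cong) (auto simp: V_sum V_scale bs_in)
    finally show ?thesis by (simp add: V_br_sum(2))
  qed
  have "bd X x = 0 \<longleftrightarrow> (\<exists>v. v \<in> carrier_vec qdim \<and> v \<noteq> 0\<^sub>v qdim \<and> ?A *\<^sub>v v = 0\<^sub>v qdim)"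
    unfolding bd_def by (rule det_0_iff_vec_prod_zero) simp
  also have "\<dots> \<longleftrightarrow> (\<exists>z. z \<noteq> 0 \<and> (\<forall>y. ext x (br y z) + (\<Sum>k<ind. ext (X k) y * ext (X k) z) = 0))"
  proof
    assume "\<exists>v. v \<in> carrier_vec qdim \<and> v \<noteq> 0\<^sub>v qdim \<and> ?A *\<^sub>v v = 0\<^sub>v qdim"
    then obtain v where v: "v \<in> carrier_vec qdim" "v \<noteq> 0\<^sub>v qdim" "?A *\<^sub>v v = 0\<^sub>v qdim" by blast
    let ?v = "\<lambda>j. v $ j"
    obtain j where j: "j < qdim" "v $ j \<noteq> 0"
    proof (rule ccontr)
      assume "\<not> thesis"
      hence "v $ j = 0" if "j < qdim" for j using that \<open>\<And>j. j < qdim \<Longrightarrow> v $ j \<noteq> 0 \<Longrightarrow> thesis\<close> by blast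
      hence "v = 0\<^sub>v qdim" using v(1) by (intro eq_vecI) auto
      thus False using v(2) by simp
    qed
    have z0: "?z ?v \<noteq> 0"
    proof
      assume "?z ?v = 0"
      hence "ext (unit (bs j)) (?z ?v) = 0" by (simp add: V_zero)
      thus False using ext_unit_sum[OF j(1), of ?v] j(2) by simp
    qed
    have rows: "ext x (br (bs i) (?z ?v)) + (\<Sum>k<ind. ext (X k) (bs i) * ext (X k) (?z ?v)) = 0" if i: "i < qdim" for i
    proof -
      have "(?A *\<^sub>v v) $ i = (\<Sum>j<qdim. ?A $$ (i, j) * ?v j)"
        using i v(1) by (simp add: scalar_prod_def atLeast0LessThan)
      thus ?thesis using v(3) i row[OF i, of ?v] by simp
    qed
    have "ext x (br y (?z ?v)) + (\<Sum>k<ind. ext (X k) y * ext (X k) (?z ?v)) = 0" for y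
    proof -
      let ?y = "\<lambda>i. representation Basis y (bs i)"
      have "ext x (br y (?z ?v)) = (\<Sum>i<qdim. ?y i * ext x (br (bs i) (?z ?v)))"
        by (subst q_sum[of y]) (simp only: V_br_sum(1)[OF ext_in_V])
      moreover have "(\<Sum>k<ind. ext (X k) y * ext (X k) (?z ?v)) = (\<Sum>i<qdim. ?y i * (\<Sum>k<ind. ext (X k) (bs i) * ext (X k) (?z ?v)))"
      proof -
        have e: "ext (X k) y = (\<Sum>i<qdim. ?y i * ext (X k) (bs i))" for k
          by (subst q_sum[of y]) (simp only: V_sum[OF ext_in_V] V_scale[OF ext_in_V])
        have "(\<Sum>k<ind. ext (X k) y * ext (X k) (?z ?v)) = (\<Sum>k<ind. \<Sum>i<qdim. ?y i * ext (X k) (bs i) * ext (X k) (?z ?v))"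
          unfolding e sum_distrib_right ..
        also have "\<dots> = (\<Sum>i<qdim. \<Sum>k<ind. ?y i * ext (X k) (bs i) * ext (X k) (?z ?v))" by (rule sum.swap)
        finally show ?thesis by (simp add: sum_distrib_left mult.assoc)
      qed
      ultimately have "ext x (br y (?z ?v)) + (\<Sum>k<ind. ext (X k) y * ext (X k) (?z ?v)) =
        (\<Sum>i<qdim. ?y i * (ext x (br (bs i) (?z ?v)) + (\<Sum>k<ind. ext (X k) (bs i) * ext (X k) (?z ?v))))"
        by (simp only: distrib_left sum.distrib)
      also have "\<dots> = 0" by (rule sum.neutral) (simp add: rows)
      finally show ?thesis .
    qed
    thus "\<exists>z. z \<noteq> 0 \<and> (\<forall>y. ext x (br y z) + (\<Sum>k<ind. ext (X k) y * ext (X k) z) = 0)"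
      using z0 by (intro exI[of _ "?z ?v"]) simp
  next
    assume "\<exists>z. z \<noteq> 0 \<and> (\<forall>y. ext x (br y z) + (\<Sum>k<ind. ext (X k) y * ext (X k) z) = 0)"
    then obtain z where z: "z \<noteq> 0" "\<And>y. ext x (br y z) + (\<Sum>k<ind. ext (X k) y * ext (X k) z) = 0" by blast
    let ?r = "\<lambda>i. representation Basis z (bs i)"
    let ?v = "Matrix.vec qdim ?r"
    have "?A *\<^sub>v ?v = 0\<^sub>v qdim"
    proof (rule eq_vecI)
      fix i assume "i < dim_vec (0\<^sub>v qdim :: 'k Matrix.vec)"
      hence i: "i < qdim" by simp
      have "(?A *\<^sub>v ?v) $ i = (\<Sum>j<qdim. ?A $$ (i, j) * ?r j)"
        using i by (simp add: scalar_prod_def atLeast0LessThan)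
      also have "\<dots> = 0" using row[OF i, of ?r] z(2)[of "bs i"] q_sum[of z] by simp
      finally show "(?A *\<^sub>v ?v) $ i = 0\<^sub>v qdim $ i" using i by simp
    qed simp
    moreover have "?v \<noteq> 0\<^sub>v qdim"
    proof
      assume v0: "?v = 0\<^sub>v qdim"
      have "?r i = 0" if "i < qdim" for i
        using arg_cong[OF v0, of "\<lambda>v. v $ i"] that by simp
      hence "z = 0" by (subst q_sum) simp
      thus False using z(1) by simp
    qed
    ultimately show "\<exists>v. v \<in> carrier_vec qdim \<and> v \<noteq> 0\<^sub>v qdim \<and> ?A *\<^sub>v v = 0\<^sub>v qdim"
      by (intro exI[of _ ?v]) simp
  qed
  finally show ?thesis .
qed

lemma stab_skew: "\<eta> \<in> V \<Longrightarrow> z \<in> stab \<eta> \<longleftrightarrow> (\<forall>y. \<eta> (br y z) = 0)"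
proof -
  assume "\<eta> \<in> V"
  hence "\<eta> (br z y) = - \<eta> (br y z)" for y by (rule V_skew)
  thus ?thesis by (simp add: coadj_stabiliser_def)
qed

lemma lin_ext: "lin (\<lambda>y. ext y q)" by (simp add: lin_def ext_comb)

lemma dual_family:
  assumes "lindep m r" shows "\<exists>Y. \<forall>i<m. \<forall>j<m. ext (Y i) (r j) = (if i = j then 1 else 0)"
proof (rule lin_dual)
  show "lin (\<lambda>y. ext y (r i))" for i by (rule lin_ext)
  fix c assume c: "\<forall>y. (\<Sum>i<m. c i * ext y (r i)) = 0"
  have "(\<Sum>i<m. sc (c i) (r i)) = 0"
  proof (rule separate)
    fix \<nu> assume \<nu>: "\<nu> \<in> V"
    have "\<nu> (\<Sum>i<m. sc (c i) (r i)) = (\<Sum>i<m. c i * ext \<nu> (r i))" using \<nu> by (simp add: V_sum V_scale)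
    thus "\<nu> (\<Sum>i<m. sc (c i) (r i)) = \<nu> 0" using spec[OF c, of \<nu>] \<nu> by (simp add: V_zero)
  qed
  thus "\<forall>i<m. c i = 0" using assms unfolding lindep_def by simp
qed

text \<open>At a regular point take covectors dual to a basis of the stabiliser: pairing a kernel
  element \<open>z\<close> with that basis shows that all covectors vanish on \<open>z\<close>, so
  \<open>z\<close> lies in the stabiliser and is zero. If the stabiliser is larger, some nonzero
  element of it is killed by all \<open>ind\<close> covectors.\<close>

lemma reg_iff_bd: "ext x \<in> reg \<longleftrightarrow> (\<exists>X. bd X x \<noteq> 0)"
proof
  assume "ext x \<in> reg"
  hence dim: "dim (stab (ext x)) = ind" by (simp add: dual_reg_def)
  obtain r where r: "\<And>j. j < ind \<Longrightarrow> r j \<in> stab (ext x)" "lindep ind r"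
    "\<And>z. z \<in> stab (ext x) \<Longrightarrow> \<exists>c. z = (\<Sum>j<ind. sc (c j) (r j))"
    using subspace_family[OF subspace_stab[OF ext_in_V[of x]]] unfolding dim by blast
  obtain Y where Y: "\<And>i j. i < ind \<Longrightarrow> j < ind \<Longrightarrow> ext (Y i) (r j) = (if i = j then 1 else 0)"
    using dual_family[OF r(2)] by blast
  have "bd Y x \<noteq> 0"
  proof
    assume "bd Y x = 0"
    then obtain z where z: "z \<noteq> 0" "\<And>y. ext x (br y z) + (\<Sum>k<ind. ext (Y k) y * ext (Y k) z) = 0"
      unfolding bd_zero_iff by blast
    have Yz: "ext (Y j) z = 0" if j: "j < ind" for j
    proof -
      have "ext x (br (r j) z) = 0" using r(1)[OF j] by (simp add: coadj_stabiliser_def)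
      hence "(\<Sum>k<ind. ext (Y k) (r j) * ext (Y k) z) = 0" using z(2)[of "r j"] by simp
      moreover have "(\<Sum>k<ind. ext (Y k) (r j) * ext (Y k) z) = (\<Sum>k<ind. if k = j then ext (Y k) z else 0)"
        by (rule sum.cong) (use Y j in auto)
      ultimately show ?thesis using j by simp
    qed
    hence "ext x (br y z) = 0" for y using z(2)[of y] by simp
    hence "z \<in> stab (ext x)" by (simp add: stab_skew)
    then obtain c where c: "z = (\<Sum>j<ind. sc (c j) (r j))" using r(3) by blast
    have "c i = 0" if i: "i < ind" for i
    proof -
      have "ext (Y i) z = (\<Sum>j<ind. c j * ext (Y i) (r j))" unfolding c by (simp add: V_sum V_scale)
      also have "\<dots> = (\<Sum>j<ind. if j = i then c j else 0)" by (rule sum.cong) (use Y i in auto)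
      finally show ?thesis using Yz[OF i] i by simp
    qed
    hence "z = 0" unfolding c by simp
    thus False using z(1) by simp
  qed
  thus "\<exists>X. bd X x \<noteq> 0" by blast
next
  assume "\<exists>X. bd X x \<noteq> 0"
  then obtain X where X: "bd X x \<noteq> 0" by blast
  have "dim (stab (ext x)) \<le> ind"
  proof (rule ccontr)
    assume n: "\<not> dim (stab (ext x)) \<le> ind"
    let ?m = "dim (stab (ext x))"
    obtain r where r: "\<And>j. j < ?m \<Longrightarrow> r j \<in> stab (ext x)" "lindep ?m r"
      using subspace_family[OF subspace_stab[OF ext_in_V[of x]]] by blast
    obtain c where c: "\<exists>j\<in>{..<?m}. c j \<noteq> 0" "\<And>k. k \<in> {..<ind} \<Longrightarrow> (\<Sum>j<?m. c j * ext (X k) (r j)) = 0"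
      using underdetermined_system[of "{..<ind}" "{..<?m}" "\<lambda>j k. ext (X k) (r j)"] n by auto
    let ?z = "\<Sum>j<?m. sc (c j) (r j)"
    have "?z \<noteq> 0" using r(2) c(1) unfolding lindep_def by auto
    moreover have "ext (X k) ?z = 0" if "k < ind" for k using c(2)[of k] that by (simp add: V_sum V_scale)
    moreover have "?z \<in> stab (ext x)"
      using r(1) by (intro subspace_sum subspace_scale subspace_stab ext_in_V) auto
    hence "ext x (br y ?z) = 0" for y by (simp add: stab_skew)
    ultimately have "bd X x = 0" unfolding bd_zero_iff by (intro exI[of _ ?z]) simp
    thus False using X by simp
  qed
  thus "ext x \<in> reg" by (simp add: reg_iff)
qed

section \<open>Jacobians of central functions compared with bordered determinants\<close>

definition central :: "(('q \<Rightarrow> 'k) \<Rightarrow> 'k) \<Rightarrow> bool" where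
  "central \<phi> \<longleftrightarrow> \<phi> \<in> pf Basis \<and> (\<forall>\<eta>\<in>V. \<forall>z. \<eta> (br (grad \<phi> \<eta>) z) = 0)"

lemma central_pf: "central \<phi> \<Longrightarrow> \<phi> \<in> pf Basis" by (simp add: central_def)

lemma central_iff: "\<phi> \<in> pf Basis \<Longrightarrow> central \<phi> \<longleftrightarrow> rst \<phi> \<in> poisson_centre sc br"
  using centre_grad[of "rst \<phi>"] centreI[of \<phi>] by (auto simp: central_def)

lemma centre_central: "F \<in> poisson_centre sc br \<Longrightarrow> central (lft F)"
proof -
  assume F: "F \<in> poisson_centre sc br"
  hence "F \<in> sym_alg sc" by (simp add: poisson_centre_def)
  hence "lft F \<in> pf Basis" "F = rst (lft F)" by (auto elim: sym_algE)
  thus ?thesis using F by (simp add: central_iff)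
qed

definition gm :: "(nat \<Rightarrow> ('q \<Rightarrow> 'k) \<Rightarrow> 'k) \<Rightarrow> ('q \<Rightarrow> 'k) \<Rightarrow> 'k mat" where
  "gm \<phi> x = Matrix.mat qdim ind (\<lambda>(j, k). dd (\<phi> k) (unit (bs j)) x)"

lemma gm_carrier [simp]: "gm \<phi> x \<in> carrier_mat qdim ind" by (simp add: gm_def)

lemma jac_eq:
  assumes "\<And>k. k < ind \<Longrightarrow> \<phi> k \<in> pf Basis"
  shows "jac ind \<phi> X x = xm X * gm \<phi> x"
proof (rule eq_matI)
  fix i j assume ij: "i < dim_row (xm X * gm \<phi> x)" "j < dim_col (xm X * gm \<phi> x)"
  hence ij: "i < ind" "j < ind" by (auto simp: xm_def gm_def)
  have "dd (\<phi> j) (X i) x = (\<Sum>b<qdim. X i (bs b) * dd (\<phi> j) (unit (bs b)) x)"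
    by (simp add: dd_sum_unit[OF finite_Basis assms[OF ij(2)], of "X i"] sum_bs)
  thus "jac ind \<phi> X x $$ (i, j) = (xm X * gm \<phi> x) $$ (i, j)"
    using ij by (simp add: jac_def xm_def gm_def scalar_prod_def atLeast0LessThan)
qed (auto simp: jac_def xm_def gm_def)

lemma pim_gm:
  assumes "\<And>k. k < ind \<Longrightarrow> central (\<phi> k)"
  shows "pim x * gm \<phi> x = 0\<^sub>m qdim ind" "transpose_mat (gm \<phi> x) * pim x = 0\<^sub>m ind qdim"
proof -
  have c: "ext x (br (grad (\<phi> k) x) z) = 0" if "k < ind" for k z
    using assms[OF that] grad_ext[of "\<phi> k" x] unfolding central_def by (metis ext_in_V)
  have g: "grad (\<phi> k) x = (\<Sum>j<qdim. sc (dd (\<phi> k) (unit (bs j)) x) (bs j))" for k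
    by (simp add: grad_def sum_bs)
  have 1: "(\<Sum>j<qdim. dd (\<phi> k) (unit (bs j)) x * ext x (br (bs j) z)) = 0" if "k < ind" for k z
    using c[OF that, of z] by (simp only: g V_br_sum(1)[OF ext_in_V])
  have 2: "(\<Sum>j<qdim. dd (\<phi> k) (unit (bs j)) x * ext x (br z (bs j))) = 0" if "k < ind" for k z
  proof -
    have "ext x (br z (grad (\<phi> k) x)) = 0" using c[OF that, of z] V_skew[OF ext_in_V, of x z "grad (\<phi> k) x"] by simp
    thus ?thesis by (simp only: g V_br_sum(2)[OF ext_in_V])
  qed
  show "pim x * gm \<phi> x = 0\<^sub>m qdim ind"
  proof (rule eq_matI)
    fix i k assume "i < dim_row (0\<^sub>m qdim ind)" "k < dim_col (0\<^sub>m qdim ind)"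
    thus "(pim x * gm \<phi> x) $$ (i, k) = 0\<^sub>m qdim ind $$ (i, k)"
      using 2[of k "bs i"] by (simp add: pim_def gm_def scalar_prod_def atLeast0LessThan mult.commute)
  qed (auto simp: pim_def gm_def)
  show "transpose_mat (gm \<phi> x) * pim x = 0\<^sub>m ind qdim"
  proof (rule eq_matI)
    fix k i assume "k < dim_row (0\<^sub>m ind qdim)" "i < dim_col (0\<^sub>m ind qdim)"
    thus "(transpose_mat (gm \<phi> x) * pim x) $$ (k, i) = 0\<^sub>m ind qdim $$ (k, i)"
      using 1[of k "bs i"] by (simp add: pim_def gm_def scalar_prod_def atLeast0LessThan)
  qed (auto simp: pim_def gm_def)
qed

text \<open>Cross-multiplied form of \<open>bordered_det\<close>, which holds for vanishing
  Jacobians too: as families in \<open>X\<close> the bordered determinants and the squared Jacobians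
  are proportional.\<close>

lemma bd_jac:
  assumes "\<And>k. k < ind \<Longrightarrow> central (\<phi> k)"
  shows "bd X' x * Determinant.det (jac ind \<phi> X x) ^ 2 = bd X x * Determinant.det (jac ind \<phi> X' x) ^ 2"
proof -
  have \<phi>: "\<And>k. k < ind \<Longrightarrow> \<phi> k \<in> pf Basis" using assms by (rule central_pf)
  have e: "bd X' x * Determinant.det (jac ind \<phi> X x) ^ 2 = Determinant.det (jac ind \<phi> X' x) ^ 2 * bd X x"
    if "Determinant.det (jac ind \<phi> X x) \<noteq> 0" for X X'
  proof -
    have j: "jac ind \<phi> Z x = xm Z * gm \<phi> x" for Z by (rule jac_eq) (rule \<phi>)
    show ?thesis unfolding bd_eq j
    proof (rule bordered_det)
      show "pim x * gm \<phi> x = 0\<^sub>m qdim ind" "transpose_mat (gm \<phi> x) * pim x = 0\<^sub>m ind qdim"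
        by (rule pim_gm, rule assms, assumption)+
      show "Determinant.det (xm X * gm \<phi> x) \<noteq> 0" using that unfolding j .
    qed simp_all
  qed
  show ?thesis
  proof (cases "Determinant.det (jac ind \<phi> X x) = 0")
    case False
    thus ?thesis using e[of X X'] by simp
  next
    case True
    thus ?thesis using e[of X' X] by (cases "Determinant.det (jac ind \<phi> X' x) = 0") auto
  qed
qed

lemma jac_scale_dir:
  assumes "\<And>k. k < ind \<Longrightarrow> \<phi> k \<in> pf Basis"
  shows "Determinant.det (jac ind \<phi> (\<lambda>i k. s * X i k) x) = s ^ ind * Determinant.det (jac ind \<phi> X x)"
proof -
  have "jac ind \<phi> (\<lambda>i k. s * X i k) x = s \<cdot>\<^sub>m jac ind \<phi> X x"
  proof (rule eq_matI)
    fix i j assume "i < dim_row (s \<cdot>\<^sub>m jac ind \<phi> X x)" "j < dim_col (s \<cdot>\<^sub>m jac ind \<phi> X x)"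
    hence ij: "i < ind" "j < ind" by (auto simp: jac_def)
    have "dd (\<phi> j) (\<lambda>k. s * X i k + 0 * X i k) x = s * dd (\<phi> j) (X i) x + 0 * dd (\<phi> j) (X i) x"
      by (rule dd_linear[OF assms[OF ij(2)]])
    thus "jac ind \<phi> (\<lambda>i k. s * X i k) x $$ (i, j) = (s \<cdot>\<^sub>m jac ind \<phi> X x) $$ (i, j)"
      using ij by (simp add: jac_def)
  qed (auto simp: jac_def)
  thus ?thesis by (simp add: jac_def)
qed

lemma square_root: "\<exists>s :: 'k. s ^ 2 = t"
proof -
  have "degree [:- t, 0, 1:] > 0" by simp
  then obtain s where "poly [:- t, 0, 1:] s = 0" using alg_closed_imp_poly_has_root by blast
  hence "s ^ 2 = t" by (simp add: power2_eq_square)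
  thus ?thesis by blast
qed

text \<open>The border does not scale with \<open>x\<close>. Dividing the covectors by a square root
  of \<open>t\<close> makes the whole matrix scale by \<open>t\<close>, and \<open>bd_jac\<close>
  compares the two borders; the outcome is homogeneity with exponent
  \<open>qdim - ind\<close>.\<close>

lemma bd_scale:
  assumes c: "\<And>k. k < ind \<Longrightarrow> central (\<phi> k)" and N: "Determinant.det (jac ind \<phi> X x) \<noteq> 0" and t: "t \<noteq> 0"
  shows "t ^ ind * bd X (\<lambda>i. t * x i) = t ^ qdim * bd X x"
proof -
  obtain s where s: "s ^ 2 = t" using square_root by blast
  have s0: "s \<noteq> 0" using s t by auto
  let ?Y = "\<lambda>i k. inverse s * X i k"
  have "Matrix.mat qdim qdim (\<lambda>(i, j). ext (\<lambda>i. t * x i) (br (bs i) (bs j)) + (\<Sum>k<ind. X k (bs i) * X k (bs j)))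
    = t \<cdot>\<^sub>m Matrix.mat qdim qdim (\<lambda>(i, j). ext x (br (bs i) (bs j)) + (\<Sum>k<ind. ?Y k (bs i) * ?Y k (bs j)))"
  proof (rule eq_matI, goal_cases)
    case (1 i j)
    have e: "t * (inverse s * a * (inverse s * b)) = a * b" for a b
      using s0 by (simp add: s[symmetric] power2_eq_square field_simps)
    have "t * (\<Sum>k<ind. ?Y k (bs i) * ?Y k (bs j)) = (\<Sum>k<ind. X k (bs i) * X k (bs j))"
      unfolding sum_distrib_left by (rule sum.cong[OF refl]) (rule e)
    thus ?case using 1 by (simp add: ext_smult distrib_left)
  qed auto
  hence 1: "bd X (\<lambda>i. t * x i) = t ^ qdim * bd ?Y x" unfolding bd_def by simp
  have "bd ?Y x * Determinant.det (jac ind \<phi> X x) ^ 2 = bd X x * Determinant.det (jac ind \<phi> ?Y x) ^ 2"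
    by (rule bd_jac[of \<phi>, OF c])
  also have "\<dots> = (bd X x * (inverse s ^ ind) ^ 2) * Determinant.det (jac ind \<phi> X x) ^ 2"
    by (simp add: jac_scale_dir[of \<phi>, OF central_pf[OF c]] power_mult_distrib)
  finally have "bd ?Y x = bd X x * (inverse s ^ ind) ^ 2" using N by simp
  also have "(inverse s ^ ind) ^ 2 = inverse (t ^ ind)"
    by (simp add: s[symmetric] power_mult[symmetric] power_inverse mult.commute)
  finally show ?thesis using t 1 by simp
qed

end

text \<open>Multiplication by \<open>t ^ degree q\<close> turns the right side into the reflected
  polynomial, whose degree is at most that of \<open>q\<close>; this leaves degree 0 for
  \<open>p\<close>.\<close>

lemma poly_inverse_const:
  fixes p q :: "'k::field_char_0 poly"
  assumes "\<And>t. t \<noteq> 0 \<Longrightarrow> poly p t = poly q (inverse t)"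
  shows "\<exists>a. p = [:a:] \<and> q = [:a:]"
proof -
  have "[:0, 1:] * (Polynomial.monom 1 (degree q) * p) = [:0, 1:] * reflect_poly q"
  proof (rule poly_ext)
    fix t show "poly ([:0, 1:] * (Polynomial.monom 1 (degree q) * p)) t = poly ([:0, 1:] * reflect_poly q) t"
      using assms[of t] by (cases "t = 0") (auto simp: poly_reflect_poly_nz Polynomial.poly_monom)
  qed
  hence e: "Polynomial.monom 1 (degree q) * p = reflect_poly q" by (subst (asm) mult_left_cancel) auto
  have "degree p = 0"
  proof (cases "p = 0")
    case False
    hence "degree q + degree p = degree (reflect_poly q)"
      by (subst e[symmetric], subst degree_mult_eq) (auto simp: degree_monom_eq)
    thus ?thesis using degree_reflect_poly_le[of q] by simp
  qed simp
  then obtain a where a: "p = [:a:]" by (rule degree_eq_zeroE)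
  have "[:0, 1:] * q = [:0, 1:] * [:a:]"
  proof (rule poly_ext)
    fix t show "poly ([:0, 1:] * q) t = poly ([:0, 1:] * [:a:]) t"
      using assms[of "inverse t"] a by (cases "t = 0") auto
  qed
  hence "q = [:a:]" by (subst (asm) mult_left_cancel) auto
  thus ?thesis using a by blast
qed

lemma sum_powers_zero:
  fixes a :: "nat \<Rightarrow> 'k::field_char_0"
  assumes "\<And>t. (\<Sum>n\<le>m. a n * t ^ n) = 0" "n \<le> m" shows "a n = 0"
proof -
  have "(\<Sum>n\<le>m. Polynomial.monom (a n) n) = 0"
    by (rule poly_ext) (simp add: poly_sum Polynomial.poly_monom assms(1))
  hence "Polynomial.coeff (\<Sum>n\<le>m. Polynomial.monom (a n) n) n = 0" by simp
  thus ?thesis using assms(2) by (simp add: coeff_sum)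
qed

lemma det_col_scale:
  fixes a :: "nat \<Rightarrow> nat \<Rightarrow> 'k::comm_ring_1"
  shows "Determinant.det (Matrix.mat n n (\<lambda>(i, j). s j * a i j)) = (\<Prod>j<n. s j) * Determinant.det (Matrix.mat n n (\<lambda>(i, j). a i j))"
proof -
  have "(\<Prod>i = 0..<n. s (p i)) = (\<Prod>j<n. s j)" if "p permutes {0..<n}" for p
    using prod.permute[OF that, of s] by (simp add: atLeast0LessThan)
  moreover have "(\<Prod>i = 0..<n. Matrix.mat n n (\<lambda>(i, j). s j * a i j) $$ (i, p i)) =
      (\<Prod>i = 0..<n. s (p i)) * (\<Prod>i = 0..<n. Matrix.mat n n (\<lambda>(i, j). a i j) $$ (i, p i))"
    if "p permutes {0..<n}" for p
    unfolding prod.distrib[symmetric]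
    by (rule prod.cong) (use permutes_in_image[OF that] in auto)
  ultimately show ?thesis
    unfolding det_def'[OF mat_carrier] sum_distrib_left
    by (intro sum.cong) (auto simp: ac_simps)
qed

lemma poly_det:
  fixes a :: "nat \<Rightarrow> nat \<Rightarrow> 'k::comm_ring_1 poly"
  shows "poly (Determinant.det (Matrix.mat n n (\<lambda>(i, j). a i j))) t = Determinant.det (Matrix.mat n n (\<lambda>(i, j). poly (a i j) t))"
proof -
  have s: "poly (signof p) t = signof p" for p :: "nat \<Rightarrow> nat" by (cases "sign p = 1") (auto simp: sign_def)
  have "(\<Prod>i = 0..<n. poly (Matrix.mat n n (\<lambda>(i, j). a i j) $$ (i, p i)) t) =
      (\<Prod>i = 0..<n. Matrix.mat n n (\<lambda>(i, j). poly (a i j) t) $$ (i, p i))" if "p permutes {0..<n}" for p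
    by (rule prod.cong) (use permutes_in_image[OF that] in auto)
  thus ?thesis unfolding det_def'[OF mat_carrier] poly_sum
    by (intro sum.cong) (auto simp: poly_prod s)
qed

section \<open>The singular set, leading components, and generation of central functions\<close>

context lie_acf
begin

lemma ext_sum: "ext (\<lambda>b. \<Sum>i<r. v i * Y i b) q = (\<Sum>i<r. v i * ext (Y i) q)" for r :: nat
proof (induction r)
  case (Suc r)
  have "ext (\<lambda>b. (\<Sum>i<r. v i * Y i b) + v r * Y r b) q = ext (\<lambda>b. \<Sum>i<r. v i * Y i b) q + v r * ext (Y r) q"
    by (simp only: ext_add)
  thus ?case using Suc by simp
qed (simp add: ext_def)

lemma singular_closed: "closedin (zariski V) (V - reg)"
proof -
  have "x \<in> reg \<longleftrightarrow> (\<exists>X. bd X x \<noteq> 0)" if "x \<in> V" for x using reg_iff_bd[of x] that by simp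
  hence "V - reg = {\<eta> \<in> V. \<forall>F\<in>range bd. F \<eta> = 0}" by auto
  hence "pclosed V Basis (V - reg)" unfolding pclosed_def using pf_bd by (intro exI[of _ "range bd"]) auto
  thus ?thesis by (subst zariski_closed_iff[OF V_finite_vars])
qed

text \<open>Elements of \<open>'q\<close> on which all \<open>e i\<close> vanish give linear
  functions constant along these directions, and at least \<open>qdim - p\<close> of them are
  independent. On a set of codimension \<open>m > p\<close> so many functions satisfy an algebraic
  relation by \<open>codim_bound\<close>, and that relation is \<open>P\<close>.\<close>

lemma singular_killer:
  assumes cp: "codim_property sc br m" and p: "p < m"
  shows "\<exists>P\<in>pf Basis. (\<exists>x. P x \<noteq> 0) \<and> (\<forall>i<p. \<forall>x t. P (\<lambda>k. x k + t * e i k) = P x) \<and> (\<forall>x. ext x \<notin> reg \<longrightarrow> P x = 0)"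
proof -
  let ?K = "{q. \<forall>i<p. ext (e i) q = 0}"
  have "subspace ?K" by (auto simp: subspace_def V_zero V_add V_scale)
  from subspace_family[OF this] obtain y where y: "\<And>j. j < dim ?K \<Longrightarrow> y j \<in> ?K" "lindep (dim ?K) y"
    "\<And>z. z \<in> ?K \<Longrightarrow> \<exists>c. z = (\<Sum>j<dim ?K. sc (c j) (y j))" by blast
  let ?r = "dim ?K"
  obtain Y where Y: "\<And>i j. i < ?r \<Longrightarrow> j < ?r \<Longrightarrow> ext (Y i) (y j) = (if i = j then 1 else 0)"
    using dual_family[OF y(2)] by blast
  have dim: "qdim \<le> ?r + p"
  proof (rule ccontr)
    assume "\<not> ?thesis"
    hence "card {..<?r + p} < card {..<qdim}" by simp
    from underdetermined_system[OF _ _ this, of "\<lambda>j k. if k < ?r then ext (Y k) (bs j) else ext (e (k - ?r)) (bs j)"]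
    obtain c where c: "\<exists>j\<in>{..<qdim}. c j \<noteq> 0"
      "\<And>k. k \<in> {..<?r + p} \<Longrightarrow> (\<Sum>j<qdim. c j * (if k < ?r then ext (Y k) (bs j) else ext (e (k - ?r)) (bs j))) = 0" by auto
    let ?z = "\<Sum>j<qdim. sc (c j) (bs j)"
    have Yz: "ext (Y k) ?z = 0" if "k < ?r" for k using c(2)[of k] that by (simp only: V_sum[OF ext_in_V] V_scale[OF ext_in_V]) simp
    have "ext (e k) ?z = 0" if "k < p" for k using c(2)[of "?r + k"] that by (simp only: V_sum[OF ext_in_V] V_scale[OF ext_in_V]) simp
    hence "?z \<in> ?K" by simp
    then obtain c' where c': "?z = (\<Sum>j<?r. sc (c' j) (y j))" using y(3) by blast
    have "c' i = 0" if i: "i < ?r" for i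
    proof -
      have "ext (Y i) ?z = (\<Sum>j<?r. c' j * ext (Y i) (y j))" unfolding c' by (simp only: V_sum[OF ext_in_V] V_scale[OF ext_in_V])
      also have "\<dots> = (\<Sum>j<?r. if j = i then c' j else 0)" by (rule sum.cong) (use Y i in auto)
      finally show ?thesis using Yz[OF i] i by simp
    qed
    hence "?z = 0" unfolding c' by simp
    hence "c j = 0" if "j < qdim" for j using ext_unit_sum[OF that, of c] by (simp add: V_zero)
    thus False using c(1) by auto
  qed
  define g where "g k = (\<lambda>x. ext x (y k))" for k
  have g: "g k \<in> pf Basis" for k unfolding g_def by (rule pfI[OF pdeg_ext_point])
  have "\<not> indep_on ?r g (V - reg)"
  proof
    assume i: "indep_on ?r g (V - reg)"
    have "codim (zariski V) (V - reg) \<ge> enat m" using cp unfolding codim_property_def .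
    from codim_bound[OF finite_Basis V_finite_vars singular_closed this g i] have "?r + m \<le> qdim" .
    thus False using dim p by simp
  qed
  then obtain \<phi> v where \<phi>: "\<phi> \<in> pf {..<?r}" "\<forall>x\<in>V - reg. \<phi> (\<lambda>k. g k x) = 0" "\<phi> v \<noteq> 0"
    unfolding indep_on_def by blast
  define P where "P = (\<lambda>x. \<phi> (\<lambda>k. g k x))"
  have "P \<in> pf Basis" unfolding P_def by (rule pf_compose[OF \<phi>(1) g])
  moreover have "\<exists>x. P x \<noteq> 0"
  proof -
    \<comment> \<open>The point at which the linear functions \<open>g j\<close> take the prescribed
      values \<open>v j\<close>, where the relation does not vanish.\<close>
    let ?x = "\<lambda>b. \<Sum>i<?r. v i * Y i b"
    have "g j ?x = v j" if j: "j \<in> {..<?r}" for j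
    proof -
      have "g j ?x = (\<Sum>i<?r. v i * ext (Y i) (y j))" unfolding g_def by (rule ext_sum)
      also have "\<dots> = (\<Sum>i<?r. if i = j then v i else 0)" by (rule sum.cong) (use Y j in auto)
      finally show ?thesis using j by simp
    qed
    hence "P ?x = \<phi> v" unfolding P_def by (intro pf_cong_vars[OF \<phi>(1)])
    thus ?thesis using \<phi>(3) by (intro exI[of _ ?x]) simp
  qed
  moreover have "P (\<lambda>k. x k + t * e i k) = P x" if i: "i < p" for i x t
    unfolding P_def
  proof (rule pf_cong_vars[OF \<phi>(1)])
    fix k assume "k \<in> {..<?r}"
    hence "ext (e i) (y k) = 0" using y(1)[of k] i by auto
    thus "g k (\<lambda>k. x k + t * e i k) = g k x" unfolding g_def by (simp only: ext_add) simp
  qed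
  moreover have "P x = 0" if "ext x \<notin> reg" for x
  proof -
    have "\<phi> (\<lambda>k. g k (ext x)) = 0" using \<phi>(2) that by simp
    thus ?thesis by (simp add: P_def g_def)
  qed
  ultimately show ?thesis by (intro bexI[of _ P]) auto
qed

lemma killer_dir:
  assumes "codim_property sc br 2"
  shows "\<exists>P\<in>pf Basis. (\<exists>x. P x \<noteq> 0) \<and> (\<forall>x t. P (\<lambda>k. x k + t * e k) = P x) \<and> (\<forall>x. ext x \<notin> reg \<longrightarrow> P x = 0)"
  using singular_killer[OF assms, of 1 "\<lambda>_. e"] by simp

lemma ad_in_V: "\<eta> \<in> V \<Longrightarrow> (\<lambda>b. \<eta> (br b z)) \<in> V"
  by (simp add: V_iff br_add br_scale)

text \<open>Bracketing with \<open>z\<close> becomes differentiation along the coadjoint vector of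
  \<open>z\<close> at \<open>\<eta>\<close>, so the calculus of \<open>dd\<close> applies.\<close>

lemma grad_ad: "\<psi> \<in> pf Basis \<Longrightarrow> \<eta> \<in> V \<Longrightarrow> \<eta> (br (grad \<psi> x) z) = dd \<psi> (\<lambda>b. \<eta> (br b z)) x"
  using V_grad[OF _ ad_in_V, of \<psi> \<eta> x z] by simp

text \<open>Coadjoint vector fields are linear in the point, so centrality along a ray is an
  identity in \<open>t\<close> that splits into homogeneous components.\<close>

lemma central_hc:
  assumes "central \<phi>" shows "central (hc \<phi> e)"
proof -
  have \<phi>: "\<phi> \<in> pf Basis" using assms by (rule central_pf)
  obtain m where m: "pdeg Basis m \<phi>" using \<phi> by (rule pfE)
  have "\<eta> (br (grad (hc \<phi> e) \<eta>) z) = 0" if \<eta>: "\<eta> \<in> V" for \<eta> z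
  proof -
    let ?y = "\<lambda>b. \<eta> (br b z)"
    have s: "(\<Sum>n\<le>m. dd (hc \<phi> n) ?y \<eta> * t ^ n) = 0" for t
    proof -
      have tV: "(\<lambda>i. t * \<eta> i) \<in> V" using V_smult[OF \<eta>] .
      have "\<forall>z. t * \<eta> (br (grad \<phi> (\<lambda>i. t * \<eta> i)) z) = 0"
        by (rule bspec[OF conjunct2[OF assms[unfolded central_def]] tV])
      hence "0 = t * \<eta> (br (grad \<phi> (\<lambda>i. t * \<eta> i)) z)" by (simp only:)
      also have "\<dots> = t * dd \<phi> ?y (\<lambda>i. t * \<eta> i)" by (simp only: grad_ad[OF \<phi> \<eta>])
      also have "\<dots> = (\<Sum>n\<le>m. dd (hc \<phi> n) ?y \<eta> * t ^ n)" by (rule dd_hc_sum[OF m])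
      finally show ?thesis by simp
    qed
    have "dd (hc \<phi> e) ?y \<eta> = 0"
    proof (cases "e \<le> m")
      case True
      show ?thesis by (rule sum_powers_zero[where a = "\<lambda>n. dd (hc \<phi> n) ?y \<eta>", OF s True])
    next
      case False
      hence "hc \<phi> e z = 0" for z using degree_line_poly[OF m, of "\<lambda>i. 0" z] by (simp add: hc_def coeff_eq_0)
      hence "hc \<phi> e = (\<lambda>z. 0)" by (intro HOL.ext)
      thus ?thesis by simp
    qed
    thus ?thesis by (simp only: grad_ad[OF pf_hc[OF \<phi>] \<eta>])
  qed
  thus ?thesis unfolding central_def using \<phi> by auto
qed

lemma indep_degree_pos:
  fixes \<phi> :: "nat \<Rightarrow> ('q \<Rightarrow> 'k) \<Rightarrow> 'k"
  assumes "k < r" "pdeg Basis (d k) (\<phi> k)" "indep_on r \<phi> UNIV" shows "d k > 0"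
proof (rule ccontr)
  assume "\<not> d k > 0"
  hence c: "\<phi> k x = \<phi> k (\<lambda>i. 0)" for x using assms(2) pdeg_0_const by auto
  have "(\<lambda>y :: nat \<Rightarrow> 'k. y k - \<phi> k (\<lambda>i. 0)) \<in> pf {..<r}" using assms(1) by (intro pf_diff pf_var) auto
  with assms(3)[unfolded indep_on_def, THEN bspec, of "\<lambda>y. y k - \<phi> k (\<lambda>i. 0)"] c
  have "\<forall>y :: nat \<Rightarrow> 'k. y k - \<phi> k (\<lambda>i. 0) = 0" by simp
  from spec[OF this, of "\<lambda>_. \<phi> k (\<lambda>i. 0) + 1"] show False by simp
qed

text \<open>The squared Jacobian determinants of the \<open>\<phi> k\<close> are multiples \<open>c\<close> of the bordered determinants, and \<open>c\<close> is
  polynomial by the extension principle. Comparing growth along \<open>x / t\<close>, where the degree hypothesis enters,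
  shows that \<open>c\<close> is constant and that only the leading components of the \<open>\<phi> k\<close> contribute.\<close>

lemma leading_components_dindep:
  assumes cp: "codim_property sc br 2" and c: "\<And>k. k < ind \<Longrightarrow> central (\<phi> k)"
    and deg: "\<And>k. k < ind \<Longrightarrow> pdeg Basis (d k) (\<phi> k)" and indep: "indep_on ind \<phi> UNIV"
    and sum: "2 * (\<Sum>k<ind. d k) \<le> qdim + ind" and x: "ext x \<in> reg"
  shows "dindep ind (\<lambda>k. hc (\<phi> k) (d k)) x"
proof -
  have \<phi>: "\<phi> k \<in> pf Basis" if "k < ind" for k using central_pf[OF c[OF that]] .
  define h where "h k = hc (\<phi> k) (d k)" for k
  have h: "h k \<in> pf Basis" if "k < ind" for k unfolding h_def by (rule pf_hc[OF \<phi>[OF that]])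
  let ?D = "\<lambda>X x. Determinant.det (jac ind \<phi> X x)"
  have Dpf: "?D X \<in> pf Basis" for X by (rule pf_jac[of ind \<phi> Basis, OF \<phi>])
  have N: "(\<lambda>x. ?D X x ^ 2) \<in> pf Basis" for X by (rule pf_power[OF Dpf])
  obtain \<eta>0 where "\<eta>0 \<in> reg" using ind_attained by blast
  hence "ext \<eta>0 \<in> reg" by (simp add: dual_reg_def)
  then obtain X0 where X0: "bd X0 \<eta>0 \<noteq> 0" using reg_iff_bd by blast
  have "\<exists>C\<in>pf Basis. \<forall>X x. ?D X x ^ 2 = C x * bd X x"
  proof (rule extension_principle[where M = bd and N = "\<lambda>X x. ?D X x ^ 2"])
    show "bd X \<in> pf Basis" for X by (rule pf_bd)
    show "(\<lambda>x. ?D X x ^ 2) \<in> pf Basis" for X by (rule N)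
    show "bd X x * ?D Y x ^ 2 = bd Y x * ?D X x ^ 2" for X Y x by (rule bd_jac[of \<phi>, OF c])
    show "bd X0 \<eta>0 \<noteq> 0" by (rule X0)
    fix e
    have "(\<forall>X. bd X x = 0) \<longleftrightarrow> ext x \<notin> reg" for x using reg_iff_bd[of x] by auto
    thus "\<exists>P\<in>pf Basis. (\<exists>x. P x \<noteq> 0) \<and> (\<forall>x t. P (\<lambda>i. x i + t * e i) = P x) \<and> (\<forall>x. (\<forall>X. bd X x = 0) \<longrightarrow> P x = 0)"
      using killer_dir[OF cp, of e] by simp
  qed
  then obtain C where C: "C \<in> pf Basis" "\<And>X x. ?D X x ^ 2 = C x * bd X x" by blast
  have dpos: "d k > 0" if "k < ind" for k
    by (rule indep_degree_pos[of k ind d \<phi>, OF that deg[OF that] indep])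
  define K where "K = (\<Sum>k<ind. d k - 1)"
  have "K + ind = (\<Sum>k<ind. d k)"
  proof -
    have "(\<Sum>k<ind. d k) = (\<Sum>k<ind. (d k - 1) + 1)" using dpos by (intro sum.cong) auto
    thus ?thesis unfolding K_def sum.distrib by simp
  qed
  hence K: "2 * K + ind \<le> qdim" using sum by simp
  have key: "C x = C (\<lambda>i. 0) \<and> Determinant.det (jac ind h X x) \<noteq> 0" if nz: "?D X x \<noteq> 0" for X x
  proof -
    \<comment> \<open>The entries of the Jacobian matrix at \<open>x / t\<close>, multiplied by
      \<open>t ^ (d j - 1)\<close>. They are polynomial in \<open>t\<close>, and at
      \<open>t = 0\<close> only the top components contribute.\<close>
    define G where "G i j = (\<Sum>e\<le>d j. Polynomial.monom (dd (hc (\<phi> j) e) (X i) x) (d j - e))" for i j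
    have G: "poly (G i j) t = t ^ (d j - 1) * dd (\<phi> j) (X i) (\<lambda>k. inverse t * x k)" if j: "j < ind" and t: "t \<noteq> 0" for i j t
    proof -
      have "poly (G i j) t = (\<Sum>e\<le>d j. dd (hc (\<phi> j) e) (X i) x * t ^ (d j - e))"
        by (simp add: G_def poly_sum Polynomial.poly_monom)
      also have "\<dots> = (\<Sum>e\<le>d j. t ^ d j * (dd (hc (\<phi> j) e) (X i) x * inverse t ^ e))"
        by (rule sum.cong) (use t in \<open>auto simp: power_diff field_simps\<close>)
      also have "\<dots> = t ^ d j * (inverse t * dd (\<phi> j) (X i) (\<lambda>k. inverse t * x k))"
        by (simp only: dd_hc_sum[OF deg[OF j]] sum_distrib_left)
      also have "\<dots> = t ^ (d j - 1) * dd (\<phi> j) (X i) (\<lambda>k. inverse t * x k)"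
        using dpos[OF j] t by (cases "d j") auto
      finally show ?thesis .
    qed
    have G0: "poly (G i j) 0 = dd (h j) (X i) x" for i j
    proof -
      have "poly (G i j) 0 = (\<Sum>e\<le>d j. if e = d j then dd (hc (\<phi> j) e) (X i) x else 0)"
        unfolding G_def poly_sum by (rule sum.cong) (auto simp: Polynomial.poly_monom)
      thus ?thesis by (simp add: h_def)
    qed
    define p where "p = Determinant.det (Matrix.mat ind ind (\<lambda>(i, j). G i j))"
    have p: "poly p t = t ^ K * ?D X (\<lambda>k. inverse t * x k)" if t: "t \<noteq> 0" for t
    proof -
      have "poly p t = Determinant.det (Matrix.mat ind ind (\<lambda>(i, j). poly (G i j) t))"
        unfolding p_def by (rule poly_det)
      also have "Matrix.mat ind ind (\<lambda>(i, j). poly (G i j) t) =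
          Matrix.mat ind ind (\<lambda>(i, j). t ^ (d j - 1) * dd (\<phi> j) (X i) (\<lambda>k. inverse t * x k))"
        by (rule eq_matI) (auto simp: G t)
      also have "Determinant.det \<dots> = (\<Prod>j<ind. t ^ (d j - 1)) * ?D X (\<lambda>k. inverse t * x k)"
        unfolding jac_def by (rule det_col_scale)
      finally show ?thesis by (simp add: K_def power_sum)
    qed
    have p0: "poly p 0 = Determinant.det (jac ind h X x)"
      unfolding p_def poly_det jac_def by (simp add: G0)
    let ?B = "bd X x"
    have nz2: "C x * ?B \<noteq> 0" using C(2)[of X x] nz by auto
    define q where "q = line_poly C (\<lambda>i. 0) x"
    have q: "poly q s = C (\<lambda>i. s * x i)" for s unfolding q_def by (simp add: poly_line_poly[OF C(1)])
    \<comment> \<open>The slack in the degree inequality. The constant term of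
      \<open>p ^ 2 * monom 1 m0\<close> is nonzero, which excludes both positive slack and a
      vanishing \<open>p\<close> at 0.\<close>
    define m0 where "m0 = qdim - (2 * K + ind)"
    have "poly (p ^ 2 * Polynomial.monom 1 m0) t = poly (Polynomial.smult ?B q) (inverse t)" if t: "t \<noteq> 0" for t
    proof -
      let ?x = "\<lambda>k. inverse t * x k"
      have "inverse t ^ ind * bd X ?x = inverse t ^ qdim * ?B" by (rule bd_scale[of \<phi>, OF c nz]) (use t in auto)
      hence "t ^ qdim * bd X ?x = t ^ ind * ?B" using t by (simp add: field_simps)
      moreover have "poly p t ^ 2 = t ^ (2 * K) * (C ?x * bd X ?x)"
        by (simp add: p[OF t] power_mult_distrib C(2) power_mult[symmetric] mult.commute)
      ultimately have "poly p t ^ 2 * t ^ qdim = t ^ (2 * K + ind) * (C ?x * ?B)"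
        by (simp add: power_add algebra_simps)
      moreover have "t ^ qdim = t ^ (2 * K + ind) * t ^ m0" using K by (simp add: m0_def power_add[symmetric])
      ultimately have "t ^ (2 * K + ind) * (poly p t ^ 2 * t ^ m0) = t ^ (2 * K + ind) * (C ?x * ?B)" by (simp add: ac_simps)
      hence "poly p t ^ 2 * t ^ m0 = C ?x * ?B" using t by simp
      thus ?thesis by (simp add: q Polynomial.poly_monom mult.commute)
    qed
    then obtain a where a: "p ^ 2 * Polynomial.monom 1 m0 = [:a:]" "Polynomial.smult ?B q = [:a:]"
      using poly_inverse_const[of "p ^ 2 * Polynomial.monom 1 m0" "Polynomial.smult ?B q"] by blast
    have "a = ?B * C x" using arg_cong[OF a(2), of "\<lambda>p. poly p 1"] by (simp add: q)
    moreover have "a = ?B * C (\<lambda>i. 0)" using arg_cong[OF a(2), of "\<lambda>p. poly p 0"] by (simp add: q)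
    moreover have "poly p 0 ^ 2 * 0 ^ m0 = a" using arg_cong[OF a(1), of "\<lambda>p. poly p 0"] by (simp add: Polynomial.poly_monom)
    ultimately show ?thesis using nz2 p0 by auto
  qed
  obtain x1 where "dindep ind \<phi> x1" using jacobian_criterion[OF finite_Basis \<phi> indep] by blast
  then obtain X1 where X1: "?D X1 x1 \<noteq> 0" using dindep_iff_jac[of ind \<phi> Basis, OF \<phi>] by blast
  have "C x = C (\<lambda>i. 0)" for x
    by (rule pf_eq_dense[where F = C and G = "\<lambda>x. C (\<lambda>i. 0)" and x = x, OF Dpf X1 C(1)]) (use key in auto)
  moreover have "C x1 \<noteq> 0" using C(2)[of X1 x1] X1 by auto
  ultimately have Cnz: "C x \<noteq> 0" for x by metis
  \<comment> \<open>A nonzero bordered determinant at a regular point gives a nonzero Jacobian of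
    the \<open>\<phi> k\<close>, because \<open>C\<close> has no zeros; \<open>key\<close> transfers
    this to the leading components.\<close>
  obtain X where "bd X x \<noteq> 0" using x reg_iff_bd by blast
  hence "?D X x \<noteq> 0" using C(2)[of X x] Cnz[of x] by auto
  hence "Determinant.det (jac ind h X x) \<noteq> 0" using key by blast
  hence "dindep ind h x" using dindep_iff_jac[of ind h Basis, OF h] by blast
  thus ?thesis unfolding h_def[abs_def] .
qed

lemma dindep_lindep:
  assumes "\<And>i. i < r \<Longrightarrow> F i \<in> pf Basis"
  shows "dindep r F x \<longleftrightarrow> lindep r (\<lambda>i. grad (F i) x)"
proof -
  have e: "(\<forall>y. (\<Sum>i<r. c i * dd (F i) y x) = 0) \<longleftrightarrow> (\<Sum>i<r. sc (c i) (grad (F i) x)) = 0" for c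
  proof -
    have "(\<Sum>i<r. c i * dd (F i) y x) = ext y (\<Sum>i<r. sc (c i) (grad (F i) x))" for y
      by (simp add: V_sum V_scale ext_grad[OF assms])
    moreover have "(\<forall>y. ext y z = 0) \<longleftrightarrow> z = 0" for z
    proof
      assume z: "\<forall>y. ext y z = 0"
      show "z = 0"
      proof (rule separate)
        fix \<nu> assume "\<nu> \<in> V"
        thus "\<nu> z = \<nu> 0" using spec[OF z, of \<nu>] by (simp add: V_zero)
      qed
    qed (simp add: V_zero)
    ultimately show ?thesis by simp
  qed
  show ?thesis unfolding dindep_def lindep_def e ..
qed

lemma central_stab: "central \<phi> \<Longrightarrow> grad \<phi> x \<in> stab (ext x)"
  using grad_ext[of \<phi> x] by (auto simp: central_def coadj_stabiliser_def dest!: bspec[of _ _ "ext x"])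

text \<open>At a regular point the stabiliser has dimension \<open>ind\<close>, so the independent
  gradients of the \<open>h k\<close> span it; the gradient of a central \<open>g\<close> also lies
  there.\<close>

lemma central_ddep:
  assumes h: "\<And>k. k < ind \<Longrightarrow> central (h k)" and d: "dindep ind h x" and x: "ext x \<in> reg" and g: "central g"
  shows "ddep ind h g x"
  unfolding ddep_def
proof (intro allI impI)
  fix y assume y: "\<forall>i<ind. dd (h i) y x = 0"
  have hp: "h k \<in> pf Basis" if "k < ind" for k using central_pf[OF h[OF that]] .
  have "lindep ind (\<lambda>i. grad (h i) x)" using d dindep_lindep[of ind h, OF hp] by simp
  then obtain c where c: "grad g x = (\<Sum>j<ind. sc (c j) (grad (h j) x))"
    using lindep_spans[of ind "\<lambda>i. grad (h i) x" "stab (ext x)" "grad g x"] central_stab[OF h] central_stab[OF g] x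
    by (auto simp: dual_reg_def)
  have "dd g y x = ext y (grad g x)" by (rule ext_grad[OF central_pf[OF g], symmetric])
  also have "\<dots> = (\<Sum>j<ind. c j * dd (h j) y x)" unfolding c by (simp add: V_sum V_scale ext_grad[OF hp])
  finally show "dd g y x = 0" using y by simp
qed

lemma central_generated:
  assumes cp: "codim_property sc br 2" and h: "\<And>k. k < ind \<Longrightarrow> central (h k)" "\<And>k. k < ind \<Longrightarrow> homog (d k) (h k)"
    "\<And>k. k < ind \<Longrightarrow> d k > 0" and ind: "\<And>x. ext x \<in> reg \<Longrightarrow> dindep ind h x" and g: "central g"
  shows "\<exists>\<psi>\<in>pf {i. i < ind \<and> d i \<le> D}. hc g D = (\<lambda>x. \<psi> (\<lambda>i. h i x))"
proof -
  obtain Q where Q: "Q \<in> pf Basis" "\<exists>x. Q x \<noteq> 0" "\<forall>x. ext x \<notin> reg \<longrightarrow> Q x = 0"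
    using killer_dir[OF cp, of "\<lambda>i. 0"] by auto
  obtain x0 where x0: "Q x0 \<noteq> 0" using Q(2) by blast
  show ?thesis
  proof (rule integration[where F = h and d = d and g = g and Q = Q and D = D and r = ind and J = Basis])
    show "h i \<in> pf Basis" "homog (d i) (h i)" "0 < d i" if "i < ind" for i
      using central_pf[OF h(1)] h(2,3) that by auto
    show "g \<in> pf Basis" by (rule central_pf[OF g])
    show "Q \<in> pf Basis" "Q x0 \<noteq> 0" by fact+
    show "ddep ind h g x" if "Q x \<noteq> 0" for x
    proof -
      have "ext x \<in> reg" using Q(3) that by blast
      thus ?thesis using central_ddep[of h x g, OF h(1) ind _ g] by blast
    qed
    fix e
    obtain P where P: "P \<in> pf Basis" "\<exists>x. P x \<noteq> 0" "\<forall>x t. P (\<lambda>k. x k + t * e k) = P x" "\<forall>x. ext x \<notin> reg \<longrightarrow> P x = 0"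
      using killer_dir[OF cp, of e] by auto
    have "P x = 0" if "\<not> dindep ind h x" for x using that ind P(4) by blast
    thus "\<exists>P\<in>pf Basis. (\<exists>x. P x \<noteq> 0) \<and> (\<forall>x t. P (\<lambda>i. x i + t * e i) = P x) \<and> (\<forall>x. \<not> dindep ind h x \<longrightarrow> P x = 0)"
      using P by (intro bexI[of _ P] conjI) auto
  qed
qed

end

section \<open>Shifts of central functions\<close>

lemma funpow_linear:
  fixes T :: "('a \<Rightarrow> 'k::comm_ring_1) \<Rightarrow> 'a \<Rightarrow> 'k"
  assumes "\<And>s t c c'. T (\<lambda>a. s * c a + t * c' a) = (\<lambda>a. s * T c a + t * T c' a)"
  shows "(T ^^ m) (\<lambda>a. s * c a + t * c' a) = (\<lambda>a. s * (T ^^ m) c a + t * (T ^^ m) c' a)"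
proof (induction m)
  case (Suc m)
  have "(T ^^ Suc m) (\<lambda>a. s * c a + t * c' a) = T (\<lambda>a. s * (T ^^ m) c a + t * (T ^^ m) c' a)"
    by (simp only: funpow.simps comp_apply Suc)
  also have "\<dots> = (\<lambda>a. s * T ((T ^^ m) c) a + t * T ((T ^^ m) c') a)" by (rule assms)
  finally show ?case by (simp only: funpow.simps comp_apply)
qed simp

text \<open>For a root \<open>r\<close> of \<open>P\<close>, either \<open>c\<close> is an
  eigenvector or \<open>T c - r c\<close> is a nonzero vector annihilated by \<open>P\<close>
  divided by the linear factor of \<open>r\<close>.\<close>

lemma eigenvector_of_annihilator:
  fixes T :: "('a \<Rightarrow> 'k::alg_closed_field) \<Rightarrow> 'a \<Rightarrow> 'k"
  assumes T: "\<And>s t c c'. T (\<lambda>a. s * c a + t * c' a) = (\<lambda>a. s * T c a + t * T c' a)"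
    and K: "\<And>s t c c'. c \<in> K \<Longrightarrow> c' \<in> K \<Longrightarrow> (\<lambda>a. s * c a + t * c' a) \<in> K" "\<And>c. c \<in> K \<Longrightarrow> T c \<in> K"
    and P: "P \<noteq> 0" "degree P \<le> N" "c \<in> K" "c \<noteq> (\<lambda>a. 0)" "\<And>a. (\<Sum>m\<le>N. Polynomial.coeff P m * (T ^^ m) c a) = 0"
  shows "\<exists>c\<in>K. c \<noteq> (\<lambda>a. 0) \<and> (\<exists>r. T c = (\<lambda>a. r * c a))"
  using P
proof (induction "degree P" arbitrary: P N c)
  case 0
  then obtain p where p: "P = [:p:]" by (metis degree_eq_zeroE)
  have "(\<Sum>m\<le>N. Polynomial.coeff P m * (T ^^ m) c a) = p * c a" for a
  proof -
    have "(\<Sum>m\<le>N. Polynomial.coeff P m * (T ^^ m) c a) = (\<Sum>m\<le>N. if m = 0 then p * c a else 0)"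
      by (rule sum.cong) (auto simp: p coeff_pCons split: nat.splits)
    thus ?thesis by simp
  qed
  hence "p * c a = 0" for a using "0.prems"(5) by simp
  moreover have "p \<noteq> 0" using p "0.prems"(1) by auto
  ultimately have "c = (\<lambda>a. 0)" by auto
  thus ?case using "0.prems"(4) by contradiction
next
  case (Suc n)
  obtain r where "poly P r = 0" using alg_closed_imp_poly_has_root[of P] Suc.hyps(2) by auto
  then obtain Q where Q: "P = [:-r, 1:] * Q" unfolding poly_eq_0_iff_dvd by (elim dvdE)
  have "Q \<noteq> 0" using Suc.prems(1) Q by auto
  hence "degree P = Suc (degree Q)" unfolding Q by (subst degree_mult_eq) auto
  hence dQ: "n = degree Q" using Suc.hyps(2) by simp
  obtain N' where N': "N = Suc N'" using Suc.prems(2) Suc.hyps(2) by (cases N) auto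
  define c' where "c' = (\<lambda>a. 1 * T c a + (- r) * c a)"
  have c'K: "c' \<in> K" unfolding c'_def by (rule K(1)[OF K(2)[OF Suc.prems(3)] Suc.prems(3)])
  show ?case
  proof (cases "c' = (\<lambda>a. 0)")
    case True
    have "T c a = r * c a" for a using fun_cong[OF True, of a] by (simp add: c'_def)
    thus ?thesis using Suc.prems(3,4) by (intro bexI[of _ c]) auto
  next
    case False
    have top: "Polynomial.coeff Q (Suc N') = 0"
      using Suc.prems(2) Suc.hyps(2) dQ N' by (intro coeff_eq_0) simp
    have "(\<Sum>m\<le>N'. Polynomial.coeff Q m * (T ^^ m) c' a) = 0" for a
    proof -
      have Tc': "(T ^^ m) c' a = (T ^^ Suc m) c a - r * (T ^^ m) c a" for m
      proof -
        have "(T ^^ m) c' = (\<lambda>a. 1 * (T ^^ m) (T c) a + (- r) * (T ^^ m) c a)"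
          unfolding c'_def by (rule funpow_linear[of T, OF T])
        thus ?thesis by (simp add: funpow_swap1)
      qed
      have cP: "Polynomial.coeff P m = (case m of 0 \<Rightarrow> 0 | Suc m' \<Rightarrow> Polynomial.coeff Q m') - r * Polynomial.coeff Q m" for m
        unfolding Q by (cases m) (simp_all add: mult_pCons_left)
      have "0 = (\<Sum>m\<le>Suc N'. Polynomial.coeff P m * (T ^^ m) c a)" using Suc.prems(5) N' by simp
      also have "\<dots> = (\<Sum>m\<le>Suc N'. (case m of 0 \<Rightarrow> 0 | Suc m' \<Rightarrow> Polynomial.coeff Q m') * (T ^^ m) c a)
          - (\<Sum>m\<le>Suc N'. r * Polynomial.coeff Q m * (T ^^ m) c a)"
        unfolding cP left_diff_distrib sum_subtractf ..
      also have "(\<Sum>m\<le>Suc N'. (case m of 0 \<Rightarrow> 0 | Suc m' \<Rightarrow> Polynomial.coeff Q m') * (T ^^ m) c a) =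
          (\<Sum>m\<le>N'. Polynomial.coeff Q m * (T ^^ Suc m) c a)"
        by (subst sum.atMost_Suc_shift) simp
      also have "(\<Sum>m\<le>Suc N'. r * Polynomial.coeff Q m * (T ^^ m) c a) = (\<Sum>m\<le>N'. r * Polynomial.coeff Q m * (T ^^ m) c a)"
        by (simp add: top)
      finally show ?thesis unfolding Tc' by (simp add: sum_subtractf[symmetric] algebra_simps)
    qed
    thus ?thesis
      by (intro Suc.hyps(1)[OF dQ \<open>Q \<noteq> 0\<close> _ c'K False, of N']) (use Suc.prems(2) Suc.hyps(2) dQ N' in auto)
  qed
qed

text \<open>The iterates of \<open>c\<close> are supported in \<open>A\<close>, so
  \<open>card A + 1\<close> of them are linearly dependent and provide an annihilating
  polynomial.\<close>

lemma eigenvector: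
  fixes T :: "('a \<Rightarrow> 'k::alg_closed_field) \<Rightarrow> 'a \<Rightarrow> 'k"
  assumes "finite A" and T: "\<And>s t c c'. T (\<lambda>a. s * c a + t * c' a) = (\<lambda>a. s * T c a + t * T c' a)"
    and K: "\<And>s t c c'. c \<in> K \<Longrightarrow> c' \<in> K \<Longrightarrow> (\<lambda>a. s * c a + t * c' a) \<in> K" "\<And>c. c \<in> K \<Longrightarrow> T c \<in> K"
      "\<And>c a. c \<in> K \<Longrightarrow> a \<notin> A \<Longrightarrow> c a = 0"
    and c: "c \<in> K" "c \<noteq> (\<lambda>a. 0)"
  shows "\<exists>c\<in>K. c \<noteq> (\<lambda>a. 0) \<and> (\<exists>r. T c = (\<lambda>a. r * c a))"
proof -
  have "card A < card {..card A}" by simp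
  from underdetermined_system[OF assms(1) _ this, of "\<lambda>m a. (T ^^ m) c a"]
  obtain p where p: "\<exists>m\<in>{..card A}. p m \<noteq> 0" "\<And>a. a \<in> A \<Longrightarrow> (\<Sum>m\<le>card A. p m * (T ^^ m) c a) = 0" by auto
  define P where "P = (\<Sum>m\<le>card A. Polynomial.monom (p m) m)"
  have cf: "Polynomial.coeff P m = p m" if "m \<le> card A" for m
    using that by (simp add: P_def coeff_sum)
  have TK: "(T ^^ m) c \<in> K" for m by (induction m) (use c K(2) in auto)
  have "(\<Sum>m\<le>card A. Polynomial.coeff P m * (T ^^ m) c a) = 0" for a
  proof (cases "a \<in> A")
    case True
    thus ?thesis using p(2)[OF True] by (simp add: cf)
  next
    case False
    thus ?thesis using K(3)[OF TK False] by simp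
  qed
  moreover have "P \<noteq> 0" using p(1) cf by (metis atMost_iff coeff_0)
  moreover have "degree P \<le> card A" unfolding P_def
    by (rule degree_sum_le) (auto intro: order_trans[OF degree_monom_le])
  ultimately show ?thesis using eigenvector_of_annihilator[of T K P "card A" c, OF T K(1,2)] c by blast
qed

section \<open>Differentials of shifts of homogeneous functions\<close>

lemma pdeg_homog:
  assumes "F \<in> pf J" "homog d F" shows "pdeg J d F"
proof -
  have "hc F d = F"
  proof
    fix x
    have "line_poly F (\<lambda>i. 0) x = Polynomial.monom (F x) d"
      by (rule line_poly_eqI) (simp add: Polynomial.poly_monom homogD[OF assms(2)])
    thus "hc F d x = F x" by (simp add: hc_def)
  qed
  thus ?thesis using assms(1) pdeg_hc[of J _ F d] by (auto elim: pfE)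
qed

text \<open>There is no cutoff in \<open>j\<close>: at and above the degree the coefficients are
  constants by \<open>shift_top_const\<close>, which every subalgebra contains.\<close>

definition shift :: "('i \<Rightarrow> 'k::field_char_0) \<Rightarrow> (('i \<Rightarrow> 'k) \<Rightarrow> 'k) \<Rightarrow> nat \<Rightarrow> ('i \<Rightarrow> 'k) \<Rightarrow> 'k" where
  "shift \<xi> F j x = Polynomial.coeff (line_poly F x \<xi>) j"

lemma pf_shift: "F \<in> pf J \<Longrightarrow> shift \<xi> F j \<in> pf J"
  unfolding shift_def[abs_def] by (rule pf_line_coeff)

lemma dd_shift: "F \<in> pf J \<Longrightarrow> dd (shift \<xi> F j) y x = Polynomial.coeff (line_poly (dd F y) x \<xi>) j"
  unfolding shift_def[abs_def] by (rule line_poly_swap_coeff)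

lemma homog_shift:
  assumes F: "F \<in> pf J" "homog d F" and j: "j < d"
  shows "homog (d - j) (shift \<xi> F j)"
  unfolding homog_def
proof (intro allI)
  fix t x
  show "shift \<xi> F j (\<lambda>i. t * x i) = t ^ (d - j) * shift \<xi> F j x"
  proof (cases "t = 0")
    case True
    have "line_poly F (\<lambda>i. 0) \<xi> = Polynomial.monom (F \<xi>) d"
      by (rule line_poly_eqI) (simp add: Polynomial.poly_monom homogD[OF F(2)])
    thus ?thesis using True j by (simp add: shift_def)
  next
    case False
    have "pcompose (line_poly F (\<lambda>i. t * x i) \<xi>) [:0, t:] = Polynomial.smult (t ^ d) (line_poly F x \<xi>)"
    proof (rule poly_ext)
      fix s
      have "F (\<lambda>i. t * x i + t * (s * \<xi> i)) = F (\<lambda>i. t * (x i + s * \<xi> i))" by (simp add: algebra_simps)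
      also have "\<dots> = t ^ d * F (\<lambda>i. x i + s * \<xi> i)" by (rule homogD[OF F(2)])
      finally show "poly (pcompose (line_poly F (\<lambda>i. t * x i) \<xi>) [:0, t:]) s = poly (Polynomial.smult (t ^ d) (line_poly F x \<xi>)) s"
        by (simp add: poly_pcompose poly_line_poly[OF F(1)] ac_simps)
    qed
    hence "Polynomial.coeff (pcompose (line_poly F (\<lambda>i. t * x i) \<xi>) [:0, t:]) j = Polynomial.coeff (Polynomial.smult (t ^ d) (line_poly F x \<xi>)) j"
      by simp
    hence "t ^ j * shift \<xi> F j (\<lambda>i. t * x i) = t ^ d * shift \<xi> F j x"
      by (simp only: coeff_pcompose_scale coeff_smult shift_def)
    also have "t ^ d = t ^ j * t ^ (d - j)" using j by (simp add: power_add[symmetric])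
    finally show ?thesis using False by simp
  qed
qed

lemma dd_line_sum:
  assumes F: "F \<in> pf J" "homog d F" "d > 0"
  shows "dd F y (\<lambda>i. x i + a * \<xi> i) = (\<Sum>j<d. a ^ j * dd (shift \<xi> F j) y x)"
proof -
  have "dd F y (\<lambda>i. x i + a * \<xi> i) = poly (line_poly (dd F y) x \<xi>) a"
    by (rule poly_line_poly[OF pf_dd[OF F(1)], symmetric])
  also have "\<dots> = (\<Sum>j\<le>d - 1. Polynomial.coeff (line_poly (dd F y) x \<xi>) j * a ^ j)"
    by (rule poly_as_sum[OF degree_line_poly[OF pdeg_dd[OF pdeg_homog[OF F(1,2)]]]])
  also have "\<dots> = (\<Sum>j<d. a ^ j * dd (shift \<xi> F j) y x)"
    by (rule sum.cong) (use F(3) in \<open>auto simp: dd_shift[OF F(1)]\<close>)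
  finally show ?thesis .
qed

text \<open>The shift with index \<open>d - 1\<close> is linear in \<open>x\<close>, so its
  differential is the same everywhere. This links the shifts to the stabiliser of
  \<open>\<xi>\<close>.\<close>

lemma dd_shift_top:
  assumes F: "F \<in> pf J" "homog d F" "d > 0"
  shows "dd (shift \<xi> F (d - 1)) y x = dd F y \<xi>"
proof -
  have "pdeg J 0 (\<lambda>x. Polynomial.coeff (line_poly (dd F y) x \<xi>) (d - 1))"
    using pdeg_line_coeff(1)[OF pdeg_dd[OF pdeg_homog[OF F(1,2)]], of "d - 1" y \<xi>] by simp
  from pdeg_0_const[OF this, of x "\<lambda>i. 0"]
  have "dd (shift \<xi> F (d - 1)) y x = Polynomial.coeff (line_poly (dd F y) (\<lambda>i. 0) \<xi>) (d - 1)"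
    by (simp add: dd_shift[OF F(1)])
  also have "line_poly (dd F y) (\<lambda>i. 0) \<xi> = Polynomial.monom (dd F y \<xi>) (d - 1)"
  proof -
    have "[:0, 1:] * line_poly (dd F y) (\<lambda>i. 0) \<xi> = [:0, 1:] * Polynomial.monom (dd F y \<xi>) (d - 1)"
    proof (rule poly_ext)
      fix t
      have "poly (line_poly (dd F y) (\<lambda>i. 0) \<xi>) t = dd F y (\<lambda>i. t * \<xi> i)"
        using poly_line_poly[OF pf_dd[OF F(1)], of y "\<lambda>i. 0" \<xi> t] by simp
      moreover have "t * dd F y (\<lambda>i. t * \<xi> i) = t ^ d * dd F y \<xi>" by (rule dd_scale[OF F(1,2)])
      moreover have "t ^ d = t * t ^ (d - 1)" using F(3) by (cases d) auto
      ultimately show "poly ([:0, 1:] * line_poly (dd F y) (\<lambda>i. 0) \<xi>) t = poly ([:0, 1:] * Polynomial.monom (dd F y \<xi>) (d - 1)) t"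
        by (simp add: Polynomial.poly_monom ac_simps)
    qed
    thus ?thesis by (subst (asm) mult_left_cancel) auto
  qed
  finally show ?thesis by simp
qed

context lie_acf
begin

text \<open>Centrality at \<open>\<eta> + a \<xi>\<close> expanded in powers of \<open>a\<close>:
  the Lenard-Magri recursion between the Lie-Poisson form at \<open>\<eta>\<close> and the form
  given by \<open>\<xi>\<close>.\<close>

lemma central_line:
  assumes h: "central h" and \<eta>: "\<eta> \<in> V" "\<xi> \<in> V"
  shows "dd (shift \<xi> h 0) (\<lambda>b. \<eta> (br b z)) \<eta> = 0"
    and "dd (shift \<xi> h (Suc j)) (\<lambda>b. \<eta> (br b z)) \<eta> + dd (shift \<xi> h j) (\<lambda>b. \<xi> (br b z)) \<eta> = 0"
proof -
  have hp: "h \<in> pf Basis" using h by (rule central_pf)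
  let ?A = "\<lambda>b. \<eta> (br b z)" and ?B = "\<lambda>b. \<xi> (br b z)"
  let ?L = "\<lambda>y. line_poly (dd h y) \<eta> \<xi>"
  have e: "?L ?A + pCons 0 (?L ?B) = 0"
  proof (rule poly_ext)
    fix a
    let ?p = "\<lambda>i. \<eta> i + a * \<xi> i"
    have p: "?p \<in> V" by (rule V_comb[OF \<eta>])
    have "\<forall>z. ?p (br (grad h ?p) z) = 0" by (rule bspec[OF conjunct2[OF h[unfolded central_def]] p])
    hence "?p (br (grad h ?p) z) = 0" by (rule spec)
    hence "dd h ?A ?p + a * dd h ?B ?p = 0" by (simp only: grad_ad[OF hp \<eta>(1)] grad_ad[OF hp \<eta>(2)])
    thus "poly (?L ?A + pCons 0 (?L ?B)) a = poly 0 a" by (simp add: poly_line_poly[OF pf_dd[OF hp]])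
  qed
  have "Polynomial.coeff (?L ?A + pCons 0 (?L ?B)) 0 = 0" unfolding e by simp
  thus "dd (shift \<xi> h 0) ?A \<eta> = 0" by (simp add: dd_shift[OF hp])
  have "Polynomial.coeff (?L ?A + pCons 0 (?L ?B)) (Suc j) = 0" unfolding e by simp
  thus "dd (shift \<xi> h (Suc j)) ?A \<eta> + dd (shift \<xi> h j) ?B \<eta> = 0" by (simp add: dd_shift[OF hp])
qed

text \<open>Gradients at the points with parameters \<open>a\<close> and \<open>a'\<close> lie in
  the kernels of the two forms at these points. For different parameters this gives two linear
  equations that make both the \<open>\<eta>\<close>- and the \<open>\<xi>\<close>-pairing vanish;
  afterwards the coefficients are extracted in \<open>a\<close> and then in
  \<open>a'\<close>.\<close>

lemma shifts_commute:
  assumes h: "central h" "central h'" and \<eta>: "\<eta> \<in> V" "\<xi> \<in> V"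
  shows "\<eta> (br (grad (shift \<xi> h j) \<eta>) (grad (shift \<xi> h' j') \<eta>)) = 0"
proof -
  have hp: "h \<in> pf Basis" "h' \<in> pf Basis" using h by (auto intro: central_pf)
  let ?p = "\<lambda>a i. \<eta> i + a * \<xi> i"
  have p: "?p a \<in> V" for a by (rule V_comb[OF \<eta>])
  have off: "\<eta> (br (grad h (?p a)) (grad h' (?p a'))) = 0" if "a \<noteq> a'" for a a'
  proof -
    let ?v = "grad h (?p a)" and ?v' = "grad h' (?p a')"
    have "?p a (br ?v ?v') = 0" by (rule spec[OF bspec[OF conjunct2[OF h(1)[unfolded central_def]] p]])
    hence 1: "\<eta> (br ?v ?v') + a * \<xi> (br ?v ?v') = 0" .
    have "?p a' (br ?v' ?v) = 0" by (rule spec[OF bspec[OF conjunct2[OF h(2)[unfolded central_def]] p]])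
    hence "\<eta> (br ?v' ?v) + a' * \<xi> (br ?v' ?v) = 0" .
    hence 2: "\<eta> (br ?v ?v') + a' * \<xi> (br ?v ?v') = 0"
      using V_skew[OF \<eta>(1), of ?v ?v'] V_skew[OF \<eta>(2), of ?v ?v'] by (simp add: add_eq_0_iff)
    have "\<eta> (br ?v ?v') + a * \<xi> (br ?v ?v') = \<eta> (br ?v ?v') + a' * \<xi> (br ?v ?v')" by (simp only: 1 2)
    hence "a * \<xi> (br ?v ?v') = a' * \<xi> (br ?v ?v')" by (simp only: add_left_cancel)
    hence "\<xi> (br ?v ?v') = 0" using that by simp
    thus ?thesis using 1 by simp
  qed
  \<comment> \<open>Multiplying by \<open>a - a'\<close> removes the excluded parameter and leaves a
    polynomial identity in \<open>a\<close>.\<close>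
  have coeff0: "dd (shift \<xi> f j) y \<eta> = 0" if f: "f \<in> pf Basis" and z: "\<And>a. a \<noteq> a' \<Longrightarrow> dd f y (?p a) = 0" for f y j a'
  proof -
    have "[:- a', 1:] * line_poly (dd f y) \<eta> \<xi> = 0"
    proof (rule poly_ext)
      fix a show "poly ([:- a', 1:] * line_poly (dd f y) \<eta> \<xi>) a = poly 0 a"
        using z[of a] by (cases "a = a'") (auto simp: poly_line_poly[OF pf_dd[OF f]])
    qed
    hence "line_poly (dd f y) \<eta> \<xi> = 0" by (simp only: mult_eq_0_iff) simp
    thus ?thesis by (simp add: dd_shift[OF f])
  qed
  have 1: "\<eta> (br (grad (shift \<xi> h j) \<eta>) (grad h' (?p a'))) = 0" for a'
    unfolding grad_ad[OF pf_shift[OF hp(1)] \<eta>(1)]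
  proof (rule coeff0[OF hp(1), of a'])
    fix a assume "a \<noteq> a'"
    from off[OF this] show "dd h (\<lambda>b. \<eta> (br b (grad h' (?p a')))) (?p a) = 0"
      by (simp only: grad_ad[OF hp(1) \<eta>(1)])
  qed
  let ?w = "grad (shift \<xi> h j) \<eta>"
  have "\<eta> (br (grad (shift \<xi> h' j') \<eta>) ?w) = 0"
    unfolding grad_ad[OF pf_shift[OF hp(2)] \<eta>(1)]
  proof (rule coeff0[OF hp(2), of 0])
    fix a
    have "\<eta> (br (grad h' (?p a)) ?w) = 0" using 1[of a] V_skew[OF \<eta>(1), of ?w "grad h' (?p a)"] by simp
    thus "dd h' (\<lambda>b. \<eta> (br b ?w)) (?p a) = 0" by (simp only: grad_ad[OF hp(2) \<eta>(1)])
  qed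
  thus ?thesis using V_skew[OF \<eta>(1), of ?w "grad (shift \<xi> h' j') \<eta>"] by simp
qed

text \<open>A relation between the differentials of the shifts at \<open>\<eta>\<close> can be shifted in \<open>j\<close>, up to a correction in the top
  components that is read off with the dual family \<open>Y\<close>. An eigenvector of this operation on relations, with
  eigenvalue \<open>r\<close>, is a relation between the differentials of the \<open>h k\<close> at the point \<open>\<eta> + r \<xi>\<close>.\<close>

lemma shifts_independent:
  assumes h: "\<And>k. k < ind \<Longrightarrow> central (h k)" "\<And>k. k < ind \<Longrightarrow> homog (d k) (h k)" "\<And>k. k < ind \<Longrightarrow> d k > 0"
    and dind: "\<And>x. ext x \<in> reg \<Longrightarrow> dindep ind h x"
    and \<xi>: "\<xi> \<in> reg" and \<eta>: "\<eta> \<in> V" and line: "\<And>a. (\<lambda>i. \<eta> i + a * \<xi> i) \<in> reg"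
    and rel: "\<And>y. (\<Sum>a\<in>Sigma {..<ind} (\<lambda>k. {..<d k}). c a * dd (shift \<xi> (h (fst a)) (snd a)) y \<eta>) = 0"
    and a: "a \<in> Sigma {..<ind} (\<lambda>k. {..<d k})"
  shows "c a = 0"
proof (rule ccontr)
  assume ca: "c a \<noteq> 0"
  let ?A = "Sigma {..<ind} (\<lambda>k. {..<d k})"
  have \<xi>V: "\<xi> \<in> V" using \<xi> by (simp add: dual_reg_def)
  have hp: "h k \<in> pf Basis" if "k < ind" for k using central_pf[OF h(1)[OF that]] .
  define u where "u a y = dd (shift \<xi> (h (fst a)) (snd a)) y \<eta>" for a y
  have u_lin: "u a (\<lambda>i. s * y i + t * y' i) = s * u a y + t * u a y'" if "a \<in> ?A" for a s t y y'
    unfolding u_def by (rule dd_linear[OF pf_shift[OF hp]]) (use that in auto)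
  have sumA: "(\<Sum>a\<in>?A. f a) = (\<Sum>k<ind. \<Sum>j<d k. f (k, j))" for f :: "nat \<times> nat \<Rightarrow> 'k"
    by (simp add: sum.Sigma)
  have u_line: "(\<Sum>j<d k. s ^ j * u (k, j) y) = dd (h k) y (\<lambda>i. \<eta> i + s * \<xi> i)" if "k < ind" for k s y
    using dd_line_sum[OF hp[OF that] h(2)[OF that] h(3)[OF that], of y \<eta> s \<xi>] by (simp add: u_def)
  have u_top: "u (k, d k - 1) y = dd (h k) y \<xi>" if "k < ind" for k y
    using dd_shift_top[OF hp[OF that] h(2)[OF that] h(3)[OF that], of \<xi> y \<eta>] by (simp add: u_def)
  have "dindep ind h \<xi>" using dind[of \<xi>] \<xi> \<xi>V by simp
  hence li: "lindep ind (\<lambda>k. grad (h k) \<xi>)" using dindep_lindep[of ind h, OF hp] by simp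
  obtain Y where Y: "\<And>i k. i < ind \<Longrightarrow> k < ind \<Longrightarrow> dd (h k) (Y i) \<xi> = (if i = k then 1 else 0)"
    using dual_family[OF li] by (auto simp: ext_grad[OF hp])
  \<comment> \<open>Moves every coefficient one index down in \<open>j\<close> and puts 0 at the top
    index.\<close>
  define S where "S c a = (if a \<in> ?A \<and> Suc (snd a) < d (fst a) then c (fst a, Suc (snd a)) else 0)"
    for c :: "nat \<times> nat \<Rightarrow> 'k" and a
  \<comment> \<open>The coordinates of the shifted combination with respect to the gradients of the
    \<open>h k\<close> at \<open>\<xi>\<close>, read off by the dual directions
    \<open>Y\<close>.\<close>
  define \<gamma> where "\<gamma> c k = (\<Sum>a\<in>?A. S c a * u a (Y k))" for c k
  define T where "T c a = S c a - (if a \<in> ?A \<and> Suc (snd a) = d (fst a) then \<gamma> c (fst a) else 0)" for c a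
  define K where "K = {c. (\<forall>y. (\<Sum>a\<in>?A. c a * u a y) = 0) \<and> (\<forall>a. a \<notin> ?A \<longrightarrow> c a = 0)}"
  have S_lin: "S (\<lambda>a. s * c a + t * c' a) a = s * S c a + t * S c' a" for s t c c' a by (simp add: S_def)
  have \<gamma>_lin: "\<gamma> (\<lambda>a. s * c a + t * c' a) k = s * \<gamma> c k + t * \<gamma> c' k" for s t c c' k
    by (simp add: \<gamma>_def S_lin sum.distrib sum_distrib_left algebra_simps)
  have T_lin: "T (\<lambda>a. s * c a + t * c' a) = (\<lambda>a. s * T c a + t * T c' a)" for s t c c'
    by (rule HOL.ext) (simp add: T_def S_lin \<gamma>_lin algebra_simps)
  have K_lin: "(\<lambda>a. s * c a + t * c' a) \<in> K" if "c \<in> K" "c' \<in> K" for s t c c'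
  proof -
    have "(\<Sum>a\<in>?A. (s * c a + t * c' a) * u a y) = s * (\<Sum>a\<in>?A. c a * u a y) + t * (\<Sum>a\<in>?A. c' a * u a y)" for y
      by (simp add: sum.distrib sum_distrib_left algebra_simps)
    thus ?thesis using that by (simp add: K_def)
  qed
  have T_K: "T c \<in> K" if c: "c \<in> K" for c
  proof -
    have fin: "finite ?A" by auto
    \<comment> \<open>The recursion \<open>central_line\<close> turns the pairing of
      \<open>?W\<close> with \<open>\<xi>\<close> into minus the given relation at
      \<open>\<eta>\<close>, which is zero. So \<open>?W\<close> lies in the stabiliser of
      \<open>\<xi>\<close>, spanned by the gradients of the top shifts, and subtracting it there
      yields a relation.\<close>
    let ?W = "\<Sum>a\<in>?A. sc (S c a) (grad (shift \<xi> (h (fst a)) (snd a)) \<eta>)"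
    have gp: "shift \<xi> (h (fst a)) (snd a) \<in> pf Basis" if "a \<in> ?A" for a
      by (rule pf_shift, rule hp) (use that in auto)
    have extW: "ext y ?W = (\<Sum>a\<in>?A. S c a * u a y)" for y
      by (simp only: V_sum[OF ext_in_V] V_scale[OF ext_in_V]) (rule sum.cong, auto simp: u_def ext_grad[OF gp])
    have "\<xi> (br ?W z) = 0" for z
    proof -
      let ?yA = "\<lambda>b. \<eta> (br b z)" and ?yB = "\<lambda>b. \<xi> (br b z)"
      have "\<xi> (br ?W z) = ext ?yB ?W" by (simp only: ext_V[OF ad_in_V[OF \<xi>V]])
      also have "\<dots> = (\<Sum>k<ind. \<Sum>j<d k. S c (k, j) * u (k, j) ?yB)" unfolding extW sumA ..
      also have "\<dots> = (\<Sum>k<ind. - (\<Sum>j<d k. c (k, j) * u (k, j) ?yA))"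
      proof (rule sum.cong[OF refl])
        fix k assume "k \<in> {..<ind}"
        hence k: "k < ind" by simp
        obtain m where m: "d k = Suc m" using h(3)[OF k] by (cases "d k") auto
        have "(\<Sum>j<d k. S c (k, j) * u (k, j) ?yB) = (\<Sum>j<m. c (k, Suc j) * u (k, j) ?yB)"
          using k by (simp add: m S_def)
        also have "\<dots> = (\<Sum>j<m. - (c (k, Suc j) * u (k, Suc j) ?yA))"
        proof (rule sum.cong[OF refl])
          fix j
          have "u (k, j) ?yB = - u (k, Suc j) ?yA"
            using central_line(2)[OF h(1)[OF k] \<eta> \<xi>V, of j z] by (simp add: u_def eq_neg_iff_add_eq_0 add.commute)
          thus "c (k, Suc j) * u (k, j) ?yB = - (c (k, Suc j) * u (k, Suc j) ?yA)" by simp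
        qed
        also have "\<dots> = - (\<Sum>j<m. c (k, Suc j) * u (k, Suc j) ?yA)" by (rule sum_negf)
        also have "(\<Sum>j<m. c (k, Suc j) * u (k, Suc j) ?yA) = (\<Sum>j<d k. c (k, j) * u (k, j) ?yA)"
        proof -
          have "u (k, 0) ?yA = 0" using central_line(1)[OF h(1)[OF k] \<eta> \<xi>V, of z] by (simp add: u_def)
          thus ?thesis unfolding m by (subst sum.lessThan_Suc_shift) simp
        qed
        finally show "(\<Sum>j<d k. S c (k, j) * u (k, j) ?yB) = - (\<Sum>j<d k. c (k, j) * u (k, j) ?yA)" .
      qed
      also have "\<dots> = - (\<Sum>a\<in>?A. c a * u a ?yA)" unfolding sumA by (rule sum_negf)
      also have "\<dots> = 0" using c by (simp add: K_def)
      finally show ?thesis .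
    qed
    hence "?W \<in> stab \<xi>" by (simp add: coadj_stabiliser_def)
    moreover have "grad (h k) \<xi> \<in> stab \<xi>" if "k < ind" for k using central_stab[OF h(1)[OF that], of \<xi>] \<xi>V by simp
    ultimately obtain g where g: "?W = (\<Sum>k<ind. sc (g k) (grad (h k) \<xi>))"
      using lindep_spans[OF li, of "stab \<xi>" ?W] \<xi> by (auto simp: dual_reg_def)
    have gW: "ext y ?W = (\<Sum>k<ind. g k * dd (h k) y \<xi>)" for y
      unfolding g by (simp only: V_sum[OF ext_in_V] V_scale[OF ext_in_V]) (rule sum.cong, auto simp: ext_grad[OF hp])
    have g\<gamma>: "g k = \<gamma> c k" if k: "k < ind" for k
    proof -
      have "\<gamma> c k = (\<Sum>i<ind. g i * dd (h i) (Y k) \<xi>)" unfolding \<gamma>_def extW[symmetric] gW ..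
      also have "\<dots> = (\<Sum>i<ind. if i = k then g i else 0)" by (rule sum.cong) (use Y k in auto)
      finally show ?thesis using k by simp
    qed
    have "(\<Sum>a\<in>?A. T c a * u a y) = 0" for y
    proof -
      have "(\<Sum>a\<in>?A. (if a \<in> ?A \<and> Suc (snd a) = d (fst a) then \<gamma> c (fst a) else 0) * u a y) = (\<Sum>k<ind. g k * dd (h k) y \<xi>)"
        unfolding sumA
      proof (rule sum.cong[OF refl])
        fix k assume "k \<in> {..<ind}"
        hence k: "k < ind" by simp
        have "(\<Sum>j<d k. (if (k, j) \<in> ?A \<and> Suc (snd (k, j)) = d (fst (k, j)) then \<gamma> c (fst (k, j)) else 0) * u (k, j) y)
          = (\<Sum>j<d k. if j = d k - 1 then \<gamma> c k * u (k, j) y else 0)"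
          by (rule sum.cong) (use k in auto)
        also have "\<dots> = \<gamma> c k * u (k, d k - 1) y" using h(3)[OF k] by simp
        finally show "(\<Sum>j<d k. (if (k, j) \<in> ?A \<and> Suc (snd (k, j)) = d (fst (k, j)) then \<gamma> c (fst (k, j)) else 0) * u (k, j) y)
          = g k * dd (h k) y \<xi>" by (simp add: u_top[OF k, simplified] g\<gamma>[OF k])
      qed
      thus ?thesis using gW[of y] extW[of y] by (simp add: T_def left_diff_distrib sum_subtractf)
    qed
    moreover have "T c a = 0" if "a \<notin> ?A" for a using that unfolding T_def S_def by simp
    ultimately show ?thesis by (simp add: K_def)
  qed
  define c0 where "c0 b = (if b \<in> ?A then c b else 0)" for b
  have c0K: "c0 \<in> K" using rel by (simp add: K_def c0_def u_def cong: sum.cong)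
  have c0n: "c0 \<noteq> (\<lambda>a. 0)" using ca a by (auto simp: c0_def dest!: fun_cong[of _ _ a])
  have "\<exists>c\<in>K. c \<noteq> (\<lambda>a. 0) \<and> (\<exists>r. T c = (\<lambda>a. r * c a))"
  proof (rule eigenvector[where A = ?A and T = T and K = K and c = c0])
    show "finite ?A" by auto
    show "c a = 0" if "c \<in> K" "a \<notin> ?A" for c a using that unfolding K_def by blast
  qed (fact T_lin K_lin T_K c0K c0n)+
  then obtain e r where e: "e \<in> K" "e \<noteq> (\<lambda>a. 0)" "T e = (\<lambda>a. r * e a)" by blast
  \<comment> \<open>Below the top index the eigenvalue equation is a geometric recursion in
    \<open>j\<close>, so the sum over \<open>j\<close> becomes the differential of
    \<open>h k\<close> at \<open>\<eta> + r \<xi>\<close>.\<close>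
  have step: "e (k, Suc j) = r * e (k, j)" if "k < ind" "Suc j < d k" for k j
    using fun_cong[OF e(3), of "(k, j)"] that by (simp add: T_def S_def)
  have pow: "e (k, j) = r ^ j * e (k, 0)" if "k < ind" "j < d k" for k j
    using that(2)
  proof (induction j)
    case (Suc j)
    thus ?case using step[OF that(1), of j] by simp
  qed simp
  have "(\<Sum>k<ind. e (k, 0) * dd (h k) y (\<lambda>i. \<eta> i + r * \<xi> i)) = 0" for y
  proof -
    have "(\<Sum>k<ind. e (k, 0) * dd (h k) y (\<lambda>i. \<eta> i + r * \<xi> i)) = (\<Sum>k<ind. \<Sum>j<d k. e (k, j) * u (k, j) y)"
    proof (rule sum.cong[OF refl])
      fix k assume "k \<in> {..<ind}"
      hence k: "k < ind" by simp
      show "e (k, 0) * dd (h k) y (\<lambda>i. \<eta> i + r * \<xi> i) = (\<Sum>j<d k. e (k, j) * u (k, j) y)"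
        unfolding u_line[OF k, symmetric] sum_distrib_left
      proof (rule sum.cong[OF refl])
        fix j assume "j \<in> {..<d k}"
        hence "j < d k" by simp
        show "e (k, 0) * (r ^ j * u (k, j) y) = e (k, j) * u (k, j) y"
          unfolding pow[OF k \<open>j < d k\<close>] by (simp only: mult.assoc mult.left_commute)
      qed
    qed
    also have "\<dots> = (\<Sum>a\<in>?A. e a * u a y)" by (rule sumA[symmetric])
    finally show ?thesis using e(1) by (simp add: K_def)
  qed
  moreover have "dindep ind h (\<lambda>i. \<eta> i + r * \<xi> i)" by (rule dind) (simp only: ext_V[OF V_comb[OF \<eta> \<xi>V]] line)
  ultimately have z: "e (k, 0) = 0" if "k < ind" for k
    using dindepD[where c = "\<lambda>k. e (k, 0)" and F = h and i = k] that by blast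
  have "e a = 0" for a
  proof (cases "a \<in> ?A")
    case True
    then obtain k j where a: "a = (k, j)" "k < ind" "j < d k" by auto
    show ?thesis unfolding a(1) pow[OF a(2,3)] z[OF a(2)] by simp
  next
    case False
    thus ?thesis using e(1) unfolding K_def by blast
  qed
  thus False using e(2) by auto
qed

section \<open>Isotropic subspaces\<close>

text \<open>A combination of the \<open>w i\<close> orthogonal to the \<open>qdim - m\<close>
  vectors completing them to a basis, and killed by \<open>ind\<close> covectors dual to the
  stabiliser, lies in the stabiliser and is zero. Hence the \<open>m\<close> unknowns cannot exceed
  the number of equations.\<close>

lemma isotropic_bound:
  assumes \<eta>: "\<eta> \<in> reg" and li: "lindep m w" and iso: "\<And>i j. i < m \<Longrightarrow> j < m \<Longrightarrow> \<eta> (br (w i) (w j)) = 0"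
  shows "2 * m \<le> qdim + ind"
proof (rule ccontr)
  assume n: "\<not> ?thesis"
  have \<eta>V: "\<eta> \<in> V" and dim: "dim (stab \<eta>) = ind" using \<eta> by (auto simp: dual_reg_def)
  let ?B0 = "w ` {..<m}"
  obtain B where B: "?B0 \<subseteq> B" "independent B" "UNIV \<subseteq> span B"
    using maximal_independent_subset_extend[of ?B0 UNIV] lindep_set(2)[OF li] by auto
  have finB: "finite B" using B(2) by (rule finiteI_independent)
  have "span B = UNIV" using B(3) by auto
  hence cB: "card B = qdim" using dim_eq_card[of B UNIV] B(2) dim_UNIV by simp
  have cB0: "card ?B0 = m" using card_image[OF lindep_set(1)[OF li]] by simp
  obtain r where r: "\<And>j. j < ind \<Longrightarrow> r j \<in> stab \<eta>" "lindep ind r" "\<And>z. z \<in> stab \<eta> \<Longrightarrow> \<exists>c. z = (\<Sum>j<ind. sc (c j) (r j))"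
    using subspace_family[OF subspace_stab[OF \<eta>V]] unfolding dim by blast
  obtain Y where Y: "\<And>i j. i < ind \<Longrightarrow> j < ind \<Longrightarrow> ext (Y i) (r j) = (if i = j then 1 else 0)"
    using dual_family[OF r(2)] by blast
  let ?E = "(B - ?B0) <+> {..<ind}"
  have "card ?E = (qdim - m) + ind"
    using finB B(1) cB cB0 by (simp add: card_Plus card_Diff_subset)
  moreover have "m \<le> qdim" using card_mono[OF finB B(1)] cB cB0 by simp
  ultimately have "card ?E < card {..<m}" using n by simp
  from underdetermined_system[OF _ _ this, of "\<lambda>i e. case e of Inl b \<Rightarrow> \<eta> (br (w i) b) | Inr k \<Rightarrow> ext (Y k) (w i)"] finB
  obtain c where c: "\<exists>i\<in>{..<m}. c i \<noteq> 0"
    "\<And>e. e \<in> ?E \<Longrightarrow> (\<Sum>i<m. c i * (case e of Inl b \<Rightarrow> \<eta> (br (w i) b) | Inr k \<Rightarrow> ext (Y k) (w i))) = 0" by auto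
  let ?x = "\<Sum>i<m. sc (c i) (w i)"
  have xB: "\<eta> (br ?x b) = 0" if "b \<in> B" for b
  proof (cases "b \<in> ?B0")
    case True
    then obtain j where "j < m" "b = w j" by auto
    thus ?thesis using iso by (simp add: V_br_sum(1)[OF \<eta>V])
  next
    case False
    have "Inl b \<in> ?E" using False that by auto
    from c(2)[OF this] show ?thesis by (simp add: V_br_sum(1)[OF \<eta>V])
  qed
  have "\<eta> (br ?x z) = 0" for z
  proof -
    have "z \<in> span B" using B(3) by auto
    then obtain v where v: "z = (\<Sum>b\<in>B. sc (v b) b)" unfolding span_finite[OF finB] by auto
    show ?thesis unfolding v V_br_sum(2)[OF \<eta>V] by (rule sum.neutral) (simp add: xB)
  qed
  hence "?x \<in> stab \<eta>" by (simp add: coadj_stabiliser_def)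
  then obtain c' where c': "?x = (\<Sum>j<ind. sc (c' j) (r j))" using r(3) by blast
  have "c' k = 0" if k: "k < ind" for k
  proof -
    have "Inr k \<in> ?E" using k by auto
    from c(2)[OF this] have "ext (Y k) ?x = 0" by (simp add: V_sum[OF ext_in_V] V_scale[OF ext_in_V])
    moreover have "ext (Y k) ?x = (\<Sum>j<ind. c' j * ext (Y k) (r j))"
      unfolding c' by (simp only: V_sum[OF ext_in_V] V_scale[OF ext_in_V])
    moreover have "\<dots> = (\<Sum>j<ind. if j = k then c' j else 0)" by (rule sum.cong) (use Y k in auto)
    ultimately show ?thesis using k by simp
  qed
  hence "?x = 0" unfolding c' by simp
  thus False using lindepD[OF li] c(1) by auto
qed

text \<open>Adjoining an independent \<open>z\<close> would give \<open>m + 1\<close> isotropic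
  vectors, and \<open>2 * (m + 1)\<close> exceeds \<open>qdim + ind\<close> even if the division
  rounds down.\<close>

lemma maximal_isotropic:
  assumes \<eta>: "\<eta> \<in> reg" and m: "m = (qdim + ind) div 2" and li: "lindep m w"
    and iso: "\<And>i j. i < m \<Longrightarrow> j < m \<Longrightarrow> \<eta> (br (w i) (w j)) = 0"
    and z: "\<And>i. i < m \<Longrightarrow> \<eta> (br z (w i)) = 0"
  shows "\<exists>c. z = (\<Sum>i<m. sc (c i) (w i))"
proof (rule ccontr)
  assume n: "\<not> ?thesis"
  have \<eta>V: "\<eta> \<in> V" using \<eta> by (auto simp: dual_reg_def)
  let ?w = "\<lambda>i. if i = m then z else w i"
  have "lindep (Suc m) ?w"
    unfolding lindep_def
  proof (intro allI impI)
    fix c i assume s: "(\<Sum>j<Suc m. sc (c j) (?w j)) = 0" and i: "i < Suc m"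
    have s': "(\<Sum>j<m. sc (c j) (w j)) + sc (c m) z = 0" using s by simp
    have cm: "c m = 0"
    proof (rule ccontr)
      assume cm: "c m \<noteq> 0"
      have "sc (c m) z = - (\<Sum>j<m. sc (c j) (w j))" using s' by (simp add: eq_neg_iff_add_eq_0 add.commute)
      hence "sc (inverse (c m)) (sc (c m) z) = sc (inverse (c m)) (- (\<Sum>j<m. sc (c j) (w j)))" by simp
      hence "z = (\<Sum>j<m. sc (- inverse (c m) * c j) (w j))"
        using cm by (simp add: scale_sum_right sum_negf[symmetric])
      hence "\<exists>c. z = (\<Sum>j<m. sc (c j) (w j))" by (rule exI[where x = "\<lambda>j. - inverse (c m) * c j"])
      with n show False by contradiction
    qed
    hence "(\<Sum>j<m. sc (c j) (w j)) = 0" using s' by simp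
    from lindepD[OF li this] show "c i = 0" using cm i by (cases "i = m") auto
  qed
  moreover have "\<eta> (br (?w i) (?w j)) = 0" if "i < Suc m" "j < Suc m" for i j
  proof -
    have "\<eta> (br z z) = 0" by (simp add: br_alternating V_zero[OF \<eta>V])
    moreover have "\<eta> (br (w i) z) = 0" if "i < m" for i using z[OF that] V_skew[OF \<eta>V, of "w i" z] by simp
    ultimately show ?thesis using that iso z by (auto simp: less_Suc_eq)
  qed
  ultimately have "2 * Suc m \<le> qdim + ind" by (rule isotropic_bound[OF \<eta>])
  thus False using m by simp
qed

end

section \<open>Algebras of functions\<close>

text \<open>The generators are their own indeterminates: the variable \<open>g\<close> is evaluated
  to \<open>g x\<close>.\<close>

definition gen :: "(('p \<Rightarrow> 'k) \<Rightarrow> bool) \<Rightarrow> ('p \<Rightarrow> 'k::field_char_0) set" where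
  "gen G = {\<lambda>x. \<psi> (\<lambda>g. g x) |\<psi>. \<psi> \<in> pf (Collect G)}"

lemma fsubalg_gen: "fsubalg (gen G)"
proof -
  have c: "(\<lambda>p. c) \<in> gen G" for c
    unfolding gen_def by (intro CollectI exI[of _ "\<lambda>y. c"]) simp
  have "(\<lambda>p. F p + F' p) \<in> gen G \<and> (\<lambda>p. F p * F' p) \<in> gen G" if FF: "F \<in> gen G" "F' \<in> gen G" for F F'
  proof -
    from FF obtain \<psi> \<psi>' where "\<psi> \<in> pf (Collect G)" "F = (\<lambda>x. \<psi> (\<lambda>g. g x))" "\<psi>' \<in> pf (Collect G)" "F' = (\<lambda>x. \<psi>' (\<lambda>g. g x))"
      unfolding gen_def by blast
    moreover from this have "(\<lambda>y. \<psi> y + \<psi>' y) \<in> pf (Collect G)" "(\<lambda>y. \<psi> y * \<psi>' y) \<in> pf (Collect G)" by auto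
    ultimately show ?thesis unfolding gen_def
      by (intro conjI CollectI exI[of _ "\<lambda>y. \<psi> y + \<psi>' y"] exI[of _ "\<lambda>y. \<psi> y * \<psi>' y"]) simp_all
  qed
  thus ?thesis using c unfolding fsubalg_def by blast
qed

lemma gen_incl: "G g \<Longrightarrow> g \<in> gen G"
  unfolding gen_def by (intro CollectI exI[of _ "\<lambda>y. y g"] conjI pf_var) auto

lemma gen_min:
  assumes "fsubalg R" "\<And>g. G g \<Longrightarrow> g \<in> R" shows "gen G \<subseteq> R"
proof
  fix F assume "F \<in> gen G"
  then obtain \<psi> where \<psi>: "\<psi> \<in> pf (Collect G)" "F = (\<lambda>x. \<psi> (\<lambda>g. g x))" unfolding gen_def by blast
  show "F \<in> R" unfolding \<psi>(2) by (rule fsubalg_compose[OF assms(1) \<psi>(1), where g = "\<lambda>g. g"]) (use assms(2) in auto)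
qed

lemma fsubalg_const: "fsubalg R \<Longrightarrow> (\<lambda>p. c) \<in> R" by (simp add: fsubalg_def)
lemma fsubalg_add: "fsubalg R \<Longrightarrow> F \<in> R \<Longrightarrow> F' \<in> R \<Longrightarrow> (\<lambda>p. F p + F' p) \<in> R" by (simp add: fsubalg_def)
lemma fsubalg_mult: "fsubalg R \<Longrightarrow> F \<in> R \<Longrightarrow> F' \<in> R \<Longrightarrow> (\<lambda>p. F p * F' p) \<in> R" by (simp add: fsubalg_def)

lemma fsubalg_uminus: "fsubalg R \<Longrightarrow> F \<in> R \<Longrightarrow> (\<lambda>p. - F p) \<in> R"
  using fsubalg_mult[of R "\<lambda>p. - 1" F] fsubalg_const[of R "- 1"] by simp

lemma fsubalg_diff: "fsubalg R \<Longrightarrow> F \<in> R \<Longrightarrow> F' \<in> R \<Longrightarrow> (\<lambda>p. F p - F' p) \<in> R"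
  using fsubalg_add[of R F "\<lambda>p. - F' p"] fsubalg_uminus[of R F'] by simp

lemma fsubalg_pf: "fsubalg (pf J)" by (auto simp: fsubalg_def)

lemma gen_pf: "(\<And>g. G g \<Longrightarrow> g \<in> pf J) \<Longrightarrow> gen G \<subseteq> pf J"
  by (rule gen_min[OF fsubalg_pf])

definition family :: "nat \<Rightarrow> (nat \<Rightarrow> 'p \<Rightarrow> 'k) \<Rightarrow> ('p \<Rightarrow> 'k) \<Rightarrow> bool" where
  "family r F g \<longleftrightarrow> (\<exists>i<r. g = F i)"

lemma gen_family: "gen (family r F) = {\<lambda>x. \<psi> (\<lambda>i. F i x) |\<psi>. \<psi> \<in> pf {..<r}}"
proof
  let ?R = "{\<lambda>x. \<psi> (\<lambda>i. F i x) |\<psi>. \<psi> \<in> pf {..<r}}"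
  show "?R \<subseteq> gen (family r F)"
  proof
    fix G assume "G \<in> ?R"
    then obtain \<psi> where \<psi>: "\<psi> \<in> pf {..<r}" "G = (\<lambda>x. \<psi> (\<lambda>i. F i x))" by blast
    show "G \<in> gen (family r F)" unfolding \<psi>(2)
      by (rule fsubalg_compose[OF fsubalg_gen \<psi>(1)], rule gen_incl) (auto simp: family_def)
  qed
  show "gen (family r F) \<subseteq> ?R"
  proof
    fix G assume "G \<in> gen (family r F)"
    then obtain \<psi> where \<psi>: "\<psi> \<in> pf (Collect (family r F))" "G = (\<lambda>x. \<psi> (\<lambda>g. g x))" unfolding gen_def by blast
    define i where "i g = (SOME i. i < r \<and> g = F i)" for g
    have i: "i g < r \<and> g = F (i g)" if "family r F g" for g
      unfolding i_def by (rule someI_ex) (use that in \<open>auto simp: family_def\<close>)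
    let ?\<psi> = "\<lambda>y. \<psi> (\<lambda>g. y (i g))"
    have "?\<psi> \<in> pf {..<r}" by (rule pf_compose[OF \<psi>(1)], rule pf_var) (use i in auto)
    moreover have "G = (\<lambda>x. ?\<psi> (\<lambda>i. F i x))"
    proof
      fix x
      have "\<psi> (\<lambda>g. g x) = \<psi> (\<lambda>g. F (i g) x)" by (rule pf_cong_vars[OF \<psi>(1)]) (use i in auto)
      thus "G x = ?\<psi> (\<lambda>i. F i x)" by (simp add: \<psi>(2))
    qed
    ultimately show "G \<in> ?R" by (intro CollectI exI[of _ ?\<psi>]) simp
  qed
qed

text \<open>Restriction to lines is a ring homomorphism into polynomials in the parameter, so shifts
  of products are convolutions of shifts. Consequently the shift algebra depends only on the algebra
  that the shifted functions generate.\<close>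

lemma shift_compose:
  assumes R: "fsubalg R" and \<theta>: "\<theta> \<in> pf K" and u: "\<And>k. k \<in> K \<Longrightarrow> u k \<in> pf J" "\<And>k j. k \<in> K \<Longrightarrow> shift \<xi> (u k) j \<in> R"
  shows "shift \<xi> (\<lambda>x. \<theta> (\<lambda>k. u k x)) j \<in> R"
proof -
  obtain d where "pdeg K d \<theta>" using \<theta> by (rule pfE)
  thus ?thesis
  proof (induction arbitrary: j)
    case (pdeg_const d c)
    have "shift \<xi> (\<lambda>x. c) j = (\<lambda>x. if j = 0 then c else 0)"
      by (rule ext) (simp add: shift_def coeff_pCons split: nat.splits)
    thus ?case by (simp add: fsubalg_const[OF R])
  next
    case (pdeg_var i d)
    thus ?case using u(2)[of i j] by simp
  next
    case (pdeg_add d F G)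
    have p: "(\<lambda>x. F (\<lambda>k. u k x)) \<in> pf J" "(\<lambda>x. G (\<lambda>k. u k x)) \<in> pf J"
      using pf_compose[OF pfI[OF pdeg_add.hyps(1)] u(1)] pf_compose[OF pfI[OF pdeg_add.hyps(2)] u(1)] by simp_all
    have "shift \<xi> (\<lambda>x. F (\<lambda>k. u k x) + G (\<lambda>k. u k x)) j = (\<lambda>x. shift \<xi> (\<lambda>x. F (\<lambda>k. u k x)) j x + shift \<xi> (\<lambda>x. G (\<lambda>k. u k x)) j x)"
      by (rule ext) (simp add: shift_def line_poly_add[OF p])
    thus ?case using fsubalg_add[OF R pdeg_add.IH] by simp
  next
    case (pdeg_mult d F e G)
    have p: "(\<lambda>x. F (\<lambda>k. u k x)) \<in> pf J" "(\<lambda>x. G (\<lambda>k. u k x)) \<in> pf J"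
      using pf_compose[OF pfI[OF pdeg_mult.hyps(1)] u(1)] pf_compose[OF pfI[OF pdeg_mult.hyps(2)] u(1)] by simp_all
    have "shift \<xi> (\<lambda>x. F (\<lambda>k. u k x) * G (\<lambda>k. u k x)) j =
      (\<lambda>x. \<Sum>i\<le>j. shift \<xi> (\<lambda>x. F (\<lambda>k. u k x)) i x * shift \<xi> (\<lambda>x. G (\<lambda>k. u k x)) (j - i) x)"
      by (rule ext) (simp add: shift_def line_poly_mult[OF p] coeff_mult)
    moreover have "(\<lambda>x. \<Sum>i\<le>j. shift \<xi> (\<lambda>x. F (\<lambda>k. u k x)) i x * shift \<xi> (\<lambda>x. G (\<lambda>k. u k x)) (j - i) x) \<in> R"
      by (rule fsubalg_sum[OF R], rule fsubalg_mult[OF R pdeg_mult.IH])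
    ultimately show ?case by simp
  qed
qed

lemma shift_top_const:
  assumes "pdeg J d F" "j \<ge> d" shows "\<exists>c. shift \<xi> F j = (\<lambda>x. c)"
proof (cases "j = d")
  case True
  have "pdeg J 0 (shift \<xi> F j)" using pdeg_line_coeff(1)[OF assms(1), of d \<xi>] True by (simp add: shift_def[abs_def])
  hence "shift \<xi> F j x = shift \<xi> F j (\<lambda>i. 0)" for x by (rule pdeg_0_const)
  thus ?thesis by (intro exI[of _ "shift \<xi> F j (\<lambda>i. 0)"] ext)
next
  case False
  hence "shift \<xi> F j x = 0" for x
    using degree_line_poly[OF assms(1), of x \<xi>] assms(2) by (simp add: shift_def coeff_eq_0)
  thus ?thesis by (intro exI[of _ 0] ext)
qed

section \<open>Coordinate rings\<close>

lemma coord_ring_simps: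
  "monoid.mult (coord_ring X) F G = (\<lambda>x. F x * G x)" "ring.add (coord_ring X) F G = (\<lambda>x. F x + G x)"
  "one (coord_ring X) = const_fun X 1" "zero (coord_ring X) = (\<lambda>x. 0)"
  by (simp_all add: coord_ring_def)

lemma cring_functions:
  fixes A :: "(('i \<Rightarrow> 'k::comm_ring_1) \<Rightarrow> 'k) set"
  assumes out: "\<And>F x. F \<in> A \<Longrightarrow> x \<notin> X \<Longrightarrow> F x = 0"
    and c: "\<And>c. const_fun X c \<in> A"
    and add: "\<And>F G. F \<in> A \<Longrightarrow> G \<in> A \<Longrightarrow> (\<lambda>x. F x + G x) \<in> A"
    and mult: "\<And>F G. F \<in> A \<Longrightarrow> G \<in> A \<Longrightarrow> (\<lambda>x. F x * G x) \<in> A"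
  shows "cring (coord_ring X\<lparr>carrier := A\<rparr>)"
    and "F \<in> A \<Longrightarrow> a_inv (coord_ring X\<lparr>carrier := A\<rparr>) F = (\<lambda>x. - F x)"
proof -
  let ?R = "coord_ring X\<lparr>carrier := A\<rparr>"
  have zero: "(\<lambda>x. 0) \<in> A" using c[of 0] by (simp add: const_fun_def cong: if_cong)
  have neg: "(\<lambda>x. - F x) \<in> A" if "F \<in> A" for F
  proof -
    have "(\<lambda>x. const_fun X (- 1) x * F x) = (\<lambda>x. - F x)"
      by (rule ext) (use out[OF that] in \<open>auto simp: const_fun_def\<close>)
    thus ?thesis using mult[OF c[of "- 1"] that] by simp
  qed
  have ab: "abelian_group ?R"
  proof (rule abelian_groupI)
    fix F assume F: "F \<in> carrier ?R"
    show "\<exists>y\<in>carrier ?R. y \<oplus>\<^bsub>?R\<^esub> F = \<zero>\<^bsub>?R\<^esub>"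
      by (rule bexI[of _ "\<lambda>x. - F x"]) (use F neg in \<open>auto simp: coord_ring_simps\<close>)
  qed (auto simp: coord_ring_simps zero add ac_simps)
  show cr: "cring ?R"
  proof (rule cringI[OF ab])
    show "Group.comm_monoid ?R"
    proof (rule comm_monoidI)
      fix F assume F: "F \<in> carrier ?R"
      show "\<one>\<^bsub>?R\<^esub> \<otimes>\<^bsub>?R\<^esub> F = F"
        by (rule ext) (use F out[of F] in \<open>auto simp: coord_ring_simps const_fun_def\<close>)
    qed (auto simp: coord_ring_simps c mult ac_simps)
  qed (auto simp: coord_ring_simps algebra_simps)
  show "a_inv ?R F = (\<lambda>x. - F x)" if F: "F \<in> A"
    by (rule abelian_group.minus_equality[OF ab]) (use F neg in \<open>auto simp: coord_ring_simps\<close>)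
qed

lemma coord_funs_closed:
  fixes X :: "('i \<Rightarrow> 'k::field_char_0) set"
  shows "F \<in> coord_funs X \<Longrightarrow> x \<notin> X \<Longrightarrow> F x = 0" "const_fun X c \<in> coord_funs X"
    "F \<in> coord_funs X \<Longrightarrow> G \<in> coord_funs X \<Longrightarrow> (\<lambda>x. F x + G x) \<in> coord_funs X"
    "F \<in> coord_funs X \<Longrightarrow> G \<in> coord_funs X \<Longrightarrow> (\<lambda>x. F x * G x) \<in> coord_funs X"
proof -
  show "F \<in> coord_funs X \<Longrightarrow> x \<notin> X \<Longrightarrow> F x = 0" by (auto simp: coord_funs_eq)
  show "const_fun X c \<in> coord_funs X" unfolding coord_funs_eq const_fun_def
    by (intro CollectI exI[of _ "\<lambda>x. c"]) simp
  assume "F \<in> coord_funs X" "G \<in> coord_funs X"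
  then obtain F' G' where F: "F' \<in> pf UNIV" "F = (\<lambda>x. if x \<in> X then F' x else 0)"
    and G: "G' \<in> pf UNIV" "G = (\<lambda>x. if x \<in> X then G' x else 0)" unfolding coord_funs_eq by blast
  show "(\<lambda>x. F x + G x) \<in> coord_funs X" unfolding coord_funs_eq
    by (intro CollectI exI[of _ "\<lambda>x. F' x + G' x"] conjI ext pf_add F(1) G(1)) (simp add: F(2) G(2))
  show "(\<lambda>x. F x * G x) \<in> coord_funs X" unfolding coord_funs_eq
    by (intro CollectI exI[of _ "\<lambda>x. F' x * G' x"] conjI ext pf_mult F(1) G(1)) (simp add: F(2) G(2))
qed

lemma coord_ring_carrier: "coord_ring X\<lparr>carrier := coord_funs X\<rparr> = coord_ring X"
  by (simp add: coord_ring_def)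

lemma cring_coord: "cring (coord_ring (X :: ('i \<Rightarrow> 'k::field_char_0) set))"
proof -
  have "cring (coord_ring X\<lparr>carrier := coord_funs X\<rparr>)"
    by (rule cring_functions(1)) (erule (1) coord_funs_closed(1) coord_funs_closed(3) coord_funs_closed(4) | rule coord_funs_closed(2))+
  thus ?thesis by (simp only: coord_ring_carrier)
qed

lemma a_inv_coord: "F \<in> coord_funs (X :: ('i \<Rightarrow> 'k::field_char_0) set) \<Longrightarrow> a_inv (coord_ring X) F = (\<lambda>x. - F x)"
proof -
  assume F: "F \<in> coord_funs X"
  have "a_inv (coord_ring X\<lparr>carrier := coord_funs X\<rparr>) F = (\<lambda>x. - F x)"
    by (rule cring_functions(2)[OF _ _ _ _ F]) (erule (1) coord_funs_closed(1) coord_funs_closed(3) coord_funs_closed(4) | rule coord_funs_closed(2))+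
  thus ?thesis by (simp only: coord_ring_carrier)
qed

context lie_acf
begin

lemma rst_ops:
  "rst (\<lambda>x. F x + G x) = (\<lambda>x. rst F x + rst G x)" "rst (\<lambda>x. F x * G x) = (\<lambda>x. rst F x * rst G x)"
  "rst (\<lambda>x. - F x) = (\<lambda>x. - rst F x)" "rst (\<lambda>x. c) = const_fun V c" "rst (\<lambda>x. 0) = (\<lambda>x. 0)"
  by (auto simp: rst_def const_fun_def)

lemma rst_inj: "F \<in> pf Basis \<Longrightarrow> G \<in> pf Basis \<Longrightarrow> rst F = rst G \<longleftrightarrow> F = G"
  by (metis lft_rst)

lemma subalg_gen:
  assumes G: "\<And>g. G g \<Longrightarrow> g \<in> pf Basis"
  shows "subalg_generated_by V (rst ` Collect G) = rst ` gen G"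
proof
  interpret R: cring "coord_ring V" by (rule cring_coord)
  let ?H = "range (const_fun V) \<union> rst ` Collect G"
  have sub: "?H \<subseteq> sym_alg sc" using coord_funs_closed(2) rst_in G by auto
  have cl: "subring (generate_ring (coord_ring V) ?H) (coord_ring V)" by (rule R.generate_ring_is_subring[OF sub])
  have inc: "?H \<subseteq> generate_ring (coord_ring V) ?H" by (auto intro: generate_ring.incl)
  show "rst ` gen G \<subseteq> subalg_generated_by V (rst ` Collect G)"
  proof -
    let ?R = "{F. rst F \<in> generate_ring (coord_ring V) ?H}"
    have "fsubalg ?R"
      unfolding fsubalg_def using subringE(6,7)[OF cl] inc by (auto simp: rst_ops coord_ring_simps)
    hence "gen G \<subseteq> ?R" by (rule gen_min) (use inc in auto)
    thus ?thesis unfolding subalg_generated_by_def by auto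
  qed
  show "subalg_generated_by V (rst ` Collect G) \<subseteq> rst ` gen G"
  proof
    fix F assume "F \<in> subalg_generated_by V (rst ` Collect G)"
    hence "F \<in> generate_ring (coord_ring V) ?H" unfolding subalg_generated_by_def .
    thus "F \<in> rst ` gen G"
    proof induction
      case one
      show ?case by (rule image_eqI[of _ _ "\<lambda>x. 1"]) (auto simp: coord_ring_simps rst_ops fsubalg_const[OF fsubalg_gen])
    next
      case (incl h)
      thus ?case
      proof
        assume "h \<in> range (const_fun V)"
        then obtain c where "h = const_fun V c" by blast
        thus ?thesis by (intro image_eqI[of _ _ "\<lambda>x. c"]) (auto simp: rst_ops fsubalg_const[OF fsubalg_gen])
      qed (auto intro: gen_incl)
    next
      case (a_inv h)
      then obtain F where F: "F \<in> gen G" "h = rst F" by blast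
      have "a_inv (coord_ring V) h = rst (\<lambda>x. - F x)"
        unfolding F(2) rst_ops by (rule a_inv_coord, rule rst_in) (use gen_pf[of G Basis] G F in blast)
      thus ?case using fsubalg_uminus[OF fsubalg_gen F(1)] by auto
    next
      case (eng_add h1 h2)
      then obtain F F' where F: "F \<in> gen G" "h1 = rst F" "F' \<in> gen G" "h2 = rst F'" by blast
      thus ?case using fsubalg_add[OF fsubalg_gen F(1,3)]
        by (auto intro!: image_eqI[of _ _ "\<lambda>p. F p + F' p"] simp: coord_ring_simps rst_ops)
    next
      case (eng_mult h1 h2)
      then obtain F F' where F: "F \<in> gen G" "h1 = rst F" "F' \<in> gen G" "h2 = rst F'" by blast
      thus ?case using fsubalg_mult[OF fsubalg_gen F(1,3)]
        by (auto intro!: image_eqI[of _ _ "\<lambda>p. F p * F' p"] simp: coord_ring_simps rst_ops)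
    qed
  qed
qed

lemma shift_coeff_eq:
  assumes "\<xi> \<in> V" "F \<in> sym_alg sc" shows "shift_coeff sc \<xi> F j = rst (shift \<xi> (lft F) j)"
  unfolding shift_coeff_def rst_def shift_def
  by (rule HOL.ext) (simp add: line_poly_lft[OF _ assms(1), of _ F])

text \<open>Removing the bound on \<open>j\<close> adds only constants, which belong to the
  generated algebra anyway.\<close>

lemma shift_subalg_eq:
  assumes \<xi>: "\<xi> \<in> V" and \<B>: "\<B> \<subseteq> sym_alg sc"
  shows "shift_subalg sc \<xi> \<B> = rst ` gen (\<lambda>g. \<exists>F\<in>\<B>. \<exists>j. g = shift \<xi> (lft F) j)"
proof -
  let ?G = "\<lambda>g. \<exists>F\<in>\<B>. \<exists>j. g = shift \<xi> (lft F) j"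
  have pf: "lft F \<in> pf Basis" if "F \<in> \<B>" for F using that \<B> by (auto elim: sym_algE)
  let ?S = "{shift_coeff sc \<xi> F j |F j. F \<in> \<B> \<and> j < fun_degree V F}"
  have "range (const_fun V) \<union> ?S = range (const_fun V) \<union> rst ` Collect ?G"
  proof
    show "range (const_fun V) \<union> ?S \<subseteq> range (const_fun V) \<union> rst ` Collect ?G"
      using shift_coeff_eq[OF \<xi>] \<B> by blast
    have "rst (shift \<xi> (lft F) j) \<in> range (const_fun V) \<union> ?S" if F: "F \<in> \<B>" for F j
    proof (cases "j < fun_degree V F")
      case True
      have "F \<in> sym_alg sc" using F \<B> by blast
      from shift_coeff_eq[OF \<xi> this, of j, symmetric] show ?thesis using True F by blast
    next
      case False
      have "pdeg Basis (fun_degree V F) (lft F)" using pdeg_fun_degree F \<B> by blast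
      then obtain c where "shift \<xi> (lft F) j = (\<lambda>x. c)" using shift_top_const False by (meson not_less)
      thus ?thesis by (simp add: rst_ops)
    qed
    thus "range (const_fun V) \<union> rst ` Collect ?G \<subseteq> range (const_fun V) \<union> ?S" by blast
  qed
  hence "shift_subalg sc \<xi> \<B> = subalg_generated_by V (rst ` Collect ?G)"
    unfolding shift_subalg_def subalg_generated_by_def by simp
  also have "\<dots> = rst ` gen ?G" by (rule subalg_gen) (use pf pf_shift in blast)
  finally show ?thesis .
qed

section \<open>Krull dimension of a polynomial algebra\<close>

lemma cring_gen:
  assumes "\<And>g. G g \<Longrightarrow> g \<in> pf Basis"
  shows "cring (coord_ring V\<lparr>carrier := rst ` gen G\<rparr>)"
proof (rule cring_functions(1))
  show "F x = 0" if "F \<in> rst ` gen G" "x \<notin> V" for F x using that by (auto simp: rst_def)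
  show "const_fun V c \<in> rst ` gen G" for c
    by (rule image_eqI[of _ _ "\<lambda>x. c"]) (auto simp: rst_ops fsubalg_const[OF fsubalg_gen])
  fix h1 h2 assume "h1 \<in> rst ` gen G" "h2 \<in> rst ` gen G"
  then obtain F F' where F: "F \<in> gen G" "h1 = rst F" "F' \<in> gen G" "h2 = rst F'" by blast
  show "(\<lambda>x. h1 x + h2 x) \<in> rst ` gen G"
    unfolding F(2,4) rst_ops[symmetric] using fsubalg_add[OF fsubalg_gen F(1,3)] by (rule imageI)
  show "(\<lambda>x. h1 x * h2 x) \<in> rst ` gen G"
    unfolding F(2,4) rst_ops[symmetric] using fsubalg_mult[OF fsubalg_gen F(1,3)] by (rule imageI)
qed

lemma primeideal_fprime:
  assumes G: "\<And>g. G g \<Longrightarrow> g \<in> pf Basis"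
    and I: "primeideal I (coord_ring V\<lparr>carrier := rst ` gen G\<rparr>)"
  shows "fprime (gen G) {F \<in> gen G. rst F \<in> I}"
proof -
  let ?R = "coord_ring V\<lparr>carrier := rst ` gen G\<rparr>"
  interpret I: primeideal I ?R by (rule I)
  have a: "(\<lambda>p. F p + F' p) \<in> {F \<in> gen G. rst F \<in> I}" if "F \<in> {F \<in> gen G. rst F \<in> I}" "F' \<in> {F \<in> gen G. rst F \<in> I}" for F F'
    using that additive_subgroup.a_closed[OF I.additive_subgroup_axioms, of "rst F" "rst F'"] fsubalg_add[OF fsubalg_gen, of F G F'] by (simp add: rst_ops coord_ring_simps)
  have m: "(\<lambda>p. F p * F' p) \<in> {F \<in> gen G. rst F \<in> I}" if "F \<in> {F \<in> gen G. rst F \<in> I}" "F' \<in> gen G" for F F'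
    using that I.I_r_closed[of "rst F" "rst F'"] fsubalg_mult[OF fsubalg_gen, of F G F'] by (simp add: rst_ops coord_ring_simps)
  have p: "F \<in> {F \<in> gen G. rst F \<in> I} \<or> F' \<in> {F \<in> gen G. rst F \<in> I}"
    if "F \<in> gen G" "F' \<in> gen G" "(\<lambda>p. F p * F' p) \<in> {F \<in> gen G. rst F \<in> I}" for F F'
    using that I.I_prime[of "rst F" "rst F'"] by (simp add: rst_ops coord_ring_simps)
  have z: "(\<lambda>p. 0) \<in> {F \<in> gen G. rst F \<in> I}"
    using additive_subgroup.zero_closed[OF I.additive_subgroup_axioms] fsubalg_const[OF fsubalg_gen]
    by (simp add: rst_ops(5) coord_ring_simps)
  have o: "(\<lambda>p. 1) \<notin> {F \<in> gen G. rst F \<in> I}"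
  proof
    assume "(\<lambda>p. 1) \<in> {F \<in> gen G. rst F \<in> I}"
    hence "\<one>\<^bsub>?R\<^esub> \<in> I" by (simp add: rst_ops coord_ring_simps)
    hence "I = carrier ?R" by (rule I.one_imp_carrier)
    thus False using I.I_notcarr by simp
  qed
  show ?thesis unfolding fprime_def using a m p z o by blast
qed

text \<open>A chain with \<open>n\<close> strict inclusions produces \<open>n\<close> independent
  elements of an algebra that is generated by \<open>b\<close> functions.\<close>

lemma krull_dim_upper:
  assumes F: "\<And>i. i < b \<Longrightarrow> F i \<in> pf Basis"
    and I: "\<And>i. i \<le> n \<Longrightarrow> primeideal (I i) (coord_ring V\<lparr>carrier := rst ` gen (family b F)\<rparr>)"
      "\<And>i. i < n \<Longrightarrow> I i \<subset> I (Suc i)"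
  shows "n \<le> b"
proof -
  let ?G = "gen (family b F)"
  let ?I = "\<lambda>i. {g \<in> ?G. rst g \<in> I i}"
  have G: "g \<in> pf Basis" if "family b F g" for g using that F by (auto simp: family_def)
  have fp: "fprime ?G (?I i)" if "i \<le> n" for i by (rule primeideal_fprime[OF G I(1)[OF that]])
  have strict: "?I i \<subset> ?I (Suc i)" if i: "i < n" for i
  proof -
    obtain h where h: "h \<in> I (Suc i)" "h \<notin> I i" using I(2)[OF i] by blast
    have "I (Suc i) \<subseteq> rst ` ?G"
      using additive_subgroup.a_subset[OF ideal.axioms(1)[OF primeideal.axioms(1)[OF I(1)[of "Suc i"]]]] i by simp
    then obtain g where "g \<in> ?G" "h = rst g" using h(1) by blast
    hence "g \<in> ?I (Suc i)" "g \<notin> ?I i" using h by auto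
    moreover have "?I i \<subseteq> ?I (Suc i)" using I(2)[OF i] by blast
    ultimately show ?thesis by blast
  qed
  have "\<exists>g'. (\<forall>k<0 + n. g' k \<in> ?G) \<and> indep_mod (0 + n) g' (?I 0)"
  proof (rule indep_mod_chain[where I = ?I and R = ?G and m = n and r = 0 and g = "\<lambda>_ _. 0"])
    \<comment> \<open>Polynomials without variables are constants, and a nonzero constant in a prime
      ideal would put 1 into it.\<close>
    show "indep_mod 0 (\<lambda>_ _. 0) (?I n)"
      unfolding indep_mod_def
    proof (intro ballI impI allI, rule ccontr)
      fix \<phi> :: "(nat \<Rightarrow> 'k) \<Rightarrow> 'k" and y
      assume \<phi>: "\<phi> \<in> pf {..<0}" and m: "(\<lambda>p. \<phi> (\<lambda>k. 0)) \<in> ?I n" and nz: "\<phi> y \<noteq> 0"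
      have "\<phi> (\<lambda>k. 0) = \<phi> y" by (rule pf_cong_vars[OF \<phi>]) auto
      hence "(\<lambda>p. \<phi> y) \<in> ?I n" using m by simp
      from fprime_multD[OF fp[OF order_refl] this fsubalg_const[OF fsubalg_gen, of "inverse (\<phi> y)"]]
      have "(\<lambda>p. 1) \<in> ?I n" using nz by simp
      thus False using fp[of n] by (simp add: fprime_def)
    qed
  qed (use fp strict fsubalg_gen in auto)
  then obtain g' where g': "\<And>k. k < n \<Longrightarrow> g' k \<in> ?G" "indep_mod n g' (?I 0)" by auto
  have "n \<le> card {..<b}"
  proof (rule indep_mod_le_card[OF _ g'(2), where u = "\<lambda>x i. F i x"])
    show "(\<lambda>p. 0) \<in> ?I 0" using fp[of 0] by (simp add: fprime_def)
    show "\<exists>\<psi>\<in>pf {..<b}. g' k = (\<lambda>p. \<psi> (\<lambda>i. F i p))" if "k < n" for k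
      using g'(1)[OF that] unfolding gen_family by blast
  qed auto
  thus ?thesis by simp
qed

text \<open>\<open>I i\<close> corresponds to the ideal of the first \<open>i\<close> variables,
  described as the polynomials vanishing on the linear subspace where these variables are zero.
  Independence of the \<open>F i\<close> makes \<open>\<psi>\<close> unique, so membership can be
  tested on \<open>\<psi>\<close>.\<close>

lemma krull_dim_chain:
  assumes F: "\<And>i. i < b \<Longrightarrow> F i \<in> pf Basis" and ind: "indep_on b F UNIV" and i: "i \<le> b"
  defines "I \<equiv> \<lambda>i. {rst (\<lambda>x. \<psi> (\<lambda>k. F k x)) |\<psi>. \<psi> \<in> pf {..<b} \<and> (\<forall>y. (\<forall>k<i. y k = 0) \<longrightarrow> \<psi> y = 0)}"
  shows "primeideal (I i) (coord_ring V\<lparr>carrier := rst ` gen (family b F)\<rparr>)" and "i < b \<Longrightarrow> I i \<subset> I (Suc i)"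
proof -
  let ?R = "coord_ring V\<lparr>carrier := rst ` gen (family b F)\<rparr>"
  let ?c = "\<lambda>\<psi>. rst (\<lambda>x. \<psi> (\<lambda>k. F k x))"
  have G: "g \<in> pf Basis" if "family b F g" for g using that F by (auto simp: family_def)
  interpret R: cring ?R by (rule cring_gen[OF G])
  have car: "rst ` gen (family b F) = {?c \<psi> |\<psi>. \<psi> \<in> pf {..<b}}" unfolding gen_family by blast
  have comp: "(\<lambda>x. \<psi> (\<lambda>k. F k x)) \<in> pf Basis" if "\<psi> \<in> pf {..<b}" for \<psi>
    by (rule pf_compose[OF that]) (use F in auto)
  have inj: "\<psi> = \<psi>'" if \<psi>: "\<psi> \<in> pf {..<b}" "\<psi>' \<in> pf {..<b}" "?c \<psi> = ?c \<psi>'" for \<psi> \<psi>'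
  proof -
    have "(\<lambda>x. \<psi> (\<lambda>k. F k x)) = (\<lambda>x. \<psi>' (\<lambda>k. F k x))" using \<psi>(3) rst_inj[OF comp[OF \<psi>(1)] comp[OF \<psi>(2)]] by simp
    hence "\<forall>x\<in>UNIV. \<psi> (\<lambda>k. F k x) - \<psi>' (\<lambda>k. F k x) = 0" by (auto dest: fun_cong)
    with ind[unfolded indep_on_def, THEN bspec, OF pf_diff[OF \<psi>(1,2)]]
    have "\<psi> y = \<psi>' y" for y by simp
    thus ?thesis by (rule HOL.ext)
  qed
  let ?Z = "\<lambda>i \<psi>. \<forall>y. (\<forall>k<i. y k = 0) \<longrightarrow> \<psi> y = (0::'k)"
  have memI: "?c \<psi> \<in> I i \<longleftrightarrow> ?Z i \<psi>" if "\<psi> \<in> pf {..<b}" for \<psi> i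
  proof
    assume "?c \<psi> \<in> I i"
    then obtain \<psi>' where "\<psi>' \<in> pf {..<b}" "?Z i \<psi>'" "?c \<psi> = ?c \<psi>'" unfolding I_def by blast
    thus "?Z i \<psi>" using inj[OF that, of \<psi>'] by simp
  next
    assume "?Z i \<psi>"
    thus "?c \<psi> \<in> I i" unfolding I_def using that by blast
  qed
  have IE: "\<exists>\<psi>\<in>pf {..<b}. h = ?c \<psi> \<and> ?Z i \<psi>" if "h \<in> I i" for h i using that unfolding I_def by blast
  have carE: "\<exists>\<psi>\<in>pf {..<b}. h = ?c \<psi>" if "h \<in> carrier ?R" for h using that car by auto
  have add: "?c \<psi> \<oplus>\<^bsub>?R\<^esub> ?c \<psi>' = ?c (\<lambda>y. \<psi> y + \<psi>' y)" and mul: "?c \<psi> \<otimes>\<^bsub>?R\<^esub> ?c \<psi>' = ?c (\<lambda>y. \<psi> y * \<psi>' y)" for \<psi> \<psi>'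
    by (simp_all add: coord_ring_simps rst_ops)
  have neg: "\<ominus>\<^bsub>?R\<^esub> ?c \<psi> = ?c (\<lambda>y. - \<psi> y)" if "\<psi> \<in> pf {..<b}" for \<psi>
  proof (rule R.minus_equality)
    show "?c (\<lambda>y. - \<psi> y) \<oplus>\<^bsub>?R\<^esub> ?c \<psi> = \<zero>\<^bsub>?R\<^esub>" by (simp add: coord_ring_simps rst_ops)
  qed (use that car in auto)
  have cpf: "\<psi> \<in> pf {..<b} \<Longrightarrow> ?c \<psi> \<in> carrier ?R" for \<psi> using car by auto
  have ideal: "ideal (I i) ?R"
  proof (rule idealI)
    show "ring ?R" by (rule R.ring_axioms)
    show "subgroup (I i) (add_monoid ?R)"
    proof (rule R.add.subgroupI)
      show "I i \<subseteq> carrier ?R"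
      proof
        fix h assume "h \<in> I i"
        then obtain \<psi> where "\<psi> \<in> pf {..<b}" "h = ?c \<psi>" using IE by blast
        thus "h \<in> carrier ?R" using cpf by simp
      qed
      have "?c (\<lambda>y. 0) \<in> I i" by (subst memI[OF pf_const]) auto
      thus "I i \<noteq> {}" by blast
    next
      fix h assume "h \<in> I i"
      then obtain \<psi> where \<psi>: "\<psi> \<in> pf {..<b}" "h = ?c \<psi>" "?Z i \<psi>" using IE by blast
      have "?c (\<lambda>y. - \<psi> y) \<in> I i" unfolding memI[OF pf_uminus[OF \<psi>(1)]] using \<psi>(3) by simp
      thus "\<ominus>\<^bsub>?R\<^esub> h \<in> I i" using neg[OF \<psi>(1)] \<psi>(2) by simp
    next
      fix h h' assume hh: "h \<in> I i" "h' \<in> I i"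
      obtain \<psi> where \<psi>: "\<psi> \<in> pf {..<b}" "h = ?c \<psi>" "?Z i \<psi>" using IE[OF hh(1)] by blast
      obtain \<psi>' where \<psi>': "\<psi>' \<in> pf {..<b}" "h' = ?c \<psi>'" "?Z i \<psi>'" using IE[OF hh(2)] by blast
      have "?c (\<lambda>y. \<psi> y + \<psi>' y) \<in> I i" unfolding memI[OF pf_add[OF \<psi>(1) \<psi>'(1)]] using \<psi>(3) \<psi>'(3) by simp
      thus "h \<oplus>\<^bsub>?R\<^esub> h' \<in> I i" unfolding \<psi>(2) \<psi>'(2) add .
    qed
  next
    fix h x assume hx: "h \<in> I i" "x \<in> carrier ?R"
    obtain \<psi> where \<psi>: "\<psi> \<in> pf {..<b}" "h = ?c \<psi>" "?Z i \<psi>" using IE[OF hx(1)] by blast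
    obtain \<psi>' where \<psi>': "\<psi>' \<in> pf {..<b}" "x = ?c \<psi>'" using carE[OF hx(2)] by blast
    have "?c (\<lambda>y. \<psi>' y * \<psi> y) \<in> I i" unfolding memI[OF pf_mult[OF \<psi>'(1) \<psi>(1)]] using \<psi>(3) by simp
    thus "x \<otimes>\<^bsub>?R\<^esub> h \<in> I i" unfolding \<psi>(2) \<psi>'(2) mul .
    have "?c (\<lambda>y. \<psi> y * \<psi>' y) \<in> I i" unfolding memI[OF pf_mult[OF \<psi>(1) \<psi>'(1)]] using \<psi>(3) by simp
    thus "h \<otimes>\<^bsub>?R\<^esub> x \<in> I i" unfolding \<psi>(2) \<psi>'(2) mul .
  qed
  show "primeideal (I i) ?R"
  proof (rule primeidealI[OF ideal R.is_cring])
    have "?c (\<lambda>y. 1) \<notin> I i" unfolding memI[OF pf_const] by (simp add: exI[of _ "\<lambda>_. 0"])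
    thus "carrier ?R \<noteq> I i" using cpf[OF pf_const, of 1] by blast
    fix h h' assume hh: "h \<in> carrier ?R" "h' \<in> carrier ?R" and m: "h \<otimes>\<^bsub>?R\<^esub> h' \<in> I i"
    obtain \<psi> where \<psi>: "\<psi> \<in> pf {..<b}" "h = ?c \<psi>" using carE[OF hh(1)] by blast
    obtain \<psi>' where \<psi>': "\<psi>' \<in> pf {..<b}" "h' = ?c \<psi>'" using carE[OF hh(2)] by blast
    have "?c (\<lambda>y. \<psi> y * \<psi>' y) \<in> I i" using m unfolding \<psi>(2) \<psi>'(2) mul .
    hence z: "?Z i (\<lambda>y. \<psi> y * \<psi>' y)" unfolding memI[OF pf_mult[OF \<psi>(1) \<psi>'(1)]] .
    \<comment> \<open>Restriction to the subspace by setting the first \<open>i\<close> variables to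
      zero; primality is the absence of zero divisors there.\<close>
    let ?r = "\<lambda>\<psi> y. \<psi> (\<lambda>k. if k < i then 0 else y k)"
    have r: "?r \<psi> \<in> pf {..<b}" if "\<psi> \<in> pf {..<b}" for \<psi> :: "(nat \<Rightarrow> 'k) \<Rightarrow> 'k"
    proof (rule pf_compose[OF that])
      fix k assume "k \<in> {..<b}"
      thus "(\<lambda>y. if k < i then 0 else y k) \<in> pf {..<b}" by (cases "k < i") auto
    qed
    have "?r \<psi> y * ?r \<psi>' y = 0" for y using z by simp
    hence "(\<forall>y. ?r \<psi> y = 0) \<or> (\<forall>y. ?r \<psi>' y = 0)"
      using pf_mult_eq_0[where F = "?r \<psi>" and G = "?r \<psi>'" and J = "{..<b}", OF r[OF \<psi>(1)] r[OF \<psi>'(1)]] by blast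
    moreover have "?Z i \<psi>" if "\<forall>y. ?r \<psi> y = 0" for \<psi> :: "(nat \<Rightarrow> 'k) \<Rightarrow> 'k"
    proof (intro allI impI)
      fix y :: "nat \<Rightarrow> 'k" assume "\<forall>k<i. y k = 0"
      hence "(\<lambda>k. if k < i then 0 else y k) = y" by auto
      thus "\<psi> y = 0" using spec[OF that, of y] by simp
    qed
    ultimately show "h \<in> I i \<or> h' \<in> I i" unfolding \<psi>(2) \<psi>'(2) memI[OF \<psi>(1)] memI[OF \<psi>'(1)] by blast
  qed
  show "I i \<subset> I (Suc i)" if ib: "i < b"
  proof -
    have v: "(\<lambda>y. y i) \<in> pf {..<b}" using ib by auto
    have "?c (\<lambda>y. y i) \<in> I (Suc i)" unfolding memI[OF v] by auto
    moreover have "?c (\<lambda>y. y i) \<notin> I i" unfolding memI[OF v] by (auto intro!: exI[of _ "unit i"] simp: unit_def)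
    moreover have "I i \<subseteq> I (Suc i)"
    proof
      fix h assume "h \<in> I i"
      then obtain \<psi> where \<psi>: "\<psi> \<in> pf {..<b}" "h = ?c \<psi>" "?Z i \<psi>" using IE by blast
      have "?Z (Suc i) \<psi>" using \<psi>(3) by simp
      thus "h \<in> I (Suc i)" unfolding \<psi>(2) memI[OF \<psi>(1)] .
    qed
    ultimately show ?thesis by blast
  qed
qed

lemma krull_dim_gen:
  assumes F: "\<And>i. i < b \<Longrightarrow> F i \<in> pf Basis" and ind: "indep_on b F UNIV"
  shows "krull_dim (coord_ring V\<lparr>carrier := rst ` gen (family b F)\<rparr>) = enat b"
  unfolding krull_dim_def
proof (rule antisym)
  let ?R = "coord_ring V\<lparr>carrier := rst ` gen (family b F)\<rparr>"
  show "(SUP n\<in>{n. \<exists>I. (\<forall>i\<le>n. primeideal (I i) ?R) \<and> (\<forall>i<n. I i \<subset> I (Suc i))}. enat n) \<le> enat b"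
  proof (rule SUP_least)
    fix n assume "n \<in> {n. \<exists>I. (\<forall>i\<le>n. primeideal (I i) ?R) \<and> (\<forall>i<n. I i \<subset> I (Suc i))}"
    then obtain I where "\<forall>i\<le>n. primeideal (I i) ?R" "\<forall>i<n. I i \<subset> I (Suc i)" by blast
    hence "n \<le> b" using krull_dim_upper[of b F n I, OF F] by blast
    thus "enat n \<le> enat b" by simp
  qed
  show "enat b \<le> (SUP n\<in>{n. \<exists>I. (\<forall>i\<le>n. primeideal (I i) ?R) \<and> (\<forall>i<n. I i \<subset> I (Suc i))}. enat n)"
  proof (rule SUP_upper, rule CollectI, intro exI conjI allI impI)
    fix i assume i: "i \<le> b"
    show "primeideal {rst (\<lambda>x. \<psi> (\<lambda>k. F k x)) |\<psi>. \<psi> \<in> pf {..<b} \<and> (\<forall>y. (\<forall>k<i. y k = 0) \<longrightarrow> \<psi> y = 0)} ?R"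
      using krull_dim_chain(1)[of b F i, OF F ind i] .
  next
    fix i assume "i < b"
    thus "{rst (\<lambda>x. \<psi> (\<lambda>k. F k x)) |\<psi>. \<psi> \<in> pf {..<b} \<and> (\<forall>y. (\<forall>k<i. y k = 0) \<longrightarrow> \<psi> y = 0)} \<subset>
        {rst (\<lambda>x. \<psi> (\<lambda>k. F k x)) |\<psi>. \<psi> \<in> pf {..<b} \<and> (\<forall>y. (\<forall>k<Suc i. y k = 0) \<longrightarrow> \<psi> y = 0)}"
      using krull_dim_chain(2)[of b F i, OF F ind] by simp
  qed
qed

end

section \<open>Maximal commutative subalgebras\<close>

lemma shift_gen:
  assumes R: "fsubalg R" and J: "\<And>g. G g \<Longrightarrow> g \<in> pf J" and G: "\<And>g j. G g \<Longrightarrow> shift \<xi> g j \<in> R"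
    and F: "F \<in> gen G"
  shows "shift \<xi> F j \<in> R"
proof -
  from F obtain \<psi> where \<psi>: "\<psi> \<in> pf (Collect G)" "F = (\<lambda>x. \<psi> (\<lambda>g. g x))" unfolding gen_def by blast
  show ?thesis unfolding \<psi>(2)
  proof (rule shift_compose[where J = J and u = "\<lambda>g. g", OF R \<psi>(1)])
    show "g \<in> pf J" if "g \<in> Collect G" for g using J that by simp
    show "shift \<xi> g j \<in> R" if "g \<in> Collect G" for g j using G that by simp
  qed
qed

lemma gen_familyI: "\<psi> \<in> pf {..<r} \<Longrightarrow> (\<lambda>x. \<psi> (\<lambda>i. F i x)) \<in> gen (family r F)"
  unfolding gen_family by (intro CollectI exI[of _ \<psi>] conjI refl)

lemma gen_familyE:
  assumes "G \<in> gen (family r F)"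
  obtains \<psi> where "\<psi> \<in> pf {..<r}" "G = (\<lambda>x. \<psi> (\<lambda>i. F i x))"
  using assms unfolding gen_family by (elim CollectE exE conjE)

context lie_acf
begin

section \<open>Algebraic independence with indices from 1 to l translated to indices below l\<close>

lemma indep_on_of_alg_independent:
  assumes "alg_independent V {1..l} f" shows "indep_on l (\<lambda>k. lft (f (Suc k))) UNIV"
  unfolding indep_on_def
proof (intro ballI impI allI)
  fix \<psi> :: "(nat \<Rightarrow> 'k) \<Rightarrow> 'k" and y :: "nat \<Rightarrow> 'k"
  assume \<psi>: "\<psi> \<in> pf {..<l}" and z: "\<forall>x\<in>UNIV. \<psi> (\<lambda>k. lft (f (Suc k)) x) = 0"
  have "(\<lambda>y :: nat \<Rightarrow> 'k. \<psi> (\<lambda>k. y (Suc k))) \<in> pf {1..l}" by (rule pf_compose[OF \<psi>]) auto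
  then obtain d where "pdeg {1..l} d (\<lambda>y :: nat \<Rightarrow> 'k. \<psi> (\<lambda>k. y (Suc k)))" by (rule pfE)
  from pdeg_imp_mpoly[OF this] obtain P where
    P: "mpoly_vars P \<subseteq> {1..l}" "mpoly_eval P = (\<lambda>y :: nat \<Rightarrow> 'k. \<psi> (\<lambda>k. y (Suc k)))" by blast
  have "mpoly_eval P (\<lambda>j. f j x) = 0" if "x \<in> V" for x
    using bspec[OF z, of x] that by (simp add: P(2) lft_V)
  hence "P = 0" using assms P(1) unfolding alg_independent_def by blast
  hence "mpoly_eval P (\<lambda>j. y (j - 1)) = 0" by (simp add: mpoly_eval_def)
  thus "\<psi> y = 0" by (simp add: P(2))
qed

lemma alg_independent_of_indep_on:
  assumes F: "\<And>i. i < b \<Longrightarrow> F i \<in> pf Basis" and ind: "indep_on b F UNIV"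
  shows "alg_independent V {1..b} (\<lambda>j. rst (F (j - 1)))"
  unfolding alg_independent_def
proof (intro allI impI, elim conjE)
  fix P :: "(nat \<Rightarrow>\<^sub>0 nat) \<Rightarrow>\<^sub>0 'k"
  assume v: "mpoly_vars P \<subseteq> {1..b}" and z: "\<forall>x\<in>V. mpoly_eval P (\<lambda>j. rst (F (j - 1)) x) = 0"
  have P: "mpoly_eval P \<in> pf {1..b}" by (rule pf_subset[OF pfI[OF pdeg_mpoly_eval] v])
  let ?\<psi> = "\<lambda>y. mpoly_eval P (\<lambda>j. y (j - 1))"
  have "?\<psi> \<in> pf {..<b}" by (rule pf_compose[OF P]) auto
  from bspec[OF ind[unfolded indep_on_def] this]
  have "\<forall>y. ?\<psi> y = 0" if "\<forall>x\<in>UNIV. ?\<psi> (\<lambda>k. F k x) = 0" using that by (rule mp)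
  moreover have "?\<psi> (\<lambda>k. F k x) = 0" for x
  proof -
    have "mpoly_eval P (\<lambda>j. F (j - 1) x) = mpoly_eval P (\<lambda>j. rst (F (j - 1)) (ext x))"
      by (rule pf_cong_vars[OF P]) (auto simp: rst_def pf_ext[OF F])
    thus ?thesis using bspec[OF z, of "ext x"] by simp
  qed
  ultimately have z': "\<forall>y. ?\<psi> y = 0" by simp
  have "mpoly_eval P y = 0" for y
  proof -
    have "mpoly_eval P y = mpoly_eval P (\<lambda>j. (\<lambda>k. y (Suc k)) (j - 1))"
      by (rule pf_cong_vars[OF P]) auto
    thus ?thesis using spec[OF z', of "\<lambda>k. y (Suc k)"] by simp
  qed
  thus "P = 0" by (rule mpoly_eval_eq_0)
qed

lemma shift_central:
  assumes "F \<in> poisson_centre sc br" shows "F \<in> sym_alg sc"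
  using assms by (simp add: poisson_centre_def)

end

text \<open>Collects what the leading components provide. \<open>en\<close> enumerates the pairs of
  a generator \<open>k\<close> and an index \<open>j < d k\<close>; there are \<open>b\<close> of
  them because the degrees add up to \<open>b\<close>.\<close>

locale argument_shift = lie_acf sc Basis br
  for sc :: "'k::{alg_closed_field, field_char_0} \<Rightarrow> 'q::ab_group_add \<Rightarrow> 'q" and Basis br +
  fixes h :: "nat \<Rightarrow> ('q \<Rightarrow> 'k) \<Rightarrow> 'k" and d :: "nat \<Rightarrow> nat" and \<xi> :: "'q \<Rightarrow> 'k" and b :: nat and en :: "nat \<Rightarrow> nat \<times> nat"
  assumes cp: "codim_property sc br 2"
    and h: "\<And>k. k < ind \<Longrightarrow> central (h k)" "\<And>k. k < ind \<Longrightarrow> homog (d k) (h k)" "\<And>k. k < ind \<Longrightarrow> d k > 0"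
    and dind: "\<And>x. ext x \<in> reg \<Longrightarrow> dindep ind h x"
    and \<xi>: "\<xi> \<in> reg"
    and en: "bij_betw en {..<b} (Sigma {..<ind} (\<lambda>k. {..<d k}))"
    and b: "b = (qdim + ind) div 2"
begin

definition F :: "nat \<Rightarrow> ('q \<Rightarrow> 'k) \<Rightarrow> 'k" where "F i = shift \<xi> (h (fst (en i))) (snd (en i))"

lemma \<xi>V: "\<xi> \<in> V" using \<xi> by (simp add: dual_reg_def)

lemma hp: "k < ind \<Longrightarrow> h k \<in> pf Basis" using central_pf[OF h(1)] .

lemma en_in: "i < b \<Longrightarrow> fst (en i) < ind \<and> snd (en i) < d (fst (en i))"
  using en by (auto simp: bij_betw_def dest!: equalityD1)

lemma F_pf: "i < b \<Longrightarrow> F i \<in> pf Basis"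
  unfolding F_def using en_in[of i] by (intro pf_shift hp) simp

lemma F_homog: "i < b \<Longrightarrow> homog (d (fst (en i)) - snd (en i)) (F i)"
  unfolding F_def using en_in[of i] by (intro homog_shift[OF hp h(2)]) simp_all

lemma F_shift: "k < ind \<Longrightarrow> j < d k \<Longrightarrow> \<exists>i<b. shift \<xi> (h k) j = F i"
proof -
  assume "k < ind" "j < d k"
  hence "(k, j) \<in> en ` {..<b}" using en by (auto simp: bij_betw_def)
  then obtain i where "i < b" "en i = (k, j)" by auto
  thus ?thesis by (intro exI[of _ i]) (simp add: F_def)
qed

lemma F_dindep:
  assumes line: "\<And>a. ext (\<lambda>i. x i + a * \<xi> i) \<in> reg" shows "dindep b F x"
  unfolding dindep_def
proof (intro allI impI)
  fix c i assume rel: "\<forall>y. (\<Sum>i<b. c i * dd (F i) y x) = 0" and i: "i < b"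
  let ?A = "Sigma {..<ind} (\<lambda>k. {..<d k})"
  define c' where "c' a = c (inv_into {..<b} en a)" for a
  have c': "c' (en i) = c i" if "i < b" for i
    using that en unfolding c'_def by (simp add: bij_betw_def inv_into_f_f)
  have "c' (en i) = 0"
  proof (rule shifts_independent[where h = h and d = d and \<xi> = \<xi> and \<eta> = "ext x" and c = c'])
    show "(\<lambda>i. ext x i + a * \<xi> i) \<in> reg" for a using line[of a] unfolding ext_add ext_V[OF \<xi>V] .
    show "(\<Sum>a\<in>?A. c' a * dd (shift \<xi> (h (fst a)) (snd a)) y (ext x)) = 0" for y
    proof -
      have "(\<Sum>a\<in>?A. c' a * dd (shift \<xi> (h (fst a)) (snd a)) y (ext x)) = (\<Sum>i<b. c' (en i) * dd (F i) y (ext x))"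
        unfolding F_def by (rule sum.reindex_bij_betw[OF en, symmetric])
      also have "\<dots> = (\<Sum>i<b. c i * dd (F i) y x)"
        by (rule sum.cong) (auto simp: c' pf_ext[OF pf_dd[OF F_pf]])
      finally show ?thesis using rel by simp
    qed
    show "en i \<in> ?A" using i en by (auto simp: bij_betw_def)
  qed (fact ext_in_V \<xi> | erule h dind)+
  thus "c i = 0" using c'[OF i] by simp
qed

lemma generic_line:
  "\<exists>P\<in>pf Basis. (\<exists>x. P x \<noteq> 0) \<and> (\<forall>x. P x \<noteq> 0 \<longrightarrow> (\<forall>a. ext (\<lambda>i. x i + a * \<xi> i) \<in> reg))"
proof -
  from killer_dir[OF cp, of \<xi>]
  obtain P where P: "P \<in> pf Basis" "\<exists>x. P x \<noteq> 0" "\<forall>x t. P (\<lambda>k. x k + t * \<xi> k) = P x" "\<forall>x. ext x \<notin> reg \<longrightarrow> P x = 0"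
    by (elim bexE conjE)
  have "ext (\<lambda>i. x i + a * \<xi> i) \<in> reg" if "P x \<noteq> 0" for x a
  proof (rule ccontr)
    assume "ext (\<lambda>i. x i + a * \<xi> i) \<notin> reg"
    hence "P (\<lambda>i. x i + a * \<xi> i) = 0" using P(4) by simp
    thus False using P(3) that by simp
  qed
  thus ?thesis using P(1,2) by (intro bexI[of _ P]) auto
qed

lemma F_indep: "indep_on b F UNIV"
proof -
  from generic_line obtain P where P: "P \<in> pf Basis" "\<exists>x. P x \<noteq> 0"
      "\<forall>x. P x \<noteq> 0 \<longrightarrow> (\<forall>a. ext (\<lambda>i. x i + a * \<xi> i) \<in> reg)"
    by (elim bexE conjE)
  from P(2) obtain x where "P x \<noteq> 0" by (rule exE)
  hence "dindep b F x" using P(3) by (intro F_dindep) simp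
  from dindep_imp_indep_on[of b F Basis, OF F_pf this] show ?thesis by simp
qed

lemma central_gen:
  assumes g: "central g" shows "g \<in> gen (family ind h)"
proof -
  obtain m where m: "pdeg Basis m g" using central_pf[OF g] by (rule pfE)
  have "hc g D \<in> gen (family ind h)" for D
  proof -
    have "\<exists>\<psi>\<in>pf {i. i < ind \<and> d i \<le> D}. hc g D = (\<lambda>x. \<psi> (\<lambda>i. h i x))"
      by (rule central_generated[where h = h and d = d and g = g and D = D, OF cp h dind g])
    then obtain \<psi> where \<psi>: "\<psi> \<in> pf {i. i < ind \<and> d i \<le> D}" "hc g D = (\<lambda>x. \<psi> (\<lambda>i. h i x))"
      by (elim bexE)
    have "\<psi> \<in> pf {..<ind}" by (rule pf_subset[OF \<psi>(1)]) auto
    thus ?thesis unfolding \<psi>(2) by (rule gen_familyI)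
  qed
  hence "(\<lambda>x. \<Sum>D\<le>m. hc g D x) \<in> gen (family ind h)" by (intro fsubalg_sum[OF fsubalg_gen])
  moreover have "(\<lambda>x. \<Sum>D\<le>m. hc g D x) = g" by (rule HOL.ext) (rule hc_sum1[OF m, symmetric])
  ultimately show ?thesis by simp
qed

lemma h_shift_gen:
  assumes "fsubalg R" "\<And>i. i < b \<Longrightarrow> F i \<in> R" "k < ind" shows "shift \<xi> (h k) j \<in> R"
proof (cases "j < d k")
  case True
  thus ?thesis using F_shift[OF assms(3)] assms(2) by metis
next
  case False
  then obtain c where "shift \<xi> (h k) j = (\<lambda>x. c)"
    using shift_top_const[OF pdeg_homog[OF hp[OF assms(3)] h(2)[OF assms(3)]], of j \<xi>] by auto
  thus ?thesis using fsubalg_const[OF assms(1)] by simp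
qed

text \<open>Used both for the whole centre and for the given \<open>f i\<close>: each shift algebra
  is compared with the one generated by the \<open>F i\<close>.\<close>

lemma shift_subalg_gen:
  assumes \<B>: "\<B> \<subseteq> poisson_centre sc br" and hg: "\<And>k. k < ind \<Longrightarrow> h k \<in> gen (\<lambda>g. \<exists>f\<in>\<B>. g = lft f)"
  shows "shift_subalg sc \<xi> \<B> = rst ` gen (family b F)"
proof -
  let ?G = "\<lambda>g. \<exists>f\<in>\<B>. \<exists>j. g = shift \<xi> (lft f) j"
  have \<B>S: "\<B> \<subseteq> sym_alg sc" using \<B> shift_central by blast
  have Fg: "F i \<in> gen (family b F)" if "i < b" for i by (rule gen_incl) (use that in \<open>auto simp: family_def\<close>)
  have "gen ?G \<subseteq> gen (family b F)"
  proof (rule gen_min[OF fsubalg_gen])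
    fix g assume "?G g"
    then obtain f j where f: "f \<in> \<B>" "g = shift \<xi> (lft f) j" by blast
    have "central (lft f)" using f(1) \<B> centre_central by blast
    hence lf: "lft f \<in> gen (family ind h)" by (rule central_gen)
    show "g \<in> gen (family b F)" unfolding f(2)
    proof (rule shift_gen[where G = "family ind h" and J = Basis, OF fsubalg_gen _ _ lf])
      show "q \<in> pf Basis" if "family ind h q" for q using that hp by (auto simp: family_def)
      show "shift \<xi> q j \<in> gen (family b F)" if "family ind h q" for q j
      proof -
        from that obtain k where "k < ind" "q = h k" unfolding family_def by blast
        thus ?thesis using h_shift_gen[OF fsubalg_gen Fg] by simp
      qed
    qed
  qed
  moreover have "gen (family b F) \<subseteq> gen ?G"
  proof (rule gen_min[OF fsubalg_gen])
    fix g assume "family b F g"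
    then obtain i where i: "i < b" "g = F i" by (auto simp: family_def)
    let ?k = "fst (en i)"
    have k: "?k < ind" using en_in[OF i(1)] by simp
    have "shift \<xi> (h ?k) (snd (en i)) \<in> gen ?G"
    proof (rule shift_gen[where J = Basis, OF fsubalg_gen _ _ hg[OF k]])
      show "q \<in> pf Basis" if "\<exists>f\<in>\<B>. q = lft f" for q
      proof -
        from that obtain f where f: "f \<in> \<B>" "q = lft f" by blast
        have "f \<in> sym_alg sc" using f(1) \<B>S by blast
        thus ?thesis unfolding f(2) by (rule sym_algE)
      qed
      show "shift \<xi> q j \<in> gen ?G" if "\<exists>f\<in>\<B>. q = lft f" for q j by (rule gen_incl) (use that in blast)
    qed
    thus "g \<in> gen ?G" unfolding i(2) F_def .
  qed
  ultimately have "gen ?G = gen (family b F)" by (rule equalityI)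
  thus ?thesis using shift_subalg_eq[OF \<xi>V \<B>S] by simp
qed

lemma shift_subalg_centre: "shift_subalg sc \<xi> (poisson_centre sc br) = rst ` gen (family b F)"
proof (rule shift_subalg_gen[OF subset_refl])
  fix k assume k: "k < ind"
  have "rst (h k) \<in> poisson_centre sc br" using central_iff[OF hp[OF k]] h(1)[OF k] by simp
  hence "\<exists>f\<in>poisson_centre sc br. h k = lft f" using lft_rst[OF hp[OF k]] by (intro bexI[of _ "rst (h k)"]) simp_all
  thus "h k \<in> gen (\<lambda>g. \<exists>f\<in>poisson_centre sc br. g = lft f)"
    by (rule gen_incl[where G = "\<lambda>g. \<exists>f\<in>poisson_centre sc br. g = lft f"])
qed

lemma family_pf: "family b F g \<Longrightarrow> g \<in> pf Basis"
  using F_pf by (auto simp: family_def)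

lemma subalg_family: "rst ` gen (family b F) = subalg_generated_by V (rst ` Collect (family b F))"
  by (rule subalg_gen[symmetric]) (rule family_pf)

lemma polynomial_algebra: "is_polynomial_algebra V (rst ` gen (family b F))"
  unfolding is_polynomial_algebra_def
proof (intro exI conjI ballI)
  show "rst (F (j - 1)) \<in> sym_alg sc" if "j \<in> {1..b}" for j by (rule rst_in, rule F_pf) (use that in auto)
  show "alg_independent V {1..b} (\<lambda>j. rst (F (j - 1)))"
    by (rule alg_independent_of_indep_on[OF F_pf F_indep])
  have "rst ` Collect (family b F) = (\<lambda>j. rst (F (j - 1))) ` {1..b}"
  proof (intro equalityI subsetI)
    fix g assume "g \<in> rst ` Collect (family b F)"
    then obtain i where "i < b" "g = rst (F i)" by (auto simp: family_def)
    thus "g \<in> (\<lambda>j. rst (F (j - 1))) ` {1..b}" by (intro image_eqI[of _ _ "Suc i"]) auto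
  next
    fix g assume "g \<in> (\<lambda>j. rst (F (j - 1))) ` {1..b}"
    then obtain j where "j \<in> {1..b}" "g = rst (F (j - 1))" by blast
    thus "g \<in> rst ` Collect (family b F)" by (intro image_eqI[of _ _ "F (j - 1)"]) (auto simp: family_def intro!: exI[of _ "j - 1"])
  qed
  thus "rst ` gen (family b F) = subalg_generated_by V ((\<lambda>j. rst (F (j - 1))) ` {1..b})" by (simp only: subalg_family)
qed

lemma grad_gen:
  assumes "G \<in> gen (family b F)" shows "\<exists>c. grad G x = (\<Sum>i<b. sc (c i) (grad (F i) x))"
proof -
  obtain \<psi> where \<psi>: "\<psi> \<in> pf {..<b}" "G = (\<lambda>x. \<psi> (\<lambda>i. F i x))" using assms by (rule gen_familyE)
  have G: "G \<in> pf Basis" by (rule subsetD[OF gen_pf[of "family b F" Basis, OF family_pf] assms])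
  let ?c = "\<lambda>i. dd \<psi> (unit i) (\<lambda>i. F i x)"
  have "grad G x = (\<Sum>i<b. sc (?c i) (grad (F i) x))"
  proof (rule separate)
    fix \<nu> assume \<nu>: "\<nu> \<in> V"
    have "\<nu> (grad G x) = dd G \<nu> x" by (rule V_grad[OF G \<nu>])
    also have "\<dots> = (\<Sum>i<b. ?c i * dd (F i) \<nu> x)" unfolding \<psi>(2) by (rule dd_compose[OF _ \<psi>(1)]) (use F_pf in auto)
    also have "\<dots> = (\<Sum>i<b. ?c i * \<nu> (grad (F i) x))"
      by (rule sum.cong[OF refl], rule arg_cong2[of _ _ _ _ "(*)", OF refl], rule V_grad[OF F_pf \<nu>, symmetric]) simp
    also have "\<dots> = \<nu> (\<Sum>i<b. sc (?c i) (grad (F i) x))" by (simp only: V_sum[OF \<nu>] V_scale[OF \<nu>])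
    finally show "\<nu> (grad G x) = \<nu> (\<Sum>i<b. sc (?c i) (grad (F i) x))" .
  qed
  thus ?thesis by (rule exI[where x = ?c])
qed

lemma F_commute: "\<eta> \<in> V \<Longrightarrow> i < b \<Longrightarrow> j < b \<Longrightarrow> \<eta> (br (grad (F i) \<eta>) (grad (F j) \<eta>)) = 0"
  unfolding F_def by (rule shifts_commute[OF h(1) h(1) _ \<xi>V]) (use en_in in auto)

lemma commutative: "commutative_subalg sc br (rst ` gen (family b F))"
  unfolding commutative_subalg_def is_subalg_def
proof (intro conjI ballI)
  interpret R: cring "coord_ring V" by (rule cring_coord)
  let ?H = "range (const_fun V) \<union> rst ` Collect (family b F)"
  have sub: "?H \<subseteq> sym_alg sc" using coord_funs_closed(2) rst_in family_pf by auto
  have e: "rst ` gen (family b F) = generate_ring (coord_ring V) ?H"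
    unfolding subalg_family subalg_generated_by_def ..
  show "subring (rst ` gen (family b F)) (coord_ring V)"
    unfolding e by (rule R.generate_ring_is_subring[OF sub])
  show "range (const_fun V) \<subseteq> rst ` gen (family b F)" unfolding e by (auto intro: generate_ring.incl)
  fix f g assume "f \<in> rst ` gen (family b F)" "g \<in> rst ` gen (family b F)"
  then obtain f' g' where fg: "f' \<in> gen (family b F)" "f = rst f'" "g' \<in> gen (family b F)" "g = rst g'"
    by (elim imageE)
  have p: "f' \<in> pf Basis" "g' \<in> pf Basis" using subsetD[OF gen_pf[of "family b F" Basis, OF family_pf]] fg(1,3) by simp_all
  have "\<eta> (br (grad f' \<eta>) (grad g' \<eta>)) = 0" if \<eta>: "\<eta> \<in> V" for \<eta>
  proof -
    from grad_gen[OF fg(1), of \<eta>] obtain c where c: "grad f' \<eta> = (\<Sum>i<b. sc (c i) (grad (F i) \<eta>))" by (rule exE)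
    from grad_gen[OF fg(3), of \<eta>] obtain c' where c': "grad g' \<eta> = (\<Sum>i<b. sc (c' i) (grad (F i) \<eta>))" by (rule exE)
    show ?thesis unfolding c c' V_br_sum(1)[OF \<eta>] V_br_sum(2)[OF \<eta>]
      by (rule sum.neutral) (auto intro!: sum.neutral simp: F_commute[OF \<eta>])
  qed
  thus "poisson sc br f g = (\<lambda>\<eta>. 0)"
    unfolding fg(2,4) poisson_eq[OF rst_in[OF p(1)] rst_in[OF p(2)]] by (auto simp: p)
qed

lemma commuting_ddep:
  assumes g: "g \<in> pf Basis" and comm: "\<And>i \<eta>. i < b \<Longrightarrow> \<eta> \<in> V \<Longrightarrow> \<eta> (br (grad g \<eta>) (grad (F i) \<eta>)) = 0"
    and line: "\<And>a. ext (\<lambda>i. x i + a * \<xi> i) \<in> reg"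
  shows "ddep b F g x"
  unfolding ddep_def
proof (intro allI impI)
  fix y assume y: "\<forall>i<b. dd (F i) y x = 0"
  let ?w = "\<lambda>i. grad (F i) x"
  have reg: "ext x \<in> reg" using line[of 0] by simp
  have li: "lindep b ?w" using F_dindep[OF line] dindep_lindep[of b F, OF F_pf] by simp
  have "\<exists>c. grad g x = (\<Sum>i<b. sc (c i) (?w i))"
  proof (rule maximal_isotropic[OF reg b li])
    show "ext x (br (?w i) (?w j)) = 0" if "i < b" "j < b" for i j
      using F_commute[OF ext_in_V that, of x] by (simp only: grad_ext[OF F_pf] that)
    show "ext x (br (grad g x) (?w i)) = 0" if "i < b" for i
      using comm[OF that ext_in_V, of x] by (simp only: grad_ext[OF F_pf] grad_ext[OF g] that)
  qed
  then obtain c where c: "grad g x = (\<Sum>i<b. sc (c i) (?w i))" by blast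
  have "dd g y x = ext y (grad g x)" by (rule ext_grad[OF g, symmetric])
  also have "\<dots> = (\<Sum>i<b. c i * ext y (?w i))" unfolding c by (simp only: V_sum[OF ext_in_V] V_scale[OF ext_in_V])
  also have "\<dots> = 0" by (rule sum.neutral) (use y in \<open>auto simp: ext_grad[OF F_pf]\<close>)
  finally show "dd g y x = 0" .
qed

text \<open>Points where the differentials of the shifts are dependent lie on lines in direction \<open>\<xi>\<close> meeting the singular
  set; by the codim--3 property these lines do not fill a hypersurface.\<close>

lemma maximal:
  assumes cp3: "codim_property sc br 3"
  shows "maximal_commutative_subalg sc br (rst ` gen (family b F))"
  unfolding maximal_commutative_subalg_def
proof (intro conjI allI impI commutative, elim conjE, rule equalityI)
  fix B assume B: "commutative_subalg sc br B" and AB: "rst ` gen (family b F) \<subseteq> B"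
  show "rst ` gen (family b F) \<subseteq> B" by (rule AB)
  show "B \<subseteq> rst ` gen (family b F)"
  proof
    fix f assume f: "f \<in> B"
    have "B \<subseteq> sym_alg sc" using B subringE(1) unfolding commutative_subalg_def is_subalg_def by blast
    hence fS: "f \<in> sym_alg sc" using f by blast
    define g where "g = lft f"
    have g: "g \<in> pf Basis" "f = rst g" using fS unfolding g_def by (auto elim: sym_algE)
    have comm: "\<eta> (br (grad g \<eta>) (grad (F i) \<eta>)) = 0" if i: "i < b" and \<eta>: "\<eta> \<in> V" for i \<eta>
    proof -
      have "F i \<in> gen (family b F)" by (rule gen_incl) (use i in \<open>auto simp: family_def\<close>)
      hence "rst (F i) \<in> B" using AB by blast
      hence "poisson sc br f (rst (F i)) = (\<lambda>\<eta>. 0)" using B f unfolding commutative_subalg_def by blast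
      hence "poisson sc br f (rst (F i)) \<eta> = 0" by simp
      thus ?thesis using \<eta> by (simp add: poisson_eq[OF fS rst_in[OF F_pf[OF i]]] lft_rst[OF F_pf[OF i]] g_def)
    qed
    from generic_line obtain Q where Q: "Q \<in> pf Basis" "\<exists>x. Q x \<noteq> 0"
        "\<forall>x. Q x \<noteq> 0 \<longrightarrow> (\<forall>a. ext (\<lambda>i. x i + a * \<xi> i) \<in> reg)"
      by (elim bexE conjE)
    from Q(2) obtain x0 where x0: "Q x0 \<noteq> 0" by (rule exE)
    let ?d = "\<lambda>i. d (fst (en i)) - snd (en i)"
    have int: "\<exists>\<psi>\<in>pf {i. i < b \<and> ?d i \<le> D}. hc g D = (\<lambda>x. \<psi> (\<lambda>i. F i x))" for D
    proof (rule integration[where F = F and d = ?d and g = g and Q = Q and D = D and r = b and J = Basis])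
      show "F i \<in> pf Basis" "homog (?d i) (F i)" "0 < ?d i" if "i < b" for i
        using F_pf[OF that] F_homog[OF that] en_in[OF that] by auto
      show "g \<in> pf Basis" by (rule g(1))
      show "Q \<in> pf Basis" "Q x0 \<noteq> 0" by (rule Q(1), rule x0)
      show "ddep b F g x" if "Q x \<noteq> 0" for x
      proof (rule commuting_ddep[where g = g, OF g(1)])
        show "\<eta> (br (grad g \<eta>) (grad (F i) \<eta>)) = 0" if "i < b" "\<eta> \<in> V" for i \<eta> using that by (rule comm)
        show "ext (\<lambda>i. x i + a * \<xi> i) \<in> reg" for a using Q(3) that by simp
      qed
      fix e
      have "2 < (3 :: nat)" by simp
      \<comment> \<open>Two directions: \<open>e\<close> is the one required by
        \<open>integration\<close>, and invariance under \<open>\<xi>\<close> carries the vanishing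
        of \<open>P\<close> from a singular point to the whole line through it.\<close>
      from singular_killer[OF cp3 this, of "\<lambda>i. if i = 0 then e else \<xi>"]
      obtain P where P: "P \<in> pf Basis" "\<exists>x. P x \<noteq> 0"
        "\<forall>i<(2::nat). \<forall>x t. P (\<lambda>k. x k + t * (if i = 0 then e else \<xi>) k) = P x" "\<forall>x. ext x \<notin> reg \<longrightarrow> P x = 0"
        by (elim bexE conjE)
      have Pe: "P (\<lambda>k. x k + t * e k) = P x" for x t using P(3)[THEN spec, of 0] by simp
      have P\<xi>: "P (\<lambda>k. x k + t * \<xi> k) = P x" for x t using P(3)[THEN spec, of 1] by simp
      have pz: "P x = 0" if nd: "\<not> dindep b F x" for x
      proof -
        have "\<not> (\<forall>a. ext (\<lambda>i. x i + a * \<xi> i) \<in> reg)"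
        proof
          assume "\<forall>a. ext (\<lambda>i. x i + a * \<xi> i) \<in> reg"
          hence "dindep b F x" by (intro F_dindep) simp
          thus False using nd by contradiction
        qed
        then obtain a where "ext (\<lambda>i. x i + a * \<xi> i) \<notin> reg" by blast
        hence "P (\<lambda>i. x i + a * \<xi> i) = 0" using P(4) by simp
        thus ?thesis by (simp only: P\<xi>)
      qed
      show "\<exists>P\<in>pf Basis. (\<exists>x. P x \<noteq> 0) \<and> (\<forall>x t. P (\<lambda>i. x i + t * e i) = P x) \<and> (\<forall>x. \<not> dindep b F x \<longrightarrow> P x = 0)"
        by (rule bexI[OF _ P(1)], intro conjI allI impI, rule P(2), rule Pe, erule pz)
    qed
    have "hc g D \<in> gen (family b F)" for D
    proof -
      from int[of D] obtain \<psi> where \<psi>: "\<psi> \<in> pf {i. i < b \<and> ?d i \<le> D}" "hc g D = (\<lambda>x. \<psi> (\<lambda>i. F i x))" by (elim bexE)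
      have "\<psi> \<in> pf {..<b}" by (rule pf_subset[OF \<psi>(1)]) auto
      thus ?thesis unfolding \<psi>(2) by (rule gen_familyI)
    qed
    moreover obtain m where m: "pdeg Basis m g" using g(1) by (rule pfE)
    ultimately have "(\<lambda>x. \<Sum>D\<le>m. hc g D x) \<in> gen (family b F)" by (intro fsubalg_sum[OF fsubalg_gen])
    moreover have "(\<lambda>x. \<Sum>D\<le>m. hc g D x) = g" by (rule HOL.ext) (rule hc_sum1[OF m, symmetric])
    ultimately have "g \<in> gen (family b F)" by simp
    thus "f \<in> rst ` gen (family b F)" unfolding g(2) by (rule imageI)
  qed
qed

end

section \<open>From the given generators to their leading components\<close>

context lie_acf
begin

text \<open>The leading components of the \<open>\<phi> k\<close> generate the same algebra: the correction terms are central of lower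
  degree, hence polynomials in the leading components of lower degree.\<close>

lemma leading_components_gen:
  assumes cp: "codim_property sc br 2" and c: "\<And>k. k < ind \<Longrightarrow> central (\<phi> k)"
    and deg: "\<And>k. k < ind \<Longrightarrow> pdeg Basis (d k) (\<phi> k)" and pos: "\<And>k. k < ind \<Longrightarrow> d k > 0"
    and dind: "\<And>x. ext x \<in> reg \<Longrightarrow> dindep ind (\<lambda>k. hc (\<phi> k) (d k)) x"
    and R: "fsubalg R" "\<And>k. k < ind \<Longrightarrow> \<phi> k \<in> R"
  shows "k < ind \<Longrightarrow> hc (\<phi> k) (d k) \<in> R"
proof (induction "d k" arbitrary: k rule: less_induct)
  case less
  let ?h = "\<lambda>k. hc (\<phi> k) (d k)"
  have h: "central (?h i)" "homog (d i) (?h i)" if "i < ind" for i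
    using central_hc[OF c[OF that]] homog_hc[OF central_pf[OF c[OF that]]] by auto
  \<comment> \<open>A component of degree \<open>e < d k\<close> involves only leading components of
    degree at most \<open>e\<close>, which are covered by the induction hypothesis.\<close>
  have low: "hc (\<phi> k) e \<in> R" if e: "e < d k" for e
  proof -
    have "\<exists>\<psi>\<in>pf {i. i < ind \<and> d i \<le> e}. hc (\<phi> k) e = (\<lambda>x. \<psi> (\<lambda>i. ?h i x))"
      by (rule central_generated[where h = ?h and d = d and g = "\<phi> k" and D = e, OF cp h pos dind c[OF less.prems]])
    then obtain \<psi> where \<psi>: "\<psi> \<in> pf {i. i < ind \<and> d i \<le> e}" "hc (\<phi> k) e = (\<lambda>x. \<psi> (\<lambda>i. ?h i x))"
      by (elim bexE)
    show ?thesis unfolding \<psi>(2)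
      by (rule fsubalg_compose[OF R(1) \<psi>(1), where g = ?h]) (use less.hyps e in auto)
  qed
  have "(\<lambda>x. \<phi> k x - (\<Sum>e<d k. hc (\<phi> k) e x)) \<in> R"
    by (rule fsubalg_diff[OF R(1) R(2)[OF less.prems] fsubalg_sum[OF R(1)]]) (use low in auto)
  moreover have "(\<lambda>x. \<phi> k x - (\<Sum>e<d k. hc (\<phi> k) e x)) = ?h k"
  proof (rule HOL.ext)
    fix x
    have "\<phi> k x = (\<Sum>e<d k. hc (\<phi> k) e x) + ?h k x"
      using hc_sum1[OF deg[OF less.prems], of x] by (simp add: lessThan_Suc_atMost[symmetric])
    thus "\<phi> k x - (\<Sum>e<d k. hc (\<phi> k) e x) = ?h k x" by simp
  qed
  ultimately show ?case by simp
qed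

end

theorem theorem3p2:
  fixes sc :: "'k::{alg_closed_field, field_char_0} \<Rightarrow> 'q::ab_group_add \<Rightarrow> 'q"
    and Basis :: "'q set"
    and br :: "'q \<Rightarrow> 'q \<Rightarrow> 'q"
    and f :: "nat \<Rightarrow> ('q \<Rightarrow> 'k) \<Rightarrow> 'k"
    and l :: nat
  assumes "lie_algebra sc Basis br"
    and "algebraic_lie_algebra sc br"
    and "codim_property sc br 2"
    and "l = lie_index sc br"
    and "\<forall>i\<in>{1..l}. f i \<in> poisson_centre sc br"
    and "alg_independent (dual_space sc) {1..l} f"
    and "(\<Sum>i=1..l. fun_degree (dual_space sc) (f i)) = b_number sc br"
  shows "(\<forall>\<xi>\<in>dual_reg sc br.
            shift_subalg sc \<xi> (poisson_centre sc br) = shift_subalg sc \<xi> (f ` {1..l}) \<and>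
            is_polynomial_algebra (dual_space sc) (shift_subalg sc \<xi> (poisson_centre sc br)) \<and>
            krull_dim ((coord_ring (dual_space sc))
              \<lparr>carrier := shift_subalg sc \<xi> (poisson_centre sc br)\<rparr>) = enat (b_number sc br)) \<and>
         (codim_property sc br 3 \<longrightarrow>
          (\<forall>\<xi>\<in>dual_reg sc br.
            maximal_commutative_subalg sc br (shift_subalg sc \<xi> (poisson_centre sc br))))"
  proof -
  interpret lie_acf sc Basis br using assms(1) by (rule lie_acf.intro)
  define \<phi> where "\<phi> k = lft (f (Suc k))" for k
  define d where "d k = fun_degree V (f (Suc k))" for k
  define h where "h k = hc (\<phi> k) (d k)" for k
  define b where "b = b_number sc br"
  have l: "l = ind" by (rule assms(4))
  have fZ: "f (Suc k) \<in> poisson_centre sc br" if "k < ind" for k using assms(5) that l by auto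
  have c: "central (\<phi> k)" if "k < ind" for k unfolding \<phi>_def by (rule centre_central[OF fZ[OF that]])
  have deg: "pdeg Basis (d k) (\<phi> k)" if "k < ind" for k
    unfolding \<phi>_def d_def by (rule pdeg_fun_degree, rule shift_central, rule fZ[OF that])
  have indep: "indep_on ind \<phi> UNIV"
    using indep_on_of_alg_independent[OF assms(6)] unfolding l \<phi>_def .
  have b: "b = (qdim + ind) div 2" unfolding b_def b_number_def dim_UNIV ..
  have sum: "(\<Sum>k<ind. d k) = b"
    using assms(7) unfolding l b_def d_def by (simp add: sum.atLeast1_atMost_eq)
  have pos: "d k > 0" if "k < ind" for k by (rule indep_degree_pos[of k ind d \<phi>, OF that deg[OF that] indep])
  \<comment> \<open>\<open>b_number\<close> divides with rounding down, so the degree hypothesis is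
    passed on as the inequality \<open>2 * b \<le> qdim + ind\<close>.\<close>
  have dind: "dindep ind h x" if "ext x \<in> reg" for x
    unfolding h_def[abs_def]
    by (rule leading_components_dindep[where \<phi> = \<phi> and d = d, OF assms(3) c deg indep _ that]) (use sum b in auto)
  have hc: "central (h k)" "homog (d k) (h k)" if "k < ind" for k
    using central_hc[OF c[OF that]] homog_hc[OF central_pf[OF c[OF that]]] unfolding h_def by auto
  have "card (Sigma {..<ind} (\<lambda>k. {..<d k})) = b" using sum by simp
  then obtain en where en: "bij_betw en {..<b} (Sigma {..<ind} (\<lambda>k. {..<d k}))"
    using ex_bij_betw_nat_finite[of "Sigma {..<ind} (\<lambda>k. {..<d k})"] by (auto simp: atLeast0LessThan)
  have shift: "argument_shift sc Basis br h d \<xi> b en" if "\<xi> \<in> reg" for \<xi>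
    by unfold_locales (use assms(3) hc pos dind that en b in auto)
  have gens: "shift_subalg sc \<xi> (f ` {1..l}) = rst ` gen (family b (argument_shift.F h \<xi> en))" if \<xi>: "\<xi> \<in> reg" for \<xi>
  proof (rule argument_shift.shift_subalg_gen[OF shift[OF \<xi>]])
    show "f ` {1..l} \<subseteq> poisson_centre sc br" using assms(5) by auto
    show "h k \<in> gen (\<lambda>g. \<exists>F\<in>f ` {1..l}. g = lft F)" if k: "k < ind" for k
      unfolding h_def
    proof (rule leading_components_gen[where \<phi> = \<phi> and d = d, OF assms(3) c deg pos _ fsubalg_gen _ k])
      show "\<phi> i \<in> gen (\<lambda>g. \<exists>F\<in>f ` {1..l}. g = lft F)" if "i < ind" for i
        by (rule gen_incl) (use that l in \<open>auto simp: \<phi>_def intro!: bexI[of _ "Suc i"]\<close>)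
      show "dindep ind (\<lambda>k. hc (\<phi> k) (d k)) x" if "ext x \<in> reg" for x
        using dind[OF that] unfolding h_def[abs_def] .
    qed
  qed
  have centre: "shift_subalg sc \<xi> (poisson_centre sc br) = rst ` gen (family b (argument_shift.F h \<xi> en))" if \<xi>: "\<xi> \<in> reg" for \<xi>
    by (rule argument_shift.shift_subalg_centre[OF shift[OF \<xi>]])
  show ?thesis
  proof (intro conjI ballI impI)
    fix \<xi> assume \<xi>: "\<xi> \<in> reg"
    interpret argument_shift sc Basis br h d \<xi> b en by (rule shift[OF \<xi>])
    show "shift_subalg sc \<xi> (poisson_centre sc br) = shift_subalg sc \<xi> (f ` {1..l})"
      by (simp only: centre[OF \<xi>] gens[OF \<xi>])
    show "is_polynomial_algebra V (shift_subalg sc \<xi> (poisson_centre sc br))"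
      unfolding centre[OF \<xi>] by (rule polynomial_algebra)
    show "krull_dim ((coord_ring V)\<lparr>carrier := shift_subalg sc \<xi> (poisson_centre sc br)\<rparr>) = enat (b_number sc br)"
      unfolding centre[OF \<xi>] b_def[symmetric] by (rule krull_dim_gen[OF F_pf F_indep])
  next
    fix \<xi> assume cp3: "codim_property sc br 3" and \<xi>: "\<xi> \<in> reg"
    show "maximal_commutative_subalg sc br (shift_subalg sc \<xi> (poisson_centre sc br))"
      unfolding centre[OF \<xi>] by (rule argument_shift.maximal[OF shift[OF \<xi>] cp3])
  qed
qed

end
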